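(* For $n\in\mathbb{N}$, there is a natural equivalence of functors $\mathbf{gr}^{op}\to\mathbb{K}\text{-}\mathrm{Mod}$ $$\mathbf{A}_1(n,-)_{\mathbf{0}}\simeq\mathcal{P}_2^{\#}\underset{\mathfrak{S}_2}{\otimes}\mathbb{K}[F_n],$$ where $\mathfrak{S}_2$ acts on $\mathbb{K}[F_n]$ by taking the inverse in $F_n$, $v\mapsto v^{-1}$, and on $\mathcal{P}_2^{\#}$ through the dual of the involution $\sigma$ of $\mathcal{P}_2$. In particular, $\mathbf{A}_1(0,-)\simeq S^2\circ\mathfrak{a}^{\#}$.
   Context: $\mathbb{K}$ is a field of characteristic $0$, $\mathbb{K}\text{-}\mathrm{Mod}$ the category of $\mathbb{K}$-vector spaces, $\mathbb{N}=\{0,1,2,\dots\}$. $\mathbf{gr}$ is the category of finitely generated free groups with objects $n\in\mathbb{N}$ identified with the free group $F_n=\langle x_1,\dots,x_n\rangle$; $\mathbf{gr}(m,n)=\mathrm{Hom}(F_m,F_n)$. $\mathfrak{S}_2$ is the symmetric group on two letters, $S^2$ the symmetric square. For $M:\mathbf{gr}\to\mathbb{K}\text{-}\mathrm{Mod}$, $M^{\#}:\mathbf{gr}^{op}\to\mathbb{K}\text{-}\mathrm{Mod}$ is $M^{\#}(G)=\mathrm{Hom}_{\mathbb{K}}(M(G),\mathbb{K})$. $\mathfrak{a}:\mathbf{gr}\to\mathbb{K}\text{-}\mathrm{Mod}$ is $\mathfrak{a}(G)=(G/[G,G])\otimes_{\mathbb{Z}}\mathbb{K}$. With $IG$ the augmentation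 ideal of $\mathbb{K}[G]$, the second Passi functor is $\mathcal{P}_2:\mathbf{gr}\to\mathbb{K}\text{-}\mathrm{Mod}$, $\mathcal{P}_2(G)=IG/(IG)^3$. The natural involution $\sigma$ of $\mathcal{P}_2$, induced by $[g]-[1]\mapsto[g^{-1}]-[1]$, defines an action of $\mathfrak{S}_2$ on $\mathcal{P}_2$, hence on $\mathcal{P}_2^{\#}$. Beaded Jacobi diagrams. $X_m$ is the oriented $1$-manifold consisting of $m$ arcs (numbered $1,\dots,m$). A Jacobi diagram $D$ on $X_m$ is a finite uni-trivalent graph with a cyclic order of the half-edges at each trivalent vertex, whose univalent vertices are embedded in the interior of $X_m$, each connected component of $D$ having at least one univalent vertex. Its degree is half its number of vertices. An $F_n$-beaded Jacobi diagram on $X_m$ is a Jacobi diagram on $X_m$ with oriented edges, together with finitely many beads, i.e. points of the interior of $X_m$ or of edges of $D$ away from vertices, labelled by elements of $F_n$. Equivalence of beaded diagrams is generated by (up to isomorphism): two consecutive beads $w$ then $x$ (along the orientation of an arc of $X_m$ or an edge) may be replaced by one bead $wx$; a bead $1$ may be removed; reversing the orientation of an edge with one bead $w$ replaces $w$ by $w^{-1}$; a bead $w$ on an arc just before a univalent vertex $v$ may be replaced by a bead $w$ on the arc just after $v$ and a bead $w$ on the edge at $v$, oriented away from $v$ (next to $v$); a bead $w$ on an edge entering a trivalent vertex, the two other edges being oriented outwards, may be replaced by a bead $w$ on each of the two outgoing edges (next to the vertex). $\mathbf{A}(n,m)$ is the $\mathbb{K}$-vector space generated by equivalence classes of $F_n$-beaded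 Jacobi diagrams on $X_m$ modulo the STU relation: if an unbeaded edge joins a point of an arc to a trivalent vertex with cyclic order (edge to the arc, $b$, $a$), the diagram equals the one where $a,b$ are attached directly to the arc with $a$ just before $b$, minus the one with $b$ just before $a$. $\mathbf{A}_d(n,m)\subset\mathbf{A}(n,m)$ is the subspace generated by diagrams of degree $d$. Functoriality. These are the morphism spaces of the Habiro–Massuyeau linear category $\mathbf{A}$ of Jacobi diagrams in handlebodies, whose degree $0$ part $\mathbf{A}_0$ is isomorphic to the $\mathbb{K}$-linearization of $\mathbf{gr}^{op}$; composition with $\mathbf{A}_0$ makes $\mathbf{A}(n,-)$ a functor on $\mathbf{gr}^{op}$ with subfunctors $\mathbf{A}_d(n,-)$. Explicitly, let $g:F_{m'}\to F_m$ with $g(x_j)=x_{p_{j,1}}^{e_{j,1}}\cdots x_{p_{j,r_j}}^{e_{j,r_j}}$, $e_{j,s}=\pm1$. Then $g$ induces $\mathbf{A}(n,m)\to\mathbf{A}(n,m')$ as follows: arc $j$ of $X_{m'}$ is the concatenation, in the order $s=1,\dots,r_j$, of copies of the arcs $p_{j,s}$ of $X_m$ with their beads, the copy being reversed and its beads inverted when $e_{j,s}=-1$; $D$ is sent to the sum, over all ways of attaching each univalent vertex of $D$ lying on an arc $p$ to the corresponding point on one of the copies of the arc $p$, of the resulting diagrams, with sign $(-1)^{r}$, $r$ the number of univalent vertices attached to reversed copies (the sum is $0$ if some arc carrying univalent vertices has no copy). The homotopy class $\mathbf{0}$ part. $\mathbf{A}(n,m)_{\mathbf{0}}\subset\mathbf{A}(n,m)$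 is the subspace generated by the beaded diagrams such that, for each arc of $X_m$, the product of the beads along it is $1\in F_n$ (equivalently, diagrams that can be represented without beads on $X_m$, beads on the edges of the Jacobi diagram being allowed). $\mathbf{A}_d(n,m)_{\mathbf{0}}$ is its degree $d$ part. These define subfunctors of $\mathbf{A}(n,-)$ on $\mathbf{gr}^{op}$; for $n=0$, $\mathbf{A}_d(0,-)_{\mathbf{0}}=\mathbf{A}_d(0,-)$. *)

theory Defs
  imports
    "HOL-Algebra.Algebraic_Closure_Type"
    "HOL-Algebra.Generated_Groups"
    "HOL-Algebra.AbelCoset"
    "HOL-Algebra.Module"
    "HOL-Library.Poly_Mapping"
begin

section \<open>Free groups and the category gr\<close>

text \<open>
  A letter \<open>(i, True)\<close> is the generator with index \<open>i\<close> and \<open>(i, False)\<close> is its inverse.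
  The elements of the free group of rank \<open>n\<close> are the reduced words in the letters
  with index below \<open>n\<close>.
\<close>

type_synonym word = "(nat \<times> bool) list"

fun cancel_cons :: "nat \<times> bool \<Rightarrow> word \<Rightarrow> word" where
  "cancel_cons a [] = [a]"
| "cancel_cons a (b # w) = (if b = (fst a, \<not> snd a) then w else a # b # w)"

definition reduce :: "word \<Rightarrow> word" where
  "reduce w = foldr cancel_cons w []"

definition Fr :: "nat \<Rightarrow> word monoid" where
  "Fr n = \<lparr>carrier = {w. reduce w = w \<and> fst ` set w \<subseteq> {..<n}},
           monoid.mult = (\<lambda>u v. reduce (u @ v)), one = []\<rparr>"

text \<open>Homomorphisms are extensional functions, so that equal morphisms are equal as functions.\<close>

definition gr :: "nat \<Rightarrow> nat \<Rightarrow> (word \<Rightarrow> word) set" where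
  "gr a b = hom (Fr a) (Fr b) \<inter> extensional (carrier (Fr a))"


section \<open>Vector spaces\<close>

text \<open>
  Vector spaces are modules in the sense of \<open>HOL-Algebra\<close>; their fields \<open>mult\<close> and \<open>one\<close>
  are irrelevant.
\<close>

abbreviation KK :: "'k::field ring" where
  "KK \<equiv> ring_of_type_algebra"

definition linear_maps :: "('k::field, 'v) module \<Rightarrow> ('k, 'w) module \<Rightarrow> ('v \<Rightarrow> 'w) set" where
  "linear_maps V W = {f \<in> carrier V \<rightarrow> carrier W.
     (\<forall>u\<in>carrier V. \<forall>v\<in>carrier V. f (u \<oplus>\<^bsub>V\<^esub> v) = f u \<oplus>\<^bsub>W\<^esub> f v) \<and>
     (\<forall>c. \<forall>v\<in>carrier V. f (c \<odot>\<^bsub>V\<^esub> v) = c \<odot>\<^bsub>W\<^esub> f v)}"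

definition vspan :: "('k::field, 'v) module \<Rightarrow> 'v set \<Rightarrow> 'v set" where
  "vspan V S = \<Inter>{N. submodule N KK V \<and> S \<subseteq> N}"

text \<open>
  \<open>quot_map W N f\<close> is the map with values in the quotient of \<open>W\<close> by \<open>N\<close> which a linear map \<open>f\<close>
  induces on cosets. If \<open>f\<close> respects the subspaces, all the cosets in the union coincide.
\<close>

definition quot_map :: "('k::field, 'w) module \<Rightarrow> 'w set \<Rightarrow> ('v \<Rightarrow> 'w) \<Rightarrow> 'v set \<Rightarrow> 'w set" where
  "quot_map W N f C = (\<Union>v\<in>C. N +>\<^bsub>W\<^esub> f v)"

definition quot_vs :: "('k::field, 'v) module \<Rightarrow> 'v set \<Rightarrow> ('k, 'v set) module" where
  "quot_vs V N = \<lparr>carrier = a_rcosets\<^bsub>V\<^esub> N, monoid.mult = undefined, one = undefined,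
     zero = N, add = set_add V, module.smult = (\<lambda>c. quot_map V N (\<lambda>v. c \<odot>\<^bsub>V\<^esub> v))\<rparr>"

definition scalars :: "('k::field, 'k) module" where
  "scalars = \<lparr>carrier = UNIV, monoid.mult = (*), one = 1, zero = 0, add = (+), module.smult = (*)\<rparr>"

definition dual :: "('k::field, 'v) module \<Rightarrow> ('k, 'v \<Rightarrow> 'k) module" where
  "dual V = \<lparr>carrier = linear_maps V scalars \<inter> extensional (carrier V),
     monoid.mult = undefined, one = undefined,
     zero = (\<lambda>v\<in>carrier V. 0),
     add = (\<lambda>f g. \<lambda>v\<in>carrier V. f v + g v),
     module.smult = (\<lambda>c f. \<lambda>v\<in>carrier V. c * f v)\<rparr>"

definition dual_map :: "('k::field, 'v) module \<Rightarrow> ('v \<Rightarrow> 'w) \<Rightarrow> ('w \<Rightarrow> 'k) \<Rightarrow> 'v \<Rightarrow> 'k" where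
  "dual_map V \<phi> f = (\<lambda>v\<in>carrier V. f (\<phi> v))"


subsection \<open>Free vector spaces, generators and relations\<close>

definition scale :: "'k::field \<Rightarrow> ('x \<Rightarrow>\<^sub>0 'k) \<Rightarrow> ('x \<Rightarrow>\<^sub>0 'k)" where
  "scale c a = Poly_Mapping.map (\<lambda>y. c * y) a"

definition gen :: "'x \<Rightarrow> ('x \<Rightarrow>\<^sub>0 'k::field)" where
  "gen x = Poly_Mapping.single x 1"

definition free_vs :: "'x set \<Rightarrow> ('k::field, 'x \<Rightarrow>\<^sub>0 'k) module" where
  "free_vs B = \<lparr>carrier = {a. Poly_Mapping.keys a \<subseteq> B}, monoid.mult = undefined, one = undefined,
     zero = 0, add = (+), module.smult = scale\<rparr>"

definition lin_ext :: "('x \<Rightarrow> ('y \<Rightarrow>\<^sub>0 'k)) \<Rightarrow> ('x \<Rightarrow>\<^sub>0 'k::field) \<Rightarrow> ('y \<Rightarrow>\<^sub>0 'k)" where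
  "lin_ext f a = (\<Sum>x\<in>Poly_Mapping.keys a. scale (Poly_Mapping.lookup a x) (f x))"

definition presented :: "'x set \<Rightarrow> ('x \<Rightarrow>\<^sub>0 'k::field) set \<Rightarrow> ('k, ('x \<Rightarrow>\<^sub>0 'k) set) module" where
  "presented B R = quot_vs (free_vs B) (vspan (free_vs B) R)"

definition presented_map ::
  "'y set \<Rightarrow> ('y \<Rightarrow>\<^sub>0 'k::field) set \<Rightarrow> ('x \<Rightarrow> ('y \<Rightarrow>\<^sub>0 'k)) \<Rightarrow> ('x \<Rightarrow>\<^sub>0 'k) set \<Rightarrow> ('y \<Rightarrow>\<^sub>0 'k) set" where
  "presented_map B R f = quot_map (free_vs B) (vspan (free_vs B) R) (lin_ext f)"


subsection \<open>Tensor products\<close>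

definition bilin_rels :: "('k::field, 'v) module \<Rightarrow> ('k, 'w) module \<Rightarrow> ('v \<times> 'w \<Rightarrow>\<^sub>0 'k) set" where
  "bilin_rels V W =
     {gen (v \<oplus>\<^bsub>V\<^esub> v', w) - gen (v, w) - gen (v', w) | v v' w.
        v \<in> carrier V \<and> v' \<in> carrier V \<and> w \<in> carrier W} \<union>
     {gen (v, w \<oplus>\<^bsub>W\<^esub> w') - gen (v, w) - gen (v, w') | v w w'.
        v \<in> carrier V \<and> w \<in> carrier W \<and> w' \<in> carrier W} \<union>
     {gen (c \<odot>\<^bsub>V\<^esub> v, w) - scale c (gen (v, w)) | c v w. v \<in> carrier V \<and> w \<in> carrier W} \<union>
     {gen (v, c \<odot>\<^bsub>W\<^esub> w) - scale c (gen (v, w)) | c v w. v \<in> carrier V \<and> w \<in> carrier W}"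

text \<open>
  Relations of the tensor product of \<open>V\<close> and \<open>W\<close> over the symmetric group on two letters,
  whose nontrivial element acts on \<open>V\<close> by \<open>s\<close> and on \<open>W\<close> by \<open>t\<close> (being its own
  inverse, it acts in the same way from the left and from the right).
\<close>

definition S2_tensor_rels ::
  "('k::field, 'v) module \<Rightarrow> ('v \<Rightarrow> 'v) \<Rightarrow> ('k, 'w) module \<Rightarrow> ('w \<Rightarrow> 'w) \<Rightarrow> ('v \<times> 'w \<Rightarrow>\<^sub>0 'k) set" where
  "S2_tensor_rels V s W t = bilin_rels V W \<union>
     {gen (s v, w) - gen (v, t w) | v w. v \<in> carrier V \<and> w \<in> carrier W}"

definition sym2_rels :: "('k::field, 'v) module \<Rightarrow> ('v \<times> 'v \<Rightarrow>\<^sub>0 'k) set" where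
  "sym2_rels V = bilin_rels V V \<union>
     {gen (v, w) - gen (w, v) | v w. v \<in> carrier V \<and> w \<in> carrier V}"

text \<open>
  Relations of the tensor product over the integers of an abelian group \<open>A\<close> (written
  multiplicatively) with the field, as a vector space generated by pairs \<open>(x, k)\<close>.
\<close>

definition extension_rels :: "'a monoid \<Rightarrow> ('a \<times> 'k \<Rightarrow>\<^sub>0 'k::field) set" where
  "extension_rels A =
     {gen (x \<otimes>\<^bsub>A\<^esub> y, k) - gen (x, k) - gen (y, k) | x y k. x \<in> carrier A \<and> y \<in> carrier A} \<union>
     {gen (x, k + l) - gen (x, k) - gen (x, l) | x k l. x \<in> carrier A} \<union>
     {gen (x, c * k) - scale c (gen (x, k)) | c x k. x \<in> carrier A}"


section \<open>Functors on gr and on its opposite\<close>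

text \<open>
  For \<open>g\<close> in \<open>gr a b\<close>, \<open>mor M a b g\<close> maps \<open>obj M a\<close> to \<open>obj M b\<close> if \<open>M\<close> is covariant,
  and \<open>obj M b\<close> to \<open>obj M a\<close> if \<open>M\<close> is contravariant.
\<close>

record ('k, 'v) gr_functor =
  obj :: "nat \<Rightarrow> ('k, 'v) module"
  mor :: "nat \<Rightarrow> nat \<Rightarrow> (word \<Rightarrow> word) \<Rightarrow> 'v \<Rightarrow> 'v"

definition contravariant_functor :: "('k::field, 'v) gr_functor \<Rightarrow> bool" where
  "contravariant_functor M \<longleftrightarrow>
     (\<forall>m. module KK (obj M m)) \<and>
     (\<forall>a b. \<forall>g\<in>gr a b. mor M a b g \<in> linear_maps (obj M b) (obj M a)) \<and>
     (\<forall>a. \<forall>v\<in>carrier (obj M a). mor M a a (\<lambda>x\<in>carrier (Fr a). x) v = v) \<and>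
     (\<forall>a b c. \<forall>g\<in>gr a b. \<forall>h\<in>gr b c. \<forall>v\<in>carrier (obj M c).
        mor M a c (compose (carrier (Fr a)) h g) v = mor M a b g (mor M b c h v))"

definition nat_equiv_op :: "('k::field, 'v) gr_functor \<Rightarrow> ('k, 'w) gr_functor \<Rightarrow> bool" where
  "nat_equiv_op M N \<longleftrightarrow> contravariant_functor M \<and> contravariant_functor N \<and>
     (\<exists>\<phi>. (\<forall>m. \<phi> m \<in> linear_maps (obj M m) (obj N m) \<and>
              bij_betw (\<phi> m) (carrier (obj M m)) (carrier (obj N m))) \<and>
          (\<forall>a b. \<forall>g\<in>gr a b. \<forall>v\<in>carrier (obj M b).
              \<phi> a (mor M a b g v) = mor N a b g (\<phi> b v)))"

definition dual_functor :: "('k::field, 'v) gr_functor \<Rightarrow> ('k, 'v \<Rightarrow> 'k) gr_functor" where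
  "dual_functor M = \<lparr>obj = (\<lambda>m. dual (obj M m)),
     mor = (\<lambda>a b g. dual_map (obj M a) (mor M a b g))\<rparr>"

definition sym2_functor ::
  "('k::field, 'v) gr_functor \<Rightarrow> ('k, ('v \<times> 'v \<Rightarrow>\<^sub>0 'k) set) gr_functor" where
  "sym2_functor M = \<lparr>
     obj = (\<lambda>m. presented (carrier (obj M m) \<times> carrier (obj M m)) (sym2_rels (obj M m))),
     mor = (\<lambda>a b g. presented_map (carrier (obj M a) \<times> carrier (obj M a)) (sym2_rels (obj M a))
                      (\<lambda>(v, w). gen (mor M a b g v, mor M a b g w)))\<rparr>"


subsection \<open>Abelianization\<close>

definition abelianization :: "'a monoid \<Rightarrow> 'a set monoid" where
  "abelianization G = G Mod derived G (carrier G)"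

definition abelianization_map :: "'b monoid \<Rightarrow> ('a \<Rightarrow> 'b) \<Rightarrow> 'a set \<Rightarrow> 'b set" where
  "abelianization_map H g C = (\<Union>x\<in>C. derived H (carrier H) #>\<^bsub>H\<^esub> g x)"

definition ab_functor :: "('k::field, (word set \<times> 'k \<Rightarrow>\<^sub>0 'k) set) gr_functor" where
  "ab_functor = \<lparr>
     obj = (\<lambda>m. presented (carrier (abelianization (Fr m)) \<times> UNIV)
                  (extension_rels (abelianization (Fr m)))),
     mor = (\<lambda>a b g. presented_map (carrier (abelianization (Fr b)) \<times> UNIV)
                      (extension_rels (abelianization (Fr b)))
                      (\<lambda>(C, k). gen (abelianization_map (Fr b) g C, k)))\<rparr>"


subsection \<open>The second Passi functor\<close>

definition group_alg_mult :: "'a monoid \<Rightarrow> ('a \<Rightarrow>\<^sub>0 'k::field) \<Rightarrow> ('a \<Rightarrow>\<^sub>0 'k) \<Rightarrow> ('a \<Rightarrow>\<^sub>0 'k)" where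
  "group_alg_mult G a b = (\<Sum>x\<in>Poly_Mapping.keys a. \<Sum>y\<in>Poly_Mapping.keys b.
     Poly_Mapping.single (x \<otimes>\<^bsub>G\<^esub> y) (Poly_Mapping.lookup a x * Poly_Mapping.lookup b y))"

definition aug_ideal :: "'a monoid \<Rightarrow> ('a \<Rightarrow>\<^sub>0 'k::field) set" where
  "aug_ideal G = {a \<in> carrier (free_vs (carrier G)).
     (\<Sum>x\<in>Poly_Mapping.keys a. Poly_Mapping.lookup a x) = 0}"

definition aug_ideal_cube :: "'a monoid \<Rightarrow> ('a \<Rightarrow>\<^sub>0 'k::field) set" where
  "aug_ideal_cube G = vspan (free_vs (carrier G))
     {group_alg_mult G (group_alg_mult G a b) c | a b c.
        a \<in> aug_ideal G \<and> b \<in> aug_ideal G \<and> c \<in> aug_ideal G}"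

definition aug_ideal_vs :: "'a monoid \<Rightarrow> ('k::field, 'a \<Rightarrow>\<^sub>0 'k) module" where
  "aug_ideal_vs G = (free_vs (carrier G))\<lparr>carrier := aug_ideal G\<rparr>"

definition passi2 :: "('k::field, (word \<Rightarrow>\<^sub>0 'k) set) gr_functor" where
  "passi2 = \<lparr>
     obj = (\<lambda>m. quot_vs (aug_ideal_vs (Fr m)) (aug_ideal_cube (Fr m))),
     mor = (\<lambda>a b g. quot_map (aug_ideal_vs (Fr b)) (aug_ideal_cube (Fr b))
                      (lin_ext (\<lambda>x. gen (g x))))\<rparr>"

definition passi2_involution :: "nat \<Rightarrow> (word \<Rightarrow>\<^sub>0 'k::field) set \<Rightarrow> (word \<Rightarrow>\<^sub>0 'k) set" where
  "passi2_involution m = quot_map (aug_ideal_vs (Fr m)) (aug_ideal_cube (Fr m))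
     (lin_ext (\<lambda>x. gen (inv\<^bsub>Fr m\<^esub> x)))"

definition passi2_dual_tensor_rels ::
  "nat \<Rightarrow> nat \<Rightarrow> (((word \<Rightarrow>\<^sub>0 'k::field) set \<Rightarrow> 'k) \<times> (word \<Rightarrow>\<^sub>0 'k) \<Rightarrow>\<^sub>0 'k) set" where
  "passi2_dual_tensor_rels n m = S2_tensor_rels
     (obj (dual_functor passi2) m) (dual_map (obj passi2 m) (passi2_involution m))
     (free_vs (carrier (Fr n))) (lin_ext (\<lambda>v. gen (inv\<^bsub>Fr n\<^esub> v)))"

definition passi2_dual_tensor ::
  "nat \<Rightarrow> ('k::field, (((word \<Rightarrow>\<^sub>0 'k) set \<Rightarrow> 'k) \<times> (word \<Rightarrow>\<^sub>0 'k) \<Rightarrow>\<^sub>0 'k) set) gr_functor" where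
  "passi2_dual_tensor n = \<lparr>
     obj = (\<lambda>m. presented
              (carrier (obj (dual_functor passi2) m) \<times> carrier (free_vs (carrier (Fr n))))
              (passi2_dual_tensor_rels n m)),
     mor = (\<lambda>a b g. presented_map
              (carrier (obj (dual_functor passi2) a) \<times> carrier (free_vs (carrier (Fr n))))
              (passi2_dual_tensor_rels n a)
              (\<lambda>(f, v). gen (mor (dual_functor passi2) a b g f, v)))\<rparr>"


section \<open>Beaded Jacobi diagrams\<close>

text \<open>
  A diagram is described through its half-edges, which are named by natural numbers.
  An arc is the list of univalent vertices and beads met along it, a univalent vertex being
  represented by its half-edge. An oriented edge \<open>(h, us, k)\<close> runs from the half-edge \<open>h\<close>
  to the half-edge \<open>k\<close> and meets the beads \<open>us\<close> in this order. A trivalent vertex is the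
  triple of its half-edges, in the cyclic order.
\<close>

datatype 'h point = Leg 'h | Bead word

type_synonym edge = "nat \<times> word list \<times> nat"

record diagram =
  arcs :: "nat point list list"
  edges :: "edge list"
  trivs :: "(nat \<times> nat \<times> nat) list"

fun edge_ends :: "edge \<Rightarrow> nat list" where
  "edge_ends (h, us, k) = [h, k]"

fun edge_beads :: "edge \<Rightarrow> word list" where
  "edge_beads (h, us, k) = us"

fun corners :: "nat \<times> nat \<times> nat \<Rightarrow> nat list" where
  "corners (a, b, c) = [a, b, c]"

fun rotations :: "nat \<times> nat \<times> nat \<Rightarrow> (nat \<times> nat \<times> nat) set" where
  "rotations (a, b, c) = {(a, b, c), (b, c, a), (c, a, b)}"

definition arc_legs :: "nat point list \<Rightarrow> nat list" where
  "arc_legs xs = [h. Leg h \<leftarrow> xs]"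

definition arc_beads :: "nat point list \<Rightarrow> word list" where
  "arc_beads xs = [w. Bead w \<leftarrow> xs]"

definition legs :: "diagram \<Rightarrow> nat list" where
  "legs D = concat (map arc_legs (arcs D))"

definition half_edges :: "diagram \<Rightarrow> nat list" where
  "half_edges D = concat (map edge_ends (edges D))"

definition adjacent :: "diagram \<Rightarrow> nat \<Rightarrow> nat \<Rightarrow> bool" where
  "adjacent D h k \<longleftrightarrow>
     (\<exists>e\<in>set (edges D). {h, k} \<subseteq> set (edge_ends e)) \<or>
     (\<exists>v\<in>set (trivs D). {h, k} \<subseteq> set (corners v))"

text \<open>
  Every half-edge belongs to exactly one edge and to exactly one vertex, and every connected
  component has a univalent vertex.
\<close>

definition diagrams :: "nat \<Rightarrow> nat \<Rightarrow> diagram set" where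
  "diagrams n m = {D.
     length (arcs D) = m \<and>
     distinct (half_edges D) \<and>
     distinct (legs D @ concat (map corners (trivs D))) \<and>
     set (half_edges D) = set (legs D @ concat (map corners (trivs D))) \<and>
     (\<forall>h\<in>set (half_edges D). \<exists>l\<in>set (legs D). (adjacent D)\<^sup>*\<^sup>* h l) \<and>
     (\<forall>xs\<in>set (arcs D). set (arc_beads xs) \<subseteq> carrier (Fr n)) \<and>
     (\<forall>e\<in>set (edges D). set (edge_beads e) \<subseteq> carrier (Fr n))}"

definition has_degree :: "nat \<Rightarrow> diagram \<Rightarrow> bool" where
  "has_degree d D \<longleftrightarrow> length (legs D) + length (trivs D) = 2 * d"

definition arc_product :: "nat \<Rightarrow> nat point list \<Rightarrow> word" where
  "arc_product n xs = foldr (\<lambda>u v. u \<otimes>\<^bsub>Fr n\<^esub> v) (arc_beads xs) \<one>\<^bsub>Fr n\<^esub>"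

definition homotopy_trivial :: "nat \<Rightarrow> diagram \<Rightarrow> bool" where
  "homotopy_trivial n D \<longleftrightarrow> (\<forall>xs\<in>set (arcs D). arc_product n xs = \<one>\<^bsub>Fr n\<^esub>)"


subsection \<open>Equivalence of beaded diagrams\<close>

text \<open>
  \<open>add_bead n w h\<close> inserts on the edge at the half-edge \<open>h\<close>, next to the vertex of \<open>h\<close>, a bead
  \<open>w\<close> with respect to the orientation away from that vertex. If the edge is oriented towards the
  vertex, this is a bead \<open>inv w\<close>; in this form the rule also makes sense for both
  ends of a loop.
\<close>

fun add_bead :: "nat \<Rightarrow> word \<Rightarrow> nat \<Rightarrow> edge \<Rightarrow> edge" where
  "add_bead n w h (a, us, b) =
     (a, (if a = h then [w] else []) @ us @ (if b = h then [inv\<^bsub>Fr n\<^esub> w] else []), b)"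

inductive bead_step :: "nat \<Rightarrow> diagram \<Rightarrow> diagram \<Rightarrow> bool" for n :: nat where
  isomorphism:
    "inj_on f (set (half_edges D)) \<Longrightarrow>
     arcs D' = map (map (map_point f)) (arcs D) \<Longrightarrow>
     set (edges D') = (\<lambda>(h, us, k). (f h, us, f k)) ` set (edges D) \<Longrightarrow>
     \<Union> (rotations ` set (trivs D')) =
       \<Union> (rotations ` (\<lambda>(a, b, c). (f a, f b, f c)) ` set (trivs D)) \<Longrightarrow>
     bead_step n D D'"
| arc_merge:
    "i < length (arcs D) \<Longrightarrow> arcs D ! i = xs @ Bead u # Bead v # ys \<Longrightarrow>
     bead_step n D (D\<lparr>arcs := (arcs D)[i := xs @ Bead (u \<otimes>\<^bsub>Fr n\<^esub> v) # ys]\<rparr>)"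
| edge_merge:
    "j < length (edges D) \<Longrightarrow> edges D ! j = (h, us @ u # v # vs, k) \<Longrightarrow>
     bead_step n D (D\<lparr>edges := (edges D)[j := (h, us @ (u \<otimes>\<^bsub>Fr n\<^esub> v) # vs, k)]\<rparr>)"
| arc_unit:
    "i < length (arcs D) \<Longrightarrow> arcs D ! i = xs @ Bead \<one>\<^bsub>Fr n\<^esub> # ys \<Longrightarrow>
     bead_step n D (D\<lparr>arcs := (arcs D)[i := xs @ ys]\<rparr>)"
| edge_unit:
    "j < length (edges D) \<Longrightarrow> edges D ! j = (h, us @ \<one>\<^bsub>Fr n\<^esub> # vs, k) \<Longrightarrow>
     bead_step n D (D\<lparr>edges := (edges D)[j := (h, us @ vs, k)]\<rparr>)"
| edge_reverse:
    "j < length (edges D) \<Longrightarrow> edges D ! j = (h, [w], k) \<Longrightarrow>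
     bead_step n D (D\<lparr>edges := (edges D)[j := (k, [inv\<^bsub>Fr n\<^esub> w], h)]\<rparr>)"
| pass_univalent:
    "i < length (arcs D) \<Longrightarrow> arcs D ! i = xs @ Bead w # Leg h # ys \<Longrightarrow>
     bead_step n D (D\<lparr>arcs := (arcs D)[i := xs @ Leg h # Bead w # ys],
                     edges := map (add_bead n w h) (edges D)\<rparr>)"
| pass_trivalent:
    "j < length (edges D) \<Longrightarrow> edges D ! j = (h, us @ [w], a) \<Longrightarrow>
     v \<in> set (trivs D) \<Longrightarrow> (a, b, c) \<in> rotations v \<Longrightarrow>
     bead_step n D (D\<lparr>edges := map (add_bead n w c) (map (add_bead n w b)
                                   ((edges D)[j := (h, us, a)]))\<rparr>)"

definition bead_equiv :: "nat \<Rightarrow> nat \<Rightarrow> diagram \<Rightarrow> diagram \<Rightarrow> bool" where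
  "bead_equiv n m =
     equivclp (\<lambda>D D'. D \<in> diagrams n m \<and> D' \<in> diagrams n m \<and> bead_step n D D')"


subsection \<open>The spaces of diagrams\<close>

definition attach ::
  "nat \<Rightarrow> edge \<Rightarrow> nat \<times> nat \<times> nat \<Rightarrow> nat point list \<Rightarrow> nat \<Rightarrow> nat \<Rightarrow> nat point list \<Rightarrow> diagram \<Rightarrow> diagram"
where
  "attach i e v xs p q ys D = D\<lparr>arcs := (arcs D)[i := xs @ Leg p # Leg q # ys],
     edges := remove1 e (edges D), trivs := remove1 v (trivs D)\<rparr>"

text \<open>
  In the STU relation, \<open>e\<close> is the unbeaded edge from the half-edge \<open>h\<close> on the arc to the corner
  \<open>k\<close> of the trivalent vertex \<open>v\<close>. That the right-hand side consists of diagrams is automatic;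
  it is stated to make the relations visibly lie in the free vector space.
\<close>

definition stu_rels :: "nat \<Rightarrow> nat \<Rightarrow> (diagram \<Rightarrow>\<^sub>0 'k::field) set" where
  "stu_rels n m =
     {gen D - (gen (attach i e v xs a b ys D) - gen (attach i e v xs b a ys D))
      | D i e v xs ys h k a b.
        {D, attach i e v xs a b ys D, attach i e v xs b a ys D} \<subseteq> diagrams n m \<and>
        i < m \<and> arcs D ! i = xs @ Leg h # ys \<and>
        e \<in> set (edges D) \<and> e \<in> {(h, [], k), (k, [], h)} \<and>
        v \<in> set (trivs D) \<and> (k, b, a) \<in> rotations v}"

text \<open>
  Dividing by the differences of equivalent diagrams turns the free vector space on the
  diagrams into the one on their equivalence classes, so that both steps are taken at once.
\<close>

definition diagram_rels :: "nat \<Rightarrow> nat \<Rightarrow> (diagram \<Rightarrow>\<^sub>0 'k::field) set" where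
  "diagram_rels n m =
     {gen D - gen D' | D D'. D \<in> diagrams n m \<and> D' \<in> diagrams n m \<and> bead_equiv n m D D'} \<union>
     stu_rels n m"

definition A_vs :: "nat \<Rightarrow> nat \<Rightarrow> ('k::field, (diagram \<Rightarrow>\<^sub>0 'k) set) module" where
  "A_vs n m = presented (diagrams n m) (diagram_rels n m)"

definition diagram_class :: "nat \<Rightarrow> nat \<Rightarrow> diagram \<Rightarrow> (diagram \<Rightarrow>\<^sub>0 'k::field) set" where
  "diagram_class n m D = vspan (free_vs (diagrams n m)) (diagram_rels n m) +>\<^bsub>free_vs (diagrams n m)\<^esub> gen D"


subsection \<open>Functoriality\<close>

text \<open>
  For \<open>g\<close> in \<open>gr a b\<close>, the reduced word \<open>g [(j, True)]\<close> lists the copies which make up the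
  new arc \<open>j < a\<close>: the \<open>s\<close>-th copy is a copy of the arc \<open>p\<close>, reversed if \<open>\<epsilon>\<close> is false,
  where \<open>(p, \<epsilon>)\<close> is the \<open>s\<close>-th letter. An attachment \<open>c\<close> sends every univalent vertex to the
  copy \<open>(j, s)\<close> to which it is attached.
\<close>

definition attachments ::
  "nat \<Rightarrow> (word \<Rightarrow> word) \<Rightarrow> diagram \<Rightarrow> (nat \<Rightarrow> nat \<times> nat) set" where
  "attachments a g D = (\<Pi>\<^sub>E h\<in>set (legs D).
     {(j, s). j < a \<and> s < length (g [(j, True)]) \<and>
              h \<in> set (arc_legs (arcs D ! fst (g [(j, True)] ! s)))})"

fun inverse_point :: "nat \<Rightarrow> nat point \<Rightarrow> nat point" where
  "inverse_point n (Leg h) = Leg h"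
| "inverse_point n (Bead w) = Bead (inv\<^bsub>Fr n\<^esub> w)"

fun kept :: "(nat \<Rightarrow> nat \<times> nat) \<Rightarrow> nat \<times> nat \<Rightarrow> nat point \<Rightarrow> bool" where
  "kept c js (Leg h) \<longleftrightarrow> c h = js"
| "kept c js (Bead w) \<longleftrightarrow> True"

definition arc_copy ::
  "nat \<Rightarrow> (word \<Rightarrow> word) \<Rightarrow> diagram \<Rightarrow> (nat \<Rightarrow> nat \<times> nat) \<Rightarrow> nat \<Rightarrow> nat \<Rightarrow> nat point list" where
  "arc_copy n g D c j s =
     (let (p, \<epsilon>) = g [(j, True)] ! s; xs = filter (kept c (j, s)) (arcs D ! p)
      in if \<epsilon> then xs else rev (map (inverse_point n) xs))"

definition pulled_diagram ::
  "nat \<Rightarrow> nat \<Rightarrow> (word \<Rightarrow> word) \<Rightarrow> diagram \<Rightarrow> (nat \<Rightarrow> nat \<times> nat) \<Rightarrow> diagram" where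
  "pulled_diagram n a g D c = D\<lparr>arcs :=
     map (\<lambda>j. concat (map (arc_copy n g D c j) [0..<length (g [(j, True)])])) [0..<a]\<rparr>"

definition reversed_legs ::
  "(word \<Rightarrow> word) \<Rightarrow> diagram \<Rightarrow> (nat \<Rightarrow> nat \<times> nat) \<Rightarrow> nat set" where
  "reversed_legs g D c =
     {h \<in> set (legs D). case c h of (j, s) \<Rightarrow> \<not> snd (g [(j, True)] ! s)}"

definition pullback ::
  "nat \<Rightarrow> nat \<Rightarrow> (word \<Rightarrow> word) \<Rightarrow> diagram \<Rightarrow> (diagram \<Rightarrow>\<^sub>0 'k::field)" where
  "pullback n a g D = (\<Sum>c\<in>attachments a g D.
     scale ((-1) ^ card (reversed_legs g D c)) (gen (pulled_diagram n a g D c)))"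

definition A_map ::
  "nat \<Rightarrow> nat \<Rightarrow> nat \<Rightarrow> (word \<Rightarrow> word) \<Rightarrow>
     (diagram \<Rightarrow>\<^sub>0 'k::field) set \<Rightarrow> (diagram \<Rightarrow>\<^sub>0 'k) set" where
  "A_map n a b g = presented_map (diagrams n a) (diagram_rels n a) (pullback n a g)"

definition A_deg :: "nat \<Rightarrow> nat \<Rightarrow> ('k::field, (diagram \<Rightarrow>\<^sub>0 'k) set) gr_functor" where
  "A_deg d n = \<lparr>
     obj = (\<lambda>m. (A_vs n m)\<lparr>carrier := vspan (A_vs n m)
              (diagram_class n m ` {D \<in> diagrams n m. has_degree d D})\<rparr>),
     mor = A_map n\<rparr>"

definition A_deg_trivial :: "nat \<Rightarrow> nat \<Rightarrow> ('k::field, (diagram \<Rightarrow>\<^sub>0 'k) set) gr_functor" where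
  "A_deg_trivial d n = \<lparr>
     obj = (\<lambda>m. (A_vs n m)\<lparr>carrier := vspan (A_vs n m)
              (diagram_class n m ` {D \<in> diagrams n m. has_degree d D \<and> homotopy_trivial n D})\<rparr>),
     mor = A_map n\<rparr>"

end

theory Submission
  imports Defs
begin

text \<open>
  On the class \<open>0\<close> part the STU relation writes a diagram of degree one as a combination of chords.
  The holonomy \<open>v\<close> of the path from the arc \<open>i\<close> along the chord to the arc \<open>j\<close> is unchanged by bead
  equivalence, so that the chords \<open>(i, j, v)\<close> with \<open>i \<le> j\<close> form a basis. A linear form on the second
  Passi functor is a function on the free group which vanishes at \<open>1\<close> and has a biadditive
  polarization. Under the involution, these functions are freely generated by those which count pairs
  of a letter \<open>i\<close> and a later letter \<open>j\<close> with \<open>i \<le> j\<close>, so that the tensors of the latter with the group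
  elements \<open>v\<close> form a basis of the tensor product over the symmetric group. Both functors pull back the basis element \<open>(i, j, v)\<close> along
  \<open>g\<close> in the same way: attaching the ends of the chord to copies of the arcs amounts to counting
  pairs of letters in the words \<open>g(x\<^sub>p)\<close>. Without beads, an element of the symmetric square is
  determined by its coefficients on products of coordinate forms, which correspond to the chords.
\<close>

section \<open>Free groups\<close>

text \<open>Two difficulties shape the proof. The spaces of diagrams are quotients, so the
  independence of the chords needs a map that survives all relations. Such a map is
  \<open>diagram_value\<close>: the bead rules act on holonomies as changes of base points, which do
  not move the starting points of the arcs, and STU opens the loop of a lollipop into a chord, read
  in its two directions. Secondly, to compose pullbacks on diagrams would mean to iterate sums over
  attachments. The composition laws are instead transported along the natural bijection from the
  other functor, where they already hold on generators. What remains on the diagram side is that a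
  pullback respects the relations, and the value of a pulled chord. The order i \<le> j is where the
  involution enters: reading a chord backwards inverts its holonomy, as \<sigma> exchanges the two
  arguments of a polarization. On a single arc both readings occur, and they match the two
  independent functions \<open>count_pairs i i\<close> and its composition with inversion.\<close>

abbreviation flip_letter :: "nat \<times> bool \<Rightarrow> nat \<times> bool" where
  "flip_letter a \<equiv> (fst a, \<not> snd a)"

lemma reduce_simps [simp]: "reduce [] = []" "reduce (a # w) = cancel_cons a (reduce w)"
  by (simp_all add: reduce_def)

lemma reduce_append: "reduce (u @ v) = foldr cancel_cons u (reduce v)"
  by (simp add: reduce_def)

lemma length_reduce: "length (reduce w) \<le> length w"
proof (induction w)
  case (Cons a w)
  then show ?case by (cases "reduce w") auto
qed simp

lemma set_reduce: "set (reduce w) \<subseteq> set w"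
proof (induction w)
  case (Cons a w)
  then show ?case by (cases "reduce w") auto
qed simp

lemma reduced_ConsD:
  assumes "reduce (a # w) = a # w"
  shows "reduce w = w" "cancel_cons a w = a # w"
proof -
  show "reduce w = w"
    using assms length_reduce[of w] by (cases "reduce w") (auto split: if_splits)
  then show "cancel_cons a w = a # w" using assms by simp
qed

lemma cancel_cons_reduced: "reduce w = w \<Longrightarrow> reduce (cancel_cons a w) = cancel_cons a w"
proof (cases w)
  case (Cons b w')
  assume w: "reduce w = w"
  then show ?thesis using reduced_ConsD[of b w'] Cons by auto
qed simp

lemma reduce_idem [simp]: "reduce (reduce w) = reduce w"
  by (induction w) (auto simp: cancel_cons_reduced)

lemma foldr_cancel_cons_reduced: "reduce z = z \<Longrightarrow> reduce (foldr cancel_cons u z) = foldr cancel_cons u z"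
  by (induction u) (auto simp: cancel_cons_reduced)

text \<open>Letters act on reduced words as permutations, inverse letters as inverse permutations
  (van der Waerden's argument). Reducedness matters when the inner step deletes a leading
  \<open>a\<close>: the outer step has to put it back without meeting its inverse.\<close>

lemma cancel_cons_cancel: "reduce w = w \<Longrightarrow> cancel_cons a (cancel_cons (flip_letter a) w) = w"
proof (cases w)
  case (Cons b w')
  assume w: "reduce w = w"
  show ?thesis
  proof (cases "b = a")
    case True
    then show ?thesis using w reduced_ConsD(2)[of b w'] Cons by simp
  next
    case False
    then show ?thesis using Cons by (auto simp: prod_eq_iff)
  qed
qed (simp add: prod_eq_iff)

text \<open>As inverse letters act by inverse permutations, a word acts on reduced words through its
  reduction. Associativity of the product in \<open>Fr\<close> rests on this.\<close>

lemma foldr_cancel_cons_reduce: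
  assumes "reduce z = z" shows "foldr cancel_cons (reduce u) z = foldr cancel_cons u z"
proof (induction u)
  case (Cons a u)
  note IH = Cons.IH
  show ?case
  proof (cases "reduce u")
    case Nil
    then show ?thesis using IH by simp
  next
    case (Cons b r)
    have r: "cancel_cons b (foldr cancel_cons r z) = foldr cancel_cons u z" using IH Cons by simp
    show ?thesis
    proof (cases "b = flip_letter a")
      case True
      then show ?thesis
        using cancel_cons_cancel[OF foldr_cancel_cons_reduced[OF assms], of a r] r Cons by simp
    next
      case False
      then show ?thesis using r Cons by simp
    qed
  qed
qed simp

lemma reduce_append_reduce [simp]:
  "reduce (reduce u @ v) = reduce (u @ v)" "reduce (u @ reduce v) = reduce (u @ v)"
  by (simp_all add: reduce_append foldr_cancel_cons_reduce)

definition inv_word :: "word \<Rightarrow> word" where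
  "inv_word w = rev (map flip_letter w)"

lemma inv_word_simps [simp]: "inv_word [] = []" "inv_word (a # w) = inv_word w @ [flip_letter a]"
  by (simp_all add: inv_word_def)

lemma reduce_inv_word_append: "reduce (inv_word w @ w) = []"
proof (induction w)
  case (Cons a w)
  have "reduce (inv_word w @ flip_letter a # a # w) =
     foldr cancel_cons (inv_word w) (cancel_cons (flip_letter a) (cancel_cons (flip_letter (flip_letter a)) (reduce w)))"
    by (simp add: reduce_append)
  also have "\<dots> = reduce (inv_word w @ w)"
    by (subst cancel_cons_cancel) (simp_all add: reduce_append)
  finally show ?case using Cons by simp
qed simp

section \<open>The group of reduced words\<close>

lemma carrier_Fr: "w \<in> carrier (Fr n) \<longleftrightarrow> reduce w = w \<and> fst ` set w \<subseteq> {..<n}"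
  by (simp add: Fr_def)

lemma mult_Fr: "u \<otimes>\<^bsub>Fr n\<^esub> v = reduce (u @ v)" and one_Fr: "\<one>\<^bsub>Fr n\<^esub> = []"
  by (simp_all add: Fr_def)

lemma reduce_in_Fr: "fst ` set w \<subseteq> {..<n} \<Longrightarrow> reduce w \<in> carrier (Fr n)"
  using set_reduce[of w] by (fastforce simp: carrier_Fr)

lemma group_Fr: "group (Fr n)"
proof (rule groupI)
  fix x assume x: "x \<in> carrier (Fr n)"
  have "reduce (inv_word x) \<in> carrier (Fr n)"
    using x by (intro reduce_in_Fr) (auto simp: carrier_Fr inv_word_def)
  then show "\<exists>y\<in>carrier (Fr n). y \<otimes>\<^bsub>Fr n\<^esub> x = \<one>\<^bsub>Fr n\<^esub>"
    by (rule bexI[rotated]) (simp add: mult_Fr one_Fr reduce_inv_word_append)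
next
  fix x y assume "x \<in> carrier (Fr n)" "y \<in> carrier (Fr n)"
  then show "x \<otimes>\<^bsub>Fr n\<^esub> y \<in> carrier (Fr n)"
    unfolding mult_Fr by (intro reduce_in_Fr) (auto simp: carrier_Fr)
qed (auto simp: mult_Fr one_Fr carrier_Fr)

lemma inv_Fr:
  assumes "x \<in> carrier (Fr n)" shows "inv\<^bsub>Fr n\<^esub> x = reduce (inv_word x)"
proof (rule group.inv_equality[OF group_Fr _ assms])
  show "reduce (inv_word x) \<in> carrier (Fr n)"
    using assms by (intro reduce_in_Fr) (auto simp: carrier_Fr inv_word_def)
qed (simp add: mult_Fr one_Fr reduce_inv_word_append)

lemma letter_in_Fr: "i < n \<Longrightarrow> [(i, e)] \<in> carrier (Fr n)"
  by (simp add: carrier_Fr)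

lemma inv_letter: "i < n \<Longrightarrow> inv\<^bsub>Fr n\<^esub> [(i, True)] = [(i, False)]"
  by (simp add: inv_Fr letter_in_Fr)

text \<open>A tail of a reduced word is reduced, and prepending the next letter cancels nothing.
  Induction on the list is therefore an induction by left multiplication with letters.\<close>

lemma Fr_induct [consumes 1, case_names one mult]:
  assumes "x \<in> carrier (Fr n)" "P []"
    and "\<And>i e y. i < n \<Longrightarrow> y \<in> carrier (Fr n) \<Longrightarrow> P y \<Longrightarrow> P ([(i, e)] \<otimes>\<^bsub>Fr n\<^esub> y)"
  shows "P x"
  using assms(1)
proof (induction x)
  case (Cons a w)
  then have "reduce w = w" "cancel_cons a w = a # w" using reduced_ConsD[of a w] by (auto simp: carrier_Fr)
  then show ?case
    using Cons assms(3)[of "fst a" w "snd a"] by (auto simp: carrier_Fr mult_Fr)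
qed (rule assms(2))

section \<open>Morphisms of the category gr\<close>

lemma gr_closed: "g \<in> gr a b \<Longrightarrow> x \<in> carrier (Fr a) \<Longrightarrow> g x \<in> carrier (Fr b)"
  by (auto simp: gr_def hom_def)

lemma gr_mult: "g \<in> gr a b \<Longrightarrow> x \<in> carrier (Fr a) \<Longrightarrow> y \<in> carrier (Fr a) \<Longrightarrow>
    g (x \<otimes>\<^bsub>Fr a\<^esub> y) = g x \<otimes>\<^bsub>Fr b\<^esub> g y"
  by (auto simp: gr_def hom_def)

lemma gr_group_hom: "g \<in> gr a b \<Longrightarrow> group_hom (Fr a) (Fr b) g"
  by (auto simp: gr_def group_hom_def group_hom_axioms_def group_Fr)

lemma gr_one: "g \<in> gr a b \<Longrightarrow> g [] = []"
  using group_hom.hom_one[OF gr_group_hom] by (simp add: one_Fr)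

lemma gr_inv: "g \<in> gr a b \<Longrightarrow> x \<in> carrier (Fr a) \<Longrightarrow> g (inv\<^bsub>Fr a\<^esub> x) = inv\<^bsub>Fr b\<^esub> (g x)"
  using group_hom.hom_inv[OF gr_group_hom] by blast

lemma id_in_gr: "(\<lambda>x\<in>carrier (Fr a). x) \<in> gr a a"
  using monoid.m_closed[OF group.is_monoid[OF group_Fr[of a]]] by (auto simp: gr_def hom_def)

lemma compose_in_gr: "g \<in> gr a b \<Longrightarrow> h \<in> gr b c \<Longrightarrow> compose (carrier (Fr a)) h g \<in> gr a c"
  using monoid.m_closed[OF group.is_monoid[OF group_Fr[of a]]]
  by (auto simp: gr_def hom_def compose_def Pi_iff)


subsection \<open>Counting letters and pairs of letters\<close>

definition letter_sign :: "nat \<Rightarrow> nat \<times> bool \<Rightarrow> 'k::field" where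
  "letter_sign i a = (if fst a = i then if snd a then 1 else - 1 else 0)"

text \<open>The exponent sum of the generator \<open>i\<close>.\<close>

definition count_letter :: "nat \<Rightarrow> word \<Rightarrow> 'k::field" where
  "count_letter i w = (\<Sum>a\<leftarrow>w. letter_sign i a)"

text \<open>
  Signed number of pairs of a letter \<open>i\<close> and a later letter \<open>j\<close>. A letter \<open>i = j\<close> counts as
  a pair with itself if it is positive, since two univalent vertices attached to the same copy
  of an arc keep their order exactly if the copy is not reversed.
\<close>

fun count_pairs :: "nat \<Rightarrow> nat \<Rightarrow> word \<Rightarrow> 'k::field" where
  "count_pairs i j [] = 0"
| "count_pairs i j (a # w) = (if fst a = i \<and> fst a = j \<and> snd a then 1 else 0) +
     count_pairs i j w + letter_sign i a * count_letter j w"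

lemma count_letter_simps [simp]:
  "count_letter i [] = 0" "count_letter i (a # w) = letter_sign i a + count_letter i w"
  "count_letter i (u @ v) = count_letter i u + count_letter i v"
  by (simp_all add: count_letter_def)

lemma count_pairs_append:
  "count_pairs i j (u @ v) = count_pairs i j u + count_pairs i j v + count_letter i u * count_letter j v"
  by (induction u) (auto simp: algebra_simps)

text \<open>Both counts are coefficients, of X_i and of X_i X_j, in the multiplicative expansion
  which sends x_p to the inverse of 1 - X_p, hence they do not see cancellations. For i = j the pair
  formed by a letter and its adjacent inverse counts -1, which is balanced by the positive one of
  the two counting as a pair with itself.\<close>

lemma count_cancel_cons:
  "count_letter i (cancel_cons a w) = count_letter i (a # w)"
  "count_pairs i j (cancel_cons a w) = count_pairs i j (a # w)"
  by (cases w; auto simp: letter_sign_def algebra_simps)+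

lemma count_letter_reduce [simp]: "count_letter i (reduce w) = count_letter i w"
  by (induction w) (auto simp: count_cancel_cons)

lemma count_pairs_reduce [simp]: "count_pairs i j (reduce w) = count_pairs i j w"
  by (induction w) (auto simp: count_cancel_cons)

lemma count_letter_mult: "count_letter i (x \<otimes>\<^bsub>Fr n\<^esub> y) = count_letter i x + count_letter i y"
  by (simp add: mult_Fr)

lemma count_pairs_mult: "count_pairs i j (x \<otimes>\<^bsub>Fr n\<^esub> y) =
    count_pairs i j x + count_pairs i j y + count_letter i x * count_letter j y"
  by (simp add: mult_Fr count_pairs_append)

lemma count_letter_inv: "x \<in> carrier (Fr n) \<Longrightarrow> count_letter i (inv\<^bsub>Fr n\<^esub> x) = - (count_letter i x :: 'k::field)"
  using count_letter_mult[of i n "inv\<^bsub>Fr n\<^esub> x" x] group.l_inv[OF group_Fr]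
  by (simp add: one_Fr eq_neg_iff_add_eq_0)


section \<open>Linear algebra\<close>

subsection \<open>Formal linear combinations\<close>

lemma lookup_scale [simp]: "Poly_Mapping.lookup (scale c a) x = c * Poly_Mapping.lookup a x"
  by (simp add: scale_def Poly_Mapping.map.rep_eq when_def)

lemma scale_simps [simp]:
  "scale 1 a = a" "scale 0 a = 0" "scale c 0 = 0" "scale c (scale d a) = scale (c * d) a"
  "scale (- c) a = - scale c a" "scale c (- a) = - scale c a"
  by (auto intro!: poly_mapping_eqI)

lemma scale_add: "scale c (a + b) = scale c a + scale c b"
  and scale_add_left: "scale (c + d) a = scale c a + scale d a"
  and scale_diff: "scale c (a - b) = scale c a - scale c b"
  and scale_diff_left: "scale (c - d) a = scale c a - scale d a"
  by (auto intro!: poly_mapping_eqI simp: lookup_add lookup_minus algebra_simps)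

lemma scale_sum: "scale c (\<Sum>x\<in>A. f x) = (\<Sum>x\<in>A. scale c (f x))"
  by (induction A rule: infinite_finite_induct) (auto simp: scale_add)

lemma scale_sum_left: "scale (\<Sum>x\<in>A. f x) a = (\<Sum>x\<in>A. scale (f x) a)"
  by (induction A rule: infinite_finite_induct) (auto simp: scale_add_left)

lemma keys_scale: "Poly_Mapping.keys (scale c a) \<subseteq> Poly_Mapping.keys a"
  by (auto simp: in_keys_iff)

lemma keys_gen [simp]: "Poly_Mapping.keys (gen x :: 'x \<Rightarrow>\<^sub>0 'k::field) = {x}"
  by (simp add: gen_def)

definition lin_map :: "(('x \<Rightarrow>\<^sub>0 'k::field) \<Rightarrow> ('y \<Rightarrow>\<^sub>0 'k)) \<Rightarrow> bool" where
  "lin_map f \<longleftrightarrow> (\<forall>a b. f (a + b) = f a + f b) \<and> (\<forall>c a. f (scale c a) = scale c (f a))"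

lemma lin_mapD:
  assumes "lin_map f"
  shows "f (a + b) = f a + f b" "f (scale c a) = scale c (f a)" "f 0 = 0"
    "f (- a) = - f a" "f (a - b) = f a - f b"
proof -
  show add: "f (a + b) = f a + f b" and sc: "f (scale c a) = scale c (f a)" for a b c
    using assms by (auto simp: lin_map_def)
  show "f 0 = 0" using sc[of 0 0] by simp
  show m: "f (- a) = - f a" for a using sc[of "- 1" a] by simp
  show "f (a - b) = f a - f b" using add[of a "- b"] m by simp
qed

lemma lin_map_sum: assumes "lin_map f" shows "f (\<Sum>x\<in>A. h x) = (\<Sum>x\<in>A. f (h x))"
  by (induction A rule: infinite_finite_induct) (auto simp: lin_mapD[OF assms])

lemma lin_map_scale: "lin_map (scale c)"
  by (auto simp: lin_map_def scale_add mult.commute)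

lemma lin_ext_superset:
  assumes "finite S" "Poly_Mapping.keys a \<subseteq> S"
  shows "lin_ext f a = (\<Sum>x\<in>S. scale (Poly_Mapping.lookup a x) (f x))"
  unfolding lin_ext_def
  by (intro sum.mono_neutral_left assms) (auto simp: in_keys_iff)

lemma lin_map_lin_ext: "lin_map (lin_ext f)"
  unfolding lin_map_def
proof (intro conjI allI)
  fix a b :: "'a \<Rightarrow>\<^sub>0 'b"
  let ?S = "Poly_Mapping.keys a \<union> Poly_Mapping.keys b"
  have k: "Poly_Mapping.keys (a + b) \<subseteq> ?S" by (rule Poly_Mapping.keys_add)
  show "lin_ext f (a + b) = lin_ext f a + lin_ext f b"
    using k by (simp add: lin_ext_superset[of ?S] lookup_add scale_add_left sum.distrib)
next
  fix c and a :: "'a \<Rightarrow>\<^sub>0 'b"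
  show "lin_ext f (scale c a) = scale c (lin_ext f a)"
    using keys_scale[of c a]
    by (simp add: lin_ext_superset[of "Poly_Mapping.keys a"] scale_sum)
qed

lemmas lin_ext_simps = lin_mapD[OF lin_map_lin_ext]

lemma lin_ext_gen [simp]: "lin_ext f (gen x) = f x"
  by (simp add: lin_ext_def gen_def)

lemma lin_ext_sum: "lin_ext f (\<Sum>x\<in>A. h x) = (\<Sum>x\<in>A. lin_ext f (h x))"
  by (rule lin_map_sum[OF lin_map_lin_ext])

lemma lin_ext_gen_id: "lin_ext gen a = a"
proof (rule poly_mapping_eqI)
  fix x
  have "Poly_Mapping.lookup (lin_ext gen a) x =
     (\<Sum>y\<in>Poly_Mapping.keys a. Poly_Mapping.lookup a y * (if y = x then 1 else 0))"
    unfolding lin_ext_def lookup_sum by (simp add: gen_def lookup_single when_def)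
  also have "\<dots> = Poly_Mapping.lookup a x"
    by (simp add: sum.delta if_distrib[of "\<lambda>z. _ * z"] in_keys_iff cong: if_cong)
  finally show "Poly_Mapping.lookup (lin_ext gen a) x = Poly_Mapping.lookup a x" .
qed

lemma lin_ext_cong: "(\<And>x. x \<in> Poly_Mapping.keys a \<Longrightarrow> f x = h x) \<Longrightarrow> lin_ext f a = lin_ext h a"
  by (simp add: lin_ext_def)

lemma lin_map_lin_ext_comp:
  assumes "lin_map h" shows "h (lin_ext f a) = lin_ext (\<lambda>x. h (f x)) a"
  unfolding lin_ext_def by (simp add: lin_map_sum[OF assms] lin_mapD[OF assms])

lemmas lin_ext_lin_ext = lin_map_lin_ext_comp[OF lin_map_lin_ext]


subsection \<open>Subspaces and quotients\<close>

definition lin_sub :: "('x \<Rightarrow>\<^sub>0 'k::field) set \<Rightarrow> bool" where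
  "lin_sub U \<longleftrightarrow> 0 \<in> U \<and> (\<forall>a\<in>U. \<forall>b\<in>U. a + b \<in> U) \<and> (\<forall>c. \<forall>a\<in>U. scale c a \<in> U)"

lemma lin_subD:
  assumes "lin_sub U"
  shows "0 \<in> U" "a \<in> U \<Longrightarrow> b \<in> U \<Longrightarrow> a + b \<in> U" "a \<in> U \<Longrightarrow> scale c a \<in> U"
    "a \<in> U \<Longrightarrow> - a \<in> U" "a \<in> U \<Longrightarrow> b \<in> U \<Longrightarrow> a - b \<in> U"
proof -
  show add: "a \<in> U \<Longrightarrow> b \<in> U \<Longrightarrow> a + b \<in> U" and sc: "a \<in> U \<Longrightarrow> scale c a \<in> U" and "0 \<in> U" for a b c
    using assms by (auto simp: lin_sub_def)
  show m: "a \<in> U \<Longrightarrow> - a \<in> U" for a using sc[of a "- 1"] by simp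
  show "a \<in> U \<Longrightarrow> b \<in> U \<Longrightarrow> a - b \<in> U" using add[of a "- b"] m by simp
qed

lemma lin_sub_sum: "lin_sub U \<Longrightarrow> (\<And>x. x \<in> A \<Longrightarrow> f x \<in> U) \<Longrightarrow> (\<Sum>x\<in>A. f x) \<in> U"
  by (induction A rule: infinite_finite_induct) (auto simp: lin_subD)

lemma lin_sub_lin_ext:
  "lin_sub U \<Longrightarrow> (\<And>x. x \<in> Poly_Mapping.keys a \<Longrightarrow> f x \<in> U) \<Longrightarrow> lin_ext f a \<in> U"
  unfolding lin_ext_def by (intro lin_sub_sum lin_subD(3))

lemma lin_sub_vimage: assumes "lin_map f" "lin_sub U" shows "lin_sub {a. f a \<in> U}"
  using assms(2) by (auto simp: lin_sub_def lin_mapD[OF assms(1)])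

lemma lin_sub_Int: "lin_sub U \<Longrightarrow> lin_sub Y \<Longrightarrow> lin_sub (U \<inter> Y)"
  by (auto simp: lin_sub_def)

lemma lin_sub_zero: "lin_sub {0}"
  by (auto simp: lin_sub_def)

lemma lin_sub_keys: "lin_sub {a. Poly_Mapping.keys a \<subseteq> B}"
  by (auto simp: lin_sub_def dest!: subsetD[OF Poly_Mapping.keys_add] subsetD[OF keys_scale])

section \<open>Subspaces of formal combinations as modules\<close>

definition pm_vs :: "('x \<Rightarrow>\<^sub>0 'k::field) set \<Rightarrow> ('k, 'x \<Rightarrow>\<^sub>0 'k) module" where
  "pm_vs U = \<lparr>carrier = U, monoid.mult = undefined, one = undefined,
     zero = 0, add = (+), module.smult = scale\<rparr>"

lemma pm_vs_simps [simp]: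
  "carrier (pm_vs U) = U" "\<zero>\<^bsub>pm_vs U\<^esub> = 0" "a \<oplus>\<^bsub>pm_vs U\<^esub> b = a + b" "c \<odot>\<^bsub>pm_vs U\<^esub> a = scale c a"
  by (simp_all add: pm_vs_def)

lemma free_vs_eq: "free_vs B = pm_vs {a. Poly_Mapping.keys a \<subseteq> B}"
  by (simp add: free_vs_def pm_vs_def)

lemma aug_ideal_vs_eq: "aug_ideal_vs G = pm_vs (aug_ideal G)"
  by (simp add: aug_ideal_vs_def free_vs_def pm_vs_def)

lemma free_vs_simps [simp]:
  "carrier (free_vs B) = {a. Poly_Mapping.keys a \<subseteq> B}" "\<zero>\<^bsub>free_vs B\<^esub> = 0"
  "a \<oplus>\<^bsub>free_vs B\<^esub> b = a + b" "c \<odot>\<^bsub>free_vs B\<^esub> a = scale c a"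
  by (simp_all add: free_vs_eq)

lemma KK_simps [simp]:
  "carrier (KK :: 'k::field ring) = UNIV" "a \<oplus>\<^bsub>KK :: 'k ring\<^esub> b = a + b"
  "a \<otimes>\<^bsub>KK :: 'k ring\<^esub> b = a * b" "\<one>\<^bsub>KK :: 'k ring\<^esub> = 1" "\<zero>\<^bsub>KK :: 'k ring\<^esub> = 0"
  by (simp_all add: ring_of_type_algebra_def)

text \<open>Additive inverses come for free as multiples by -1, because the multiple by 0 is the
  zero of the space.\<close>

lemma module_KK_I:
  fixes V :: "('k::field, 'v) module"
  assumes "\<And>x y. x \<in> carrier V \<Longrightarrow> y \<in> carrier V \<Longrightarrow> x \<oplus>\<^bsub>V\<^esub> y \<in> carrier V"
    "\<zero>\<^bsub>V\<^esub> \<in> carrier V"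
    "\<And>x y z. x \<in> carrier V \<Longrightarrow> y \<in> carrier V \<Longrightarrow> z \<in> carrier V \<Longrightarrow>
        (x \<oplus>\<^bsub>V\<^esub> y) \<oplus>\<^bsub>V\<^esub> z = x \<oplus>\<^bsub>V\<^esub> (y \<oplus>\<^bsub>V\<^esub> z)"
    "\<And>x y. x \<in> carrier V \<Longrightarrow> y \<in> carrier V \<Longrightarrow> x \<oplus>\<^bsub>V\<^esub> y = y \<oplus>\<^bsub>V\<^esub> x"
    "\<And>x. x \<in> carrier V \<Longrightarrow> \<zero>\<^bsub>V\<^esub> \<oplus>\<^bsub>V\<^esub> x = x"
    "\<And>c x. x \<in> carrier V \<Longrightarrow> c \<odot>\<^bsub>V\<^esub> x \<in> carrier V"
    "\<And>c d x. x \<in> carrier V \<Longrightarrow> (c + d) \<odot>\<^bsub>V\<^esub> x = c \<odot>\<^bsub>V\<^esub> x \<oplus>\<^bsub>V\<^esub> d \<odot>\<^bsub>V\<^esub> x"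
    "\<And>c x y. x \<in> carrier V \<Longrightarrow> y \<in> carrier V \<Longrightarrow>
        c \<odot>\<^bsub>V\<^esub> (x \<oplus>\<^bsub>V\<^esub> y) = c \<odot>\<^bsub>V\<^esub> x \<oplus>\<^bsub>V\<^esub> c \<odot>\<^bsub>V\<^esub> y"
    "\<And>c d x. x \<in> carrier V \<Longrightarrow> (c * d) \<odot>\<^bsub>V\<^esub> x = c \<odot>\<^bsub>V\<^esub> (d \<odot>\<^bsub>V\<^esub> x)"
    "\<And>x. x \<in> carrier V \<Longrightarrow> 1 \<odot>\<^bsub>V\<^esub> x = x"
    "\<And>x. x \<in> carrier V \<Longrightarrow> 0 \<odot>\<^bsub>V\<^esub> x = \<zero>\<^bsub>V\<^esub>"
  shows "module KK V"
proof (intro moduleI abelian_groupI cring_from_type_algebra)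
  fix x assume x: "x \<in> carrier V"
  show "\<exists>y\<in>carrier V. y \<oplus>\<^bsub>V\<^esub> x = \<zero>\<^bsub>V\<^esub>"
  proof (rule bexI[of _ "(- 1) \<odot>\<^bsub>V\<^esub> x"])
    show "(- 1) \<odot>\<^bsub>V\<^esub> x \<oplus>\<^bsub>V\<^esub> x = \<zero>\<^bsub>V\<^esub>"
      using assms(7)[OF x, of "- 1" 1] assms(10,11)[OF x] by simp
  qed (rule assms(6)[OF x])
qed (use assms in auto)

lemma module_pm_vs: "lin_sub U \<Longrightarrow> module KK (pm_vs U)"
  by (rule module_KK_I) (auto simp: lin_subD scale_add scale_add_left ac_simps)

lemma module_free_vs: "module KK (free_vs B)"
  unfolding free_vs_eq by (rule module_pm_vs[OF lin_sub_keys])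

lemma submodule_iff:
  assumes "module KK V"
  shows "submodule N KK V \<longleftrightarrow> N \<subseteq> carrier V \<and> \<zero>\<^bsub>V\<^esub> \<in> N \<and>
     (\<forall>a\<in>N. \<forall>b\<in>N. a \<oplus>\<^bsub>V\<^esub> b \<in> N) \<and> (\<forall>c. \<forall>a\<in>N. c \<odot>\<^bsub>V\<^esub> a \<in> N)" (is "_ = ?R")
proof
  interpret module KK V by fact
  show "submodule N KK V \<Longrightarrow> ?R"
    using submoduleE[of N] by auto (metis abelian_group.a_inv_closed abelian_groupI additive_subgroup.zero_closed additive_subgroupI submodule.axioms(1))
  assume R: ?R
  have inv: "\<ominus>\<^bsub>V\<^esub> a = (- 1) \<odot>\<^bsub>V\<^esub> a" if "a \<in> carrier V" for a
  proof -
    have "(- 1) \<odot>\<^bsub>V\<^esub> a \<oplus>\<^bsub>V\<^esub> a = \<zero>\<^bsub>V\<^esub>"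
      using smult_l_distr[of "- 1" 1 a] that smult_l_null[OF that] smult_one[OF that] by simp
    then show ?thesis using that by (intro M.minus_equality) auto
  qed
  show "submodule N KK V"
    by (rule submoduleI) (use R inv in \<open>auto simp: subset_iff\<close>)
qed

lemma submodule_pm_vs_iff: "lin_sub U \<Longrightarrow> submodule N KK (pm_vs U) \<longleftrightarrow> lin_sub N \<and> N \<subseteq> U"
  by (subst submodule_iff[OF module_pm_vs]) (auto simp: lin_sub_def)

lemma submodule_vspan:
  assumes "module KK V" "S \<subseteq> carrier V"
  shows "submodule (vspan V S) KK V" "S \<subseteq> vspan V S"
proof -
  have c: "submodule (carrier V) KK V" by (rule module.carrier_is_submodule[OF assms(1)])
  then have sub: "vspan V S \<subseteq> carrier V" unfolding vspan_def using assms by blast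
  show "S \<subseteq> vspan V S" by (auto simp: vspan_def)
  show "submodule (vspan V S) KK V"
    unfolding submodule_iff[OF assms(1)] using sub
    by (auto simp: vspan_def submodule_iff[OF assms(1)])
qed

lemma vspan_least: "submodule N KK V \<Longrightarrow> S \<subseteq> N \<Longrightarrow> vspan V S \<subseteq> N"
  by (auto simp: vspan_def)

lemma vspan_pm_vs:
  assumes "lin_sub U" "S \<subseteq> U"
  shows "lin_sub (vspan (pm_vs U) S)" "S \<subseteq> vspan (pm_vs U) S" "vspan (pm_vs U) S \<subseteq> U"
  using submodule_vspan[of "pm_vs U" S] assms
  by (auto simp: submodule_pm_vs_iff[OF assms(1)] module_pm_vs)

lemma vspan_pm_vs_least:
  assumes "lin_sub U" "S \<subseteq> U" "lin_sub P" "S \<subseteq> P"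
  shows "vspan (pm_vs U) S \<subseteq> P"
proof -
  have "vspan (pm_vs U) S \<subseteq> P \<inter> U"
    by (rule vspan_least) (use assms in \<open>auto simp: submodule_pm_vs_iff intro: lin_sub_Int\<close>)
  then show ?thesis by blast
qed

text \<open>A coset does not depend on the ambient carrier. This form serves the quotients of free
  spaces and of the augmentation ideal alike.\<close>

definition cls :: "('x \<Rightarrow>\<^sub>0 'k::field) set \<Rightarrow> ('x \<Rightarrow>\<^sub>0 'k) \<Rightarrow> ('x \<Rightarrow>\<^sub>0 'k) set" where
  "cls N v = (\<lambda>h. h + v) ` N"

lemma coset_pm_vs [simp]: "N +>\<^bsub>pm_vs U\<^esub> v = cls N v"
  by (auto simp: a_r_coset_def r_coset_def cls_def)

lemma coset_free_vs [simp]: "N +>\<^bsub>free_vs U\<^esub> v = cls N v"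
  by (simp add: free_vs_eq)

lemma in_cls: "u \<in> cls N v \<longleftrightarrow> u - v \<in> N"
  by (force simp: cls_def)

lemma cls_self: "lin_sub N \<Longrightarrow> v \<in> cls N v"
  by (simp add: in_cls lin_subD)

lemma cls_eq_iff:
  assumes "lin_sub N" shows "cls N u = cls N v \<longleftrightarrow> u - v \<in> N"
proof
  assume "cls N u = cls N v"
  then show "u - v \<in> N" using cls_self[OF assms, of u] by (simp add: in_cls)
next
  assume a: "u - v \<in> N"
  have "w - u \<in> N \<longleftrightarrow> w - v \<in> N" for w
    using lin_subD(2)[OF assms, of "w - u" "u - v"] lin_subD(5)[OF assms, of "w - v" "u - v"] a by auto
  then show "cls N u = cls N v" by (auto simp: in_cls)
qed

lemma cls_add: assumes "lin_sub N" shows "set_add (pm_vs U) (cls N u) (cls N v) = cls N (u + v)"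
proof -
  have "set_add (pm_vs U) (cls N u) (cls N v) = (\<Union>a\<in>cls N u. \<Union>b\<in>cls N v. {a + b})"
    by (auto simp: set_add_def set_mult_def)
  also have "\<dots> = cls N (u + v)"
  proof (intro subset_antisym subsetI)
    fix w assume "w \<in> (\<Union>a\<in>cls N u. \<Union>b\<in>cls N v. {a + b})"
    then obtain a b where "w = a + b" "a - u \<in> N" "b - v \<in> N" by (auto simp: in_cls)
    then show "w \<in> cls N (u + v)" using lin_subD(2)[OF assms, of "a - u" "b - v"]
      by (simp add: in_cls algebra_simps)
  next
    fix w assume "w \<in> cls N (u + v)"
    then have "w - v \<in> cls N u" "v \<in> cls N v" using lin_subD(1)[OF assms]
      by (simp_all add: in_cls algebra_simps)
    then show "w \<in> (\<Union>a\<in>cls N u. \<Union>b\<in>cls N v. {a + b})" by (intro UN_I) auto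
  qed
  finally show ?thesis .
qed

lemma quot_map_cls:
  assumes "lin_map f" "lin_sub M" "lin_sub N" "f ` M \<subseteq> N"
  shows "quot_map (pm_vs Y) N f (cls M v) = cls N (f v)"
proof -
  have "cls N (f w) = cls N (f v)" if "w \<in> cls M v" for w
  proof -
    have "w - v \<in> M" using that by (simp add: in_cls)
    then have "f (w - v) \<in> N" using assms(4) by blast
    then show ?thesis by (simp add: cls_eq_iff[OF assms(3)] lin_mapD(5)[OF assms(1)])
  qed
  moreover have "cls M v \<noteq> {}" using cls_self[OF assms(2)] by blast
  ultimately show ?thesis unfolding quot_map_def coset_pm_vs by (intro SUP_eq_const)
qed

lemma quot_vs_simps:
  assumes "lin_sub N"
  shows "carrier (quot_vs (pm_vs U) N) = cls N ` U"
    "\<zero>\<^bsub>quot_vs (pm_vs U) N\<^esub> = cls N 0"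
    "cls N u \<oplus>\<^bsub>quot_vs (pm_vs U) N\<^esub> cls N v = cls N (u + v)"
    "c \<odot>\<^bsub>quot_vs (pm_vs U) N\<^esub> cls N v = cls N (scale c v)"
proof -
  show "carrier (quot_vs (pm_vs U) N) = cls N ` U"
    by (auto simp: quot_vs_def A_RCOSETS_def' )
  show "\<zero>\<^bsub>quot_vs (pm_vs U) N\<^esub> = cls N 0" by (simp add: quot_vs_def cls_def)
  show "cls N u \<oplus>\<^bsub>quot_vs (pm_vs U) N\<^esub> cls N v = cls N (u + v)"
    by (simp add: quot_vs_def cls_add assms)
  show "c \<odot>\<^bsub>quot_vs (pm_vs U) N\<^esub> cls N v = cls N (scale c v)"
    by (simp add: quot_vs_def quot_map_cls assms lin_map_scale image_subset_iff lin_subD)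
qed

lemma module_quot_vs:
  assumes "lin_sub U" "lin_sub N"
  shows "module KK (quot_vs (pm_vs U) N)"
  by (rule module_KK_I)
    (use assms in \<open>auto simp: quot_vs_simps lin_subD scale_add scale_add_left ac_simps\<close>)

text \<open>Evaluation at an arbitrary representative, for functions which are constant on
  cosets.\<close>

definition descend :: "(('x \<Rightarrow>\<^sub>0 'k::field) \<Rightarrow> 'c) \<Rightarrow> ('x \<Rightarrow>\<^sub>0 'k) set \<Rightarrow> 'c" where
  "descend f C = f (SOME a. a \<in> C)"

lemma descend_cls:
  assumes "lin_sub N" "\<And>u w. u - w \<in> N \<Longrightarrow> f u = f w"
  shows "descend f (cls N v) = f v"
  unfolding descend_def by (rule someI2[of _ v]) (use assms(1) in \<open>auto simp: in_cls lin_subD(1) intro: assms(2)\<close>)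

subsection \<open>Presentations by generators and relations\<close>

abbreviation rel_span :: "'x set \<Rightarrow> ('x \<Rightarrow>\<^sub>0 'k::field) set \<Rightarrow> ('x \<Rightarrow>\<^sub>0 'k) set" where
  "rel_span B R \<equiv> vspan (free_vs B) R"

lemma rel_span:
  assumes "R \<subseteq> carrier (free_vs B)"
  shows "lin_sub (rel_span B R)" "r \<in> R \<Longrightarrow> r \<in> rel_span B R"
    "rel_span B R \<subseteq> {a. Poly_Mapping.keys a \<subseteq> B}"
  using vspan_pm_vs[OF lin_sub_keys, of R B] assms by (auto simp: free_vs_eq)

lemma rel_span_least:
  assumes "R \<subseteq> carrier (free_vs B)" "lin_sub P" "R \<subseteq> P"
  shows "rel_span B R \<subseteq> P"
  unfolding free_vs_eq by (rule vspan_pm_vs_least[OF lin_sub_keys _ assms(2,3)]) (use assms in auto)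

lemma rel_span_lin_map:
  assumes "R \<subseteq> carrier (free_vs B)" "lin_map f" "lin_sub P" "\<And>r. r \<in> R \<Longrightarrow> f r \<in> P" "a \<in> rel_span B R"
  shows "f a \<in> P"
  using rel_span_least[OF assms(1) lin_sub_vimage[OF assms(2,3)]] assms(4,5) by auto

lemma presented_simps:
  assumes "R \<subseteq> carrier (free_vs B)"
  shows "carrier (presented B R) = cls (rel_span B R) ` {a. Poly_Mapping.keys a \<subseteq> B}"
    "\<zero>\<^bsub>presented B R\<^esub> = cls (rel_span B R) 0"
    "cls (rel_span B R) u \<oplus>\<^bsub>presented B R\<^esub> cls (rel_span B R) v = cls (rel_span B R) (u + v)"
    "c \<odot>\<^bsub>presented B R\<^esub> cls (rel_span B R) v = cls (rel_span B R) (scale c v)"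
  using quot_vs_simps[OF rel_span(1)[OF assms]] by (simp_all add: presented_def free_vs_eq)

lemma module_presented:
  assumes "R \<subseteq> carrier (free_vs B)" shows "module KK (presented B R)"
  unfolding presented_def using rel_span(1)[OF assms]
  by (simp add: free_vs_eq module_quot_vs lin_sub_keys)

lemma presented_map_cls:
  assumes "R \<subseteq> carrier (free_vs B)" "R' \<subseteq> carrier (free_vs B')"
    and "\<And>r. r \<in> R \<Longrightarrow> lin_ext f r \<in> rel_span B' R'"
  shows "presented_map B' R' f (cls (rel_span B R) a) = cls (rel_span B' R') (lin_ext f a)"
proof -
  have "lin_ext f ` rel_span B R \<subseteq> rel_span B' R'"
    using rel_span_lin_map[OF assms(1) lin_map_lin_ext rel_span(1)[OF assms(2)] assms(3)] by auto
  then show ?thesis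
    unfolding presented_map_def using quot_map_cls[OF lin_map_lin_ext rel_span(1)[OF assms(1)] rel_span(1)[OF assms(2)]]
    by (simp add: free_vs_eq)
qed

lemma keys_lin_ext:
  assumes "\<And>x. x \<in> Poly_Mapping.keys a \<Longrightarrow> Poly_Mapping.keys (f x) \<subseteq> B"
  shows "Poly_Mapping.keys (lin_ext f a) \<subseteq> B"
  using lin_sub_lin_ext[OF lin_sub_keys[of B], of a f] assms by auto

lemma presented_map_linear:
  assumes "R \<subseteq> carrier (free_vs B)" "R' \<subseteq> carrier (free_vs B')"
    and "\<And>r. r \<in> R \<Longrightarrow> lin_ext f r \<in> rel_span B' R'"
    and "\<And>x. x \<in> B \<Longrightarrow> Poly_Mapping.keys (f x) \<subseteq> B'"
  shows "presented_map B' R' f \<in> linear_maps (presented B R) (presented B' R')"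
proof -
  have k: "Poly_Mapping.keys (lin_ext f a) \<subseteq> B'" if "Poly_Mapping.keys a \<subseteq> B" for a
    using that assms(4) by (intro keys_lin_ext) auto
  show ?thesis
    unfolding linear_maps_def
    by (auto simp: presented_simps[OF assms(1)] presented_simps[OF assms(2)] presented_map_cls[OF assms(1-3)]
      lin_ext_simps intro!: imageI dest!: k)
qed


subsection \<open>Linear maps and natural equivalences\<close>

lemma linear_mapsD:
  assumes "f \<in> linear_maps V W"
  shows "v \<in> carrier V \<Longrightarrow> f v \<in> carrier W"
    "u \<in> carrier V \<Longrightarrow> v \<in> carrier V \<Longrightarrow> f (u \<oplus>\<^bsub>V\<^esub> v) = f u \<oplus>\<^bsub>W\<^esub> f v"
    "v \<in> carrier V \<Longrightarrow> f (c \<odot>\<^bsub>V\<^esub> v) = c \<odot>\<^bsub>W\<^esub> f v"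
  using assms by (auto simp: linear_maps_def)

lemma linear_maps_zero:
  assumes "module KK V" "module KK W" "f \<in> linear_maps V W"
  shows "f \<zero>\<^bsub>V\<^esub> = \<zero>\<^bsub>W\<^esub>"
proof -
  interpret V: module KK V by fact
  interpret W: module KK W by fact
  have "f (0 \<odot>\<^bsub>V\<^esub> \<zero>\<^bsub>V\<^esub>) = 0 \<odot>\<^bsub>W\<^esub> f \<zero>\<^bsub>V\<^esub>" by (rule linear_mapsD(3)[OF assms(3)]) simp
  then show ?thesis
    using V.smult_l_null[of "\<zero>\<^bsub>V\<^esub>"] W.smult_l_null[OF linear_mapsD(1)[OF assms(3) V.zero_closed]] by simp
qed

lemma free_vs_induct [consumes 1, case_names zero gen add scale]:
  assumes "Poly_Mapping.keys a \<subseteq> B"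
    and z: "P 0" and g: "\<And>x. x \<in> B \<Longrightarrow> P (gen x)"
    and ad: "\<And>a b. Poly_Mapping.keys a \<subseteq> B \<Longrightarrow> Poly_Mapping.keys b \<subseteq> B \<Longrightarrow> P a \<Longrightarrow> P b \<Longrightarrow> P (a + b)"
    and sc: "\<And>c a. Poly_Mapping.keys a \<subseteq> B \<Longrightarrow> P a \<Longrightarrow> P (scale c a)"
  shows "P a"
proof -
  \<comment> \<open>The support condition and \<open>P\<close> together cut out a subspace which
    contains the generators, and \<open>a\<close> is its own expansion in generators.\<close>
  have "lin_ext gen a \<in> {a. Poly_Mapping.keys a \<subseteq> B \<and> P a}"
  proof (rule lin_sub_lin_ext)
    show "lin_sub {a. Poly_Mapping.keys a \<subseteq> B \<and> P a}"
      using z ad sc by (auto simp: lin_sub_def dest!: subsetD[OF Poly_Mapping.keys_add] subsetD[OF keys_scale])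
  qed (use assms in auto)
  then show ?thesis by (simp add: lin_ext_gen_id)
qed

lemma linear_maps_inv_into:
  assumes "module KK V" "f \<in> linear_maps V W" "bij_betw f (carrier V) (carrier W)"
  shows "inv_into (carrier V) f \<in> linear_maps W V"
proof -
  interpret module KK V by fact
  have inv: "inv_into (carrier V) f (f v) = v" if "v \<in> carrier V" for v
    using assms(3) that by (simp add: bij_betw_inv_into_left)
  have surj: "\<exists>v\<in>carrier V. w = f v" if "w \<in> carrier W" for w
    using assms(3) that by (auto simp: bij_betw_def)
  show ?thesis
    unfolding linear_maps_def
  proof (intro CollectI conjI ballI allI funcsetI)
    fix w assume "w \<in> carrier W"
    then show "inv_into (carrier V) f w \<in> carrier V" using surj inv by metis
  next
    fix w w' assume "w \<in> carrier W" "w' \<in> carrier W"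
    then obtain v v' where v: "v \<in> carrier V" "v' \<in> carrier V" "w = f v" "w' = f v'" using surj by metis
    then show "inv_into (carrier V) f (w \<oplus>\<^bsub>W\<^esub> w') =
        inv_into (carrier V) f w \<oplus>\<^bsub>V\<^esub> inv_into (carrier V) f w'"
      using linear_mapsD(2)[OF assms(2), of v v'] inv by (metis M.a_closed)
  next
    fix c w assume "w \<in> carrier W"
    then obtain v where v: "v \<in> carrier V" "w = f v" using surj by metis
    have "inv_into (carrier V) f (f (c \<odot>\<^bsub>V\<^esub> v)) = c \<odot>\<^bsub>V\<^esub> v"
      by (rule inv) (use smult_closed[of c v] v in simp)
    then show "inv_into (carrier V) f (c \<odot>\<^bsub>W\<^esub> w) = c \<odot>\<^bsub>V\<^esub> inv_into (carrier V) f w"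
      using linear_mapsD(3)[OF assms(2) v(1)] v inv by simp
  qed
qed

lemma linear_maps_comp: "f \<in> linear_maps U V \<Longrightarrow> h \<in> linear_maps V W \<Longrightarrow> (\<lambda>x. h (f x)) \<in> linear_maps U W"
  by (auto simp: linear_maps_def Pi_iff)

section \<open>Natural equivalences from compatible bases\<close>

lemma contravariant_functorD:
  assumes "contravariant_functor M"
  shows "module KK (obj M m)"
    "g \<in> gr a b \<Longrightarrow> mor M a b g \<in> linear_maps (obj M b) (obj M a)"
    "v \<in> carrier (obj M a) \<Longrightarrow> mor M a a (\<lambda>x\<in>carrier (Fr a). x) v = v"
    "g \<in> gr a b \<Longrightarrow> h \<in> gr b c \<Longrightarrow> w \<in> carrier (obj M c) \<Longrightarrow>
       mor M a c (compose (carrier (Fr a)) h g) w = mor M a b g (mor M b c h w)"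
proof -
  note * = assms[unfolded contravariant_functor_def]
  show "module KK (obj M m)" by (rule *[THEN conjunct1, rule_format])
  show "g \<in> gr a b \<Longrightarrow> mor M a b g \<in> linear_maps (obj M b) (obj M a)"
    by (rule *[THEN conjunct2, THEN conjunct1, rule_format])
  show "v \<in> carrier (obj M a) \<Longrightarrow> mor M a a (\<lambda>x\<in>carrier (Fr a). x) v = v"
    by (rule *[THEN conjunct2, THEN conjunct2, THEN conjunct1, rule_format])
  show "g \<in> gr a b \<Longrightarrow> h \<in> gr b c \<Longrightarrow> w \<in> carrier (obj M c) \<Longrightarrow>
       mor M a c (compose (carrier (Fr a)) h g) w = mor M a b g (mor M b c h w)"
    by (rule *[THEN conjunct2, THEN conjunct2, THEN conjunct2, rule_format])
qed

text \<open>Both functors are parametrized by the same free spaces, and it suffices to compare the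
  morphisms on basis elements. The resulting bijection is natural, so the identity and composition
  laws of \<open>N\<close> force those of \<open>M\<close>. For diagrams this replaces the analysis
  of iterated attachments.\<close>

lemma nat_equiv_op_via_basis:
  fixes M :: "('k::field, 'v) gr_functor" and N :: "('k, 'w) gr_functor"
    and \<Psi> :: "nat \<Rightarrow> ('x \<Rightarrow>\<^sub>0 'k) \<Rightarrow> 'v" and \<Theta> :: "nat \<Rightarrow> ('x \<Rightarrow>\<^sub>0 'k) \<Rightarrow> 'w"
  assumes M: "\<And>m. module KK (obj M m)"
      "\<And>a b g. g \<in> gr a b \<Longrightarrow> mor M a b g \<in> linear_maps (obj M b) (obj M a)"
    and N: "contravariant_functor N"
    and \<Psi>: "\<And>m. \<Psi> m \<in> linear_maps (free_vs (B m)) (obj M m)"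
      "\<And>m. bij_betw (\<Psi> m) (carrier (free_vs (B m))) (carrier (obj M m))"
    and \<Theta>: "\<And>m. \<Theta> m \<in> linear_maps (free_vs (B m)) (obj N m)"
      "\<And>m. bij_betw (\<Theta> m) (carrier (free_vs (B m))) (carrier (obj N m))"
    and E: "\<And>a b g x. g \<in> gr a b \<Longrightarrow> x \<in> B b \<Longrightarrow> \<exists>e\<in>carrier (free_vs (B a)).
        mor M a b g (\<Psi> b (gen x)) = \<Psi> a e \<and> mor N a b g (\<Theta> b (gen x)) = \<Theta> a e"
  shows "nat_equiv_op M N"
proof -
  have modN: "module KK (obj N m)" for m by (rule contravariant_functorD(1)[OF N])
  have linN: "mor N a b g \<in> linear_maps (obj N b) (obj N a)" if "g \<in> gr a b" for a b g
    by (rule contravariant_functorD(2)[OF N that])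
  \<comment> \<open>The common witness \<open>e\<close> exists on generators by assumption, and the
    elements which have one are closed under linear combinations.\<close>
  have natural: "\<exists>e\<in>carrier (free_vs (B a)). mor M a b g (\<Psi> b y) = \<Psi> a e \<and> mor N a b g (\<Theta> b y) = \<Theta> a e"
    if g: "g \<in> gr a b" and y: "Poly_Mapping.keys y \<subseteq> B b" for a b g y
    using y
  proof (induction rule: free_vs_induct)
    case zero
    have "\<Psi> m 0 = \<zero>\<^bsub>obj M m\<^esub>" "\<Theta> m 0 = \<zero>\<^bsub>obj N m\<^esub>" for m
      using linear_maps_zero[OF module_free_vs M(1) \<Psi>(1)] linear_maps_zero[OF module_free_vs modN \<Theta>(1)] by simp_all
    then have "mor M a b g (\<Psi> b 0) = \<Psi> a 0" "mor N a b g (\<Theta> b 0) = \<Theta> a 0"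
      using linear_maps_zero[OF M(1) M(1) M(2)[OF g]] linear_maps_zero[OF modN modN linN[OF g]] by simp_all
    then show ?case by (intro bexI[of _ 0]) auto
  next
    case (gen x) then show ?case by (rule E[OF g])
  next
    case (add y z)
    then obtain e e' where *: "e \<in> carrier (free_vs (B a))" "e' \<in> carrier (free_vs (B a))"
      "mor M a b g (\<Psi> b y) = \<Psi> a e" "mor N a b g (\<Theta> b y) = \<Theta> a e"
      "mor M a b g (\<Psi> b z) = \<Psi> a e'" "mor N a b g (\<Theta> b z) = \<Theta> a e'" by blast
    have "mor M a b g (\<Psi> b (y \<oplus>\<^bsub>free_vs (B b)\<^esub> z)) = \<Psi> a (e \<oplus>\<^bsub>free_vs (B a)\<^esub> e')"
      using * add linear_mapsD(1)[OF \<Psi>(1)]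
      by (simp only: free_vs_simps(1) mem_Collect_eq linear_mapsD(2)[OF \<Psi>(1)] linear_mapsD(2)[OF M(2)[OF g]])
    moreover have "mor N a b g (\<Theta> b (y \<oplus>\<^bsub>free_vs (B b)\<^esub> z)) = \<Theta> a (e \<oplus>\<^bsub>free_vs (B a)\<^esub> e')"
      using * add linear_mapsD(1)[OF \<Theta>(1)]
      by (simp only: free_vs_simps(1) mem_Collect_eq linear_mapsD(2)[OF \<Theta>(1)] linear_mapsD(2)[OF linN[OF g]])
    ultimately show ?case using *(1,2) Poly_Mapping.keys_add[of e e'] by (intro bexI[of _ "e + e'"]) auto
  next
    case (scale c y)
    then obtain e where *: "e \<in> carrier (free_vs (B a))"
      "mor M a b g (\<Psi> b y) = \<Psi> a e" "mor N a b g (\<Theta> b y) = \<Theta> a e" by blast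
    have "mor M a b g (\<Psi> b (c \<odot>\<^bsub>free_vs (B b)\<^esub> y)) = \<Psi> a (c \<odot>\<^bsub>free_vs (B a)\<^esub> e)"
      using * scale linear_mapsD(1)[OF \<Psi>(1)]
      by (simp only: free_vs_simps(1) mem_Collect_eq linear_mapsD(3)[OF \<Psi>(1)] linear_mapsD(3)[OF M(2)[OF g]])
    moreover have "mor N a b g (\<Theta> b (c \<odot>\<^bsub>free_vs (B b)\<^esub> y)) = \<Theta> a (c \<odot>\<^bsub>free_vs (B a)\<^esub> e)"
      using * scale linear_mapsD(1)[OF \<Theta>(1)]
      by (simp only: free_vs_simps(1) mem_Collect_eq linear_mapsD(3)[OF \<Theta>(1)] linear_mapsD(3)[OF linN[OF g]])
    ultimately show ?case using *(1) keys_scale[of c e] by (intro bexI[of _ "Defs.scale c e"]) auto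
  qed
  define \<phi> where "\<phi> m v = \<Theta> m (inv_into (carrier (free_vs (B m))) (\<Psi> m) v)" for m v
  have \<phi>\<Psi>: "\<phi> m (\<Psi> m y) = \<Theta> m y" if "y \<in> carrier (free_vs (B m))" for m y
    unfolding \<phi>_def bij_betw_inv_into_left[OF \<Psi>(2) that] ..
  have surj: "\<exists>y\<in>carrier (free_vs (B m)). v = \<Psi> m y" if "v \<in> carrier (obj M m)" for v m
    using \<Psi>(2)[of m] that by (auto simp: bij_betw_def)
  have \<phi>_lin: "\<phi> m \<in> linear_maps (obj M m) (obj N m)" for m
    unfolding \<phi>_def by (rule linear_maps_comp[OF linear_maps_inv_into[OF module_free_vs \<Psi>] \<Theta>(1)])
  have "bij_betw (\<Theta> m \<circ> inv_into (carrier (free_vs (B m))) (\<Psi> m)) (carrier (obj M m)) (carrier (obj N m))" for m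
    by (rule bij_betw_trans[OF bij_betw_inv_into[OF \<Psi>(2)] \<Theta>(2)])
  then have \<phi>_bij: "bij_betw (\<phi> m) (carrier (obj M m)) (carrier (obj N m))" for m
    by (simp add: \<phi>_def[abs_def] comp_def)
  have \<phi>_nat: "\<phi> a (mor M a b g v) = mor N a b g (\<phi> b v)" if g: "g \<in> gr a b" and v: "v \<in> carrier (obj M b)" for a b g v
  proof -
    obtain y where y: "y \<in> carrier (free_vs (B b))" "v = \<Psi> b y" using surj v by blast
    then obtain e where "e \<in> carrier (free_vs (B a))" "mor M a b g v = \<Psi> a e" "mor N a b g (\<Theta> b y) = \<Theta> a e"
      using natural[OF g, of y] by auto
    then show ?thesis using y by (simp add: \<phi>\<Psi>)
  qed
  have \<phi>_inj: "v = v'" if "v \<in> carrier (obj M m)" "v' \<in> carrier (obj M m)" "\<phi> m v = \<phi> m v'" for m v v'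
    using bij_betw_imp_inj_on[OF \<phi>_bij] that by (auto dest: inj_onD)
  \<comment> \<open>Each law of \<open>M\<close> is tested after applying the injective map
    \<open>\<phi>\<close>, where naturality turns it into the law of \<open>N\<close>.\<close>
  have "contravariant_functor M"
    unfolding contravariant_functor_def
  proof (intro conjI allI ballI M)
    fix a v assume v: "v \<in> carrier (obj M a)"
    have "\<phi> a (mor M a a (\<lambda>x\<in>carrier (Fr a). x) v) = \<phi> a v"
      using \<phi>_nat[OF id_in_gr v] contravariant_functorD(3)[OF N linear_mapsD(1)[OF \<phi>_lin v]] by simp
    then show "mor M a a (\<lambda>x\<in>carrier (Fr a). x) v = v"
      using \<phi>_inj linear_mapsD(1)[OF M(2)[OF id_in_gr] v] v by blast
  next
    fix a b c g h v assume g: "g \<in> gr a b" and h: "h \<in> gr b c" and v: "v \<in> carrier (obj M c)"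
    have hv: "mor M b c h v \<in> carrier (obj M b)" by (rule linear_mapsD(1)[OF M(2)[OF h] v])
    have "\<phi> a (mor M a c (compose (carrier (Fr a)) h g) v) = \<phi> a (mor M a b g (mor M b c h v))"
      using \<phi>_nat[OF compose_in_gr[OF g h] v] \<phi>_nat[OF g hv] \<phi>_nat[OF h v]
        contravariant_functorD(4)[OF N g h linear_mapsD(1)[OF \<phi>_lin v]] by simp
    then show "mor M a c (compose (carrier (Fr a)) h g) v = mor M a b g (mor M b c h v)"
      using \<phi>_inj linear_mapsD(1)[OF M(2)[OF compose_in_gr[OF g h]] v] linear_mapsD(1)[OF M(2)[OF g] hv] by blast
  qed
  then show ?thesis
    unfolding nat_equiv_op_def using N \<phi>_lin \<phi>_bij \<phi>_nat by blast
qed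


section \<open>Holonomy of beaded diagrams\<close>

lemma (in group) cancel_left:
  "x \<in> carrier G \<Longrightarrow> y \<in> carrier G \<Longrightarrow> x \<otimes> (inv x \<otimes> y) = y"
  "x \<in> carrier G \<Longrightarrow> y \<in> carrier G \<Longrightarrow> inv x \<otimes> (x \<otimes> y) = y"
  by (simp_all flip: m_assoc)

text \<open>These rules associate products to the right and cancel adjacent inverse factors, which
  settles the identities between holonomies below.\<close>

lemmas (in group) group_word_simps = m_assoc inv_mult_group cancel_left

section \<open>Products of beads along edges and arcs\<close>

definition bead_product :: "nat \<Rightarrow> word list \<Rightarrow> word" where
  "bead_product n us = foldr (\<lambda>u v. u \<otimes>\<^bsub>Fr n\<^esub> v) us \<one>\<^bsub>Fr n\<^esub>"

lemma bead_product_simps [simp]: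
  "bead_product n [] = \<one>\<^bsub>Fr n\<^esub>"
  "bead_product n (u # us) = u \<otimes>\<^bsub>Fr n\<^esub> bead_product n us"
  by (simp_all add: bead_product_def)

lemma bead_product_closed [simp]: "set us \<subseteq> carrier (Fr n) \<Longrightarrow> bead_product n us \<in> carrier (Fr n)"
proof -
  interpret group "Fr n" by (rule group_Fr)
  show "set us \<subseteq> carrier (Fr n) \<Longrightarrow> bead_product n us \<in> carrier (Fr n)"
    by (induction us) auto
qed

lemma bead_product_append:
  assumes "set us \<subseteq> carrier (Fr n)" "set vs \<subseteq> carrier (Fr n)"
  shows "bead_product n (us @ vs) = bead_product n us \<otimes>\<^bsub>Fr n\<^esub> bead_product n vs"
proof -
  interpret group "Fr n" by (rule group_Fr)
  show ?thesis using assms by (induction us) (auto simp: m_assoc)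
qed

lemma arc_legs_simps [simp]:
  "arc_legs [] = []" "arc_legs (Leg h # xs) = h # arc_legs xs" "arc_legs (Bead w # xs) = arc_legs xs"
  "arc_legs (xs @ ys) = arc_legs xs @ arc_legs ys"
  by (simp_all add: arc_legs_def)

lemma arc_beads_simps [simp]:
  "arc_beads [] = []" "arc_beads (Leg h # xs) = arc_beads xs" "arc_beads (Bead w # xs) = w # arc_beads xs"
  "arc_beads (xs @ ys) = arc_beads xs @ arc_beads ys"
  by (simp_all add: arc_beads_def)

lemma arc_product_eq: "arc_product n xs = bead_product n (arc_beads xs)"
  by (simp add: arc_product_def bead_product_def)

lemma arc_legs_map_point [simp]: "arc_legs (map (map_point f) xs) = map f (arc_legs xs)"
proof (induction xs)
  case (Cons x xs) then show ?case by (cases x) auto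
qed simp

text \<open>The holonomy from the beginning of the arc, which serves as base point, to the leg
  \<open>h\<close>. On a list without \<open>h\<close> it is the product of all beads, as the rule
  for concatenations requires.\<close>

fun prefix_product :: "nat \<Rightarrow> nat point list \<Rightarrow> nat \<Rightarrow> word" where
  "prefix_product n [] h = \<one>\<^bsub>Fr n\<^esub>"
| "prefix_product n (Leg k # xs) h = (if k = h then \<one>\<^bsub>Fr n\<^esub> else prefix_product n xs h)"
| "prefix_product n (Bead w # xs) h = w \<otimes>\<^bsub>Fr n\<^esub> prefix_product n xs h"

lemma prefix_product_closed [simp]:
  assumes "set (arc_beads xs) \<subseteq> carrier (Fr n)"
  shows "prefix_product n xs h \<in> carrier (Fr n)"
proof -
  interpret group "Fr n" by (rule group_Fr)
  show ?thesis using assms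
  proof (induction xs)
    case (Cons x xs) then show ?case by (cases x) auto
  qed simp
qed

lemma prefix_product_append:
  assumes "set (arc_beads xs) \<subseteq> carrier (Fr n)" "set (arc_beads ys) \<subseteq> carrier (Fr n)"
  shows "prefix_product n (xs @ ys) h = (if h \<in> set (arc_legs xs) then prefix_product n xs h
      else bead_product n (arc_beads xs) \<otimes>\<^bsub>Fr n\<^esub> prefix_product n ys h)"
proof -
  interpret group "Fr n" by (rule group_Fr)
  show ?thesis using assms
  proof (induction xs)
    case (Cons x xs) then show ?case by (cases x) (auto simp: m_assoc)
  qed simp
qed

lemma prefix_product_map_point:
  assumes "inj_on f (insert h (set (arc_legs xs)))"
  shows "prefix_product n (map (map_point f) xs) (f h) = prefix_product n xs h"
  using assms
proof (induction xs)
  case (Cons x xs)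
  show ?case
  proof (cases x)
    case (Leg k)
    have "f k = f h \<longleftrightarrow> k = h" "inj_on f (insert h (set (arc_legs xs)))"
      using Cons.prems Leg by (auto simp: inj_on_def)
    then show ?thesis using Cons.IH Leg by simp
  qed (use Cons in simp)
qed simp

text \<open>The transport from \<open>h\<close> to \<open>k\<close> along their edge, whichever way
  the edge is stored. In a diagram this relation is a partial function of \<open>h\<close>
  (\<open>holonomy_unique\<close>).\<close>

definition holonomy :: "nat \<Rightarrow> diagram \<Rightarrow> nat \<Rightarrow> nat \<Rightarrow> word \<Rightarrow> bool" where
  "holonomy n D h k u \<longleftrightarrow> (\<exists>us. (h, us, k) \<in> set (edges D) \<and> u = bead_product n us \<or>
      (k, us, h) \<in> set (edges D) \<and> u = inv\<^bsub>Fr n\<^esub> (bead_product n us))"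

section \<open>Edges, vertices and legs of a diagram\<close>

lemma diagramsD:
  assumes "D \<in> diagrams n m"
  shows "length (arcs D) = m" "distinct (half_edges D)" "distinct (legs D)"
    "distinct (concat (map corners (trivs D)))"
    "set (half_edges D) = set (legs D) \<union> set (concat (map corners (trivs D)))"
    "set (legs D) \<inter> set (concat (map corners (trivs D))) = {}"
    "xs \<in> set (arcs D) \<Longrightarrow> set (arc_beads xs) \<subseteq> carrier (Fr n)"
    "e \<in> set (edges D) \<Longrightarrow> set (edge_beads e) \<subseteq> carrier (Fr n)"
    "(h, us, k) \<in> set (edges D) \<Longrightarrow> set us \<subseteq> carrier (Fr n)"
proof -
  have *: "length (arcs D) = m \<and> distinct (half_edges D) \<and>
     distinct (legs D @ concat (map corners (trivs D))) \<and>
     set (half_edges D) = set (legs D @ concat (map corners (trivs D))) \<and>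
     (\<forall>xs\<in>set (arcs D). set (arc_beads xs) \<subseteq> carrier (Fr n)) \<and>
     (\<forall>e\<in>set (edges D). set (edge_beads e) \<subseteq> carrier (Fr n))"
    using assms unfolding diagrams_def by blast
  then show "length (arcs D) = m" "distinct (half_edges D)" "distinct (legs D)"
    "distinct (concat (map corners (trivs D)))"
    "set (half_edges D) = set (legs D) \<union> set (concat (map corners (trivs D)))"
    "set (legs D) \<inter> set (concat (map corners (trivs D))) = {}"
    by simp_all
  from * show "xs \<in> set (arcs D) \<Longrightarrow> set (arc_beads xs) \<subseteq> carrier (Fr n)"
    and e: "e \<in> set (edges D) \<Longrightarrow> set (edge_beads e) \<subseteq> carrier (Fr n)" for e by blast+
  show "(h, us, k) \<in> set (edges D) \<Longrightarrow> set us \<subseteq> carrier (Fr n)" using e[of "(h, us, k)"] by simp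
qed

lemma edge_beads_holonomy:
  "D \<in> diagrams n m \<Longrightarrow> (h, us, k) \<in> set (edges D) \<Longrightarrow> bead_product n us \<in> carrier (Fr n)"
  using diagramsD(9) by auto

lemma holonomy_closed: "D \<in> diagrams n m \<Longrightarrow> holonomy n D h k u \<Longrightarrow> u \<in> carrier (Fr n)"
  using group.inv_closed[OF group_Fr] edge_beads_holonomy by (fastforce simp: holonomy_def)

lemma holonomy_sym: "D \<in> diagrams n m \<Longrightarrow> holonomy n D h k u \<Longrightarrow> holonomy n D k h (inv\<^bsub>Fr n\<^esub> u)"
  using group.inv_inv[OF group_Fr edge_beads_holonomy] unfolding holonomy_def by metis

lemma distinct_concat_nth:
  assumes "distinct (concat xss)" "i < length xss" "j < length xss" "x \<in> set (xss ! i)" "x \<in> set (xss ! j)"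
  shows "i = j"
  using assms
proof (induction xss arbitrary: i j)
  case (Cons xs xss)
  have "x \<in> set (concat xss)" if "x \<in> set (xss ! k)" "k < length xss" for k
    using that by (auto intro: nth_mem)
  with Cons show ?case
    by (cases i; cases j; simp; blast dest: nth_mem)
qed simp

lemma distinct_concat_map:
  assumes "distinct (concat (map f xs))" "x \<in> set xs" "y \<in> set xs" "a \<in> set (f x)" "a \<in> set (f y)"
  shows "x = y"
  using distinct_concat_nth[OF assms(1)] assms(2-) by (auto simp: in_set_conv_nth)

lemma edge_unique:
  assumes "D \<in> diagrams n m" "e \<in> set (edges D)" "e' \<in> set (edges D)"
    "h \<in> set (edge_ends e)" "h \<in> set (edge_ends e')"
  shows "e = e'"
  using distinct_concat_map[of edge_ends "edges D" e e' h] diagramsD(2)[OF assms(1)] assms(2-)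
  by (simp add: half_edges_def)

lemma edge_ends_distinct: "D \<in> diagrams n m \<Longrightarrow> (h, us, k) \<in> set (edges D) \<Longrightarrow> h \<noteq> k"
  using diagramsD(2)[of D n m] by (force simp: half_edges_def distinct_concat_iff)

text \<open>A half-edge lies on exactly one edge, and the two ends of an edge differ, so that it
  occupies one position only.\<close>

lemma holonomy_unique:
  assumes "D \<in> diagrams n m" "holonomy n D h k u" "holonomy n D h k' u'"
  shows "k = k'" "u = u'"
proof -
  obtain e where e: "e \<in> set (edges D)" "h \<in> set (edge_ends e)"
    "\<exists>us. e = (h, us, k) \<and> u = bead_product n us \<or> e = (k, us, h) \<and> u = inv\<^bsub>Fr n\<^esub> (bead_product n us)"
    using assms(2) unfolding holonomy_def by force
  obtain e' where e': "e' \<in> set (edges D)" "h \<in> set (edge_ends e')"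
    "\<exists>us. e' = (h, us, k') \<and> u' = bead_product n us \<or> e' = (k', us, h) \<and> u' = inv\<^bsub>Fr n\<^esub> (bead_product n us)"
    using assms(3) unfolding holonomy_def by force
  have eq: "e = e'" using edge_unique[OF assms(1)] e e' by blast
  have "k = k' \<and> u = u'" using e e' eq edge_ends_distinct[OF assms(1)] by auto
  then show "k = k'" "u = u'" by auto
qed

lemma half_edge_holonomy:
  assumes "h \<in> set (half_edges D)"
  obtains k u where "holonomy n D h k u" "k \<in> set (half_edges D)"
proof -
  obtain e where "e \<in> set (edges D)" "h \<in> set (edge_ends e)" using assms by (auto simp: half_edges_def)
  moreover obtain a us b where e: "e = (a, us, b)" by (cases e)
  ultimately show thesis
    using that[of b "bead_product n us"] that[of a "inv\<^bsub>Fr n\<^esub> (bead_product n us)"]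
    by (force simp: holonomy_def half_edges_def)
qed

lemma holonomy_neq: "D \<in> diagrams n m \<Longrightarrow> holonomy n D h k u \<Longrightarrow> h \<noteq> k"
  unfolding holonomy_def using edge_ends_distinct by blast

lemma rotations_corners: "(a, b, c) \<in> rotations v \<Longrightarrow> set (corners v) = {a, b, c}"
  by (cases v) auto

lemma rotations_distinct: "D \<in> diagrams n m \<Longrightarrow> v \<in> set (trivs D) \<Longrightarrow> (a, b, c) \<in> rotations v \<Longrightarrow>
    a \<noteq> b \<and> b \<noteq> c \<and> a \<noteq> c"
  using diagramsD(4)[of D n m] by (cases v) (force simp: distinct_concat_iff)

lemma leg_on_arc:
  assumes "h \<in> set (legs D)"
  obtains i where "i < length (arcs D)" "h \<in> set (arc_legs (arcs D ! i))"
  using assms by (auto simp: legs_def in_set_conv_nth) (metis in_set_conv_nth)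

lemma leg_on_arc_unique:
  assumes "D \<in> diagrams n m" "i < length (arcs D)" "h \<in> set (arc_legs (arcs D ! i))"
    "j < length (arcs D)" "h \<in> set (arc_legs (arcs D ! j))"
  shows "i = j"
  using distinct_concat_nth[of "map arc_legs (arcs D)" i j h] diagramsD(3)[OF assms(1)] assms(2-)
  by (simp add: legs_def)

lemma arc_leg_in_legs: "i < length (arcs D) \<Longrightarrow> h \<in> set (arc_legs (arcs D ! i)) \<Longrightarrow> h \<in> set (legs D)"
  by (auto simp: legs_def)


subsection \<open>Gauge transformations\<close>

text \<open>
  A step of the bead equivalence acts on the holonomies as a change of base points: \<open>\<gamma> h\<close> is
  the path from the old to the new base point of the vertex of the half-edge \<open>h\<close>.
\<close>

definition gauge_related :: "nat \<Rightarrow> (nat \<Rightarrow> nat) \<Rightarrow> (nat \<Rightarrow> word) \<Rightarrow> diagram \<Rightarrow> diagram \<Rightarrow> bool" where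
  "gauge_related n f \<gamma> D D' \<longleftrightarrow>
     range \<gamma> \<subseteq> carrier (Fr n) \<and>
     map arc_legs (arcs D') = map (map f \<circ> arc_legs) (arcs D) \<and>
     (\<forall>i<length (arcs D). \<forall>h\<in>set (arc_legs (arcs D ! i)).
        prefix_product n (arcs D' ! i) (f h) = prefix_product n (arcs D ! i) h \<otimes>\<^bsub>Fr n\<^esub> \<gamma> h) \<and>
     (\<forall>h us k. (h, us, k) \<in> set (edges D) \<longrightarrow>
        holonomy n D' (f h) (f k) (inv\<^bsub>Fr n\<^esub> (\<gamma> h) \<otimes>\<^bsub>Fr n\<^esub> bead_product n us \<otimes>\<^bsub>Fr n\<^esub> \<gamma> k)) \<and>
     length (trivs D') = length (trivs D) \<and>
     (\<forall>a b c. (a, b, c) \<in> \<Union> (rotations ` set (trivs D)) \<longrightarrow>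
        (f a, f b, f c) \<in> \<Union> (rotations ` set (trivs D')) \<and> \<gamma> a = \<gamma> b \<and> \<gamma> b = \<gamma> c)"

lemma gauge_relatedD:
  assumes "gauge_related n f \<gamma> D D'"
  shows "\<gamma> h \<in> carrier (Fr n)" "legs D' = map f (legs D)" "length (arcs D') = length (arcs D)"
    "length (trivs D') = length (trivs D)"
    "i < length (arcs D) \<Longrightarrow> arc_legs (arcs D' ! i) = map f (arc_legs (arcs D ! i))"
    "i < length (arcs D) \<Longrightarrow> h \<in> set (arc_legs (arcs D ! i)) \<Longrightarrow>
       prefix_product n (arcs D' ! i) (f h) = prefix_product n (arcs D ! i) h \<otimes>\<^bsub>Fr n\<^esub> \<gamma> h"
    "(a, b, c) \<in> \<Union> (rotations ` set (trivs D)) \<Longrightarrow>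
        (f a, f b, f c) \<in> \<Union> (rotations ` set (trivs D')) \<and> \<gamma> a = \<gamma> b \<and> \<gamma> b = \<gamma> c"
proof -
  have eq: "map arc_legs (arcs D') = map (map f \<circ> arc_legs) (arcs D)"
    using assms unfolding gauge_related_def by blast
  then show len: "length (arcs D') = length (arcs D)" by (metis length_map)
  have "legs D' = concat (map (map f \<circ> arc_legs) (arcs D))" by (simp add: legs_def eq)
  then show "legs D' = map f (legs D)" by (simp add: legs_def map_concat comp_def)
  show "i < length (arcs D) \<Longrightarrow> arc_legs (arcs D' ! i) = map f (arc_legs (arcs D ! i))"
    using arg_cong[OF eq, of "\<lambda>xs. xs ! i"] len by simp
  have r: "range \<gamma> \<subseteq> carrier (Fr n)"
    using assms unfolding gauge_related_def by (elim conjE) assumption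
  have p: "\<forall>i<length (arcs D). \<forall>h\<in>set (arc_legs (arcs D ! i)).
        prefix_product n (arcs D' ! i) (f h) = prefix_product n (arcs D ! i) h \<otimes>\<^bsub>Fr n\<^esub> \<gamma> h"
    using assms unfolding gauge_related_def by (elim conjE) assumption
  have t: "\<forall>a b c. (a, b, c) \<in> \<Union> (rotations ` set (trivs D)) \<longrightarrow>
        (f a, f b, f c) \<in> \<Union> (rotations ` set (trivs D')) \<and> \<gamma> a = \<gamma> b \<and> \<gamma> b = \<gamma> c"
    using assms unfolding gauge_related_def by (elim conjE) assumption
  show "length (trivs D') = length (trivs D)"
    using assms unfolding gauge_related_def by (elim conjE) assumption
  show "\<gamma> h \<in> carrier (Fr n)" using r by blast
  show "i < length (arcs D) \<Longrightarrow> h \<in> set (arc_legs (arcs D ! i)) \<Longrightarrow>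
       prefix_product n (arcs D' ! i) (f h) = prefix_product n (arcs D ! i) h \<otimes>\<^bsub>Fr n\<^esub> \<gamma> h"
    by (rule p[rule_format])
  show "(a, b, c) \<in> \<Union> (rotations ` set (trivs D)) \<Longrightarrow>
        (f a, f b, f c) \<in> \<Union> (rotations ` set (trivs D')) \<and> \<gamma> a = \<gamma> b \<and> \<gamma> b = \<gamma> c"
    by (rule t[THEN spec, THEN spec, THEN spec, THEN mp])
qed

text \<open>\<open>gauge_related\<close> speaks of edges in their stored direction only. The
  opposite direction follows by inverting, which exchanges the two gauge factors.\<close>

lemma gauge_related_holonomy:
  assumes "gauge_related n f \<gamma> D D'" "D \<in> diagrams n m" "D' \<in> diagrams n m" "holonomy n D h k u"
  shows "holonomy n D' (f h) (f k) (inv\<^bsub>Fr n\<^esub> (\<gamma> h) \<otimes>\<^bsub>Fr n\<^esub> u \<otimes>\<^bsub>Fr n\<^esub> \<gamma> k)"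
proof -
  interpret group "Fr n" by (rule group_Fr)
  have *: "holonomy n D' (f h) (f k) (inv\<^bsub>Fr n\<^esub> (\<gamma> h) \<otimes>\<^bsub>Fr n\<^esub> bead_product n us \<otimes>\<^bsub>Fr n\<^esub> \<gamma> k)"
    if "(h, us, k) \<in> set (edges D)" for h us k
  proof -
    have "\<forall>h us k. (h, us, k) \<in> set (edges D) \<longrightarrow>
        holonomy n D' (f h) (f k) (inv\<^bsub>Fr n\<^esub> (\<gamma> h) \<otimes>\<^bsub>Fr n\<^esub> bead_product n us \<otimes>\<^bsub>Fr n\<^esub> \<gamma> k)"
      using assms(1) unfolding gauge_related_def by (elim conjE) assumption
    then show ?thesis using that by blast
  qed
  note c [simp] = gauge_relatedD(1)[OF assms(1)]
  from assms(4) consider us where "(h, us, k) \<in> set (edges D)" "u = bead_product n us"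
    | us where "(k, us, h) \<in> set (edges D)" "u = inv\<^bsub>Fr n\<^esub> (bead_product n us)"
    unfolding holonomy_def by blast
  then show ?thesis
  proof cases
    case 1 then show ?thesis using * by blast
  next
    case 2
    have b: "bead_product n us \<in> carrier (Fr n)" by (rule edge_beads_holonomy[OF assms(2) 2(1)])
    show ?thesis using holonomy_sym[OF assms(3) *[OF 2(1)]] b 2(2) by (simp add: group_word_simps)
  qed
qed

text \<open>An isomorphism constrains the trivalent vertices only through the set of their rotated
  triples. Their number is recovered from it: all corners are distinct, three for each vertex, and
  each is the first entry of a rotation.\<close>

lemma length_trivs_eq_card:
  assumes "D \<in> diagrams n m"
  shows "3 * length (trivs D) = card {a. \<exists>b c. (a, b, c) \<in> \<Union> (rotations ` set (trivs D))}"
proof -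
  have c: "length (corners v) = 3" for v by (cases v) simp
  have "length (concat (map corners vs)) = 3 * length vs" for vs
    by (induction vs) (simp_all add: c)
  then have "3 * length (trivs D) = card (set (concat (map corners (trivs D))))"
    using distinct_card[OF diagramsD(4)[OF assms]] by simp
  moreover have *: "a \<in> set (corners v) \<longleftrightarrow> (\<exists>b c. (a, b, c) \<in> rotations v)" for a v
    by (cases v) auto
  have "set (concat (map corners (trivs D))) = {a. \<exists>v\<in>set (trivs D). a \<in> set (corners v)}"
    by (simp only: set_concat set_map) blast
  then have "set (concat (map corners (trivs D))) = {a. \<exists>b c. (a, b, c) \<in> \<Union> (rotations ` set (trivs D))}"
    unfolding * by blast
  ultimately show ?thesis by simp
qed

lemma prefix_product_cong:
  assumes "arc_legs xs = arc_legs ys" "bead_product n (arc_beads xs) = bead_product n (arc_beads ys)"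
    "\<And>h. h \<in> set (arc_legs xs) \<Longrightarrow> prefix_product n xs h = prefix_product n ys h"
    "set (arc_beads (us @ xs @ vs)) \<subseteq> carrier (Fr n)" "set (arc_beads ys) \<subseteq> carrier (Fr n)"
  shows "prefix_product n (us @ xs @ vs) h = prefix_product n (us @ ys @ vs) h"
  using assms by (auto simp: prefix_product_append)

lemma gauge_related_edges:
  assumes "D \<in> diagrams n m" "arcs D' = arcs D" "trivs D' = trivs D"
    and "\<And>h us k. (h, us, k) \<in> set (edges D) \<Longrightarrow> holonomy n D' h k (bead_product n us)"
  shows "gauge_related n id (\<lambda>_. \<one>\<^bsub>Fr n\<^esub>) D D'"
proof -
  interpret group "Fr n" by (rule group_Fr)
  show ?thesis
    using assms diagramsD(7)[OF assms(1) nth_mem] edge_beads_holonomy[OF assms(1)]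
    by (auto simp: gauge_related_def)
qed

text \<open>Replacing a segment by one with the same total product and the same transports to its
  legs leaves every transport along the arc unchanged, so no base point moves.\<close>

lemma gauge_related_arcs:
  assumes "D \<in> diagrams n m" "edges D' = edges D" "trivs D' = trivs D"
    and i: "i < length (arcs D)" "arcs D ! i = us @ xs @ vs" "arcs D' = (arcs D)[i := us @ ys @ vs]"
    and "arc_legs xs = arc_legs ys" "bead_product n (arc_beads xs) = bead_product n (arc_beads ys)"
    "\<And>h. h \<in> set (arc_legs xs) \<Longrightarrow> prefix_product n xs h = prefix_product n ys h"
    "set (arc_beads ys) \<subseteq> carrier (Fr n)"
  shows "gauge_related n id (\<lambda>_. \<one>\<^bsub>Fr n\<^esub>) D D'"
proof -
  interpret group "Fr n" by (rule group_Fr)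
  have b: "set (arc_beads (arcs D ! j)) \<subseteq> carrier (Fr n)" if "j < length (arcs D)" for j
    using diagramsD(7)[OF assms(1) nth_mem] that by blast
  have p: "prefix_product n (us @ xs @ vs) h = prefix_product n (us @ ys @ vs) h" for h
    by (rule prefix_product_cong) (use assms b[OF i(1)] in auto)
  have "map arc_legs (arcs D') = map arc_legs (arcs D)"
    using assms by (auto simp: map_update intro!: list_update_same_conv[THEN iffD2])
  moreover have "prefix_product n (arcs D' ! j) h = prefix_product n (arcs D ! j) h" if "j < length (arcs D)" for j h
    using that i p by (cases "i = j") auto
  ultimately show ?thesis
    using assms(2,3) b edge_beads_holonomy[OF assms(1)] by (auto simp: gauge_related_def holonomy_def)
qed

lemma in_set_list_update:
  assumes "x \<in> set xs" "j < length xs"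
  shows "x \<in> set (xs[j := y]) \<or> x = xs ! j \<and> y \<in> set (xs[j := y])"
  using assms by (metis in_set_conv_nth length_list_update nth_list_update_eq nth_list_update_neq)

lemma holonomyI: "(h, us, k) \<in> set (edges D) \<Longrightarrow> u = bead_product n us \<Longrightarrow> holonomy n D h k u"
  by (auto simp: holonomy_def)

lemma gauge_related_edge_update:
  assumes "D \<in> diagrams n m" "j < length (edges D)" "edges D ! j = (h, us, k)"
    and "holonomy n (D\<lparr>edges := (edges D)[j := e]\<rparr>) h k (bead_product n us)"
  shows "gauge_related n id (\<lambda>_. \<one>\<^bsub>Fr n\<^esub>) D (D\<lparr>edges := (edges D)[j := e]\<rparr>)"
proof (rule gauge_related_edges[OF assms(1)])
  fix a ws b assume "(a, ws, b) \<in> set (edges D)"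
  from in_set_list_update[OF this assms(2), of e]
  show "holonomy n (D\<lparr>edges := (edges D)[j := e]\<rparr>) a b (bead_product n ws)"
    using assms(3,4) by (auto intro: holonomyI)
qed simp_all

lemma arc_beads_closed: "D \<in> diagrams n m \<Longrightarrow> i < length (arcs D) \<Longrightarrow> set (arc_beads (arcs D ! i)) \<subseteq> carrier (Fr n)"
  using diagramsD(7) nth_mem by blast

lemma add_bead_product:
  assumes "set us \<subseteq> carrier (Fr n)" "w \<in> carrier (Fr n)" "add_bead n w h (a, us, b) = (a', us', b')"
  shows "a' = a" "b' = b" "set us' \<subseteq> carrier (Fr n)"
    "bead_product n us' = (if a = h then w else \<one>\<^bsub>Fr n\<^esub>) \<otimes>\<^bsub>Fr n\<^esub> bead_product n us \<otimes>\<^bsub>Fr n\<^esub>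
       (if b = h then inv\<^bsub>Fr n\<^esub> w else \<one>\<^bsub>Fr n\<^esub>)"
proof -
  interpret group "Fr n" by (rule group_Fr)
  show "a' = a" "b' = b" "set us' \<subseteq> carrier (Fr n)"
    "bead_product n us' = (if a = h then w else \<one>\<^bsub>Fr n\<^esub>) \<otimes>\<^bsub>Fr n\<^esub> bead_product n us \<otimes>\<^bsub>Fr n\<^esub>
       (if b = h then inv\<^bsub>Fr n\<^esub> w else \<one>\<^bsub>Fr n\<^esub>)"
    using assms by (auto simp: bead_product_append m_assoc)
qed

text \<open>Merging, removing units, reversing an edge and renaming leave all holonomies as they
  are, with trivial gauge. Pushing a bead through a vertex moves the base point of this vertex
  across the bead, so the gauge is nontrivial exactly on the half-edges of the vertex.\<close>

lemma bead_step_gauge_related: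
  assumes "bead_step n D D'" "D \<in> diagrams n m" "D' \<in> diagrams n m"
  shows "\<exists>f \<gamma>. gauge_related n f \<gamma> D D'"
proof -
  interpret group "Fr n" by (rule group_Fr)
  show ?thesis
    using assms(1)
  proof cases
    case (isomorphism f)
    have arcs: "map arc_legs (arcs D') = map (map f \<circ> arc_legs) (arcs D)"
      by (simp add: isomorphism(2))
    have pp: "prefix_product n (arcs D' ! i) (f h) = prefix_product n (arcs D ! i) h"
      if "i < length (arcs D)" "h \<in> set (arc_legs (arcs D ! i))" for i h
    proof -
      have "insert h (set (arc_legs (arcs D ! i))) \<subseteq> set (half_edges D)"
        using that arc_leg_in_legs diagramsD(5)[OF assms(2)] by blast
      then show ?thesis
        using that(1) prefix_product_map_point[OF inj_on_subset[OF isomorphism(1)]] by (simp add: isomorphism(2))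
    qed
    have hol: "holonomy n D' (f h) (f k) (bead_product n us)" if "(h, us, k) \<in> set (edges D)" for h us k
      by (rule holonomyI[of _ us]) (use that in \<open>force simp: isomorphism(3)\<close>, rule refl)
    have rot: "\<Union> (rotations ` (\<lambda>(a, b, c). (f a, f b, f c)) ` T) = (\<lambda>(a, b, c). (f a, f b, f c)) ` \<Union> (rotations ` T)" for T
      by force
    have tr: "\<Union> (rotations ` set (trivs D')) = (\<lambda>(a, b, c). (f a, f b, f c)) ` \<Union> (rotations ` set (trivs D))"
      using isomorphism(4) unfolding rot .
    have "{a. \<exists>b c. (a, b, c) \<in> \<Union> (rotations ` set (trivs D'))} = f ` {a. \<exists>b c. (a, b, c) \<in> \<Union> (rotations ` set (trivs D))}"
      unfolding tr by force
    moreover have "inj_on f {a. \<exists>b c. (a, b, c) \<in> \<Union> (rotations ` set (trivs D))}"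
    proof (rule inj_on_subset[OF isomorphism(1)], rule subsetI)
      fix a assume "a \<in> {a. \<exists>b c. (a, b, c) \<in> \<Union> (rotations ` set (trivs D))}"
      then obtain b c v where v: "v \<in> set (trivs D)" "(a, b, c) \<in> rotations v" by blast
      then have "a \<in> set (corners v)" using rotations_corners[OF v(2)] by simp
      with v(1) show "a \<in> set (half_edges D)" unfolding diagramsD(5)[OF assms(2)] by auto
    qed
    ultimately have len: "length (trivs D') = length (trivs D)"
      using length_trivs_eq_card[OF assms(2)] length_trivs_eq_card[OF assms(3)] card_image by fastforce
    have "gauge_related n f (\<lambda>_. \<one>\<^bsub>Fr n\<^esub>) D D'"
      unfolding gauge_related_def
      using arcs pp hol len edge_beads_holonomy[OF assms(2)] arc_beads_closed[OF assms(2)]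
      by (auto simp: tr intro: rev_image_eqI)
    then show ?thesis by blast
  next
    case (arc_merge i xs u v ys)
    have b: "u \<in> carrier (Fr n)" "v \<in> carrier (Fr n)"
      using arc_beads_closed[OF assms(2) arc_merge(2)] arc_merge(3) by auto
    have "gauge_related n id (\<lambda>_. \<one>\<^bsub>Fr n\<^esub>) D D'"
      by (rule gauge_related_arcs[OF assms(2) _ _ arc_merge(2), of _ xs "[Bead u, Bead v]" ys "[Bead (u \<otimes>\<^bsub>Fr n\<^esub> v)]"])
        (use b in \<open>simp_all add: arc_merge m_assoc\<close>)
    then show ?thesis by blast
  next
    case (edge_merge j h us u v vs k)
    have b: "set (us @ u # v # vs) \<subseteq> carrier (Fr n)"
      using diagramsD(9)[OF assms(2), of h "us @ u # v # vs" k] edge_merge(2,3) nth_mem[of j "edges D"] by auto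
    have "gauge_related n id (\<lambda>_. \<one>\<^bsub>Fr n\<^esub>) D D'"
      unfolding edge_merge(1)
      by (rule gauge_related_edge_update[OF assms(2) edge_merge(2,3)], rule holonomyI[of _ "us @ (u \<otimes>\<^bsub>Fr n\<^esub> v) # vs"])
        (use b edge_merge(2) in \<open>auto simp: set_update_memI bead_product_append m_assoc\<close>)
    then show ?thesis by blast
  next
    case (arc_unit i xs ys)
    have "gauge_related n id (\<lambda>_. \<one>\<^bsub>Fr n\<^esub>) D D'"
      by (rule gauge_related_arcs[OF assms(2) _ _ arc_unit(2), of _ xs "[Bead \<one>\<^bsub>Fr n\<^esub>]" ys "[]"])
        (simp_all add: arc_unit)
    then show ?thesis by blast
  next
    case (edge_unit j h us vs k)
    have b: "set (us @ vs) \<subseteq> carrier (Fr n)"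
      using diagramsD(9)[OF assms(2), of h "us @ \<one>\<^bsub>Fr n\<^esub> # vs" k] edge_unit(2,3) nth_mem[of j "edges D"] by auto
    have "gauge_related n id (\<lambda>_. \<one>\<^bsub>Fr n\<^esub>) D D'"
      unfolding edge_unit(1)
      by (rule gauge_related_edge_update[OF assms(2) edge_unit(2,3)], rule holonomyI[of _ "us @ vs"])
        (use b edge_unit(2) in \<open>auto simp: set_update_memI bead_product_append\<close>)
    then show ?thesis by blast
  next
    case (edge_reverse j h w k)
    have b: "w \<in> carrier (Fr n)"
      using diagramsD(9)[OF assms(2), of h "[w]" k] edge_reverse(2,3) nth_mem[of j "edges D"] by auto
    have "gauge_related n id (\<lambda>_. \<one>\<^bsub>Fr n\<^esub>) D D'"
      unfolding edge_reverse(1)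
      by (rule gauge_related_edge_update[OF assms(2) edge_reverse(2,3)], unfold holonomy_def,
          rule exI[of _ "[inv\<^bsub>Fr n\<^esub> w]"])
        (use b edge_reverse(2) in \<open>auto simp: set_update_memI\<close>)
    then show ?thesis by blast
  next
    case (pass_univalent i xs w h ys)
    \<comment> \<open>The transport from the start of the arc to \<open>h\<close> loses its last
      factor \<open>w\<close>, hence the inverse.\<close>
    define \<gamma> where "\<gamma> k = (if k = h then inv\<^bsub>Fr n\<^esub> w else \<one>\<^bsub>Fr n\<^esub>)" for k
    have b: "w \<in> carrier (Fr n)" "set (arc_beads xs) \<subseteq> carrier (Fr n)" "set (arc_beads ys) \<subseteq> carrier (Fr n)"
      using arc_beads_closed[OF assms(2) pass_univalent(2)] pass_univalent(3) by auto
    have \<gamma>: "\<gamma> k \<in> carrier (Fr n)" for k using b by (simp add: \<gamma>_def)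
    have arcs: "map arc_legs (arcs D') = map (map id \<circ> arc_legs) (arcs D)"
      using pass_univalent(2,3) by (auto simp: pass_univalent(1) map_update intro!: list_update_same_conv[THEN iffD2])
    have h: "h \<in> set (arc_legs (arcs D ! i))" using pass_univalent(3) by simp
    have "distinct (arc_legs (arcs D ! i))"
      using diagramsD(3)[OF assms(2)] pass_univalent(2) by (auto simp: legs_def distinct_concat_iff)
    then have nh: "h \<notin> set (arc_legs xs)" "h \<notin> set (arc_legs ys)" using pass_univalent(3) by auto
    have pp: "prefix_product n (arcs D' ! l) k = prefix_product n (arcs D ! l) k \<otimes>\<^bsub>Fr n\<^esub> \<gamma> k"
      if "l < length (arcs D)" "k \<in> set (arc_legs (arcs D ! l))" for l k
    proof (cases "l = i")
      case True
      then show ?thesis using that b nh pass_univalent(2,3)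
        by (auto simp: pass_univalent(1) prefix_product_append \<gamma>_def m_assoc)
    next
      case False
      then have "k \<noteq> h" using leg_on_arc_unique[OF assms(2) that] h pass_univalent(2) by blast
      then show ?thesis using False that arc_beads_closed[OF assms(2) that(1)] by (simp add: pass_univalent(1) \<gamma>_def)
    qed
    have hol: "holonomy n D' a c (inv\<^bsub>Fr n\<^esub> (\<gamma> a) \<otimes>\<^bsub>Fr n\<^esub> bead_product n us \<otimes>\<^bsub>Fr n\<^esub> \<gamma> c)"
      if e: "(a, us, c) \<in> set (edges D)" for a us c
    proof -
      have us: "set us \<subseteq> carrier (Fr n)" by (rule diagramsD(9)[OF assms(2) e])
      obtain a' us' c' where *: "add_bead n w h (a, us, c) = (a', us', c')" by (rule prod_cases3)
      have "(a', us', c') \<in> set (edges D')" using e by (force simp: pass_univalent(1) simp flip: *)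
      then show ?thesis
        using add_bead_product[OF us b(1) *] b(1) us by (intro holonomyI[of _ us']) (auto simp: \<gamma>_def)
    qed
    have "gauge_related n id \<gamma> D D'"
      unfolding gauge_related_def id_apply
    proof (intro conjI allI impI ballI)
      show "range \<gamma> \<subseteq> carrier (Fr n)" using \<gamma> by blast
      fix x y z assume "(x, y, z) \<in> \<Union> (rotations ` set (trivs D))"
      then obtain v where v: "v \<in> set (trivs D)" "(x, y, z) \<in> rotations v" by blast
      have "h \<notin> set (corners v)" using diagramsD(6)[OF assms(2)] v(1) arc_leg_in_legs[OF pass_univalent(2) h] by auto
      then show "\<gamma> x = \<gamma> y" "\<gamma> y = \<gamma> z" using rotations_corners[OF v(2)] by (auto simp: \<gamma>_def)
    qed (use arcs pp hol in \<open>simp_all add: pass_univalent(1)\<close>)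
    then show ?thesis by blast
  next
    case (pass_trivalent j h us w a v b c)
    \<comment> \<open>The edge which enters at \<open>a\<close> loses its last bead
      \<open>w\<close>, hence the inverse, at all three corners.\<close>
    define \<gamma> where "\<gamma> k = (if k \<in> {a, b, c} then inv\<^bsub>Fr n\<^esub> w else \<one>\<^bsub>Fr n\<^esub>)" for k
    have e: "(h, us @ [w], a) \<in> set (edges D)" using pass_trivalent(2,3) nth_mem by metis
    have w: "w \<in> carrier (Fr n)" "set us \<subseteq> carrier (Fr n)" using diagramsD(9)[OF assms(2) e] by auto
    have \<gamma>: "\<gamma> k \<in> carrier (Fr n)" for k using w by (simp add: \<gamma>_def)
    note abc = rotations_distinct[OF assms(2) pass_trivalent(4,5)]
    have corn: "set (corners v) = {a, b, c}" by (rule rotations_corners[OF pass_trivalent(5)])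
    have hol: "holonomy n D' p q (inv\<^bsub>Fr n\<^esub> (\<gamma> p) \<otimes>\<^bsub>Fr n\<^esub> bead_product n ps \<otimes>\<^bsub>Fr n\<^esub> \<gamma> q)"
      if pq: "(p, ps, q) \<in> set (edges D)" for p ps q
    proof -
      have ps: "set ps \<subseteq> carrier (Fr n)" by (rule diagramsD(9)[OF assms(2) pq])
      \<comment> \<open>The beads after the loss of \<open>w\<close> and before the two additions.
        The far end \<open>h\<close> may itself be \<open>b\<close> or \<open>c\<close>, so that the
        same edge loses a bead at one end and gains one at the other.\<close>
      define ps0 where "ps0 = (if (p, ps, q) = (h, us @ [w], a) then us else ps)"
      have ps0: "set ps0 \<subseteq> carrier (Fr n)" using ps w by (auto simp: ps0_def)
      have "(p, ps0, q) \<in> set ((edges D)[j := (h, us, a)])"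
        using in_set_list_update[OF pq pass_trivalent(2), of "(h, us, a)"] pass_trivalent(2,3)
        by (auto simp: ps0_def set_update_memI)
      moreover obtain p1 ps1 q1 where 1: "add_bead n w b (p, ps0, q) = (p1, ps1, q1)" by (rule prod_cases3)
      moreover obtain p2 ps2 q2 where 2: "add_bead n w c (p1, ps1, q1) = (p2, ps2, q2)" by (rule prod_cases3)
      ultimately have mem: "(p2, ps2, q2) \<in> set (edges D')"
        unfolding pass_trivalent(1) by (force simp del: add_bead.simps simp flip: 1 2)
      note A = add_bead_product[OF ps0 w(1) 1]
      note B = add_bead_product[OF A(3) w(1) 2]
      show ?thesis
      proof (cases "(p, ps, q) = (h, us @ [w], a)")
        case True
        then have "h \<noteq> a" using edge_ends_distinct[OF assms(2) e] by simp
        then show ?thesis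
          using mem A B w True abc
          by (intro holonomyI[of _ ps2]) (auto simp: \<gamma>_def ps0_def bead_product_append m_assoc)
      next
        case False
        have "p \<noteq> a" "q \<noteq> a"
          using False edge_unique[OF assms(2) pq e, of a] by auto
        then show ?thesis
          using mem A B w(1) ps False abc
          by (intro holonomyI[of _ ps2]) (auto simp: \<gamma>_def ps0_def m_assoc)
      qed
    qed
    have "gauge_related n id \<gamma> D D'"
      unfolding gauge_related_def id_apply
    proof (intro conjI allI impI ballI)
      show "range \<gamma> \<subseteq> carrier (Fr n)" using \<gamma> by blast
      fix x y z assume "(x, y, z) \<in> \<Union> (rotations ` set (trivs D))"
      then obtain v' where v': "v' \<in> set (trivs D)" "(x, y, z) \<in> rotations v'" by blast
      have xyz: "set (corners v') = {x, y, z}" by (rule rotations_corners[OF v'(2)])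
      \<comment> \<open>Distinct vertices share no corner, so the gauge is constant on the corners
        of every vertex.\<close>
      have "k \<in> {a, b, c} \<longleftrightarrow> v' = v" if "k \<in> {x, y, z}" for k
        using distinct_concat_map[OF diagramsD(4)[OF assms(2)] v'(1) pass_trivalent(4), of k] that xyz corn by blast
      then have "\<gamma> k = (if v' = v then inv\<^bsub>Fr n\<^esub> w else \<one>\<^bsub>Fr n\<^esub>)" if "k \<in> {x, y, z}" for k
        using that unfolding \<gamma>_def by presburger
      then show "\<gamma> x = \<gamma> y" "\<gamma> y = \<gamma> z" by simp_all
    next
      fix l k assume l: "l < length (arcs D)" "k \<in> set (arc_legs (arcs D ! l))"
      have "k \<notin> set (corners v)"
        using diagramsD(6)[OF assms(2)] pass_trivalent(4) arc_leg_in_legs[OF l] by auto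
      then show "prefix_product n (arcs D' ! l) k = prefix_product n (arcs D ! l) k \<otimes>\<^bsub>Fr n\<^esub> \<gamma> k"
        using l corn arc_beads_closed[OF assms(2) l(1)] by (simp add: pass_trivalent(1) \<gamma>_def)
    qed (use hol in \<open>simp_all add: pass_trivalent(1)\<close>)
    then show ?thesis by blast
  qed
qed


section \<open>Values of diagrams of degree one\<close>

definition chord_basis :: "nat \<Rightarrow> nat \<Rightarrow> (nat \<times> nat \<times> word) set" where
  "chord_basis n m = {(i, j, v). i \<le> j \<and> j < m \<and> v \<in> carrier (Fr n)}"

text \<open>The two transports along arcs close the path up at the beginnings of the arcs. The gauge
  factors at the two legs cancel there, which makes \<open>v\<close> an invariant.\<close>

definition chord_inv :: "nat \<Rightarrow> diagram \<Rightarrow> nat \<times> nat \<times> word \<Rightarrow> bool" where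
  "chord_inv n D = (\<lambda>(i, j, v). \<exists>h k u. legs D = [h, k] \<and>
     i < length (arcs D) \<and> h \<in> set (arc_legs (arcs D ! i)) \<and>
     j < length (arcs D) \<and> k \<in> set (arc_legs (arcs D ! j)) \<and>
     holonomy n D h k u \<and>
     v = prefix_product n (arcs D ! i) h \<otimes>\<^bsub>Fr n\<^esub> u \<otimes>\<^bsub>Fr n\<^esub> inv\<^bsub>Fr n\<^esub> (prefix_product n (arcs D ! j) k))"

text \<open>The path follows the stick, runs once around the loop and returns. The loop is traversed
  from the third corner \<open>z\<close> to the second corner \<open>y\<close>, because the positive
  term of STU attaches \<open>z\<close> before \<open>y\<close>.\<close>

definition lollipop_inv :: "nat \<Rightarrow> diagram \<Rightarrow> nat \<times> word \<Rightarrow> bool" where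
  "lollipop_inv n D = (\<lambda>(i, v). \<exists>l t x y z q r. legs D = [l] \<and> trivs D = [t] \<and> (x, y, z) \<in> rotations t \<and>
     i < length (arcs D) \<and> l \<in> set (arc_legs (arcs D ! i)) \<and>
     holonomy n D l x q \<and> holonomy n D z y r \<and>
     v = (prefix_product n (arcs D ! i) l \<otimes>\<^bsub>Fr n\<^esub> q) \<otimes>\<^bsub>Fr n\<^esub> r \<otimes>\<^bsub>Fr n\<^esub>
         inv\<^bsub>Fr n\<^esub> (prefix_product n (arcs D ! i) l \<otimes>\<^bsub>Fr n\<^esub> q))"

lemma lollipop_invE:
  assumes "lollipop_inv n D (i, v)"
  obtains l t x y z q r where "legs D = [l]" "trivs D = [t]" "(x, y, z) \<in> rotations t"
     "i < length (arcs D)" "l \<in> set (arc_legs (arcs D ! i))"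
     "holonomy n D l x q" "holonomy n D z y r"
     "v = (prefix_product n (arcs D ! i) l \<otimes>\<^bsub>Fr n\<^esub> q) \<otimes>\<^bsub>Fr n\<^esub> r \<otimes>\<^bsub>Fr n\<^esub>
         inv\<^bsub>Fr n\<^esub> (prefix_product n (arcs D ! i) l \<otimes>\<^bsub>Fr n\<^esub> q)"
  using assms unfolding lollipop_inv_def prod.case by blast

definition is_chord :: "diagram \<Rightarrow> bool" where
  "is_chord D \<longleftrightarrow> length (legs D) = 2 \<and> trivs D = []"

definition is_lollipop :: "diagram \<Rightarrow> bool" where
  "is_lollipop D \<longleftrightarrow> length (legs D) = 1 \<and> length (trivs D) = 1"

text \<open>
  A chord is determined by the arcs of its univalent vertices, in the order along the arcs, and
  by the holonomy of the path which runs from the first arc along the chord to the second one.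
  By the STU relation a lollipop is the difference of a chord on one arc and its reverse.
\<close>

definition diagram_value :: "nat \<Rightarrow> diagram \<Rightarrow> (nat \<times> nat \<times> word \<Rightarrow>\<^sub>0 'k::field)" where
  "diagram_value n D =
     (if is_chord D then gen (THE x. chord_inv n D x)
      else if is_lollipop D then
        (case THE x. lollipop_inv n D x of (i, v) \<Rightarrow> gen (i, i, v) - gen (i, i, inv\<^bsub>Fr n\<^esub> v))
      else 0)"

text \<open>The legs are listed arc by arc. If \<open>j\<close> were smaller than \<open>i\<close>,
  splitting the list before the arc \<open>i\<close> would put \<open>k\<close> into the first part
  and \<open>h\<close> into the second.\<close>

lemma ordered_legs:
  assumes "legs D = [h, k]" "h \<noteq> k" "i < length (arcs D)" "h \<in> set (arc_legs (arcs D ! i))"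
    "j < length (arcs D)" "k \<in> set (arc_legs (arcs D ! j))"
  shows "i \<le> j"
proof (rule ccontr)
  assume "\<not> i \<le> j"
  then have "j < i" by simp
  let ?x = "concat (map arc_legs (take i (arcs D)))"
  let ?y = "concat (map arc_legs (drop i (arcs D)))"
  have "arcs D ! j \<in> set (take i (arcs D))" using \<open>j < i\<close> assms(3,5) by (auto simp: in_set_conv_nth intro!: exI[of _ j])
  then have kx: "k \<in> set ?x" using assms(6) by auto
  have "arcs D ! i \<in> set (drop i (arcs D))" using assms(3) by (metis Cons_nth_drop_Suc list.set_intros(1))
  then have hy: "h \<in> set ?y" using assms(4) by auto
  have "legs D = ?x @ ?y" by (simp add: legs_def flip: map_append concat_append)
  then have "[h, k] = ?x @ ?y" using assms(1) by simp
  then show False using kx hy assms(2) by (cases ?x) (auto simp: Cons_eq_append_conv append_eq_Cons_conv)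
qed

lemma chord_inv_unique:
  assumes "D \<in> diagrams n m" "chord_inv n D x" "chord_inv n D y"
  shows "x = y"
proof -
  obtain i j v i' j' v' where xy: "x = (i, j, v)" "y = (i', j', v')" by (metis prod_cases3)
  obtain h k u where 1: "legs D = [h, k]" "i < length (arcs D)" "h \<in> set (arc_legs (arcs D ! i))"
     "j < length (arcs D)" "k \<in> set (arc_legs (arcs D ! j))" "holonomy n D h k u"
     "v = prefix_product n (arcs D ! i) h \<otimes>\<^bsub>Fr n\<^esub> u \<otimes>\<^bsub>Fr n\<^esub> inv\<^bsub>Fr n\<^esub> (prefix_product n (arcs D ! j) k)"
    using assms(2) xy by (auto simp: chord_inv_def)
  obtain u' where 2: "i' < length (arcs D)" "h \<in> set (arc_legs (arcs D ! i'))"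
     "j' < length (arcs D)" "k \<in> set (arc_legs (arcs D ! j'))" "holonomy n D h k u'"
     "v' = prefix_product n (arcs D ! i') h \<otimes>\<^bsub>Fr n\<^esub> u' \<otimes>\<^bsub>Fr n\<^esub> inv\<^bsub>Fr n\<^esub> (prefix_product n (arcs D ! j') k)"
    using assms(3) xy 1(1) by (auto simp: chord_inv_def)
  have "i = i'" "j = j'" using leg_on_arc_unique[OF assms(1)] 1 2 by blast+
  moreover have "u = u'" using holonomy_unique[OF assms(1) 1(6) 2(5)] by simp
  ultimately show ?thesis using xy 1 2 by simp
qed

lemma chord_inv_exists:
  assumes "D \<in> diagrams n m" "is_chord D"
  obtains x where "chord_inv n D x" "x \<in> chord_basis n m"
proof -
  interpret group "Fr n" by (rule group_Fr)
  obtain h k where hk: "legs D = [h, k]" using assms(2) by (auto simp: is_chord_def numeral_2_eq_2 length_Suc_conv)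
  have half: "set (half_edges D) = {h, k}" using diagramsD(5)[OF assms(1)] assms(2) hk by (simp add: is_chord_def)
  have "h \<noteq> k" using diagramsD(3)[OF assms(1)] hk by simp
  obtain k' u where u: "holonomy n D h k' u" "k' \<in> set (half_edges D)"
    using half_edge_holonomy[of h D n] half by auto
  have "k' = k" using half u holonomy_neq[OF assms(1) u(1)] by auto
  obtain i where i: "i < length (arcs D)" "h \<in> set (arc_legs (arcs D ! i))" using leg_on_arc[of h D] hk by auto
  obtain j where j: "j < length (arcs D)" "k \<in> set (arc_legs (arcs D ! j))" using leg_on_arc[of k D] hk by auto
  have "i \<le> j" by (rule ordered_legs[OF hk \<open>h \<noteq> k\<close> i j])
  show thesis
  proof
    let ?v = "prefix_product n (arcs D ! i) h \<otimes>\<^bsub>Fr n\<^esub> u \<otimes>\<^bsub>Fr n\<^esub> inv\<^bsub>Fr n\<^esub> (prefix_product n (arcs D ! j) k)"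
    show "chord_inv n D (i, j, ?v)" using hk u(1) i j \<open>k' = k\<close> by (auto simp: chord_inv_def)
    show "(i, j, ?v) \<in> chord_basis n m"
      using \<open>i \<le> j\<close> j(1) diagramsD(1)[OF assms(1)] arc_beads_closed[OF assms(1)] i(1) holonomy_closed[OF assms(1) u(1)]
      by (simp add: chord_basis_def)
  qed
qed

lemma lollipop_inv_unique:
  assumes "D \<in> diagrams n m" "lollipop_inv n D x" "lollipop_inv n D y"
  shows "x = y"
proof -
  obtain i v i' v' where xy: "x = (i, v)" "y = (i', v')" by (metis prod.exhaust)
  obtain l t a b c q r where 1: "legs D = [l]" "trivs D = [t]" "(a, b, c) \<in> rotations t"
     "i < length (arcs D)" "l \<in> set (arc_legs (arcs D ! i))" "holonomy n D l a q" "holonomy n D c b r"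
     "v = (prefix_product n (arcs D ! i) l \<otimes>\<^bsub>Fr n\<^esub> q) \<otimes>\<^bsub>Fr n\<^esub> r \<otimes>\<^bsub>Fr n\<^esub>
         inv\<^bsub>Fr n\<^esub> (prefix_product n (arcs D ! i) l \<otimes>\<^bsub>Fr n\<^esub> q)"
    using assms(2) unfolding xy by (elim lollipop_invE)
  obtain l' t' a' b' c' q' r' where 2: "(a', b', c') \<in> rotations t'"
     "i' < length (arcs D)" "l' \<in> set (arc_legs (arcs D ! i'))" "holonomy n D l' a' q'" "holonomy n D c' b' r'"
     "v' = (prefix_product n (arcs D ! i') l' \<otimes>\<^bsub>Fr n\<^esub> q') \<otimes>\<^bsub>Fr n\<^esub> r' \<otimes>\<^bsub>Fr n\<^esub>
         inv\<^bsub>Fr n\<^esub> (prefix_product n (arcs D ! i') l' \<otimes>\<^bsub>Fr n\<^esub> q')" "legs D = [l']" "trivs D = [t']"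
    using assms(3) unfolding xy by (elim lollipop_invE)
  have lt: "l' = l" "t' = t" using 1(1,2) 2(7,8) by simp_all
  note 2 = 2[unfolded lt]
  have i: "i = i'" using leg_on_arc_unique[OF assms(1)] 1 2 by blast
  have a: "a = a'" "q = q'" using holonomy_unique[OF assms(1) 1(6) 2(4)] by auto
  have t: "t \<in> set (trivs D)" using 1(2) by simp
  have "c = c'" using a 1(3) 2(1) rotations_distinct[OF assms(1) t 1(3)] by (cases t) auto
  then have "r = r'" using holonomy_unique[OF assms(1) 1(7)] 2(5) by blast
  then show ?thesis using xy 1 2 i a by simp
qed

text \<open>There are four half-edges, one leg and three corners. The edge at the leg ends at a
  corner, which leaves the other two corners to be joined by the loop.\<close>

lemma lollipop_inv_exists:
  assumes "D \<in> diagrams n m" "is_lollipop D"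
  obtains i v where "lollipop_inv n D (i, v)" "i < m" "v \<in> carrier (Fr n)"
proof -
  interpret group "Fr n" by (rule group_Fr)
  obtain l where l: "legs D = [l]" using assms(2) by (auto simp: is_lollipop_def length_Suc_conv)
  obtain t where t: "trivs D = [t]" using assms(2) by (auto simp: is_lollipop_def length_Suc_conv)
  have half: "set (half_edges D) = insert l (set (corners t))" using diagramsD(5)[OF assms(1)] t l by simp
  have nl: "l \<notin> set (corners t)" using diagramsD(6)[OF assms(1)] t l by simp
  obtain x q where x: "holonomy n D l x q" "x \<in> set (half_edges D)"
    using half_edge_holonomy[of l D n] half by auto
  have "x \<in> set (corners t)" using half x holonomy_neq[OF assms(1) x(1)] by auto
  then obtain y z where r: "(x, y, z) \<in> rotations t" by (cases t) auto
  note ct = rotations_corners[OF r]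
  have d: "x \<noteq> y \<and> y \<noteq> z \<and> x \<noteq> z" by (rule rotations_distinct[OF assms(1) _ r]) (simp add: t)
  obtain z' w where w: "holonomy n D z z' w" "z' \<in> set (half_edges D)"
    using half_edge_holonomy[of z D n] half ct by auto
  have "z' \<noteq> l" using holonomy_unique(1)[OF assms(1) holonomy_sym[OF assms(1) w(1)]] x(1) d by blast
  moreover have "z' \<noteq> x"
    using holonomy_unique(1)[OF assms(1) holonomy_sym[OF assms(1) w(1)]] holonomy_sym[OF assms(1) x(1)] nl ct by auto
  moreover have "z' \<noteq> z" using holonomy_neq[OF assms(1) w(1)] by simp
  ultimately have z': "z' = y" using w(2) half ct by auto
  obtain i where i: "i < length (arcs D)" "l \<in> set (arc_legs (arcs D ! i))" using leg_on_arc[of l D] l by auto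
  let ?p = "prefix_product n (arcs D ! i) l \<otimes>\<^bsub>Fr n\<^esub> q"
  have "lollipop_inv n D (i, ?p \<otimes>\<^bsub>Fr n\<^esub> w \<otimes>\<^bsub>Fr n\<^esub> inv\<^bsub>Fr n\<^esub> ?p)"
    unfolding lollipop_inv_def using l t r i x(1) w(1) z' by blast
  moreover have "?p \<in> carrier (Fr n)" "w \<in> carrier (Fr n)"
    using arc_beads_closed[OF assms(1) i(1)] holonomy_closed[OF assms(1) x(1)] holonomy_closed[OF assms(1) w(1)] by auto
  ultimately show thesis using that i(1) diagramsD(1)[OF assms(1)] by (meson inv_closed m_closed)
qed

lemma diagram_value_chord:
  assumes "D \<in> diagrams n m" "chord_inv n D x" "trivs D = []"
  shows "diagram_value n D = gen x"
proof -
  have "is_chord D" using assms(2,3) by (auto simp: chord_inv_def is_chord_def)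
  moreover have "(THE x. chord_inv n D x) = x"
    using assms chord_inv_unique by blast
  ultimately show ?thesis by (simp add: diagram_value_def)
qed

lemma diagram_value_lollipop:
  assumes "D \<in> diagrams n m" "lollipop_inv n D (i, v)"
  shows "diagram_value n D = gen (i, i, v) - gen (i, i, inv\<^bsub>Fr n\<^esub> v)"
proof -
  have "is_lollipop D" "\<not> is_chord D" using assms(2) by (auto simp: lollipop_inv_def is_chord_def is_lollipop_def)
  moreover have "(THE x. lollipop_inv n D x) = (i, v)"
    using assms lollipop_inv_unique by blast
  ultimately show ?thesis by (simp add: diagram_value_def)
qed

lemma diagram_value_carrier:
  assumes "D \<in> diagrams n m"
  shows "Poly_Mapping.keys (diagram_value n D :: _ \<Rightarrow>\<^sub>0 'k::field) \<subseteq> chord_basis n m"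
proof -
  consider "is_chord D" | "is_lollipop D" | "\<not> is_chord D" "\<not> is_lollipop D" by blast
  then show ?thesis
  proof cases
    case 1
    then obtain x where x: "chord_inv n D x" "x \<in> chord_basis n m" using chord_inv_exists[OF assms] by blast
    have "diagram_value n D = (gen x :: _ \<Rightarrow>\<^sub>0 'k)"
      by (rule diagram_value_chord[OF assms x(1)]) (use 1 in \<open>simp add: is_chord_def\<close>)
    then show ?thesis using x by simp
  next
    case 2
    then obtain i v where x: "lollipop_inv n D (i, v)" "i < m" "v \<in> carrier (Fr n)"
      using lollipop_inv_exists[OF assms] by blast
    have "diagram_value n D = gen (i, i, v) - (gen (i, i, inv\<^bsub>Fr n\<^esub> v) :: _ \<Rightarrow>\<^sub>0 'k)"
      by (rule diagram_value_lollipop[OF assms x(1)])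
    moreover have "gen (i, i, v) - gen (i, i, inv\<^bsub>Fr n\<^esub> v) \<in> {a :: _ \<Rightarrow>\<^sub>0 'k. Poly_Mapping.keys a \<subseteq> chord_basis n m}"
      by (intro lin_subD(5)[OF lin_sub_keys]) (use x group.inv_closed[OF group_Fr] in \<open>auto simp: chord_basis_def\<close>)
    ultimately show ?thesis by simp
  next
    case 3 then show ?thesis by (simp add: diagram_value_def)
  qed
qed

text \<open>The gauge factors telescope along the invariant paths: at the legs they cancel against
  those of the transports along the arcs, and at a trivalent vertex they cancel because the gauge is
  the same at its three corners.\<close>

lemma gauge_related_value:
  assumes g: "gauge_related n f \<gamma> D D'" and D: "D \<in> diagrams n m" "D' \<in> diagrams n m"
  shows "diagram_value n D' = (diagram_value n D :: _ \<Rightarrow>\<^sub>0 'k::field)"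
proof -
  interpret group "Fr n" by (rule group_Fr)
  note gD = gauge_relatedD[OF g]
  have lt: "is_chord D' \<longleftrightarrow> is_chord D" "is_lollipop D' \<longleftrightarrow> is_lollipop D"
    using gD(2,4) by (auto simp: is_chord_def is_lollipop_def)
  consider "is_chord D" | "is_lollipop D" | "\<not> is_chord D" "\<not> is_lollipop D" by blast
  then show ?thesis
  proof cases
    case 1
    then obtain x where x: "chord_inv n D x" using chord_inv_exists[OF D(1)] by blast
    obtain i j v where ijv: "x = (i, j, v)" by (rule prod_cases3)
    obtain h k u where *: "legs D = [h, k]" "i < length (arcs D)" "h \<in> set (arc_legs (arcs D ! i))"
     "j < length (arcs D)" "k \<in> set (arc_legs (arcs D ! j))" "holonomy n D h k u"
     "v = prefix_product n (arcs D ! i) h \<otimes>\<^bsub>Fr n\<^esub> u \<otimes>\<^bsub>Fr n\<^esub> inv\<^bsub>Fr n\<^esub> (prefix_product n (arcs D ! j) k)"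
      using x ijv by (auto simp: chord_inv_def)
    have c: "prefix_product n (arcs D ! i) h \<in> carrier (Fr n)" "prefix_product n (arcs D ! j) k \<in> carrier (Fr n)" "u \<in> carrier (Fr n)"
      using arc_beads_closed[OF D(1)] *(2,4) holonomy_closed[OF D(1) *(6)] by simp_all
    have x': "chord_inv n D' x"
      unfolding ijv chord_inv_def prod.case
      by (rule exI[of _ "f h"], rule exI[of _ "f k"], rule exI, intro conjI, rule_tac [6] gauge_related_holonomy[OF g D *(6)])
        (use * gD(1,2,3) c in \<open>simp_all add: gD(5,6) group_word_simps\<close>)
    have "diagram_value n D' = (gen x :: _ \<Rightarrow>\<^sub>0 'k)" "diagram_value n D = (gen x :: _ \<Rightarrow>\<^sub>0 'k)"
      using diagram_value_chord[OF D(2) x'] diagram_value_chord[OF D(1) x] lt 1 by (auto simp: is_chord_def)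
    then show ?thesis by simp
  next
    case 2
    then obtain i v where x: "lollipop_inv n D (i, v)" using lollipop_inv_exists[OF D(1)] by blast
    obtain l t a b c q r where *: "legs D = [l]" "trivs D = [t]" "(a, b, c) \<in> rotations t"
     "i < length (arcs D)" "l \<in> set (arc_legs (arcs D ! i))" "holonomy n D l a q" "holonomy n D c b r"
     "v = (prefix_product n (arcs D ! i) l \<otimes>\<^bsub>Fr n\<^esub> q) \<otimes>\<^bsub>Fr n\<^esub> r \<otimes>\<^bsub>Fr n\<^esub>
         inv\<^bsub>Fr n\<^esub> (prefix_product n (arcs D ! i) l \<otimes>\<^bsub>Fr n\<^esub> q)"
      using x by (elim lollipop_invE)
    obtain t' where t': "trivs D' = [t']" using gD(4) *(2) by (auto simp: length_Suc_conv)
    have rot: "(f a, f b, f c) \<in> rotations t'" "\<gamma> b = \<gamma> a" "\<gamma> c = \<gamma> a"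
      using gD(7)[of a b c] *(2,3) t' by auto
    have cc: "prefix_product n (arcs D ! i) l \<in> carrier (Fr n)" "q \<in> carrier (Fr n)" "r \<in> carrier (Fr n)"
      using arc_beads_closed[OF D(1)] *(4) holonomy_closed[OF D(1) *(6)] holonomy_closed[OF D(1) *(7)] by simp_all
    have hol: "holonomy n D' (f l) (f a) (inv\<^bsub>Fr n\<^esub> (\<gamma> l) \<otimes>\<^bsub>Fr n\<^esub> q \<otimes>\<^bsub>Fr n\<^esub> \<gamma> a)"
      "holonomy n D' (f c) (f b) (inv\<^bsub>Fr n\<^esub> (\<gamma> a) \<otimes>\<^bsub>Fr n\<^esub> r \<otimes>\<^bsub>Fr n\<^esub> \<gamma> a)"
      using gauge_related_holonomy[OF g D *(6)] gauge_related_holonomy[OF g D *(7)] rot by simp_all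
    have arcs: "legs D' = [f l]" "i < length (arcs D')" "f l \<in> set (arc_legs (arcs D' ! i))"
      using gD(2,3) gD(5)[OF *(4)] * by simp_all
    have "v = prefix_product n (arcs D' ! i) (f l) \<otimes>\<^bsub>Fr n\<^esub> (inv\<^bsub>Fr n\<^esub> (\<gamma> l) \<otimes>\<^bsub>Fr n\<^esub> q \<otimes>\<^bsub>Fr n\<^esub> \<gamma> a) \<otimes>\<^bsub>Fr n\<^esub>
       (inv\<^bsub>Fr n\<^esub> (\<gamma> a) \<otimes>\<^bsub>Fr n\<^esub> r \<otimes>\<^bsub>Fr n\<^esub> \<gamma> a) \<otimes>\<^bsub>Fr n\<^esub>
       inv\<^bsub>Fr n\<^esub> (prefix_product n (arcs D' ! i) (f l) \<otimes>\<^bsub>Fr n\<^esub> (inv\<^bsub>Fr n\<^esub> (\<gamma> l) \<otimes>\<^bsub>Fr n\<^esub> q \<otimes>\<^bsub>Fr n\<^esub> \<gamma> a))"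
      unfolding gD(6)[OF *(4,5)] *(8) using cc gD(1) by (simp add: group_word_simps)
    then have x': "lollipop_inv n D' (i, v)"
      unfolding lollipop_inv_def prod.case using arcs t' rot(1) hol by blast
    show ?thesis
      unfolding diagram_value_lollipop[OF D(1) x] diagram_value_lollipop[OF D(2) x'] ..
  next
    case 3
    then show ?thesis using lt by (simp add: diagram_value_def)
  qed
qed

lemma bead_equiv_value:
  assumes "bead_equiv n m D D'"
  shows "diagram_value n D = (diagram_value n D' :: _ \<Rightarrow>\<^sub>0 'k::field)"
  using assms unfolding bead_equiv_def
proof (induction rule: equivclp_induct)
  case (step y z)
  then have "diagram_value n y = (diagram_value n z :: _ \<Rightarrow>\<^sub>0 'k)"
    using bead_step_gauge_related gauge_related_value by metis
  with step show ?case by simp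
qed simp

section \<open>Values and the STU relation\<close>

lemma legs_arc_update:
  assumes "i < length (arcs D)"
  obtains L1 L2 where "\<And>zs. legs (D\<lparr>arcs := (arcs D)[i := zs]\<rparr>) = L1 @ arc_legs zs @ L2"
    "legs D = L1 @ arc_legs (arcs D ! i) @ L2"
proof
  let ?L1 = "concat (map arc_legs (take i (arcs D)))" and ?L2 = "concat (map arc_legs (drop (Suc i) (arcs D)))"
  show *: "legs (D\<lparr>arcs := (arcs D)[i := zs]\<rparr>) = ?L1 @ arc_legs zs @ ?L2" for zs
    using assms by (simp add: legs_def upd_conv_take_nth_drop)
  show "legs D = ?L1 @ arc_legs (arcs D ! i) @ ?L2" using *[of "arcs D ! i"] by simp
qed

lemma attach_simps:
  "arcs (attach i e v xs p q ys D) = (arcs D)[i := xs @ Leg p # Leg q # ys]"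
  "edges (attach i e v xs p q ys D) = remove1 e (edges D)"
  "trivs (attach i e v xs p q ys D) = remove1 v (trivs D)"
  by (simp_all add: attach_def)

text \<open>Attaching trades a trivalent vertex for a leg, so the attached diagrams are chords
  exactly if \<open>D\<close> is a lollipop. Otherwise all three values vanish: \<open>D\<close> has
  a trivalent vertex, hence is no chord, and the others have at least two legs. For a lollipop, the
  two attached diagrams are its opened loop, read in the two directions.\<close>

lemma stu_value:
  assumes D: "D \<in> diagrams n m" "attach i e v xs a b ys D \<in> diagrams n m" "attach i e v xs b a ys D \<in> diagrams n m"
    and i: "i < m" "arcs D ! i = xs @ Leg h # ys"
    and e: "e \<in> set (edges D)" "e \<in> {(h, [], k), (k, [], h)}"
    and v: "v \<in> set (trivs D)" "(k, b, a) \<in> rotations v"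
  shows "diagram_value n D =
     (diagram_value n (attach i e v xs a b ys D) - diagram_value n (attach i e v xs b a ys D) :: _ \<Rightarrow>\<^sub>0 'k::field)"
proof -
  interpret group "Fr n" by (rule group_Fr)
  let ?A = "attach i e v xs a b ys D" and ?B = "attach i e v xs b a ys D"
  have il: "i < length (arcs D)" using i(1) diagramsD(1)[OF D(1)] by simp
  obtain L1 L2 where L: "\<And>zs. legs (D\<lparr>arcs := (arcs D)[i := zs]\<rparr>) = L1 @ arc_legs zs @ L2"
    "legs D = L1 @ arc_legs (arcs D ! i) @ L2" using legs_arc_update[OF il] by blast
  have lA: "legs (attach i e v xs p q ys D) = L1 @ arc_legs xs @ p # q # arc_legs ys @ L2" for p q
    using L(1)[of "xs @ Leg p # Leg q # ys"] by (simp add: legs_def attach_def)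
  have lD: "legs D = L1 @ arc_legs xs @ h # arc_legs ys @ L2" using L(2) i(2) by simp
  have pos: "length (trivs D) > 0" using v(1) by auto
  have tr: "length (trivs D) = Suc (length (trivs (attach i e v xs p q ys D)))" for p q
    using v(1) pos by (simp add: attach_simps length_remove1)
  have nc: "\<not> is_chord D" using pos by (auto simp: is_chord_def)
  have nl: "\<not> is_lollipop (attach i e v xs p q ys D)" for p q using lA by (simp add: is_lollipop_def)
  have ch: "is_chord (attach i e v xs p q ys D) \<longleftrightarrow> is_lollipop D" for p q
    using lA[of p q] lD tr[of p q] by (simp add: is_lollipop_def is_chord_def)
  show ?thesis
  proof (cases "is_lollipop D")
    case False
    then show ?thesis using nc nl ch by (simp add: diagram_value_def)
  next
    case True
    then obtain i' u where lol: "lollipop_inv n D (i', u)" using lollipop_inv_exists[OF D(1)] by blast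
    then obtain l t x y z q r where *: "legs D = [l]" "trivs D = [t]" "(x, y, z) \<in> rotations t"
       "i' < length (arcs D)" "l \<in> set (arc_legs (arcs D ! i'))" "holonomy n D l x q" "holonomy n D z y r"
       "u = (prefix_product n (arcs D ! i') l \<otimes>\<^bsub>Fr n\<^esub> q) \<otimes>\<^bsub>Fr n\<^esub> r \<otimes>\<^bsub>Fr n\<^esub>
           inv\<^bsub>Fr n\<^esub> (prefix_product n (arcs D ! i') l \<otimes>\<^bsub>Fr n\<^esub> q)"
      by (elim lollipop_invE)
    have nil: "arc_legs xs = []" "arc_legs ys = []" "L1 = []" "L2 = []" and l: "l = h"
      using lD *(1) by (auto simp: Cons_eq_append_conv)
    have i': "i' = i" using leg_on_arc_unique[OF D(1) *(4,5) il] l i(2) by simp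
    have t: "t = v" using v(1) *(2) by simp
    \<comment> \<open>The edge of the relation is unbeaded. It is the stick of the lollipop,
      contributes nothing to the path, and ends at the corner \<open>k\<close>.\<close>
    have "holonomy n D h k \<one>\<^bsub>Fr n\<^esub>" using e by (force simp: holonomy_def)
    then have x: "x = k" "q = \<one>\<^bsub>Fr n\<^esub>" using holonomy_unique[OF D(1) *(6)] l by auto
    have dist: "k \<noteq> b \<and> b \<noteq> a \<and> k \<noteq> a" by (rule rotations_distinct[OF D(1) v])
    have yz: "y = b" "z = a" using *(3) v(2) dist x(1) t by (cases v; auto)+
    let ?p = "bead_product n (arc_beads xs)"
    have cb: "set (arc_beads xs) \<subseteq> carrier (Fr n)" "set (arc_beads ys) \<subseteq> carrier (Fr n)"
      using arc_beads_closed[OF D(1) il] i(2) by simp_all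
    have p: "?p \<in> carrier (Fr n)" using cb by simp
    have r: "r \<in> carrier (Fr n)" by (rule holonomy_closed[OF D(1) *(7)])
    have u: "u = ?p \<otimes>\<^bsub>Fr n\<^esub> r \<otimes>\<^bsub>Fr n\<^esub> inv\<^bsub>Fr n\<^esub> ?p"
      unfolding *(8) i' i(2) using l x cb nil p by (simp add: prefix_product_append)
    have "h \<noteq> a" "h \<noteq> b" using diagramsD(6)[OF D(1)] lD v(1) rotations_corners[OF v(2)] by auto
    then have ends: "a \<notin> set (edge_ends e)" using e(2) dist by auto
    have hol: "holonomy n (attach i e v xs p' q' ys D) a b r" for p' q'
    proof -
      obtain us where us: "(a, us, b) \<in> set (edges D) \<and> r = bead_product n us \<or>
          (b, us, a) \<in> set (edges D) \<and> r = inv\<^bsub>Fr n\<^esub> (bead_product n us)"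
        using *(7) yz unfolding holonomy_def by blast
      moreover have "(a, us, b) \<noteq> e" "(b, us, a) \<noteq> e" using ends by auto
      ultimately show ?thesis unfolding holonomy_def attach_simps by (metis in_set_remove1)
    qed
    have hA: "holonomy n ?A a b r" by (rule hol)
    have hB: "holonomy n ?B b a (inv\<^bsub>Fr n\<^esub> r)" by (rule holonomy_sym[OF D(3) hol])
    have ab: "a \<noteq> b" using dist by simp
    have iA: "chord_inv n ?A (i, i, u)"
      unfolding chord_inv_def prod.case
      by (rule exI[of _ a], rule exI[of _ b], rule exI[of _ r])
        (use hA nil il cb ab in \<open>simp add: lA attach_simps(1) prefix_product_append u\<close>)
    have iB: "chord_inv n ?B (i, i, inv\<^bsub>Fr n\<^esub> u)"
      unfolding chord_inv_def prod.case
      by (rule exI[of _ b], rule exI[of _ a], rule exI[of _ "inv\<^bsub>Fr n\<^esub> r"])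
        (use hB nil il cb ab p r in \<open>simp add: lA attach_simps(1) prefix_product_append u group_word_simps\<close>)
    have tn: "trivs (attach i e v xs p' q' ys D) = []" for p' q' using *(2) t by (simp add: attach_simps)
    show ?thesis
      unfolding diagram_value_lollipop[OF D(1) lol] diagram_value_chord[OF D(2) iA tn]
        diagram_value_chord[OF D(3) iB tn] i' ..
  qed
qed

lemma diagram_rels_carrier: "diagram_rels n m \<subseteq> carrier (free_vs (diagrams n m) :: ('k::field, _) module)"
proof -
  have A: "gen D - gen D' \<in> {a. Poly_Mapping.keys a \<subseteq> diagrams n m}"
    if "D \<in> diagrams n m" "D' \<in> diagrams n m" for D D'
    using that by (intro lin_subD(5)[OF lin_sub_keys]) auto
  have B: "gen D - (gen D' - gen D'') \<in> {a. Poly_Mapping.keys a \<subseteq> diagrams n m}"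
    if "{D, D', D''} \<subseteq> diagrams n m" for D D' D''
    using that by (intro lin_subD(5)[OF lin_sub_keys]) auto
  show ?thesis
    unfolding diagram_rels_def stu_rels_def free_vs_simps
  proof (intro Un_least subsetI, goal_cases)
    case (1 r)
    then obtain D D' where r: "r = gen D - gen D'" and D: "D \<in> diagrams n m" "D' \<in> diagrams n m"
      by (elim CollectE exE conjE)
    show ?case unfolding r by (rule A[OF D])
  next
    case (2 r)
    then obtain D i e v xs ys a b
      where r: "r = gen D - (gen (attach i e v xs a b ys D) - gen (attach i e v xs b a ys D))"
        and D: "{D, attach i e v xs a b ys D, attach i e v xs b a ys D} \<subseteq> diagrams n m"
      by (elim CollectE exE conjE)
    show ?case unfolding r by (rule B[OF D])
  qed
qed

lemma diagram_value_rels: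
  assumes "r \<in> diagram_rels n m"
  shows "lin_ext (diagram_value n) r = (0 :: _ \<Rightarrow>\<^sub>0 'k::field)"
  using assms unfolding diagram_rels_def
proof
  assume "r \<in> {gen D - gen D' | D D'. D \<in> diagrams n m \<and> D' \<in> diagrams n m \<and> bead_equiv n m D D'}"
  then obtain D D' where r: "r = gen D - gen D'" and "bead_equiv n m D D'"
    by (elim CollectE exE conjE)
  then show ?thesis using bead_equiv_value[of n m D D', where 'k='k] by (simp add: lin_ext_simps)
next
  assume "r \<in> stu_rels n m"
  then obtain D i e v xs ys h k a b where *: "r = gen D - (gen (attach i e v xs a b ys D) - gen (attach i e v xs b a ys D))"
    "{D, attach i e v xs a b ys D, attach i e v xs b a ys D} \<subseteq> diagrams n m"
    "i < m" "arcs D ! i = xs @ Leg h # ys" "e \<in> set (edges D)" "e \<in> {(h, [], k), (k, [], h)}"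
    "v \<in> set (trivs D)" "(k, b, a) \<in> rotations v" unfolding stu_rels_def by (elim CollectE exE conjE)
  then show ?thesis using stu_value[of D n m i e v xs a b ys h k, where 'k='k] by (simp add: lin_ext_simps)
qed


section \<open>Bead equivalence\<close>

text \<open>Apart from the labels of the beads, the conditions on a diagram see only its legs,
  half-edges, vertices and unoriented edges. The number of arcs may change, as it does under
  pullback.\<close>

lemma diagrams_transfer:
  assumes "D \<in> diagrams n m'" "length (arcs D') = m" "mset (legs D') = mset (legs D)"
    "mset (half_edges D') = mset (half_edges D)" "trivs D' = trivs D"
    "(\<lambda>e. set (edge_ends e)) ` set (edges D') = (\<lambda>e. set (edge_ends e)) ` set (edges D)"
    "\<And>xs. xs \<in> set (arcs D') \<Longrightarrow> set (arc_beads xs) \<subseteq> carrier (Fr n)"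
    "\<And>e. e \<in> set (edges D') \<Longrightarrow> set (edge_beads e) \<subseteq> carrier (Fr n)"
  shows "D' \<in> diagrams n m"
proof -
  have ex: "(\<exists>e\<in>set (edges D). {h, k} \<subseteq> set (edge_ends e)) \<longleftrightarrow>
      (\<exists>s\<in>(\<lambda>e. set (edge_ends e)) ` set (edges D). {h, k} \<subseteq> s)" for h k D by blast
  have adj: "adjacent D' = adjacent D"
    unfolding adjacent_def ex assms(5,6) ..
  have sets: "set (legs D') = set (legs D)" "set (half_edges D') = set (half_edges D)"
    using assms(3,4) mset_eq_setD by blast+
  have d: "distinct (legs D') = distinct (legs D)" "distinct (half_edges D') = distinct (half_edges D)"
    using assms(3,4) mset_eq_imp_distinct_iff by blast+
  show ?thesis
    using assms(1,2,5,7,8) unfolding diagrams_def mem_Collect_eq adj distinct_append set_append sets d by simp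
qed

lemma bead_equiv_refl: "bead_equiv n m D D"
  by (simp add: bead_equiv_def)

lemma bead_equiv_sym: "bead_equiv n m D D' \<Longrightarrow> bead_equiv n m D' D"
  unfolding bead_equiv_def by (rule equivclp_sym)

lemma bead_equiv_trans: "bead_equiv n m D D' \<Longrightarrow> bead_equiv n m D' D'' \<Longrightarrow> bead_equiv n m D D''"
  unfolding bead_equiv_def by (rule equivclp_trans)

lemma bead_equiv_step: "bead_step n D D' \<Longrightarrow> D \<in> diagrams n m \<Longrightarrow> D' \<in> diagrams n m \<Longrightarrow> bead_equiv n m D D'"
  unfolding bead_equiv_def by (intro r_into_equivclp) blast

lemma equivclp_image:
  assumes "equivclp r x y" "\<And>x y. r x y \<Longrightarrow> s (f x) (f y)"
  shows "equivclp s (f x) (f y)"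
  using assms(1)
proof (induction rule: equivclp_induct)
  case (step y z)
  then have "equivclp s (f y) (f z)" using assms(2) by (meson equivclp_sym r_into_equivclp)
  then show ?case using step.IH equivclp_trans by fastforce
qed simp


subsection \<open>Beads on arcs\<close>

text \<open>Moves of beads alone, stated for lists. As every copy of an arc keeps all beads, these
  moves survive the filtering, reversal and concatenation from which pulled arcs are made.\<close>

inductive arc_step :: "nat \<Rightarrow> nat point list \<Rightarrow> nat point list \<Rightarrow> bool" for n where
  merge: "u \<in> carrier (Fr n) \<Longrightarrow> v \<in> carrier (Fr n) \<Longrightarrow>
    arc_step n (xs @ [Bead u, Bead v] @ ys) (xs @ [Bead (u \<otimes>\<^bsub>Fr n\<^esub> v)] @ ys)"
| unit: "arc_step n (xs @ [Bead \<one>\<^bsub>Fr n\<^esub>] @ ys) (xs @ ys)"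

definition arc_equiv :: "nat \<Rightarrow> nat point list \<Rightarrow> nat point list \<Rightarrow> bool" where
  "arc_equiv n = equivclp (arc_step n)"

lemma arc_step_context: "arc_step n xs ys \<Longrightarrow> arc_step n (us @ xs @ vs) (us @ ys @ vs)"
proof (induction rule: arc_step.induct)
  case (merge u v xs ys)
  then show ?case using arc_step.merge[of u n v "us @ xs" "ys @ vs"] by simp
next
  case (unit xs ys)
  then show ?case using arc_step.unit[of n "us @ xs" "ys @ vs"] by simp
qed

lemma arc_equiv_refl [simp]: "arc_equiv n xs xs"
  and arc_equiv_sym: "arc_equiv n xs ys \<Longrightarrow> arc_equiv n ys xs"
  and arc_equiv_trans: "arc_equiv n xs ys \<Longrightarrow> arc_equiv n ys zs \<Longrightarrow> arc_equiv n xs zs"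
  and arc_equiv_step: "arc_step n xs ys \<Longrightarrow> arc_equiv n xs ys"
  unfolding arc_equiv_def by (auto intro: equivclp_sym equivclp_trans)

lemma arc_equiv_context: "arc_equiv n xs ys \<Longrightarrow> arc_equiv n (us @ xs @ vs) (us @ ys @ vs)"
  unfolding arc_equiv_def by (erule equivclp_image) (rule arc_step_context)

lemma arc_equiv_append: "arc_equiv n xs ys \<Longrightarrow> arc_equiv n xs' ys' \<Longrightarrow> arc_equiv n (xs @ xs') (ys @ ys')"
  using arc_equiv_context[of n xs ys "[]" xs'] arc_equiv_context[of n xs' ys' ys "[]"] arc_equiv_trans by fastforce

lemma arc_equiv_concat: "list_all2 (arc_equiv n) xss yss \<Longrightarrow> arc_equiv n (concat xss) (concat yss)"
  by (induction rule: list_all2_induct) (auto intro: arc_equiv_append)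

lemma arc_step_invariants:
  assumes "arc_step n xs ys"
  shows "arc_legs xs = arc_legs ys" "set (arc_beads xs) \<subseteq> carrier (Fr n) \<longleftrightarrow> set (arc_beads ys) \<subseteq> carrier (Fr n)"
proof -
  interpret group "Fr n" by (rule group_Fr)
  show "arc_legs xs = arc_legs ys" "set (arc_beads xs) \<subseteq> carrier (Fr n) \<longleftrightarrow> set (arc_beads ys) \<subseteq> carrier (Fr n)"
    using assms by (induction rule: arc_step.induct) auto
qed

lemma arc_equiv_invariants:
  assumes "arc_equiv n xs ys"
  shows "arc_legs xs = arc_legs ys" "set (arc_beads xs) \<subseteq> carrier (Fr n) \<longleftrightarrow> set (arc_beads ys) \<subseteq> carrier (Fr n)"
proof -
  have "arc_legs xs = arc_legs ys \<and> (set (arc_beads xs) \<subseteq> carrier (Fr n) \<longleftrightarrow> set (arc_beads ys) \<subseteq> carrier (Fr n))"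
    using assms unfolding arc_equiv_def
  proof (induction rule: equivclp_induct)
    case (step y z)
    then show ?case using arc_step_invariants[of n y z] arc_step_invariants[of n z y] by auto
  qed simp
  then show "arc_legs xs = arc_legs ys" "set (arc_beads xs) \<subseteq> carrier (Fr n) \<longleftrightarrow> set (arc_beads ys) \<subseteq> carrier (Fr n)"
    by blast+
qed

lemma arc_update_diagrams:
  assumes "D \<in> diagrams n m" "i < m" "arc_legs ys = arc_legs (arcs D ! i)" "set (arc_beads ys) \<subseteq> carrier (Fr n)"
  shows "D\<lparr>arcs := (arcs D)[i := ys]\<rparr> \<in> diagrams n m"
proof (rule diagrams_transfer[OF assms(1)])
  have "map arc_legs ((arcs D)[i := ys]) = map arc_legs (arcs D)"
    using assms(2,3) diagramsD(1)[OF assms(1)] by (auto simp: map_update intro!: list_update_same_conv[THEN iffD2])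
  then show "mset (legs (D\<lparr>arcs := (arcs D)[i := ys]\<rparr>)) = mset (legs D)" by (simp add: legs_def)
  fix xs assume "xs \<in> set (arcs (D\<lparr>arcs := (arcs D)[i := ys]\<rparr>))"
  then have "xs = ys \<or> xs \<in> set (arcs D)" using set_update_subset_insert[of "arcs D" i ys] by auto
  then show "set (arc_beads xs) \<subseteq> carrier (Fr n)" using assms(4) diagramsD(7)[OF assms(1)] by blast
qed (use diagramsD(1,8)[OF assms(1)] in \<open>auto simp: half_edges_def\<close>)

lemma arc_step_bead_step:
  assumes "arc_step n (arcs D ! i) ys" "i < length (arcs D)"
  shows "bead_step n D (D\<lparr>arcs := (arcs D)[i := ys]\<rparr>)"
  using assms(1)
proof cases
  case (merge u v xs zs)
  then show ?thesis using bead_step.arc_merge[OF assms(2), of xs u v zs] by simp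
next
  case (unit xs zs)
  then show ?thesis using bead_step.arc_unit[OF assms(2), of xs n zs] by simp
qed

lemma arc_equiv_bead_equiv:
  assumes "D \<in> diagrams n m" "i < m" "arc_equiv n (arcs D ! i) ys"
  shows "bead_equiv n m D (D\<lparr>arcs := (arcs D)[i := ys]\<rparr>)"
proof -
  have len: "length (arcs D) = m" by (rule diagramsD(1)[OF assms(1)])
  have b: "set (arc_beads (arcs D ! i)) \<subseteq> carrier (Fr n)" using arc_beads_closed[OF assms(1)] assms(2) len by simp
  let ?D = "\<lambda>zs. D\<lparr>arcs := (arcs D)[i := zs]\<rparr>"
  have dia: "?D zs \<in> diagrams n m" if "arc_equiv n (arcs D ! i) zs" for zs
    using arc_equiv_invariants[OF that] b by (intro arc_update_diagrams[OF assms(1,2)]) auto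
  have st: "bead_step n (?D zs) (?D zs')" if "arc_step n zs zs'" for zs zs'
    using arc_step_bead_step[of n "?D zs" i zs'] that assms(2) len by simp
  have "bead_equiv n m D (?D zs)" if "equivclp (arc_step n) (arcs D ! i) zs" for zs
    using that
  proof (induction rule: equivclp_induct)
    case base
    show ?case by (simp add: bead_equiv_refl)
  next
    case (step y z)
    then have yz: "arc_equiv n (arcs D ! i) y" "arc_equiv n (arcs D ! i) z"
      unfolding arc_equiv_def using equivclp_into_equivclp by metis+
    from step(2) have "bead_equiv n m (?D y) (?D z)"
    proof
      assume "arc_step n y z"
      then show ?thesis using bead_equiv_step[OF st dia[OF yz(1)] dia[OF yz(2)]] by blast
    next
      assume "arc_step n z y"
      then show ?thesis using bead_equiv_sym[OF bead_equiv_step[OF st dia[OF yz(2)] dia[OF yz(1)]]] by blast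
    qed
    then show ?case using step.IH bead_equiv_trans by blast
  qed
  then show ?thesis using assms(3) by (simp add: arc_equiv_def)
qed

lemma arc_equiv_diagrams:
  assumes "D \<in> diagrams n m" "i < m" "arc_equiv n (arcs D ! i) ys"
  shows "D\<lparr>arcs := (arcs D)[i := ys]\<rparr> \<in> diagrams n m"
  using arc_equiv_invariants[OF assms(3)] arc_beads_closed[OF assms(1)] assms(2) diagramsD(1)[OF assms(1)]
  by (intro arc_update_diagrams[OF assms(1,2)]) auto

lemma arcs_equiv_bead_equiv:
  assumes "D \<in> diagrams n m" "list_all2 (arc_equiv n) (arcs D) as"
  shows "bead_equiv n m D (D\<lparr>arcs := as\<rparr>)" "D\<lparr>arcs := as\<rparr> \<in> diagrams n m"
proof -
  have len: "length (arcs D) = m" "length as = m"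
    using diagramsD(1)[OF assms(1)] list_all2_lengthD[OF assms(2)] by auto
  \<comment> \<open>The arcs are replaced one at a time, and every intermediate family is again a
    diagram.\<close>
  have "bead_equiv n m D (D\<lparr>arcs := take k as @ drop k (arcs D)\<rparr>) \<and>
      D\<lparr>arcs := take k as @ drop k (arcs D)\<rparr> \<in> diagrams n m" if "k \<le> m" for k
    using that
  proof (induction k)
    case 0 then show ?case using assms(1) by (simp add: bead_equiv_refl)
  next
    case (Suc k)
    let ?E = "D\<lparr>arcs := take k as @ drop k (arcs D)\<rparr>"
    have E: "?E \<in> diagrams n m" "bead_equiv n m D ?E" using Suc by auto
    have eq: "?E\<lparr>arcs := (arcs ?E)[k := as ! k]\<rparr> = D\<lparr>arcs := take (Suc k) as @ drop (Suc k) (arcs D)\<rparr>"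
      using Suc.prems len by (simp add: list_update_append take_Suc_conv_app_nth flip: Cons_nth_drop_Suc)
    have "arc_equiv n (arcs ?E ! k) (as ! k)"
      using list_all2_nthD[OF assms(2), of k] Suc.prems len by (simp add: nth_append)
    then have "bead_equiv n m ?E (D\<lparr>arcs := take (Suc k) as @ drop (Suc k) (arcs D)\<rparr>)"
      "D\<lparr>arcs := take (Suc k) as @ drop (Suc k) (arcs D)\<rparr> \<in> diagrams n m"
      using arc_equiv_bead_equiv[OF E(1), of k "as ! k"] arc_equiv_diagrams[OF E(1), of k "as ! k"] Suc.prems
      unfolding eq by auto
    then show ?case using E(2) bead_equiv_trans by blast
  qed
  from this[of m] show "bead_equiv n m D (D\<lparr>arcs := as\<rparr>)" "D\<lparr>arcs := as\<rparr> \<in> diagrams n m"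
    using len by simp_all
qed


subsection \<open>Beads on edges\<close>

lemma edge_update_diagrams:
  assumes "D \<in> diagrams n m" "j < length (edges D)" "edges D ! j = (h, us, k)"
    "set vs \<subseteq> carrier (Fr n)" "(a, b) = (h, k) \<or> (a, b) = (k, h)"
  shows "D\<lparr>edges := (edges D)[j := (a, vs, b)]\<rparr> \<in> diagrams n m"
proof (rule diagrams_transfer[OF assms(1)])
  have split: "edges D = take j (edges D) @ (h, us, k) # drop (Suc j) (edges D)"
    using assms(2,3) id_take_nth_drop by metis
  let ?l = "take j (edges D)" and ?r = "drop (Suc j) (edges D)"
  have upd: "(edges D)[j := (a, vs, b)] = ?l @ (a, vs, b) # ?r"
    using assms(2) by (simp add: upd_conv_take_nth_drop)
  have h: "half_edges D = concat (map edge_ends ?l) @ [h, k] @ concat (map edge_ends ?r)"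
    unfolding half_edges_def by (subst split) simp
  show "mset (half_edges (D\<lparr>edges := (edges D)[j := (a, vs, b)]\<rparr>)) = mset (half_edges D)"
    unfolding h using assms(5) by (auto simp: half_edges_def upd)
  have s: "set (edges D) = insert (h, us, k) (set ?l \<union> set ?r)"
    by (subst split) auto
  have ab: "{a, b} = {h, k}" using assms(5) by auto
  show "(\<lambda>e. set (edge_ends e)) ` set (edges (D\<lparr>edges := (edges D)[j := (a, vs, b)]\<rparr>)) =
    (\<lambda>e. set (edge_ends e)) ` set (edges D)"
    unfolding s by (simp add: upd ab)
  fix e assume "e \<in> set (edges (D\<lparr>edges := (edges D)[j := (a, vs, b)]\<rparr>))"
  then have "e = (a, vs, b) \<or> e \<in> set (edges D)"
    using set_update_subset_insert[of "edges D" j "(a, vs, b)"] by auto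
  then show "set (edge_beads e) \<subseteq> carrier (Fr n)" using assms(4) diagramsD(8)[OF assms(1), of e] by auto
qed (use diagramsD(1,7)[OF assms(1)] in \<open>auto simp: legs_def\<close>)

lemma edge_beads_closed:
  "D \<in> diagrams n m \<Longrightarrow> j < length (edges D) \<Longrightarrow> edges D ! j = (h, us, k) \<Longrightarrow> set us \<subseteq> carrier (Fr n)"
  using diagramsD(9)[of D n m h us k] nth_mem[of j "edges D"] by simp

lemma edge_collapse:
  assumes "D \<in> diagrams n m" "j < length (edges D)" "edges D ! j = (h, us, k)"
  shows "bead_equiv n m D (D\<lparr>edges := (edges D)[j := (h, [bead_product n us], k)]\<rparr>)"
  using assms
proof (induction "length us" arbitrary: us D)
  case 0
  \<comment> \<open>An unbeaded edge is reached from the edge with the single bead \<open>1\<close>,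
    by reading the unit rule backwards. Longer lists are shortened by merging their first two
    beads.\<close>
  let ?E = "D\<lparr>edges := (edges D)[j := (h, [\<one>\<^bsub>Fr n\<^esub>], k)]\<rparr>"
  have us: "us = []" using 0 by simp
  have E: "?E \<in> diagrams n m"
    by (rule edge_update_diagrams[OF "0.prems"]) (simp_all add: one_Fr carrier_Fr)
  have "bead_step n ?E (?E\<lparr>edges := (edges ?E)[j := (h, [] @ [], k)]\<rparr>)"
    by (rule bead_step.edge_unit) (use "0.prems" in auto)
  also have "?E\<lparr>edges := (edges ?E)[j := (h, [] @ [], k)]\<rparr> = D"
    using "0.prems" us by (metis (no_types, lifting) append_Nil diagram.select_convs(2) diagram.surjective diagram.update_convs(2) list_update_id list_update_overwrite)
  finally show ?case using bead_equiv_sym[OF bead_equiv_step[OF _ E "0.prems"(1)]] us by simp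
next
  case (Suc l)
  have us: "set us \<subseteq> carrier (Fr n)" by (rule edge_beads_closed[OF Suc.prems])
  interpret group "Fr n" by (rule group_Fr)
  show ?case
  proof (cases "l = 0")
    case True
    then obtain u where u: "us = [u]" using Suc(2)[symmetric] by (auto simp: length_Suc_conv)
    then have "(edges D)[j := (h, [bead_product n us], k)] = edges D"
      using Suc.prems us by (simp add: list_update_same_conv)
    then show ?thesis by (simp add: bead_equiv_refl)
  next
    case False
    then obtain u v vs where u: "us = u # v # vs" using Suc(2)
      by (cases us; cases "tl us") auto
    let ?E = "D\<lparr>edges := (edges D)[j := (h, [] @ (u \<otimes>\<^bsub>Fr n\<^esub> v) # vs, k)]\<rparr>"
    have E: "?E \<in> diagrams n m"
      by (rule edge_update_diagrams[OF Suc.prems]) (use us u in auto)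
    have "bead_step n D ?E"
      by (rule bead_step.edge_merge) (use Suc.prems u in auto)
    then have DE: "bead_equiv n m D ?E" by (rule bead_equiv_step[OF _ Suc.prems(1) E])
    have "bead_equiv n m ?E (?E\<lparr>edges := (edges ?E)[j := (h, [bead_product n ((u \<otimes>\<^bsub>Fr n\<^esub> v) # vs)], k)]\<rparr>)"
      by (rule Suc.hyps(1)[OF _ E]) (use Suc(2) Suc.prems u in auto)
    also have "bead_product n ((u \<otimes>\<^bsub>Fr n\<^esub> v) # vs) = bead_product n us" using u us by (simp add: m_assoc)
    finally show ?thesis using bead_equiv_trans[OF DE] by simp
  qed
qed

text \<open>Both edges collapse to the same single bead.\<close>

lemma edge_same_product:
  assumes "D \<in> diagrams n m" "j < length (edges D)" "edges D ! j = (h, us, k)"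
    "set vs \<subseteq> carrier (Fr n)" "bead_product n us = bead_product n vs"
  shows "bead_equiv n m D (D\<lparr>edges := (edges D)[j := (h, vs, k)]\<rparr>)"
proof -
  let ?E = "D\<lparr>edges := (edges D)[j := (h, vs, k)]\<rparr>"
  have "?E \<in> diagrams n m" by (rule edge_update_diagrams[OF assms(1-4)]) simp
  from edge_collapse[OF this, of j h vs k]
  have "bead_equiv n m ?E (D\<lparr>edges := (edges D)[j := (h, [bead_product n us], k)]\<rparr>)"
    using assms by simp
  then show ?thesis using edge_collapse[OF assms(1-3)] bead_equiv_trans bead_equiv_sym by blast
qed

lemma edges_same_product:
  assumes "D \<in> diagrams n m"
    "list_all2 (\<lambda>(h, us, k) (h', us', k'). h' = h \<and> k' = k \<and> set us' \<subseteq> carrier (Fr n) \<and>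
       bead_product n us = bead_product n us') (edges D) es"
  shows "bead_equiv n m D (D\<lparr>edges := es\<rparr>)"
proof -
  let ?m = "length (edges D)"
  have len: "length es = ?m" using list_all2_lengthD[OF assms(2)] by simp
  have "bead_equiv n m D (D\<lparr>edges := take l es @ drop l (edges D)\<rparr>) \<and>
      D\<lparr>edges := take l es @ drop l (edges D)\<rparr> \<in> diagrams n m" if "l \<le> ?m" for l
    using that
  proof (induction l)
    case 0 then show ?case using assms(1) by (simp add: bead_equiv_refl)
  next
    case (Suc l)
    let ?E = "D\<lparr>edges := take l es @ drop l (edges D)\<rparr>"
    have E: "?E \<in> diagrams n m" "bead_equiv n m D ?E" using Suc by auto
    obtain h us k where e: "edges D ! l = (h, us, k)" by (rule prod_cases3)
    obtain h' us' k' where e'0: "es ! l = (h', us', k')" by (rule prod_cases3)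
    then have e': "es ! l = (h, us', k)" "set us' \<subseteq> carrier (Fr n)" "bead_product n us = bead_product n us'"
      using list_all2_nthD[OF assms(2), of l] e Suc.prems by auto
    have El: "l < length (edges ?E)" "edges ?E ! l = (h, us, k)" using Suc.prems e len by (auto simp: nth_append)
    have eq: "?E\<lparr>edges := (edges ?E)[l := (h, us', k)]\<rparr> = D\<lparr>edges := take (Suc l) es @ drop (Suc l) (edges D)\<rparr>"
      using Suc.prems len e' by (simp add: list_update_append take_Suc_conv_app_nth flip: Cons_nth_drop_Suc)
    have "bead_equiv n m ?E (D\<lparr>edges := take (Suc l) es @ drop (Suc l) (edges D)\<rparr>)"
      using edge_same_product[OF E(1) El e'(2,3)] unfolding eq .
    moreover have "D\<lparr>edges := take (Suc l) es @ drop (Suc l) (edges D)\<rparr> \<in> diagrams n m"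
      using edge_update_diagrams[OF E(1) El e'(2), of h k] unfolding eq by simp
    ultimately show ?case using E(2) bead_equiv_trans by blast
  qed
  from this[of ?m] show ?thesis using len by simp
qed

lemma map_add_bead_diagrams:
  assumes "D \<in> diagrams n m" "w \<in> carrier (Fr n)"
  shows "D\<lparr>edges := map (add_bead n w h) (edges D)\<rparr> \<in> diagrams n m"
proof (rule diagrams_transfer[OF assms(1)])
  have ends: "edge_ends (add_bead n w h e) = edge_ends e" for e by (cases e) simp
  show "mset (half_edges (D\<lparr>edges := map (add_bead n w h) (edges D)\<rparr>)) = mset (half_edges D)"
    by (simp add: half_edges_def comp_def ends)
  show "(\<lambda>e. set (edge_ends e)) ` set (edges (D\<lparr>edges := map (add_bead n w h) (edges D)\<rparr>)) =
      (\<lambda>e. set (edge_ends e)) ` set (edges D)" by (simp add: image_image ends)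
  fix e assume "e \<in> set (edges (D\<lparr>edges := map (add_bead n w h) (edges D)\<rparr>))"
  then obtain e0 where "e0 \<in> set (edges D)" "e = add_bead n w h e0" by auto
  moreover obtain a us b where "e0 = (a, us, b)" by (rule prod_cases3)
  ultimately show "set (edge_beads e) \<subseteq> carrier (Fr n)"
    using diagramsD(9)[OF assms(1), of a us b] assms(2) group.inv_closed[OF group_Fr assms(2)] by auto
qed (use diagramsD(1,7)[OF assms(1)] in \<open>auto simp: legs_def\<close>)


section \<open>Normal forms of diagrams of degree one\<close>

definition chord_diagram :: "nat \<Rightarrow> nat \<times> nat \<times> word \<Rightarrow> diagram" where
  "chord_diagram m = (\<lambda>(i, j, v). \<lparr>arcs = map (\<lambda>l. (if l = i then [Leg 0] else []) @ (if l = j then [Leg 1] else [])) [0..<m],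
     edges = [(0, [v], 1)], trivs = []\<rparr>)"

text \<open>Each leg that is passed leaves a bead on its edge. Only the ends of the edges are
  recorded here, since their beads are collected at the end.\<close>

lemma move_bead:
  assumes "D \<in> diagrams n m" "i < m" "arcs D ! i = xs @ Bead u # map Leg ls @ ys"
  shows "\<exists>D'. bead_equiv n m D D' \<and> D' \<in> diagrams n m \<and> arcs D' = (arcs D)[i := xs @ map Leg ls @ Bead u # ys] \<and>
     map edge_ends (edges D') = map edge_ends (edges D) \<and> trivs D' = trivs D"
  using assms
proof (induction ls arbitrary: D xs)
  case Nil
  have "arcs D = (arcs D)[i := xs @ map Leg [] @ Bead u # ys]"
    using list_update_id[of "arcs D" i] by (simp add: Nil.prems(3))
  then show ?case using Nil bead_equiv_refl by (intro exI[of _ D]) simp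
next
  case (Cons l ls)
  have len: "length (arcs D) = m" by (rule diagramsD(1)[OF Cons.prems(1)])
  let ?ys = "(xs @ [Leg l]) @ Bead u # map Leg ls @ ys"
  let ?E = "D\<lparr>arcs := (arcs D)[i := ?ys]\<rparr>"
  let ?F = "?E\<lparr>edges := map (add_bead n u l) (edges ?E)\<rparr>"
  have b: "set (arc_beads (arcs D ! i)) \<subseteq> carrier (Fr n)"
    using arc_beads_closed[OF Cons.prems(1)] Cons.prems(2) len by simp
  have E: "?E \<in> diagrams n m"
    by (rule arc_update_diagrams[OF Cons.prems(1,2)]) (use b Cons.prems(3) in auto)
  have F: "?F \<in> diagrams n m" by (rule map_add_bead_diagrams[OF E]) (use b Cons.prems(3) in auto)
  have "bead_step n D (D\<lparr>arcs := (arcs D)[i := xs @ Leg l # Bead u # map Leg ls @ ys], edges := map (add_bead n u l) (edges D)\<rparr>)"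
    by (rule bead_step.pass_univalent) (use Cons.prems len in auto)
  also have "D\<lparr>arcs := (arcs D)[i := xs @ Leg l # Bead u # map Leg ls @ ys], edges := map (add_bead n u l) (edges D)\<rparr> = ?F" by simp
  finally have DF: "bead_equiv n m D ?F" by (rule bead_equiv_step[OF _ Cons.prems(1) F])
  have Fi: "arcs ?F ! i = (xs @ [Leg l]) @ Bead u # map Leg ls @ ys" using Cons.prems(2) len by simp
  obtain D' where D': "bead_equiv n m ?F D'" "D' \<in> diagrams n m"
     "arcs D' = (arcs ?F)[i := (xs @ [Leg l]) @ map Leg ls @ Bead u # ys]"
     "map edge_ends (edges D') = map edge_ends (edges ?F)" "trivs D' = trivs ?F"
    using Cons.IH[OF F Cons.prems(2) Fi] by blast
  have ends: "edge_ends (add_bead n u l e) = edge_ends e" for e by (cases e) simp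
  show ?case
    using D' DF bead_equiv_trans[OF DF D'(1)] by (intro exI[of _ D']) (simp add: comp_def ends)
qed

text \<open>The tail is cleared first. A bead at its head is then pushed through the remaining legs
  and merged with the collected bead; \<open>xs\<close> is the part of the arc that is still
  untouched.\<close>

lemma clear_arc:
  assumes "D \<in> diagrams n m" "i < m" "arcs D ! i = xs @ ys"
  shows "\<exists>D'. bead_equiv n m D D' \<and> D' \<in> diagrams n m \<and>
     arcs D' = (arcs D)[i := xs @ map Leg (arc_legs ys) @ [Bead (arc_product n ys)]] \<and>
     map edge_ends (edges D') = map edge_ends (edges D) \<and> trivs D' = trivs D"
  using assms
proof (induction ys arbitrary: D xs)
  case Nil
  have "arc_equiv n xs (xs @ [Bead \<one>\<^bsub>Fr n\<^esub>])"
    using arc_step.unit[of n xs "[]"] by (simp add: arc_equiv_step arc_equiv_sym)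
  then have "arc_equiv n (arcs D ! i) (xs @ [Bead \<one>\<^bsub>Fr n\<^esub>])" using Nil by simp
  from arc_equiv_bead_equiv[OF Nil(1,2) this] arc_equiv_diagrams[OF Nil(1,2) this]
  show ?case by (intro exI[of _ "D\<lparr>arcs := (arcs D)[i := xs @ [Bead \<one>\<^bsub>Fr n\<^esub>]]\<rparr>"]) (simp add: arc_product_eq)
next
  case (Cons y ys)
  have len: "length (arcs D) = m" by (rule diagramsD(1)[OF Cons.prems(1)])
  have b: "set (arc_beads (arcs D ! i)) \<subseteq> carrier (Fr n)"
    using arc_beads_closed[OF Cons.prems(1)] Cons.prems(2) len by simp
  obtain D' where D': "bead_equiv n m D D'" "D' \<in> diagrams n m"
     "arcs D' = (arcs D)[i := (xs @ [y]) @ map Leg (arc_legs ys) @ [Bead (arc_product n ys)]]"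
     "map edge_ends (edges D') = map edge_ends (edges D)" "trivs D' = trivs D"
    using Cons.IH[OF Cons.prems(1,2), of "xs @ [y]"] Cons.prems(3) by auto
  show ?case
  proof (cases y)
    case (Leg l)
    then show ?thesis using D' by (intro exI[of _ D']) (simp add: arc_product_eq)
  next
    case (Bead u)
    have D'i: "arcs D' ! i = xs @ Bead u # map Leg (arc_legs ys) @ [Bead (arc_product n ys)]"
      using D'(3) Bead Cons.prems(2) len by simp
    obtain D'' where D'': "bead_equiv n m D' D''" "D'' \<in> diagrams n m"
     "arcs D'' = (arcs D')[i := xs @ map Leg (arc_legs ys) @ Bead u # [Bead (arc_product n ys)]]"
     "map edge_ends (edges D'') = map edge_ends (edges D')" "trivs D'' = trivs D'"
      using move_bead[OF D'(2) Cons.prems(2) D'i] by blast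
    let ?zs = "xs @ map Leg (arc_legs ys) @ [Bead (arc_product n (y # ys))]"
    have ub: "u \<in> carrier (Fr n)" "arc_product n ys \<in> carrier (Fr n)"
      using b Cons.prems(3) Bead by (auto simp: arc_product_eq)
    have "arc_equiv n (arcs D'' ! i) ?zs"
      using arc_step.merge[OF ub, of "xs @ map Leg (arc_legs ys)" "[]"] D''(3) D'(3) Cons.prems(2) len Bead
      by (simp add: arc_product_eq arc_equiv_step)
    from arc_equiv_bead_equiv[OF D''(2) Cons.prems(2) this] arc_equiv_diagrams[OF D''(2) Cons.prems(2) this]
    show ?thesis
      using D'' D' Bead bead_equiv_trans[OF D'(1) bead_equiv_trans[OF D''(1)]]
      by (intro exI[of _ "D''\<lparr>arcs := (arcs D'')[i := ?zs]\<rparr>"]) simp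
  qed
qed

lemma clear_arcs:
  assumes "D \<in> diagrams n m" "homotopy_trivial n D"
  shows "\<exists>D'. bead_equiv n m D D' \<and> D' \<in> diagrams n m \<and> arcs D' = map (\<lambda>xs. map Leg (arc_legs xs)) (arcs D) \<and>
     map edge_ends (edges D') = map edge_ends (edges D) \<and> trivs D' = trivs D"
proof -
  have len: "length (arcs D) = m" by (rule diagramsD(1)[OF assms(1)])
  let ?f = "\<lambda>xs. map Leg (arc_legs xs) :: nat point list"
  have "\<exists>D'. bead_equiv n m D D' \<and> D' \<in> diagrams n m \<and>
      arcs D' = map ?f (take k (arcs D)) @ drop k (arcs D) \<and>
      map edge_ends (edges D') = map edge_ends (edges D) \<and> trivs D' = trivs D" if "k \<le> m" for k
    using that
  proof (induction k)
    case 0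
    then show ?case using assms(1) bead_equiv_refl by (intro exI[of _ D]) simp
  next
    case (Suc k)
    then obtain D' where D': "bead_equiv n m D D'" "D' \<in> diagrams n m"
      "arcs D' = map ?f (take k (arcs D)) @ drop k (arcs D)"
      "map edge_ends (edges D') = map edge_ends (edges D)" "trivs D' = trivs D" by auto
    have km: "k < m" using Suc.prems by simp
    have k: "arcs D' ! k = [] @ arcs D ! k" using D'(3) km len by (simp add: nth_append)
    obtain D'' where D'': "bead_equiv n m D' D''" "D'' \<in> diagrams n m"
      "arcs D'' = (arcs D')[k := [] @ ?f (arcs D ! k) @ [Bead (arc_product n (arcs D ! k))]]"
      "map edge_ends (edges D'') = map edge_ends (edges D')" "trivs D'' = trivs D'"
      using clear_arc[OF D'(2) km k] by blast
    have "arc_product n (arcs D ! k) = \<one>\<^bsub>Fr n\<^esub>" using assms(2) km len by (simp add: homotopy_trivial_def)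
    then have eq: "arc_equiv n (arcs D'' ! k) (?f (arcs D ! k))"
      using arc_step.unit[of n "?f (arcs D ! k)" "[]"] D''(3) D'(3) km len by (simp add: arc_equiv_step)
    let ?E = "D''\<lparr>arcs := (arcs D'')[k := ?f (arcs D ! k)]\<rparr>"
    have "arcs ?E = map ?f (take (Suc k) (arcs D)) @ drop (Suc k) (arcs D)"
      using D''(3) D'(3) km len by (simp add: list_update_append take_Suc_conv_app_nth flip: Cons_nth_drop_Suc)
    moreover have "bead_equiv n m D ?E"
      using bead_equiv_trans[OF D'(1) bead_equiv_trans[OF D''(1) arc_equiv_bead_equiv[OF D''(2) km eq]]] .
    ultimately show ?case
      using arc_equiv_diagrams[OF D''(2) km eq] D'' D' by (intro exI[of _ ?E]) simp
  qed
  from this[of m] show ?thesis using len by simp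
qed

lemma chord_diagram_simps:
  "edges (chord_diagram m (i, j, v)) = [(0, [v], 1)]" "trivs (chord_diagram m x) = []"
  "length (arcs (chord_diagram m x)) = m"
  "l < m \<Longrightarrow> arcs (chord_diagram m (i, j, v)) ! l =
     (if l = i then [Leg 0] else []) @ (if l = j then [Leg 1] else [])"
  by (cases x; simp add: chord_diagram_def)+

lemma upt_split: "i \<le> j \<Longrightarrow> j \<le> m \<Longrightarrow> [i..<m] = [i..<j] @ [j..<m]"
  using upt_add_eq_append[of i j "m - j"] by simp

lemma legs_chord_diagram:
  assumes "i \<le> j" "j < m" shows "legs (chord_diagram m (i, j, v)) = [0, 1]"
proof -
  let ?g = "\<lambda>l. (if l = i then [0] else []) @ (if l = j then [1::nat] else [])"
  have m: "[0..<m] = [0..<i] @ [i..<Suc j] @ [Suc j..<m]"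
    using assms upt_split[of 0 i m] upt_split[of i "Suc j" m] by simp
  have nil: "concat (map ?g ls) = []" if "i \<notin> set ls" "j \<notin> set ls" for ls
    using that by (induction ls) auto
  have mid: "concat (map ?g [i..<Suc j]) = [0, 1]"
  proof (cases "i = j")
    case False
    then have "[i..<Suc j] = i # [Suc i..<j] @ [j]" using assms by (simp add: upt_conv_Cons)
    then show ?thesis using nil[of "[Suc i..<j]"] False by simp
  qed simp
  have "legs (chord_diagram m (i, j, v)) = concat (map ?g [0..<m])"
    by (simp add: legs_def chord_diagram_def comp_def if_distrib[of arc_legs] cong: if_cong)
  also have "\<dots> = [0, 1]"
  proof -
    have z: "concat (map ?g [0..<i]) = []" "concat (map ?g [Suc j..<m]) = []"
      by (rule nil; use assms in auto)+
    show ?thesis unfolding m map_append concat_append mid z by simp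
  qed
  finally show ?thesis .
qed

lemma chord_diagram:
  assumes "x \<in> chord_basis n m"
  shows "chord_diagram m x \<in> diagrams n m" "has_degree 1 (chord_diagram m x)"
    "homotopy_trivial n (chord_diagram m x)" "chord_inv n (chord_diagram m x) x"
proof -
  interpret group "Fr n" by (rule group_Fr)
  obtain i j v where x: "x = (i, j, v)" by (rule prod_cases3)
  have b: "i \<le> j" "j < m" "v \<in> carrier (Fr n)" using assms by (auto simp: x chord_basis_def)
  note l = legs_chord_diagram[OF b(1,2), of v]
  have nb: "arc_beads xs = []" if "xs \<in> set (arcs (chord_diagram m (i, j, v)))" for xs
    using that by (auto simp: chord_diagram_def)
  show "chord_diagram m x \<in> diagrams n m"
    using l b(3) nb unfolding x
    by (auto simp: diagrams_def chord_diagram_simps half_edges_def)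
  show "has_degree 1 (chord_diagram m x)" using l by (simp add: x has_degree_def chord_diagram_simps)
  show "homotopy_trivial n (chord_diagram m x)" using nb by (simp add: x homotopy_trivial_def arc_product_eq)
  have hol: "holonomy n (chord_diagram m (i, j, v)) 0 1 v"
    by (rule holonomyI[of _ "[v]"]) (use b in \<open>simp_all add: chord_diagram_simps\<close>)
  show "chord_inv n (chord_diagram m x) x"
    unfolding x chord_inv_def prod.case
    by (rule exI[of _ "0::nat"], rule exI[of _ "1::nat"], rule exI[of _ v], intro conjI)
      (use b l hol in \<open>simp_all add: chord_diagram_simps\<close>)
qed

section \<open>Normal forms of chords and lollipops\<close>

lemma distinct_list_two:
  assumes "distinct xs" "set xs = {a, b}" "a \<noteq> b"
  shows "xs = [a, b] \<or> xs = [b, a]"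
proof -
  have "length xs = 2" using distinct_card[OF assms(1)] assms(2,3) by simp
  then obtain p q where "xs = [p, q]" by (auto simp: numeral_2_eq_2 length_Suc_conv)
  then show ?thesis using assms by (auto simp: doubleton_eq_iff)
qed

lemma distinct_list_one: "distinct xs \<Longrightarrow> set xs = {a} \<Longrightarrow> xs = [a]"
  by (cases xs; cases "tl xs") auto

text \<open>Which legs lie on an arc is clear; the point is their order when both do. It is
  inherited from \<open>legs D\<close>, of which the legs of one arc form a segment.\<close>

lemma chord_arcs:
  assumes "D \<in> diagrams n m" "legs D = [h, k]" "i < m" "h \<in> set (arc_legs (arcs D ! i))"
    "j < m" "k \<in> set (arc_legs (arcs D ! j))" "l < m"
  shows "arc_legs (arcs D ! l) = (if l = i then [h] else []) @ (if l = j then [k] else [])"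
proof -
  have len: "length (arcs D) = m" by (rule diagramsD(1)[OF assms(1)])
  have hk: "h \<noteq> k" using diagramsD(3)[OF assms(1)] assms(2) by simp
  have d: "distinct (arc_legs (arcs D ! l))"
    using diagramsD(3)[OF assms(1)] assms(7) len by (auto simp: legs_def distinct_concat_iff)
  have sub: "set (arc_legs (arcs D ! l)) \<subseteq> {h, k}"
    using arc_leg_in_legs[of l D] assms(2,7) len by auto
  have hl: "h \<in> set (arc_legs (arcs D ! l)) \<longleftrightarrow> l = i" and kl: "k \<in> set (arc_legs (arcs D ! l)) \<longleftrightarrow> l = j"
    using leg_on_arc_unique[OF assms(1), of l] assms len by blast+
  have s: "set (arc_legs (arcs D ! l)) = (if l = i then {h} else {}) \<union> (if l = j then {k} else {})"
  proof (rule Set.set_eqI)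
    fix a
    have "a \<in> set (arc_legs (arcs D ! l)) \<Longrightarrow> a = h \<or> a = k" using sub by blast
    then show "a \<in> set (arc_legs (arcs D ! l)) \<longleftrightarrow> a \<in> (if l = i then {h} else {}) \<union> (if l = j then {k} else {})"
      using hl kl by auto
  qed
  obtain L1 L2 where L: "legs D = L1 @ arc_legs (arcs D ! l) @ L2"
    using legs_arc_update[of l D] assms(7) len by metis
  show ?thesis
  proof (cases "l = i \<and> l = j")
    case True
    then have "arc_legs (arcs D ! l) = [h, k] \<or> arc_legs (arcs D ! l) = [k, h]"
      using distinct_list_two[OF d _ hk] s by auto
    then show ?thesis using True L assms(2) hk by (auto simp: Cons_eq_append_conv)
  next
    case False
    then show ?thesis using s distinct_list_one[OF d] by (auto split: if_splits)
  qed
qed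

text \<open>Once the arcs are free of beads, the only remaining datum is the single edge. Its beads
  are merged into one, the edge is turned to start at the first leg, and the half-edges are
  renamed.\<close>

lemma chord_normal_form:
  assumes "D \<in> diagrams n m" "homotopy_trivial n D" "is_chord D"
  shows "\<exists>x\<in>chord_basis n m. bead_equiv n m D (chord_diagram m x)"
proof -
  interpret group "Fr n" by (rule group_Fr)
  obtain D1 where D1: "bead_equiv n m D D1" "D1 \<in> diagrams n m"
    "arcs D1 = map (\<lambda>xs. map Leg (arc_legs xs)) (arcs D)"
    "map edge_ends (edges D1) = map edge_ends (edges D)" "trivs D1 = trivs D"
    using clear_arcs[OF assms(1,2)] by blast
  have ll: "arc_legs (map Leg ls) = ls" for ls by (induction ls) auto
  have legs: "legs D1 = legs D" by (simp add: legs_def D1(3) comp_def ll)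
  have "is_chord D1" using assms(3) D1(5) legs by (simp add: is_chord_def)
  obtain h k where hk: "legs D1 = [h, k]" using assms(3) legs by (auto simp: is_chord_def numeral_2_eq_2 length_Suc_conv)
  have half: "set (half_edges D1) = {h, k}" using diagramsD(5)[OF D1(2)] \<open>is_chord D1\<close> hk by (simp add: is_chord_def)
  have "h \<noteq> k" using diagramsD(3)[OF D1(2)] hk by simp
  have len: "length (arcs D1) = m" by (rule diagramsD(1)[OF D1(2)])
  obtain i where i: "i < m" "h \<in> set (arc_legs (arcs D1 ! i))" using leg_on_arc[of h D1] hk len by auto
  obtain j where j: "j < m" "k \<in> set (arc_legs (arcs D1 ! j))" using leg_on_arc[of k D1] hk len by auto
  have ij: "i \<le> j" by (rule ordered_legs[OF hk \<open>h \<noteq> k\<close>]) (use i j len in auto)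
  have half_list: "half_edges D1 = [h, k] \<or> half_edges D1 = [k, h]"
    using distinct_list_two[OF diagramsD(2)[OF D1(2)] half \<open>h \<noteq> k\<close>] .
  obtain a us b where e: "edges D1 = [(a, us, b)]" and ab: "(a, b) = (h, k) \<or> (a, b) = (k, h)"
  proof -
    have "\<exists>e. edges D1 = [e] \<and> (edge_ends e = [h, k] \<or> edge_ends e = [k, h])"
    proof (cases "edges D1")
      case (Cons e es)
      obtain a us b where "e = (a, us, b)" by (rule prod_cases3)
      moreover have "es = []"
      proof (cases es)
        case (Cons e' es')
        obtain a' us' b' where "e' = (a', us', b')" by (rule prod_cases3)
        then show ?thesis using half_list Cons \<open>edges D1 = e # es\<close> \<open>e = (a, us, b)\<close> by (simp add: half_edges_def)
      qed
      ultimately show ?thesis using half_list Cons by (simp add: half_edges_def)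
    qed (use half_list in \<open>simp add: half_edges_def\<close>)
    then obtain e where "edges D1 = [e]" "edge_ends e = [h, k] \<or> edge_ends e = [k, h]" by blast
    then show thesis using that by (cases e) auto
  qed
  have us: "set us \<subseteq> carrier (Fr n)" using diagramsD(9)[OF D1(2), of a us b] e by simp
  define w where "w = bead_product n us"
  have w: "w \<in> carrier (Fr n)" using us by (simp add: w_def)
  let ?D2 = "D1\<lparr>edges := (edges D1)[0 := (a, [w], b)]\<rparr>"
  have D2: "bead_equiv n m D1 ?D2" "?D2 \<in> diagrams n m"
    using edge_collapse[OF D1(2), of 0 a us b] edge_update_diagrams[OF D1(2), of 0 a us b "[w]"] e w
    by (auto simp: w_def)
  \<comment> \<open>The stored edge may run against the order of the legs; the reversal rule then
    inverts its bead.\<close>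
  define v where "v = (if (a, b) = (h, k) then w else inv\<^bsub>Fr n\<^esub> w)"
  have v: "v \<in> carrier (Fr n)" using w by (simp add: v_def)
  let ?D3 = "D1\<lparr>edges := [(h, [v], k)]\<rparr>"
  have D3: "bead_equiv n m D1 ?D3 \<and> ?D3 \<in> diagrams n m"
  proof (cases "(a, b) = (h, k)")
    case True
    then show ?thesis using D2 e by (simp add: v_def)
  next
    case False
    then have ba: "(a, b) = (k, h)" using ab by blast
    have "bead_step n ?D2 (?D2\<lparr>edges := (edges ?D2)[0 := (b, [inv\<^bsub>Fr n\<^esub> w], a)]\<rparr>)"
      by (rule bead_step.edge_reverse) (use e in auto)
    moreover have "?D2\<lparr>edges := (edges ?D2)[0 := (b, [inv\<^bsub>Fr n\<^esub> w], a)]\<rparr> = ?D3"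
      using e ba False by (simp add: v_def)
    moreover have "?D3 \<in> diagrams n m"
      using edge_update_diagrams[OF D1(2), of 0 a us b "[v]" h k] e ba v by simp
    ultimately show ?thesis using bead_equiv_trans[OF D2(1) bead_equiv_step[OF _ D2(2)]] by metis
  qed
  let ?x = "(i, j, v)"
  have x: "?x \<in> chord_basis n m" using ij j v by (simp add: chord_basis_def)
  define f where "f a = (if a = h then 0 else 1::nat)" for a
  have "bead_step n ?D3 (chord_diagram m ?x)"
  proof (rule bead_step.isomorphism[of f])
    show "inj_on f (set (half_edges ?D3))" using \<open>h \<noteq> k\<close> by (auto simp: half_edges_def inj_on_def f_def)
    show "arcs (chord_diagram m ?x) = map (map (map_point f)) (arcs ?D3)"
    proof (rule nth_equalityI)
      fix l assume "l < length (arcs (chord_diagram m ?x))"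
      then have l: "l < m" by (simp add: chord_diagram_simps)
      have "arcs D1 ! l = map Leg (arc_legs (arcs D1 ! l))" using D1(3) l len by (simp add: ll)
      also have "arc_legs (arcs D1 ! l) = (if l = i then [h] else []) @ (if l = j then [k] else [])"
        by (rule chord_arcs[OF D1(2) hk i j l])
      finally show "arcs (chord_diagram m ?x) ! l = map (map (map_point f)) (arcs ?D3) ! l"
        using l len \<open>h \<noteq> k\<close> by (simp add: chord_diagram_simps f_def)
    qed (simp add: chord_diagram_simps len)
    show "set (edges (chord_diagram m ?x)) = (\<lambda>(h, us, k). (f h, us, f k)) ` set (edges ?D3)"
      using \<open>h \<noteq> k\<close> by (simp add: chord_diagram_simps f_def)
    show "\<Union> (rotations ` set (trivs (chord_diagram m ?x))) =
      \<Union> (rotations ` (\<lambda>(a, b, c). (f a, f b, f c)) ` set (trivs ?D3))"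
      using D1(5) assms(3) by (simp add: chord_diagram_simps is_chord_def)
  qed
  then have "bead_equiv n m ?D3 (chord_diagram m ?x)"
    using bead_equiv_step D3 chord_diagram(1)[OF x] by blast
  then have "bead_equiv n m D (chord_diagram m ?x)"
    using bead_equiv_trans[OF D1(1) bead_equiv_trans[OF conjunct1[OF D3]]] by blast
  then show ?thesis using x by blast
qed

text \<open>STU applies to an unbeaded stick only. After clearing the arcs, the bead of the stick is
  pushed through the trivalent vertex onto the loop, and STU then opens the lollipop into two
  chords.\<close>

lemma lollipop_normal_form:
  assumes "D \<in> diagrams n m" "homotopy_trivial n D" "is_lollipop D"
  shows "\<exists>E A B. bead_equiv n m D E \<and> E \<in> diagrams n m \<and> A \<in> diagrams n m \<and> B \<in> diagrams n m \<and>
     homotopy_trivial n A \<and> homotopy_trivial n B \<and> is_chord A \<and> is_chord B \<and>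
     (gen E - (gen A - gen B) :: _ \<Rightarrow>\<^sub>0 'k::field) \<in> stu_rels n m"
proof -
  interpret group "Fr n" by (rule group_Fr)
  obtain D1 where D1: "bead_equiv n m D D1" "D1 \<in> diagrams n m"
    "arcs D1 = map (\<lambda>xs. map Leg (arc_legs xs)) (arcs D)"
    "map edge_ends (edges D1) = map edge_ends (edges D)" "trivs D1 = trivs D"
    using clear_arcs[OF assms(1,2)] by blast
  have ll: "arc_legs (map Leg ls) = ls" "arc_beads (map Leg ls) = []" for ls by (induction ls) auto
  have legs: "legs D1 = legs D" by (simp add: legs_def D1(3) comp_def ll)
  have lol: "is_lollipop D1" using assms(3) D1(5) legs by (simp add: is_lollipop_def)
  obtain i0 u0 where "lollipop_inv n D1 (i0, u0)" using lollipop_inv_exists[OF D1(2) lol] by blast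
  then obtain l t x y z q r where *: "legs D1 = [l]" "trivs D1 = [t]" "(x, y, z) \<in> rotations t"
     "i0 < length (arcs D1)" "l \<in> set (arc_legs (arcs D1 ! i0))" "holonomy n D1 l x q" "holonomy n D1 z y r"
    by (elim lollipop_invE)
  have len: "length (arcs D1) = m" by (rule diagramsD(1)[OF D1(2)])
  have i: "i0 < m" using *(4) len by simp
  obtain L1 L2 where L: "legs D1 = L1 @ arc_legs (arcs D1 ! i0) @ L2"
      "\<And>zs. legs (D1\<lparr>arcs := (arcs D1)[i0 := zs]\<rparr>) = L1 @ arc_legs zs @ L2"
    using legs_arc_update[OF *(4)] by metis
  have arc: "arc_legs (arcs D1 ! i0) = [l]" "L1 = []" "L2 = []"
    using L(1) *(1,5) by (auto simp: Cons_eq_append_conv)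
  have "arcs D1 ! i0 = map Leg (arc_legs (arcs D1 ! i0))" using D1(3) i len by (simp add: ll)
  then have arci: "arcs D1 ! i0 = [Leg l]" using arc by simp
  have tt: "t \<in> set (trivs D1)" using *(2) by simp
  note dist = rotations_distinct[OF D1(2) tt *(3)] and corn = rotations_corners[OF *(3)]
  have lnc: "l \<notin> {x, y, z}" using diagramsD(6)[OF D1(2)] *(1,2) corn by auto
  obtain a us b where ab: "(a, us, b) \<in> set (edges D1)" "(a, b) = (l, x) \<or> (a, b) = (x, l)"
    using *(6) unfolding holonomy_def by blast
  then obtain j where j: "j < length (edges D1)" "edges D1 ! j = (a, us, b)" by (auto simp: in_set_conv_nth)
  have us: "set us \<subseteq> carrier (Fr n)" by (rule diagramsD(9)[OF D1(2) ab(1)])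
  define w where "w = bead_product n us"
  have w: "w \<in> carrier (Fr n)" using us by (simp add: w_def)
  let ?D2 = "D1\<lparr>edges := (edges D1)[j := (a, [w], b)]\<rparr>"
  have D2: "bead_equiv n m D1 ?D2" "?D2 \<in> diagrams n m"
    using edge_collapse[OF D1(2) j] edge_update_diagrams[OF D1(2) j, of "[w]"] w by (auto simp: w_def)
  define v where "v = (if (a, b) = (l, x) then w else inv\<^bsub>Fr n\<^esub> w)"
  have v: "v \<in> carrier (Fr n)" using w by (simp add: v_def)
  let ?D3 = "D1\<lparr>edges := (edges D1)[j := (l, [v], x)]\<rparr>"
  have D3: "bead_equiv n m D1 ?D3 \<and> ?D3 \<in> diagrams n m"
  proof (cases "(a, b) = (l, x)")
    case True
    then show ?thesis using D2 by (simp add: v_def)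
  next
    case False
    then have ba: "(a, b) = (x, l)" using ab(2) by blast
    have "bead_step n ?D2 (?D2\<lparr>edges := (edges ?D2)[j := (b, [inv\<^bsub>Fr n\<^esub> w], a)]\<rparr>)"
      by (rule bead_step.edge_reverse) (use j in auto)
    moreover have "?D2\<lparr>edges := (edges ?D2)[j := (b, [inv\<^bsub>Fr n\<^esub> w], a)]\<rparr> = ?D3"
      using ba False by (simp add: v_def)
    moreover have "?D3 \<in> diagrams n m"
      using edge_update_diagrams[OF D1(2) j, of "[v]" l x] ba v by simp
    ultimately show ?thesis using bead_equiv_trans[OF D2(1) bead_equiv_step[OF _ D2(2)]] by metis
  qed
  let ?D4 = "D1\<lparr>edges := (edges D1)[j := (l, [], x)]\<rparr>"
  let ?E = "D1\<lparr>edges := map (add_bead n v z) (map (add_bead n v y) ((edges D1)[j := (l, [], x)]))\<rparr>"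
  have D4: "?D4 \<in> diagrams n m" by (rule edge_update_diagrams[OF D1(2) j]) (use ab in auto)
  have E: "?E \<in> diagrams n m"
    using map_add_bead_diagrams[OF map_add_bead_diagrams[OF D4 v] v] by simp
  have "bead_step n ?D3 (?D3\<lparr>edges := map (add_bead n v z) (map (add_bead n v y) ((edges ?D3)[j := (l, [], x)]))\<rparr>)"
    by (rule bead_step.pass_trivalent[of j _ l "[]"]) (use j *(2,3) in auto)
  then have "bead_step n ?D3 ?E" by simp
  then have DE: "bead_equiv n m D ?E"
    using bead_equiv_trans[OF D1(1) bead_equiv_trans[OF conjunct1[OF D3] bead_equiv_step[OF _ conjunct2[OF D3] E]]] by blast
  let ?e = "(l, [], x) :: edge"
  \<comment> \<open>Neither \<open>y\<close> nor \<open>z\<close> is an end of the stick, which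
    therefore stays unbeaded.\<close>
  have "add_bead n v z (add_bead n v y ?e) = ?e" using lnc dist by auto
  moreover have "?e \<in> set ((edges D1)[j := ?e])" using j(1) by (rule set_update_memI)
  ultimately have e: "?e \<in> set (edges ?E)" by (metis (no_types, lifting) diagram.select_convs(2) diagram.surjective diagram.update_convs(2) image_eqI list.set_map)
  let ?at = "\<lambda>p q. attach i0 ?e t [] p q [] ?E"
  have ends: "edge_ends (add_bead n w h e) = edge_ends e" for w h e by (cases e) simp
  have legsA: "legs (?at p q) = [p, q]" for p q
    using L(2)[of "[Leg p, Leg q]"] arc by (simp add: legs_def attach_def)
  have trA: "trivs (?at p q) = []" for p q using *(2) by (simp add: attach_simps)
  \<comment> \<open>Multisets, because the position of the stick in the list of edges is unknown.
    Without the stick, exactly the half-edges \<open>y\<close> and \<open>z\<close> remain.\<close>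
  have mh: "mset (half_edges ?E) = {#l, x#} + mset (concat (map edge_ends (remove1 ?e (edges ?E))))"
  proof -
    obtain es1 es2 where es: "edges ?E = es1 @ ?e # es2" "?e \<notin> set es1" using e by (meson split_list_first)
    then have "remove1 ?e (edges ?E) = es1 @ es2" by (simp add: remove1_append)
    then show ?thesis using es(1) unfolding half_edges_def by simp
  qed
  have corE: "set (half_edges ?E) = {l, x, y, z}"
  proof -
    have "legs ?E = [l]" "trivs ?E = [t]" using *(1,2) by (simp_all add: legs_def)
    then show ?thesis unfolding diagramsD(5)[OF E] using corn by auto
  qed
  have dE: "distinct (half_edges ?E)" by (rule diagramsD(2)[OF E])
  have halfA: "half_edges (?at p q) = concat (map edge_ends (remove1 ?e (edges ?E)))" for p q
    by (simp add: half_edges_def attach_simps)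
  have "mset (half_edges ?E) = {#l, x, y, z#}"
  proof -
    have "mset (half_edges ?E) = mset_set {l, x, y, z}" using mset_set_set[OF dE] unfolding corE by simp
    also have "\<dots> = {#l, x, y, z#}" using lnc dist by simp
    finally show ?thesis .
  qed
  then have mA: "mset (half_edges (?at p q)) = {#y, z#}" for p q
    using mh unfolding halfA by (simp add: add_mset_commute)
  have hA: "distinct (half_edges (?at p q))" "set (half_edges (?at p q)) = {y, z}" for p q
    using mset_eq_imp_distinct_iff[of "half_edges (?at p q)" "[y, z]"] mset_eq_setD[of "half_edges (?at p q)" "[y, z]"] mA dist by auto
  have bA: "arc_beads xs = []" if "xs \<in> set (arcs (?at p q))" for xs p q
    using that set_update_subset_insert[of "arcs D1" i0 "[Leg p, Leg q]"] D1(3) by (auto simp: attach_simps ll)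
  have A: "?at p q \<in> diagrams n m \<and> homotopy_trivial n (?at p q) \<and> is_chord (?at p q)"
    if pq: "{p, q} = {y, z}" for p q
  proof (intro conjI)
    have "p \<noteq> q" using pq dist by (auto simp: doubleton_eq_iff)
    have "set (edge_beads e') \<subseteq> carrier (Fr n)" if "e' \<in> set (edges (?at p q))" for e'
    proof -
      have "e' \<in> set (edges ?E)" using that notin_set_remove1 unfolding attach_simps by metis
      then show ?thesis by (rule diagramsD(8)[OF E])
    qed
    then show "?at p q \<in> diagrams n m"
      unfolding diagrams_def using hA[of p q] legsA[of p q] trA pq \<open>p \<noteq> q\<close> bA len
      by (auto simp: attach_simps(1))
    show "homotopy_trivial n (?at p q)" using bA by (simp add: homotopy_trivial_def arc_product_eq)
    show "is_chord (?at p q)" using legsA trA by (simp add: is_chord_def)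
  qed
  \<comment> \<open>In the STU relation the triple \<open>(x, y, z)\<close> is read as stick, b, a.
    Hence \<open>z\<close> comes first in the positive term.\<close>
  have "(gen ?E - (gen (?at z y) - gen (?at y z)) :: _ \<Rightarrow>\<^sub>0 'k) \<in> stu_rels n m"
    unfolding stu_rels_def
    by (rule CollectI, rule exI[of _ ?E], rule exI[of _ i0], rule exI[of _ ?e], rule exI[of _ t], rule exI[of _ "[]"],
        rule exI[of _ "[]"], rule exI[of _ l], rule exI[of _ x], rule exI[of _ z], rule exI[of _ y])
      (use A[of z y] A[of y z] E i arci e *(2,3) in auto)
  then show ?thesis using DE E A[of z y] A[of y z] by blast
qed


section \<open>Functoriality of the spaces of diagrams\<close>

definition oriented_copy :: "nat \<Rightarrow> bool \<Rightarrow> nat point list \<Rightarrow> nat point list" where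
  "oriented_copy n \<epsilon> xs = (if \<epsilon> then xs else rev (map (inverse_point n) xs))"

lemma arc_copy_eq:
  "arc_copy n g D c j s = oriented_copy n (snd (g [(j, True)] ! s)) (filter (kept c (j, s)) (arcs D ! fst (g [(j, True)] ! s)))"
  by (simp add: arc_copy_def oriented_copy_def split: prod.split)

lemma arc_legs_inverse [simp]: "arc_legs (map (inverse_point n) xs) = arc_legs xs"
proof (induction xs)
  case (Cons x xs) then show ?case by (cases x) auto
qed simp

lemma arc_beads_inverse [simp]: "arc_beads (map (inverse_point n) xs) = map (\<lambda>w. inv\<^bsub>Fr n\<^esub> w) (arc_beads xs)"
proof (induction xs)
  case (Cons x xs) then show ?case by (cases x) auto
qed simp

lemma arc_legs_rev [simp]: "arc_legs (rev xs) = rev (arc_legs xs)"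
proof (induction xs)
  case (Cons x xs) then show ?case by (cases x) auto
qed simp

lemma arc_beads_rev [simp]: "arc_beads (rev xs) = rev (arc_beads xs)"
proof (induction xs)
  case (Cons x xs) then show ?case by (cases x) auto
qed simp

lemma arc_legs_kept [simp]: "arc_legs (filter (kept c js) xs) = filter (\<lambda>h. c h = js) (arc_legs xs)"
proof (induction xs)
  case (Cons x xs) then show ?case by (cases x) auto
qed simp

lemma arc_beads_kept [simp]: "arc_beads (filter (kept c js) xs) = arc_beads xs"
proof (induction xs)
  case (Cons x xs) then show ?case by (cases x) auto
qed simp

lemma arc_legs_concat: "arc_legs (concat xss) = concat (map arc_legs xss)"
  by (induction xss) auto

lemma arc_beads_concat: "arc_beads (concat xss) = concat (map arc_beads xss)"
  by (induction xss) auto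

lemma set_arc_legs_copy: "set (arc_legs (arc_copy n g D c j s)) =
    {h \<in> set (arc_legs (arcs D ! fst (g [(j, True)] ! s))). c h = (j, s)}"
  by (auto simp: arc_copy_eq oriented_copy_def)

lemma oriented_copy_beads:
  "set (arc_beads xs) \<subseteq> carrier (Fr n) \<Longrightarrow> set (arc_beads (oriented_copy n \<epsilon> xs)) \<subseteq> carrier (Fr n)"
  using group.inv_closed[OF group_Fr] by (auto simp: oriented_copy_def)

text \<open>A tag which recovers the index keeps the blocks disjoint. For pulled diagrams the tag of
  a leg is the copy chosen by the attachment.\<close>

lemma distinct_concat_tagged:
  assumes "\<And>i. i < N \<Longrightarrow> distinct (f i)" "\<And>i x. i < N \<Longrightarrow> x \<in> set (f i) \<Longrightarrow> t x = i"
  shows "distinct (concat (map f [0..<N]))"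
  using assms
proof (induction N)
  case (Suc N)
  have "set (concat (map f [0..<N])) \<inter> set (f N) = {}"
  proof (rule equals0I)
    fix x assume "x \<in> set (concat (map f [0..<N])) \<inter> set (f N)"
    then obtain i where "i < N" "x \<in> set (f i)" "x \<in> set (f N)" by auto
    then show False using Suc.prems(2)[of i x] Suc.prems(2)[of N x] by simp
  qed
  moreover have "distinct (concat (map f [0..<N]))"
    by (rule Suc.IH) (simp_all add: Suc.prems)
  ultimately show ?case using Suc.prems(1)[of N] by simp
qed simp

lemma gr_letters:
  assumes "g \<in> gr a b" "j < a" "s < length (g [(j, True)])"
  shows "fst (g [(j, True)] ! s) < b"
proof -
  have "g [(j, True)] \<in> carrier (Fr b)" by (rule gr_closed[OF assms(1) letter_in_Fr[OF assms(2)]])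
  then have "fst ` set (g [(j, True)]) \<subseteq> {..<b}" unfolding carrier_Fr by blast
  then show ?thesis using nth_mem[OF assms(3)] by blast
qed

lemma attachmentsD:
  assumes "c \<in> attachments a g D" "h \<in> set (legs D)"
  shows "fst (c h) < a" "snd (c h) < length (g [(fst (c h), True)])"
    "h \<in> set (arc_legs (arcs D ! fst (g [(fst (c h), True)] ! snd (c h))))"
  using PiE_mem[OF assms(1)[unfolded attachments_def] assms(2)] by auto

lemma finite_attachments: "finite (attachments a g D)"
proof -
  have "finite {(j, s). j < a \<and> s < length (g [(j, True)]) \<and> P j s}" for P
    by (rule finite_subset[of _ "Sigma {..<a} (\<lambda>j. {..<length (g [(j, True)])})"]) auto
  then show ?thesis unfolding attachments_def by (intro finite_PiE) auto
qed

lemma pulled_diagram_simps [simp]: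
  "edges (pulled_diagram n a g D c) = edges D" "trivs (pulled_diagram n a g D c) = trivs D"
  "length (arcs (pulled_diagram n a g D c)) = a" "half_edges (pulled_diagram n a g D c) = half_edges D"
  by (simp_all add: pulled_diagram_def half_edges_def)

lemma arcs_pulled_diagram:
  "j < a \<Longrightarrow> arcs (pulled_diagram n a g D c) ! j = concat (map (arc_copy n g D c j) [0..<length (g [(j, True)])])"
  by (simp add: pulled_diagram_def)

text \<open>For every leg the attachment names the one copy in which it survives, and this copy does
  contain it, so that no leg is lost or doubled.\<close>

lemma mset_legs_pulled_diagram:
  assumes "D \<in> diagrams n b" "g \<in> gr a b" "c \<in> attachments a g D"
  shows "mset (legs (pulled_diagram n a g D c)) = mset (legs D)"
proof -
  let ?L = "\<lambda>j s. arc_legs (arc_copy n g D c j s)"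
  have eq: "legs (pulled_diagram n a g D c) = concat (map (\<lambda>j. concat (map (?L j) [0..<length (g [(j, True)])])) [0..<a])"
    by (simp add: legs_def pulled_diagram_def arc_legs_concat comp_def)
  have "distinct (?L j s)" if "j < a" "s < length (g [(j, True)])" for j s
  proof -
    have "distinct (arc_legs (arcs D ! fst (g [(j, True)] ! s)))"
      using diagramsD(3)[OF assms(1)] gr_letters[OF assms(2) that] diagramsD(1)[OF assms(1)]
      by (auto simp: legs_def distinct_concat_iff)
    then show ?thesis by (simp add: arc_copy_eq oriented_copy_def)
  qed
  then have dj: "distinct (concat (map (?L j) [0..<length (g [(j, True)])]))" if "j < a" for j
    by (rule distinct_concat_tagged[where t = "\<lambda>h. snd (c h)"]) (use that in \<open>auto simp: set_arc_legs_copy\<close>)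
  have "distinct (legs (pulled_diagram n a g D c))"
    unfolding eq
    by (rule distinct_concat_tagged[where t = "\<lambda>h. fst (c h)"]) (use dj in \<open>auto simp: set_arc_legs_copy\<close>)
  moreover have "set (legs (pulled_diagram n a g D c)) = set (legs D)"
  proof (intro subset_antisym subsetI)
    fix h assume "h \<in> set (legs (pulled_diagram n a g D c))"
    then obtain j s where "j < a" "s < length (g [(j, True)])" "h \<in> set (?L j s)" unfolding eq by auto
    then show "h \<in> set (legs D)"
      using arc_leg_in_legs[of "fst (g [(j, True)] ! s)" D h] gr_letters[OF assms(2)] diagramsD(1)[OF assms(1)]
      by (simp add: set_arc_legs_copy)
  next
    fix h assume h: "h \<in> set (legs D)"
    have "h \<in> set (?L (fst (c h)) (snd (c h)))"
      using attachmentsD(3)[OF assms(3) h] by (simp add: set_arc_legs_copy)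
    then show "h \<in> set (legs (pulled_diagram n a g D c))"
      unfolding eq using attachmentsD(1,2)[OF assms(3) h] by fastforce
  qed
  ultimately show ?thesis using diagramsD(3)[OF assms(1)] by (metis set_eq_iff_mset_eq_distinct)
qed

lemma pulled_diagram_diagrams:
  assumes "D \<in> diagrams n b" "g \<in> gr a b" "c \<in> attachments a g D"
  shows "pulled_diagram n a g D c \<in> diagrams n a"
proof (rule diagrams_transfer[OF assms(1) _ mset_legs_pulled_diagram[OF assms]])
  fix xs assume "xs \<in> set (arcs (pulled_diagram n a g D c))"
  then obtain j where j: "j < a" "xs = concat (map (arc_copy n g D c j) [0..<length (g [(j, True)])])"
    by (auto simp: pulled_diagram_def)
  have "set (arc_beads (arc_copy n g D c j s)) \<subseteq> carrier (Fr n)" if "s < length (g [(j, True)])" for s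
    unfolding arc_copy_eq
    using arc_beads_closed[OF assms(1)] gr_letters[OF assms(2) j(1) that] diagramsD(1)[OF assms(1)]
    by (intro oriented_copy_beads) simp
  then show "set (arc_beads xs) \<subseteq> carrier (Fr n)" by (fastforce simp: j(2) arc_beads_concat)
next
  show "set (edge_beads e) \<subseteq> carrier (Fr n)" if "e \<in> set (edges (pulled_diagram n a g D c))" for e
    using that diagramsD(8)[OF assms(1)] by simp
qed simp_all

lemma keys_pullback:
  assumes "D \<in> diagrams n b" "g \<in> gr a b"
  shows "Poly_Mapping.keys (pullback n a g D :: _ \<Rightarrow>\<^sub>0 'k::field) \<subseteq> diagrams n a"
proof -
  have "(pullback n a g D :: _ \<Rightarrow>\<^sub>0 'k) \<in> {x. Poly_Mapping.keys x \<subseteq> diagrams n a}"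
    unfolding pullback_def
    by (intro lin_sub_sum[OF lin_sub_keys] lin_subD(3)[OF lin_sub_keys])
      (use pulled_diagram_diagrams[OF assms] in auto)
  then show ?thesis by simp
qed

lemma bead_product_inverse:
  assumes "set ws \<subseteq> carrier (Fr n)"
  shows "bead_product n (rev (map (\<lambda>w. inv\<^bsub>Fr n\<^esub> w) ws)) = inv\<^bsub>Fr n\<^esub> (bead_product n ws)"
proof -
  interpret group "Fr n" by (rule group_Fr)
  show ?thesis using assms
  proof (induction ws)
    case (Cons w ws)
    have "set (rev (map (\<lambda>w. inv\<^bsub>Fr n\<^esub> w) ws)) \<subseteq> carrier (Fr n)" using Cons.prems by auto
    then show ?case using Cons by (simp add: bead_product_append inv_mult_group)
  qed simp
qed

text \<open>Every copy keeps all the beads of its arc, so its product is \<open>1\<close> or the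
  inverse of \<open>1\<close>, and a new arc is a concatenation of copies.\<close>

lemma homotopy_trivial_pulled_diagram:
  assumes "D \<in> diagrams n b" "g \<in> gr a b" "homotopy_trivial n D"
  shows "homotopy_trivial n (pulled_diagram n a g D c)"
proof -
  interpret group "Fr n" by (rule group_Fr)
  have copy: "bead_product n (arc_beads (arc_copy n g D c j s)) = \<one>\<^bsub>Fr n\<^esub> \<and>
      set (arc_beads (arc_copy n g D c j s)) \<subseteq> carrier (Fr n)"
    if "j < a" "s < length (g [(j, True)])" for j s
  proof -
    let ?p = "fst (g [(j, True)] ! s)"
    have p: "?p < length (arcs D)" using gr_letters[OF assms(2) that] diagramsD(1)[OF assms(1)] by simp
    note bc = arc_beads_closed[OF assms(1) p]
    have "bead_product n (arc_beads (arcs D ! ?p)) = \<one>\<^bsub>Fr n\<^esub>"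
      using assms(3) p by (simp add: homotopy_trivial_def arc_product_eq)
    then show ?thesis
      using bc bead_product_inverse[OF bc] oriented_copy_beads[of "filter (kept c (j, s)) (arcs D ! ?p)" n]
      by (simp add: arc_copy_eq oriented_copy_def)
  qed
  have "bead_product n (arc_beads (concat (map (arc_copy n g D c j) ss))) = \<one>\<^bsub>Fr n\<^esub> \<and>
      set (arc_beads (concat (map (arc_copy n g D c j) ss))) \<subseteq> carrier (Fr n)"
    if "j < a" "set ss \<subseteq> {..<length (g [(j, True)])}" for j ss
    using that(2)
  proof (induction ss)
    case (Cons s ss)
    then show ?case using copy[OF that(1), of s] by (simp add: bead_product_append)
  qed simp
  note all = this
  have "bead_product n (arc_beads (concat (map (arc_copy n g D c j) [0..<length (g [(j, True)])]))) = \<one>\<^bsub>Fr n\<^esub>"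
    if "j < a" for j using all[OF that, of "[0..<length (g [(j, True)])]"] by (simp add: atLeast0LessThan)
  then show ?thesis
    by (simp add: homotopy_trivial_def arc_product_eq pulled_diagram_def)
qed


subsection \<open>Compatibility with bead equivalence\<close>

abbreviation diagram_rel_span :: "nat \<Rightarrow> nat \<Rightarrow> (diagram \<Rightarrow>\<^sub>0 'k::field) set" where
  "diagram_rel_span n m \<equiv> rel_span (diagrams n m) (diagram_rels n m)"

lemmas lin_sub_diagram_rel_span = rel_span(1)[OF diagram_rels_carrier]

lemma bead_equiv_rel_span:
  assumes "bead_equiv n m D D'" "D \<in> diagrams n m" "D' \<in> diagrams n m"
  shows "gen D - gen D' \<in> diagram_rel_span n m"
  by (rule rel_span(2)[OF diagram_rels_carrier]) (use assms in \<open>auto simp: diagram_rels_def\<close>)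

lemma attachments_cong:
  assumes "g \<in> gr a b" "length (arcs D) = b" "map arc_legs (arcs D) = map arc_legs (arcs D')"
  shows "attachments a g D = attachments a g D'" "reversed_legs g D = reversed_legs g D'"
proof -
  have l: "legs D = legs D'" unfolding legs_def assms(3) ..
  have len: "length (arcs D') = b" using assms(2) map_eq_imp_length_eq[OF assms(3)] by simp
  have "arc_legs (arcs D ! p) = arc_legs (arcs D' ! p)" if "p < b" for p
    using arg_cong[OF assms(3), of "\<lambda>xs. xs ! p"] that assms(2) len by simp
  then have "arc_legs (arcs D ! fst (g [(j, True)] ! s)) = arc_legs (arcs D' ! fst (g [(j, True)] ! s))"
    if "j < a" "s < length (g [(j, True)])" for j s
    using gr_letters[OF assms(1) that] by simp
  then have "{(j, s). j < a \<and> s < length (g [(j, True)]) \<and> h \<in> set (arc_legs (arcs D ! fst (g [(j, True)] ! s)))} =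
    {(j, s). j < a \<and> s < length (g [(j, True)]) \<and> h \<in> set (arc_legs (arcs D' ! fst (g [(j, True)] ! s)))}" for h
    by auto
  then show "attachments a g D = attachments a g D'" unfolding attachments_def l by simp
  show "reversed_legs g D = reversed_legs g D'" by (simp add: reversed_legs_def l fun_eq_iff)
qed

text \<open>If the legs agree arc by arc, so do the index sets and the signs of the two sums, and
  they may be compared term by term.\<close>

lemma pullback_diff_rel_span:
  assumes "D \<in> diagrams n b" "D' \<in> diagrams n b" "g \<in> gr a b"
    "map arc_legs (arcs D) = map arc_legs (arcs D')"
    "\<And>c. c \<in> attachments a g D \<Longrightarrow> bead_equiv n a (pulled_diagram n a g D c) (pulled_diagram n a g D' c)"
  shows "pullback n a g D - pullback n a g D' \<in> (diagram_rel_span n a :: (_ \<Rightarrow>\<^sub>0 'k::field) set)"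
proof -
  note att = attachments_cong[OF assms(3) diagramsD(1)[OF assms(1)] assms(4)]
  have "pullback n a g D - (pullback n a g D' :: _ \<Rightarrow>\<^sub>0 'k) = (\<Sum>c\<in>attachments a g D.
     scale ((-1) ^ card (reversed_legs g D c)) (gen (pulled_diagram n a g D c) - gen (pulled_diagram n a g D' c)))"
    unfolding pullback_def att[symmetric] by (simp add: scale_diff sum_subtractf)
  also have "\<dots> \<in> diagram_rel_span n a"
    by (intro lin_sub_sum[OF lin_sub_diagram_rel_span] lin_subD(3)[OF lin_sub_diagram_rel_span]
        bead_equiv_rel_span assms(5) pulled_diagram_diagrams[OF assms(1,3)] pulled_diagram_diagrams[OF assms(2,3)])
      (use att in auto)
  finally show ?thesis .
qed

lemma pulled_diagram_update:
  "pulled_diagram n a g (D\<lparr>edges := es\<rparr>) c = (pulled_diagram n a g D c)\<lparr>edges := es\<rparr>"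
proof -
  have "arc_copy n g (D\<lparr>edges := es\<rparr>) c = arc_copy n g D c" by (intro ext) (simp add: arc_copy_eq)
  then show ?thesis by (simp add: pulled_diagram_def)
qed

lemma oriented_copy_arc_equiv:
  assumes "arc_equiv n xs ys"
  shows "arc_equiv n (oriented_copy n \<epsilon> (filter (kept c js) xs)) (oriented_copy n \<epsilon> (filter (kept c js) ys))"
  using assms unfolding arc_equiv_def
proof (rule equivclp_image)
  interpret group "Fr n" by (rule group_Fr)
  fix xs ys assume "arc_step n xs ys"
  then show "arc_step n (oriented_copy n \<epsilon> (filter (kept c js) xs)) (oriented_copy n \<epsilon> (filter (kept c js) ys))"
  proof cases
    case (merge u v us vs)
    show ?thesis
    proof (cases \<epsilon>)
      case True
      then show ?thesis using arc_step.merge[OF merge(3,4)] by (simp add: oriented_copy_def merge(1,2))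
    next
      case False
      \<comment> \<open>In a reversed copy the beads appear inverted and in the opposite order, and
        their product is the inverse of the merged bead.\<close>
      have "arc_step n (p @ [Bead (inv\<^bsub>Fr n\<^esub> v), Bead (inv\<^bsub>Fr n\<^esub> u)] @ q) (p @ [Bead (inv\<^bsub>Fr n\<^esub> (u \<otimes>\<^bsub>Fr n\<^esub> v))] @ q)" for p q
        using arc_step.merge[of "inv\<^bsub>Fr n\<^esub> v" n "inv\<^bsub>Fr n\<^esub> u" p q] merge(3,4) by (simp add: inv_mult_group)
      then show ?thesis using False by (simp add: oriented_copy_def merge(1,2))
    qed
  next
    case (unit us vs)
    then show ?thesis using arc_step.unit[of n] by (simp add: oriented_copy_def)
  qed
qed

lemma pulled_diagram_arcs_equiv:
  assumes "D \<in> diagrams n b" "g \<in> gr a b" "c \<in> attachments a g D"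
    "\<And>p. p < b \<Longrightarrow> arc_equiv n (arcs D ! p) (as ! p)"
  shows "bead_equiv n a (pulled_diagram n a g D c) (pulled_diagram n a g (D\<lparr>arcs := as\<rparr>) c)"
proof -
  have eq: "pulled_diagram n a g (D\<lparr>arcs := as\<rparr>) c =
     (pulled_diagram n a g D c)\<lparr>arcs := arcs (pulled_diagram n a g (D\<lparr>arcs := as\<rparr>) c)\<rparr>"
    by (simp add: pulled_diagram_def)
  have "list_all2 (arc_equiv n) (arcs (pulled_diagram n a g D c)) (arcs (pulled_diagram n a g (D\<lparr>arcs := as\<rparr>) c))"
  proof (rule list_all2_all_nthI)
    fix j assume "j < length (arcs (pulled_diagram n a g D c))"
    then have j: "j < a" by simp
    have "arc_equiv n (arc_copy n g D c j s) (arc_copy n g (D\<lparr>arcs := as\<rparr>) c j s)" if "s < length (g [(j, True)])" for s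
      unfolding arc_copy_eq using assms(4)[OF gr_letters[OF assms(2) j that]] by (simp add: oriented_copy_arc_equiv)
    then show "arc_equiv n (arcs (pulled_diagram n a g D c) ! j) (arcs (pulled_diagram n a g (D\<lparr>arcs := as\<rparr>) c) ! j)"
      unfolding arcs_pulled_diagram[OF j] by (intro arc_equiv_concat) (auto simp: list_all2_conv_all_nth)
  qed simp
  from arcs_equiv_bead_equiv(1)[OF pulled_diagram_diagrams[OF assms(1-3)] this] show ?thesis
    unfolding eq[symmetric] .
qed

text \<open>A change next to a leg is visible only in the copy to which this leg is attached. This
  isolates the copy for the two relations that move legs, the passing of a bead and STU.\<close>

lemma pulled_diagram_one_copy:
  assumes "J < a" "S < length (g [(J, True)])"
    "\<And>j s. j < a \<Longrightarrow> s < length (g [(j, True)]) \<Longrightarrow> (j, s) \<noteq> (J, S) \<Longrightarrow> arc_copy n g D c j s = arc_copy n g D' c' j s"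
  defines "A \<equiv> concat (map (arc_copy n g D c J) [0..<S])"
    and "B \<equiv> concat (map (arc_copy n g D c J) [Suc S..<length (g [(J, True)])])"
  shows "arcs (pulled_diagram n a g D c) ! J = A @ arc_copy n g D c J S @ B"
    "arcs (pulled_diagram n a g D' c') = (arcs (pulled_diagram n a g D c))[J := A @ arc_copy n g D' c' J S @ B]"
proof -
  let ?l = "length (g [(J, True)])"
  have split: "[0..<?l] = [0..<S] @ S # [Suc S..<?l]"
    using upt_split[of 0 S ?l] assms(2) by (simp add: upt_conv_Cons)
  show "arcs (pulled_diagram n a g D c) ! J = A @ arc_copy n g D c J S @ B"
    unfolding arcs_pulled_diagram[OF assms(1)] split by (simp add: A_def B_def)
  show "arcs (pulled_diagram n a g D' c') = (arcs (pulled_diagram n a g D c))[J := A @ arc_copy n g D' c' J S @ B]"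
  proof (rule nth_equalityI)
    fix j assume "j < length (arcs (pulled_diagram n a g D' c'))"
    then have j: "j < a" by simp
    show "arcs (pulled_diagram n a g D' c') ! j = (arcs (pulled_diagram n a g D c))[J := A @ arc_copy n g D' c' J S @ B] ! j"
    proof (cases "j = J")
      case True
      have eqs: "map (arc_copy n g D' c' J) [0..<S] = map (arc_copy n g D c J) [0..<S]"
        "map (arc_copy n g D' c' J) [Suc S..<?l] = map (arc_copy n g D c J) [Suc S..<?l]"
        using assms(1-3) by auto
      show ?thesis using True assms(1) unfolding arcs_pulled_diagram[OF j] by (simp add: split eqs A_def B_def)
    next
      case False
      then have "arc_copy n g D' c' j s = arc_copy n g D c j s" if "s < length (g [(j, True)])" for s
        using assms(3)[OF j that] by simp
      then have eqs: "map (arc_copy n g D' c' j) [0..<length (g [(j, True)])] = map (arc_copy n g D c j) [0..<length (g [(j, True)])]"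
        by (intro map_cong) simp_all
      show ?thesis using False j by (simp add: arcs_pulled_diagram eqs)
    qed
  qed simp
qed

text \<open>In a copy with its original orientation this is the same move. In a reversed copy the
  leg already precedes the bead, which is inverted; there the move is applied to the other diagram
  instead, and the beads it leaves on the edge cancel those of the original move.\<close>

lemma pulled_diagram_pass_univalent:
  assumes D: "D \<in> diagrams n b" and g: "g \<in> gr a b" and c: "c \<in> attachments a g D"
    and i: "i < length (arcs D)" "arcs D ! i = xs @ Bead w # Leg h # ys"
    and D': "D' = D\<lparr>arcs := (arcs D)[i := xs @ Leg h # Bead w # ys], edges := map (add_bead n w h) (edges D)\<rparr>" "D' \<in> diagrams n b"
  shows "bead_equiv n a (pulled_diagram n a g D c) (pulled_diagram n a g D' c)"
proof -
  interpret group "Fr n" by (rule group_Fr)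
  have w: "w \<in> carrier (Fr n)" using arc_beads_closed[OF D i(1)] i(2) by simp
  have hi: "h \<in> set (arc_legs (arcs D ! i))" using i(2) by simp
  have h: "h \<in> set (legs D)" by (rule arc_leg_in_legs[OF i(1) hi])
  obtain J S where JS: "c h = (J, S)" by (cases "c h")
  note att = attachmentsD[OF c h, unfolded JS fst_conv snd_conv]
  have pJ: "fst (g [(J, True)] ! S) = i"
    using leg_on_arc_unique[OF D _ att(3) i(1) hi] gr_letters[OF g att(1,2)] diagramsD(1)[OF D] by simp
  have D'D: "map arc_legs (arcs D') = map arc_legs (arcs D)"
    using i by (auto simp: D' map_update intro!: list_update_same_conv[THEN iffD2])
  have c': "c \<in> attachments a g D'"
    using c attachments_cong(1)[OF g diagramsD(1)[OF D'(2)] D'D] by simp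
  have pD: "pulled_diagram n a g D c \<in> diagrams n a" "pulled_diagram n a g D' c \<in> diagrams n a"
    using pulled_diagram_diagrams D g c D'(2) c' by auto
  \<comment> \<open>A copy without the leg \<open>h\<close> cannot tell the two orders of bead and
    leg apart.\<close>
  have other: "arc_copy n g D c j s = arc_copy n g D' c j s"
    if "j < a" "s < length (g [(j, True)])" "(j, s) \<noteq> (J, S)" for j s
    using that JS i by (cases "fst (g [(j, True)] ! s) = i") (auto simp: arc_copy_eq D'(1))
  define A where "A = concat (map (arc_copy n g D c J) [0..<S])"
  define B where "B = concat (map (arc_copy n g D c J) [Suc S..<length (g [(J, True)])])"
  note AB = pulled_diagram_one_copy[OF att(1,2) other, folded A_def B_def]
  let ?fx = "filter (kept c (J, S)) xs" and ?fy = "filter (kept c (J, S)) ys"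
  let ?P = "pulled_diagram n a g D c" and ?P' = "pulled_diagram n a g D' c"
  have P': "?P' = ?P\<lparr>arcs := (arcs ?P)[J := A @ arc_copy n g D' c J S @ B], edges := map (add_bead n w h) (edges D)\<rparr>"
    using AB(2) by (simp add: pulled_diagram_def D'(1))
  show ?thesis
  proof (cases "snd (g [(J, True)] ! S)")
    case True
    have cp: "arc_copy n g D c J S = ?fx @ Bead w # Leg h # ?fy" "arc_copy n g D' c J S = ?fx @ Leg h # Bead w # ?fy"
      using True pJ JS i by (simp_all add: arc_copy_eq oriented_copy_def D'(1))
    have "bead_step n ?P (?P\<lparr>arcs := (arcs ?P)[J := (A @ ?fx) @ Leg h # Bead w # (?fy @ B)], edges := map (add_bead n w h) (edges ?P)\<rparr>)"
      by (rule bead_step.pass_univalent) (use att(1) AB(1) cp in simp_all)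
    also have "\<dots> = ?P'" unfolding P' by (simp add: cp)
    finally show ?thesis by (rule bead_equiv_step[OF _ pD])
  next
    case False
    let ?rx = "rev (map (inverse_point n) ?fx)" and ?ry = "rev (map (inverse_point n) ?fy)"
    let ?w = "inv\<^bsub>Fr n\<^esub> w"
    have cp: "arc_copy n g D c J S = ?ry @ Leg h # Bead ?w # ?rx" "arc_copy n g D' c J S = ?ry @ Bead ?w # Leg h # ?rx"
      using False pJ JS i by (simp_all add: arc_copy_eq oriented_copy_def D'(1))
    let ?es = "map (add_bead n ?w h) (map (add_bead n w h) (edges D))"
    let ?Q = "?P'\<lparr>arcs := (arcs ?P')[J := (A @ ?ry) @ Leg h # Bead ?w # (?rx @ B)], edges := map (add_bead n ?w h) (edges ?P')\<rparr>"
    have st: "bead_step n ?P' ?Q"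
      by (rule bead_step.pass_univalent) (use att(1) AB cp in \<open>simp_all add: P'\<close>)
    have "(arcs ?P)[J := A @ (?ry @ Leg h # Bead ?w # ?rx) @ B] = arcs ?P"
    proof -
      have "A @ (?ry @ Leg h # Bead ?w # ?rx) @ B = arcs ?P ! J" using AB(1) cp(1) by simp
      then show ?thesis by (simp only: list_update_id)
    qed
    then have Q: "?Q = ?P\<lparr>edges := ?es\<rparr>"
      unfolding P' by (intro diagram.equality) (simp_all add: cp)
    have Qd: "?P\<lparr>edges := ?es\<rparr> \<in> diagrams n a"
      using map_add_bead_diagrams[OF map_add_bead_diagrams[OF pD(1) w], of ?w] w by simp
    have "bead_equiv n a ?P' (?P\<lparr>edges := ?es\<rparr>)"
      using bead_equiv_step[OF st pD(2)] Qd unfolding Q by blast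
    \<comment> \<open>At the end \<open>h\<close> of an edge, the bead \<open>w\<close> and its
      inverse are now adjacent and cancel.\<close>
    moreover have "bead_equiv n a ?P (?P\<lparr>edges := ?es\<rparr>)"
    proof (rule edges_same_product[OF pD(1)])
      show "list_all2 (\<lambda>(h, us, k) (h', us', k'). h' = h \<and> k' = k \<and> set us' \<subseteq> carrier (Fr n) \<and>
       bead_product n us = bead_product n us') (edges ?P) ?es"
        unfolding list_all2_map2 pulled_diagram_simps
      proof (rule list_all2_same[THEN iffD2, rule_format])
        fix e assume e: "e \<in> set (edges D)"
        obtain p us q where pq: "e = (p, us, q)" by (rule prod_cases3)
        have us: "set us \<subseteq> carrier (Fr n)" using diagramsD(9)[OF D, of p us q] e pq by simp
        obtain p1 us1 q1 where 1: "add_bead n w h (p, us, q) = (p1, us1, q1)" by (rule prod_cases3)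
        obtain p2 us2 q2 where 2: "add_bead n ?w h (p1, us1, q1) = (p2, us2, q2)" by (rule prod_cases3)
        note X = add_bead_product[OF us w 1]
        note Y = add_bead_product[OF X(3) inv_closed[OF w] 2]
        show "(\<lambda>(h, us, k) (h', us', k'). h' = h \<and> k' = k \<and> set us' \<subseteq> carrier (Fr n) \<and>
          bead_product n us = bead_product n us') e (add_bead n ?w h (add_bead n w h e))"
          unfolding pq 1 2 using X Y w us by (simp add: group_word_simps)
      qed
    qed
    ultimately show ?thesis using bead_equiv_sym bead_equiv_trans by blast
  qed
qed


lemma map_point_kept:
  assumes "\<And>h. h \<in> set (arc_legs xs) \<Longrightarrow> c' (f h) = js \<longleftrightarrow> c h = js"
  shows "filter (kept c' js) (map (map_point f) xs) = map (map_point f) (filter (kept c js) xs)"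
  using assms
proof (induction xs)
  case (Cons x xs) then show ?case by (cases x) auto
qed simp

lemma map_point_inverse: "map (inverse_point n) (map (map_point f) xs) = map (map_point f) (map (inverse_point n) xs)"
proof (induction xs)
  case (Cons x xs) then show ?case by (cases x) auto
qed simp

lemma oriented_copy_map_point: "oriented_copy n \<epsilon> (map (map_point f) xs) = map (map_point f) (oriented_copy n \<epsilon> xs)"
  using map_point_inverse[of n f xs] by (simp add: oriented_copy_def rev_map)

text \<open>Renaming the legs puts the attachments of the two diagrams in bijection. Corresponding
  terms have equal signs, and the same renaming is an isomorphism between their diagrams.\<close>

lemma pullback_isomorphism:
  fixes f :: "nat \<Rightarrow> nat"
  assumes D: "D \<in> diagrams n b" "D' \<in> diagrams n b" and g: "g \<in> gr a b"
    and f: "inj_on f (set (half_edges D))"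
    and iso: "arcs D' = map (map (map_point f)) (arcs D)"
      "set (edges D') = (\<lambda>(h, us, k). (f h, us, f k)) ` set (edges D)"
      "\<Union> (rotations ` set (trivs D')) = \<Union> (rotations ` (\<lambda>(a, b, c). (f a, f b, f c)) ` set (trivs D))"
  shows "pullback n a g D - pullback n a g D' \<in> (diagram_rel_span n a :: (_ \<Rightarrow>\<^sub>0 'k::field) set)"
proof -
  have legs': "legs D' = map f (legs D)"
    by (simp add: legs_def iso(1) comp_def map_concat)
  have inj: "inj_on f (set (legs D))" using f diagramsD(5)[OF D(1)] by (auto intro: inj_on_subset)
  define fi where "fi = inv_into (set (legs D)) f"
  have fi: "fi (f h) = h" if "h \<in> set (legs D)" for h using inj that by (simp add: fi_def)
  \<comment> \<open>Restricted to the legs, since attachments are extensional functions and the two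
    transports have to be inverse to each other on the nose.\<close>
  define to where "to c = (\<lambda>h\<in>set (legs D'). c (fi h))" for c :: "nat \<Rightarrow> nat \<times> nat"
  define from' where "from' c = (\<lambda>h\<in>set (legs D). c (f h))" for c :: "nat \<Rightarrow> nat \<times> nat"
  have len: "length (arcs D) = b" by (rule diagramsD(1)[OF D(1)])
  have arc': "arcs D' ! p = map (map_point f) (arcs D ! p)" if "p < b" for p
    using that len by (simp add: iso(1))
  have arc_leg: "h \<in> set (legs D)" if "p < b" "h \<in> set (arc_legs (arcs D ! p))" for p h
    using arc_leg_in_legs[of p D h] that len by simp
  have mem: "f h \<in> set (arc_legs (arcs D' ! p)) \<longleftrightarrow> h \<in> set (arc_legs (arcs D ! p))"
    if "p < b" "h \<in> set (legs D)" for p h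
    using that arc_leg inj by (auto simp: arc' dest: inj_onD)
  have to_att: "to c \<in> attachments a g D'" if c: "c \<in> attachments a g D" for c
    unfolding attachments_def
  proof (rule PiE_I)
    fix k assume "k \<in> set (legs D')"
    then obtain h where h: "h \<in> set (legs D)" "k = f h" by (auto simp: legs')
    have tk: "to c k = c h" using h by (simp add: to_def fi legs')
    note att = attachmentsD[OF c h(1)]
    show "to c k \<in> {(j, s). j < a \<and> s < length (g [(j, True)]) \<and> k \<in> set (arc_legs (arcs D' ! fst (g [(j, True)] ! s)))}"
      using att mem[OF gr_letters[OF g att(1,2)] h(1)] by (simp add: h(2) tk[unfolded h(2)] case_prod_beta)
  qed (auto simp: to_def)
  have from_att: "from' c \<in> attachments a g D" if c: "c \<in> attachments a g D'" for c
    unfolding attachments_def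
  proof (rule PiE_I)
    fix h assume h: "h \<in> set (legs D)"
    then have fh: "f h \<in> set (legs D')" by (simp add: legs')
    have tk: "from' c h = c (f h)" using h by (simp add: from'_def)
    note att = attachmentsD[OF c fh]
    show "from' c h \<in> {(j, s). j < a \<and> s < length (g [(j, True)]) \<and> h \<in> set (arc_legs (arcs D ! fst (g [(j, True)] ! s)))}"
      using att mem[OF gr_letters[OF g att(1,2)] h] by (simp add: tk case_prod_beta)
  qed (auto simp: from'_def)
  have ft: "from' (to c) = c" if c: "c \<in> attachments a g D" for c
  proof
    fix h show "from' (to c) h = c h"
      using PiE_arb[OF c[unfolded attachments_def], of h] by (auto simp: from'_def to_def legs' fi)
  qed
  have tf: "to (from' c) = c" if c: "c \<in> attachments a g D'" for c
  proof
    fix h show "to (from' c) h = c h"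
      using PiE_arb[OF c[unfolded attachments_def], of h] by (auto simp: from'_def to_def legs' fi)
  qed
  let ?F = "\<lambda>D c. scale ((-1) ^ card (reversed_legs g D c)) (gen (pulled_diagram n a g D c)) :: _ \<Rightarrow>\<^sub>0 'k"
  have "pullback n a g D' = (\<Sum>c\<in>attachments a g D. ?F D' (to c))"
    unfolding pullback_def
    by (rule sum.reindex_bij_witness[of _ to from']) (use to_att from_att ft tf in auto)
  then have "pullback n a g D - pullback n a g D' = (\<Sum>c\<in>attachments a g D. ?F D c - ?F D' (to c))"
    by (simp add: pullback_def sum_subtractf)
  also have "\<dots> \<in> diagram_rel_span n a"
  proof (rule lin_sub_sum[OF lin_sub_diagram_rel_span])
    fix c assume c: "c \<in> attachments a g D"
    have tc: "to c (f h) = c h" if "h \<in> set (legs D)" for h using that by (simp add: to_def fi legs')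
    have "reversed_legs g D' (to c) = f ` reversed_legs g D c"
      by (auto simp: reversed_legs_def legs' tc)
    moreover have "inj_on f (reversed_legs g D c)" by (rule inj_on_subset[OF inj]) (auto simp: reversed_legs_def)
    ultimately have card: "card (reversed_legs g D' (to c)) = card (reversed_legs g D c)" by (simp add: card_image)
    have copy: "arc_copy n g D' (to c) j s = map (map_point f) (arc_copy n g D c j s)"
      if "j < a" "s < length (g [(j, True)])" for j s
    proof -
      let ?p = "fst (g [(j, True)] ! s)"
      have p: "?p < b" by (rule gr_letters[OF g that])
      have "filter (kept (to c) (j, s)) (arcs D' ! ?p) = map (map_point f) (filter (kept c (j, s)) (arcs D ! ?p))"
        unfolding arc'[OF p] by (rule map_point_kept) (use tc arc_leg[OF p] in simp)
      then show ?thesis by (simp add: arc_copy_eq oriented_copy_map_point)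
    qed
    have arcs: "arcs (pulled_diagram n a g D' (to c)) = map (map (map_point f)) (arcs (pulled_diagram n a g D c))"
    proof (rule nth_equalityI)
      fix j assume "j < length (arcs (pulled_diagram n a g D' (to c)))"
      then have j: "j < a" by simp
      have eqs: "map (arc_copy n g D' (to c) j) [0..<length (g [(j, True)])] =
          map (\<lambda>s. map (map_point f) (arc_copy n g D c j s)) [0..<length (g [(j, True)])]"
        using copy[OF j] by (intro map_cong) simp_all
      show "arcs (pulled_diagram n a g D' (to c)) ! j = map (map (map_point f)) (arcs (pulled_diagram n a g D c)) ! j"
        using j by (simp add: arcs_pulled_diagram map_concat comp_def eqs)
    qed simp
    have "bead_step n (pulled_diagram n a g D c) (pulled_diagram n a g D' (to c))"
      by (rule bead_step.isomorphism[of f]) (use f iso(2,3) arcs in simp_all)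
    then have be: "bead_equiv n a (pulled_diagram n a g D c) (pulled_diagram n a g D' (to c))"
      by (rule bead_equiv_step) (use pulled_diagram_diagrams D g c to_att[OF c] in blast)+
    have "?F D c - ?F D' (to c) = scale ((-1) ^ card (reversed_legs g D c))
        (gen (pulled_diagram n a g D c) - gen (pulled_diagram n a g D' (to c)))"
      by (simp add: card scale_diff)
    also have "\<dots> \<in> diagram_rel_span n a"
      by (intro lin_subD(3)[OF lin_sub_diagram_rel_span] bead_equiv_rel_span be pulled_diagram_diagrams[OF D(1) g c]
          pulled_diagram_diagrams[OF D(2) g to_att[OF c]])
    finally show "?F D c - ?F D' (to c) \<in> diagram_rel_span n a" .
  qed
  finally show ?thesis .
qed

text \<open>A pullback leaves edges and trivalent vertices alone, so moves there carry over to each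
  summand. Merges and units on an arc take place in all its copies. Only renaming and the passing of
  a leg interact with the attachments.\<close>

lemma pullback_bead_step:
  assumes st: "bead_step n D D'" and D: "D \<in> diagrams n b" "D' \<in> diagrams n b" and g: "g \<in> gr a b"
  shows "pullback n a g D - pullback n a g D' \<in> (diagram_rel_span n a :: (_ \<Rightarrow>\<^sub>0 'k::field) set)"
proof -
  have len: "length (arcs D) = b" by (rule diagramsD(1)[OF D(1)])
  \<comment> \<open>The rule must apply to every diagram with these edges and vertices, because the
    summands differ from \<open>D\<close> in their arcs.\<close>
  have by_edges: ?thesis
    if D': "D' = D\<lparr>edges := es\<rparr>" and "\<And>P :: diagram. edges P = edges D \<Longrightarrow> trivs P = trivs D \<Longrightarrow> bead_step n P (P\<lparr>edges := es\<rparr>)" for es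
  proof (rule pullback_diff_rel_span[OF D g])
    fix c assume c: "c \<in> attachments a g D"
    have "attachments a g D' = attachments a g D"
      by (rule attachments_cong(1)[OF g diagramsD(1)[OF D(2)]]) (simp add: D')
    with c have c': "c \<in> attachments a g D'" by simp
    have "bead_step n (pulled_diagram n a g D c) (pulled_diagram n a g D' c)"
      unfolding D' pulled_diagram_update by (rule that(2)) simp_all
    then show "bead_equiv n a (pulled_diagram n a g D c) (pulled_diagram n a g D' c)"
      by (rule bead_equiv_step) (use pulled_diagram_diagrams D g c c' in blast)+
  qed (simp add: D')
  have by_arcs: ?thesis
    if D': "D' = D\<lparr>arcs := (arcs D)[i := ys]\<rparr>" and i: "i < length (arcs D)" and eq: "arc_step n (arcs D ! i) ys" for i ys
  proof (rule pullback_diff_rel_span[OF D g])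
    show "map arc_legs (arcs D) = map arc_legs (arcs D')"
      using arc_step_invariants(1)[OF eq] i
      by (auto simp: D' map_update intro!: list_update_same_conv[THEN iffD2, symmetric])
    fix c assume c: "c \<in> attachments a g D"
    have "arc_equiv n (arcs D ! p) ((arcs D)[i := ys] ! p)" if "p < b" for p
      using that i arc_equiv_step[OF eq] by (cases "p = i") auto
    then show "bead_equiv n a (pulled_diagram n a g D c) (pulled_diagram n a g D' c)"
      unfolding D' by (rule pulled_diagram_arcs_equiv[OF D(1) g c])
  qed
  from st show ?thesis
  proof cases
    case (isomorphism f)
    then show ?thesis by (intro pullback_isomorphism[OF D g])
  next
    case (arc_merge i xs u v ys)
    have "u \<in> carrier (Fr n)" "v \<in> carrier (Fr n)"
      using arc_beads_closed[OF D(1) arc_merge(2)] arc_merge(3) by auto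
    from arc_step.merge[OF this, of xs ys] show ?thesis
      by (intro by_arcs[OF arc_merge(1,2)]) (simp add: arc_merge(3))
  next
    case (edge_merge j h us u v vs k)
    show ?thesis
      by (rule by_edges[OF edge_merge(1)]) (metis bead_step.edge_merge edge_merge(2,3))
  next
    case (arc_unit i xs ys)
    from arc_step.unit[of n xs ys] show ?thesis
      by (intro by_arcs[OF arc_unit(1,2)]) (simp add: arc_unit(3))
  next
    case (edge_unit j h us vs k)
    show ?thesis
      by (rule by_edges[OF edge_unit(1)]) (metis bead_step.edge_unit edge_unit(2,3))
  next
    case (edge_reverse j h w k)
    show ?thesis
      by (rule by_edges[OF edge_reverse(1)]) (metis bead_step.edge_reverse edge_reverse(2,3))
  next
    case (pass_univalent i xs w h ys)
    show ?thesis
    proof (rule pullback_diff_rel_span[OF D g])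
      show "map arc_legs (arcs D) = map arc_legs (arcs D')"
        using pass_univalent(2,3)
        by (auto simp: pass_univalent(1) map_update intro!: list_update_same_conv[THEN iffD2, symmetric])
      show "bead_equiv n a (pulled_diagram n a g D c) (pulled_diagram n a g D' c)" if "c \<in> attachments a g D" for c
        by (rule pulled_diagram_pass_univalent[OF D(1) g that pass_univalent(2,3,1) D(2)])
    qed
  next
    case (pass_trivalent j h us w p v q r)
    show ?thesis
    proof (rule by_edges[OF pass_trivalent(1)])
      fix P :: diagram assume P: "edges P = edges D" "trivs P = trivs D"
      show "bead_step n P (P\<lparr>edges := map (add_bead n w r) (map (add_bead n w q) ((edges D)[j := (h, us, p)]))\<rparr>)"
        unfolding P(1)[symmetric]
        by (rule bead_step.pass_trivalent[OF _ _ _ pass_trivalent(5)]) (use pass_trivalent(2-4) P in simp_all)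
    qed
  qed
qed

lemma pullback_bead_equiv:
  assumes "bead_equiv n b D D'" and g: "g \<in> gr a b"
  shows "pullback n a g D - pullback n a g D' \<in> (diagram_rel_span n a :: (_ \<Rightarrow>\<^sub>0 'k::field) set)"
  using assms(1) unfolding bead_equiv_def
proof (induction rule: equivclp_induct)
  case base
  show ?case by (simp add: lin_subD(1)[OF lin_sub_diagram_rel_span])
next
  case (step y z)
  let ?R = "diagram_rel_span n a :: (_ \<Rightarrow>\<^sub>0 'k) set"
  have "pullback n a g y - pullback n a g z \<in> ?R"
    using step(2)
  proof
    assume "z \<in> diagrams n b \<and> y \<in> diagrams n b \<and> bead_step n z y"
    then have "pullback n a g z - pullback n a g y \<in> ?R" using pullback_bead_step[OF _ _ _ g] by blast
    from lin_subD(4)[OF lin_sub_diagram_rel_span this] show ?thesis by simp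
  qed (use pullback_bead_step[OF _ _ _ g] in blast)
  from lin_subD(2)[OF lin_sub_diagram_rel_span step.IH this] show ?case by simp
qed


subsection \<open>Compatibility with the STU relation\<close>

text \<open>The new legs \<open>p\<close> and \<open>q\<close> are attached independently, while
  \<open>h\<close> is attached once. If \<open>p\<close> and \<open>q\<close> go to different
  copies, their order on the old arc is forgotten, and the terms of the two attached diagrams
  cancel. The remaining terms correspond to attachments of \<open>D\<close> and yield an STU
  relation in the copy. In a reversed copy the two terms are exchanged, and a second reversed leg
  supplies the compensating sign.\<close>

lemma pullback_stu:
  assumes D: "D \<in> diagrams n m" "attach i e v xs p q ys D \<in> diagrams n m" "attach i e v xs q p ys D \<in> diagrams n m"
    and i: "i < m" "arcs D ! i = xs @ Leg h # ys"
    and e: "e \<in> set (edges D)" "e \<in> {(h, [], k), (k, [], h)}"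
    and v: "v \<in> set (trivs D)" "(k, q, p) \<in> rotations v"
    and g: "g \<in> gr a m"
  shows "pullback n a g D - (pullback n a g (attach i e v xs p q ys D) - pullback n a g (attach i e v xs q p ys D))
     \<in> (diagram_rel_span n a :: (_ \<Rightarrow>\<^sub>0 'k::field) set)"
proof -
  let ?A = "attach i e v xs p q ys D" and ?B = "attach i e v xs q p ys D"
  let ?R = "diagram_rel_span n a :: (_ \<Rightarrow>\<^sub>0 'k) set"
  let ?F = "\<lambda>D c. scale ((-1) ^ card (reversed_legs g D c)) (gen (pulled_diagram n a g D c)) :: _ \<Rightarrow>\<^sub>0 'k"
  have len: "length (arcs D) = m" by (rule diagramsD(1)[OF D(1)])
  have il: "i < length (arcs D)" using i len by simp
  obtain L1 L2 where L: "\<And>zs. legs (D\<lparr>arcs := (arcs D)[i := zs]\<rparr>) = L1 @ arc_legs zs @ L2"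
    "legs D = L1 @ arc_legs (arcs D ! i) @ L2" using legs_arc_update[OF il] by blast
  have lA: "legs (attach i e v xs r s ys D) = L1 @ arc_legs xs @ r # s # arc_legs ys @ L2" for r s
    using L(1)[of "xs @ Leg r # Leg s # ys"] by (simp add: legs_def attach_def)
  have lD: "legs D = L1 @ arc_legs xs @ h # arc_legs ys @ L2" using L(2) i(2) by simp
  have hD: "h \<in> set (legs D)" using lD by simp
  have dist: "k \<noteq> q \<and> q \<noteq> p \<and> k \<noteq> p" by (rule rotations_distinct[OF D(1) v])
  have nleg: "p \<notin> set (legs D)" "q \<notin> set (legs D)"
    using diagramsD(6)[OF D(1)] v(1) rotations_corners[OF v(2)] by auto
  then have hpq: "h \<noteq> p" "h \<noteq> q" using hD by auto
  have hA: "h \<notin> set (legs ?A)"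
    using diagramsD(3)[OF D(1)] lD lA[of p q] hpq by auto
  have sA: "set (legs ?A) = insert p (insert q (set (legs D) - {h}))" "set (legs ?B) = set (legs ?A)"
    using lD lA diagramsD(3)[OF D(1)] hpq by auto
  have arcA: "arcs (attach i e v xs r s ys D) ! l = (if l = i then xs @ Leg r # Leg s # ys else arcs D ! l)" if "l < m" for l r s
    using that len by (simp add: attach_simps)
  have attB: "attachments a g ?B = attachments a g ?A"
  proof -
    have "set (arc_legs (arcs ?A ! fst (g [(j, True)] ! s))) = set (arc_legs (arcs ?B ! fst (g [(j, True)] ! s)))"
      if "j < a" "s < length (g [(j, True)])" for j s
      using gr_letters[OF g that] by (auto simp: arcA)
    then have "{(j, s). j < a \<and> s < length (g [(j, True)]) \<and> x \<in> set (arc_legs (arcs ?A ! fst (g [(j, True)] ! s)))} =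
      {(j, s). j < a \<and> s < length (g [(j, True)]) \<and> x \<in> set (arc_legs (arcs ?B ! fst (g [(j, True)] ! s)))}" for x
      by auto
    then show ?thesis unfolding attachments_def sA by simp
  qed
  have revB: "reversed_legs g ?B c = reversed_legs g ?A c" for c
    unfolding reversed_legs_def sA(2) ..
  \<comment> \<open>Both new legs go where \<open>h\<close> went. The value at \<open>h\<close> is
    reset to \<open>undefined\<close>, since \<open>h\<close> is no longer a leg and attachments are
    extensional.\<close>
  have to_A: "c(p := c h, q := c h, h := undefined) \<in> attachments a g ?A" if c: "c \<in> attachments a g D" for c
    unfolding attachments_def
  proof (rule PiE_I)
    fix x assume x: "x \<in> set (legs ?A)"
    then have xh: "x \<noteq> h" using hA by auto
    let ?y = "if x = p \<or> x = q then h else x"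
    have y: "?y \<in> set (legs D)" using x sA hD by auto
    note att = attachmentsD[OF c y]
    have "x \<in> set (arc_legs (arcs ?A ! fst (g [(fst (c ?y), True)] ! snd (c ?y))))"
    proof (cases "x = p \<or> x = q")
      case True
      have "fst (g [(fst (c h), True)] ! snd (c h)) = i"
        using leg_on_arc_unique[OF D(1) _ _ il, of "fst (g [(fst (c h), True)] ! snd (c h))" h] att(3) True
          gr_letters[OF g att(1,2)] len i(2) by simp
      then show ?thesis using True il by (auto simp: attach_simps)
    next
      case False
      then show ?thesis
        using att(3) arcA[OF gr_letters[OF g att(1,2)], of p q] xh i by auto
    qed
    then show "(c(p := c h, q := c h, h := undefined)) x \<in>
       {(j, s). j < a \<and> s < length (g [(j, True)]) \<and> x \<in> set (arc_legs (arcs ?A ! fst (g [(j, True)] ! s)))}"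
      using att(1,2) xh by (auto simp: case_prod_beta)
  next
    fix x assume x: "x \<notin> set (legs ?A)"
    then show "(c(p := c h, q := c h, h := undefined)) x = undefined"
      using PiE_arb[OF c[unfolded attachments_def], of x] sA by auto
  qed
  \<comment> \<open>The attachments which put both new legs on one copy; all others drop out of the
    difference.\<close>
  define T0 where "T0 = {c \<in> attachments a g ?A. c p = c q}"
  have diff0: "?F ?A c = ?F ?B c" if "c \<in> attachments a g ?A - T0" for c
  proof -
    have ne: "c p \<noteq> c q" using that by (simp add: T0_def)
    have "arc_copy n g ?A c j s = arc_copy n g ?B c j s" if "j < a" "s < length (g [(j, True)])" for j s
      using gr_letters[OF g that] ne by (auto simp: arc_copy_eq arcA)
    then have "map (\<lambda>j. concat (map (arc_copy n g ?A c j) [0..<length (g [(j, True)])])) [0..<a] =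
      map (\<lambda>j. concat (map (arc_copy n g ?B c j) [0..<length (g [(j, True)])])) [0..<a]"
      by (intro map_cong arg_cong[of _ _ concat]) simp_all
    then have "pulled_diagram n a g ?A c = pulled_diagram n a g ?B c"
      by (simp add: pulled_diagram_def attach_def)
    then show ?thesis by (simp add: revB)
  qed
  have "pullback n a g ?A - pullback n a g ?B = (\<Sum>c\<in>attachments a g ?A. ?F ?A c - ?F ?B c)"
    unfolding pullback_def attB by (simp add: sum_subtractf)
  also have "\<dots> = (\<Sum>c\<in>T0. ?F ?A c - ?F ?B c)"
    by (rule sum.mono_neutral_right) (use finite_attachments diff0 in \<open>auto simp: T0_def\<close>)
  also have "\<dots> = (\<Sum>c\<in>attachments a g D. ?F ?A (c(p := c h, q := c h, h := undefined)) - ?F ?B (c(p := c h, q := c h, h := undefined)))"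
  proof (rule sum.reindex_bij_witness[of _ "\<lambda>c. c(p := c h, q := c h, h := undefined)" "\<lambda>c. c(h := c p, p := undefined, q := undefined)"])
    fix c assume c: "c \<in> T0"
    then have cA: "c \<in> attachments a g ?A" and cpq: "c p = c q" by (auto simp: T0_def)
    have und: "c h = undefined" using PiE_arb[OF cA[unfolded attachments_def] hA] .
    show cc: "(c(h := c p, p := undefined, q := undefined))
      (p := (c(h := c p, p := undefined, q := undefined)) h, q := (c(h := c p, p := undefined, q := undefined)) h, h := undefined) = c"
      using und cpq hpq dist by (intro ext) auto
    show "c(h := c p, p := undefined, q := undefined) \<in> attachments a g D"
      unfolding attachments_def
    proof (rule PiE_I)
      fix x assume x: "x \<in> set (legs D)"
      then have xpq: "x \<noteq> p" "x \<noteq> q" using nleg by auto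
      let ?y = "if x = h then p else x"
      have y: "?y \<in> set (legs ?A)" using x sA by auto
      note att = attachmentsD[OF cA y]
      have "x \<in> set (arc_legs (arcs D ! fst (g [(fst (c ?y), True)] ! snd (c ?y))))"
      proof (cases "x = h")
        case True
        have "fst (g [(fst (c p), True)] ! snd (c p)) = i"
          using att(3) arcA[OF gr_letters[OF g att(1,2)], of p q] True nleg(1)
            arc_leg_in_legs[of "fst (g [(fst (c p), True)] ! snd (c p))" D p] gr_letters[OF g att(1,2)] len
          by (auto split: if_splits)
        then show ?thesis using True i by simp
      next
        case False
        then show ?thesis
          using att(3) arcA[OF gr_letters[OF g att(1,2)], of p q] xpq i by (auto split: if_splits)
      qed
      then show "(c(h := c p, p := undefined, q := undefined)) x \<in>
         {(j, s). j < a \<and> s < length (g [(j, True)]) \<and> x \<in> set (arc_legs (arcs D ! fst (g [(j, True)] ! s)))}"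
        using att(1,2) xpq by (auto simp: case_prod_beta)
    next
      fix x assume x: "x \<notin> set (legs D)"
      then show "(c(h := c p, p := undefined, q := undefined)) x = undefined"
        using PiE_arb[OF cA[unfolded attachments_def], of x] sA hD by auto
    qed
    show "?F ?A ((c(h := c p, p := undefined, q := undefined))
      (p := (c(h := c p, p := undefined, q := undefined)) h, q := (c(h := c p, p := undefined, q := undefined)) h, h := undefined)) -
      ?F ?B ((c(h := c p, p := undefined, q := undefined))
      (p := (c(h := c p, p := undefined, q := undefined)) h, q := (c(h := c p, p := undefined, q := undefined)) h, h := undefined)) =
      ?F ?A c - ?F ?B c" unfolding cc ..
  next
    fix c assume c: "c \<in> attachments a g D"
    have und: "c p = undefined" "c q = undefined" using PiE_arb[OF c[unfolded attachments_def]] nleg by blast+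
    show "(c(p := c h, q := c h, h := undefined))
      (h := (c(p := c h, q := c h, h := undefined)) p, p := undefined, q := undefined) = c"
      using und hpq dist by (intro ext) auto
    show "c(p := c h, q := c h, h := undefined) \<in> T0" using to_A[OF c] hpq dist by (simp add: T0_def)
  qed
  finally have "pullback n a g D - (pullback n a g ?A - pullback n a g ?B) =
    (\<Sum>c\<in>attachments a g D. ?F D c - (?F ?A (c(p := c h, q := c h, h := undefined)) - ?F ?B (c(p := c h, q := c h, h := undefined))))"
    by (simp add: pullback_def sum_subtractf)
  also have "\<dots> \<in> ?R"
  proof (rule lin_sub_sum[OF lin_sub_diagram_rel_span])
    fix c assume c: "c \<in> attachments a g D"
    obtain J S where JS: "c h = (J, S)" by (cases "c h")
    define c' where "c' = c(p := c h, q := c h, h := undefined)"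
    have c': "c' p = (J, S)" "c' q = (J, S)" "x \<notin> {p, q, h} \<Longrightarrow> c' x = c x" for x
      using JS hpq dist by (auto simp: c'_def)
    have c'_pq: "c' r = (J, S) \<and> c' t = (J, S)" if "{r, t} = {p, q}" for r t
      using that c' by (auto simp: doubleton_eq_iff)
    note att = attachmentsD[OF c hD, unfolded JS fst_conv snd_conv]
    have pJ: "fst (g [(J, True)] ! S) = i"
      using leg_on_arc_unique[OF D(1) _ att(3) il] i(2) gr_letters[OF g att(1,2)] len by simp
    have cA: "c' \<in> attachments a g ?A" unfolding c'_def by (rule to_A[OF c])
    have cB: "c' \<in> attachments a g ?B" using cA attB by simp
    have nx: "h \<notin> set (arc_legs xs)" "h \<notin> set (arc_legs ys)"
      using diagramsD(3)[OF D(1)] lD by auto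
    have npq: "p \<notin> set (arc_legs (arcs D ! l))" "q \<notin> set (arc_legs (arcs D ! l))" if "l < m" for l
      using nleg arc_leg_in_legs[of l D] that len by auto
    have kept_eq: "filter (kept c' js) zs = filter (kept c js) zs"
      if "h \<notin> set (arc_legs zs)" "p \<notin> set (arc_legs zs)" "q \<notin> set (arc_legs zs)" for zs js
      using that
    proof (induction zs)
      case (Cons z zs)
      show ?case
      proof (cases z)
        case (Leg x)
        have "c' x = c x" using c'(3)[of x] Cons.prems Leg by auto
        then show ?thesis using Cons Leg by simp
      qed (use Cons in simp)
    qed simp
    have pxy: "p \<notin> set (arc_legs xs)" "p \<notin> set (arc_legs ys)" "q \<notin> set (arc_legs xs)" "q \<notin> set (arc_legs ys)"
      using npq[OF i(1)] i(2) by auto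
    let ?fx = "filter (kept c (J, S)) xs" and ?fy = "filter (kept c (J, S)) ys"
    have other: "arc_copy n g D c j s = arc_copy n g (attach i e v xs r t ys D) c' j s"
      if rt: "{r, t} = {p, q}" and js: "j < a" "s < length (g [(j, True)])" "(j, s) \<noteq> (J, S)" for j s r t
    proof -
      let ?p = "fst (g [(j, True)] ! s)"
      have pm: "?p < m" by (rule gr_letters[OF g js(1,2)])
      have "filter (kept c (j, s)) (arcs D ! ?p) = filter (kept c' (j, s)) (arcs (attach i e v xs r t ys D) ! ?p)"
      proof (cases "?p = i")
        case True
        have "c' r = (J, S)" "c' t = (J, S)" using c'_pq[OF rt] by auto
        then show ?thesis
          using True js(3) JS kept_eq[OF nx(1) pxy(1,3)] kept_eq[OF nx(2) pxy(2,4)] i by (auto simp: arcA)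
      next
        case False
        have "h \<notin> set (arc_legs (arcs D ! ?p))"
          using leg_on_arc_unique[OF D(1) _ _ il, of ?p h] False pm len i(2) by auto
        then show ?thesis using False kept_eq npq[OF pm] pm by (simp add: arcA)
      qed
      then show ?thesis by (simp add: arc_copy_eq)
    qed
    have kA: "filter (kept c (J, S)) (arcs D ! i) = ?fx @ Leg h # ?fy"
      using JS i by simp
    have kB: "filter (kept c' (J, S)) (arcs (attach i e v xs r t ys D) ! i) = ?fx @ Leg r # Leg t # ?fy"
      if rt: "{r, t} = {p, q}" for r t
    proof -
      have "c' r = (J, S)" "c' t = (J, S)" using c'_pq[OF rt] by auto
      then show ?thesis using kept_eq[OF nx(1) pxy(1,3)] kept_eq[OF nx(2) pxy(2,4)] i by (simp add: arcA)
    qed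
    let ?P = "pulled_diagram n a g D c"
    have Pd: "?P \<in> diagrams n a" by (rule pulled_diagram_diagrams[OF D(1) g c])
    have Ad: "pulled_diagram n a g ?A c' \<in> diagrams n a" by (rule pulled_diagram_diagrams[OF D(2) g cA])
    have Bd: "pulled_diagram n a g ?B c' \<in> diagrams n a" by (rule pulled_diagram_diagrams[OF D(3) g cB])
    let ?\<epsilon> = "snd (g [(J, True)] ! S)"
    \<comment> \<open>\<open>U\<close> precedes and \<open>V\<close> follows the leg in its copy,
      with respect to the orientation of the new arc.\<close>
    define U where "U = (if ?\<epsilon> then ?fx else rev (map (inverse_point n) ?fy))"
    define V where "V = (if ?\<epsilon> then ?fy else rev (map (inverse_point n) ?fx))"
    have copyD: "arc_copy n g D c J S = U @ Leg h # V"
      using pJ kA by (simp add: arc_copy_eq oriented_copy_def U_def V_def)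
    have copyA: "arc_copy n g (attach i e v xs r t ys D) c' J S = (if ?\<epsilon> then U @ Leg r # Leg t # V else U @ Leg t # Leg r # V)"
      if "{r, t} = {p, q}" for r t
      using pJ kB[OF that] by (simp add: arc_copy_eq oriented_copy_def U_def V_def)
    define A where "A = concat (map (arc_copy n g D c J) [0..<S])"
    define B where "B = concat (map (arc_copy n g D c J) [Suc S..<length (g [(J, True)])])"
    have AB: "arcs ?P ! J = A @ arc_copy n g D c J S @ B"
      "arcs (pulled_diagram n a g (attach i e v xs r t ys D) c') =
         (arcs ?P)[J := A @ arc_copy n g (attach i e v xs r t ys D) c' J S @ B]"
      if "{r, t} = {p, q}" for r t
      using pulled_diagram_one_copy[OF att(1,2) other[OF that], folded A_def B_def] by auto
    let ?at = "\<lambda>r t. attach J e v (A @ U) r t (V @ B) ?P"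
    have pulled: "pulled_diagram n a g (attach i e v xs r t ys D) c' = (if ?\<epsilon> then ?at r t else ?at t r)"
      if rt: "{r, t} = {p, q}" for r t
      by (rule diagram.equality) (simp_all add: attach_simps AB(2)[OF rt] copyA[OF rt])
    have qp: "{q, p} = {p, q}" by auto
    have atd: "?at p q \<in> diagrams n a" "?at q p \<in> diagrams n a"
      using Ad Bd pulled[of p q] pulled[OF qp] by (auto split: if_splits)
    have arcJ: "arcs ?P ! J = (A @ U) @ Leg h # (V @ B)" using AB(1)[of p q] copyD by simp
    have "gen ?P - (gen (?at p q) - gen (?at q p)) \<in> (stu_rels n a :: (_ \<Rightarrow>\<^sub>0 'k) set)"
      unfolding stu_rels_def
      by (rule CollectI, rule exI[of _ ?P], rule exI[of _ J], rule exI[of _ e], rule exI[of _ v], rule exI[of _ "A @ U"],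
          rule exI[of _ "V @ B"], rule exI[of _ h], rule exI[of _ k], rule exI[of _ p], rule exI[of _ q], intro conjI)
        (use Pd att(1) e v atd arcJ in simp_all)
    then have stu: "gen ?P - (gen (?at p q) - gen (?at q p)) \<in> ?R"
      by (intro rel_span(2)[OF diagram_rels_carrier]) (simp add: diagram_rels_def)
    \<comment> \<open>In a reversed copy one reversed leg is replaced by two. This changes the sign,
      just as the reversal exchanges the two attached diagrams.\<close>
    have rA: "reversed_legs g ?A c' = (reversed_legs g D c - {h}) \<union> (if ?\<epsilon> then {} else {p, q})"
    proof -
      define rv where "rv y \<longleftrightarrow> (case y of (j, s) \<Rightarrow> \<not> snd (g [(j, True)] ! s))" for y
      have rl: "reversed_legs g E d = {x \<in> set (legs E). rv (d x)}" for E d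
        by (simp add: reversed_legs_def rv_def)
      have "rv (J, S) \<longleftrightarrow> \<not> ?\<epsilon>" by (simp add: rv_def)
      moreover have "c' x = c x" if "x \<in> set (legs D)" "x \<noteq> h" for x using c'(3)[of x] that nleg by auto
      ultimately show ?thesis using nleg hpq c'(1,2) unfolding rl sA(1) by (auto split: if_splits)
    qed
    have hR: "h \<in> reversed_legs g D c \<longleftrightarrow> \<not> ?\<epsilon>" using JS hD by (simp add: reversed_legs_def)
    have fin: "finite (reversed_legs g D c)" by (simp add: reversed_legs_def)
    have pR: "p \<notin> reversed_legs g D c" "q \<notin> reversed_legs g D c" using nleg by (auto simp: reversed_legs_def)
    have card: "card (reversed_legs g ?A c') = (if ?\<epsilon> then card (reversed_legs g D c) else Suc (card (reversed_legs g D c)))"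
    proof (cases ?\<epsilon>)
      case False
      have "card (reversed_legs g D c) = Suc (card (reversed_legs g D c - {h}))"
        by (rule card.remove[OF fin]) (use hR False in blast)
      moreover have "card ((reversed_legs g D c - {h}) \<union> {p, q}) = card (reversed_legs g D c - {h}) + 2"
        using fin pR dist by (simp add: card_Un_disjoint)
      ultimately show ?thesis using False rA by simp
    qed (use rA hR in simp)
    have "?F D c - (?F ?A c' - ?F ?B c') \<in> ?R"
    proof (cases ?\<epsilon>)
      case True
      have "?F D c - (?F ?A c' - ?F ?B c') = scale ((-1) ^ card (reversed_legs g D c)) (gen ?P - (gen (?at p q) - gen (?at q p)))"
        using True pulled[of p q] pulled[OF qp] card by (simp add: revB scale_diff)
      then show ?thesis using lin_subD(3)[OF lin_sub_diagram_rel_span stu] by simp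
    next
      case False
      have "?F D c - (?F ?A c' - ?F ?B c') = scale ((-1) ^ card (reversed_legs g D c)) (gen ?P - (gen (?at p q) - gen (?at q p)))"
        using False pulled[of p q] pulled[OF qp] card by (simp add: revB scale_diff)
      then show ?thesis using lin_subD(3)[OF lin_sub_diagram_rel_span stu] by simp
    qed
    then show "?F D c - (?F ?A (c(p := c h, q := c h, h := undefined)) - ?F ?B (c(p := c h, q := c h, h := undefined))) \<in> ?R"
      unfolding c'_def .
  qed
  finally show ?thesis .
qed


lemma lin_ext_pullback_rels:
  assumes "r \<in> diagram_rels n b" and g: "g \<in> gr a b"
  shows "lin_ext (pullback n a g) r \<in> (diagram_rel_span n a :: (_ \<Rightarrow>\<^sub>0 'k::field) set)"
proof -
  have "r \<in> {gen D - gen D' | D D'. D \<in> diagrams n b \<and> D' \<in> diagrams n b \<and> bead_equiv n b D D'} \<union> stu_rels n b"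
    using assms(1) unfolding diagram_rels_def .
  then show ?thesis
  proof
  assume "r \<in> {gen D - gen D' | D D'. D \<in> diagrams n b \<and> D' \<in> diagrams n b \<and> bead_equiv n b D D'}"
  then obtain D D' where r: "r = gen D - gen D'" "bead_equiv n b D D'" by (elim CollectE exE conjE)
  show ?thesis using pullback_bead_equiv[OF r(2) g] by (simp add: r(1) lin_ext_simps)
next
  assume "r \<in> stu_rels n b"
  then obtain D i e v xs ys h k p q where *: "r = gen D - (gen (attach i e v xs p q ys D) - gen (attach i e v xs q p ys D))"
    "{D, attach i e v xs p q ys D, attach i e v xs q p ys D} \<subseteq> diagrams n b"
    "i < b" "arcs D ! i = xs @ Leg h # ys" "e \<in> set (edges D)" "e \<in> {(h, [], k), (k, [], h)}"
    "v \<in> set (trivs D)" "(k, q, p) \<in> rotations v" unfolding stu_rels_def by (elim CollectE exE conjE)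
  then show ?thesis using pullback_stu[of D n b i e v xs p q ys h k g a, where 'k='k] g
    by (simp add: lin_ext_simps)
  qed
qed

section \<open>The quotient spaces and their pullback maps\<close>

abbreviation diagram_cls :: "nat \<Rightarrow> nat \<Rightarrow> (diagram \<Rightarrow>\<^sub>0 'k::field) \<Rightarrow> (diagram \<Rightarrow>\<^sub>0 'k) set" where
  "diagram_cls n m \<equiv> cls (diagram_rel_span n m)"

lemma diagram_class_eq: "diagram_class n m D = diagram_cls n m (gen D)"
  by (simp add: diagram_class_def)

lemmas A_vs_simps = presented_simps[OF diagram_rels_carrier, folded A_vs_def]

lemma module_A_vs: "module KK (A_vs n m)"
  unfolding A_vs_def by (rule module_presented[OF diagram_rels_carrier])

lemma A_map_cls: "g \<in> gr a b \<Longrightarrow> A_map n a b g (diagram_cls n b x) = diagram_cls n a (lin_ext (pullback n a g) x)"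
  unfolding A_map_def by (rule presented_map_cls[OF diagram_rels_carrier diagram_rels_carrier lin_ext_pullback_rels])

lemma A_map_linear: "g \<in> gr a b \<Longrightarrow> A_map n a b g \<in> linear_maps (A_vs n b :: ('k::field, _) module) (A_vs n a)"
  unfolding A_map_def A_vs_def
  by (rule presented_map_linear[OF diagram_rels_carrier diagram_rels_carrier lin_ext_pullback_rels keys_pullback])

section \<open>Chords as a basis in degree one\<close>

definition degree_one_trivial :: "nat \<Rightarrow> nat \<Rightarrow> diagram set" where
  "degree_one_trivial n m = {D \<in> diagrams n m. has_degree 1 D \<and> homotopy_trivial n D}"

text \<open>There are two vertices in all. They cannot both be trivalent, because every component of
  a diagram has a leg.\<close>

lemma degree_one_cases:
  assumes "D \<in> diagrams n m" "has_degree 1 D"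
  shows "is_chord D \<or> is_lollipop D"
proof -
  have "legs D \<noteq> []" if ne: "trivs D \<noteq> []"
  proof -
    obtain t where t: "t \<in> set (trivs D)" using ne by (cases "trivs D") auto
    obtain a b c where "t = (a, b, c)" by (rule prod_cases3)
    then have "a \<in> set (half_edges D)" using t diagramsD(5)[OF assms(1)] by force
    then obtain l where "l \<in> set (legs D)" using assms(1) unfolding diagrams_def by blast
    then show ?thesis by auto
  qed
  note ne = this
  show ?thesis
  proof (cases "trivs D = []")
    case True
    then show ?thesis using assms(2) by (simp add: has_degree_def is_chord_def)
  next
    case False
    then have "length (legs D) > 0" "length (trivs D) > 0" using ne by auto
    then have "length (legs D) = 1" "length (trivs D) = 1" using assms(2) unfolding has_degree_def by linarith+
    then show ?thesis by (simp add: is_lollipop_def)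
  qed
qed

definition chord_class :: "nat \<Rightarrow> nat \<Rightarrow> (nat \<times> nat \<times> word \<Rightarrow>\<^sub>0 'k::field) \<Rightarrow> (diagram \<Rightarrow>\<^sub>0 'k) set" where
  "chord_class n m y = diagram_cls n m (lin_ext (\<lambda>x. gen (chord_diagram m x)) y)"

lemma diagram_value_chord_diagram:
  assumes "x \<in> chord_basis n m" shows "diagram_value n (chord_diagram m x) = gen x"
  using diagram_value_chord[OF chord_diagram(1,4)[OF assms]] by (simp add: chord_diagram_simps)

lemma lin_ext_value_chords:
  assumes "Poly_Mapping.keys y \<subseteq> chord_basis n m"
  shows "lin_ext (diagram_value n) (lin_ext (\<lambda>x. gen (chord_diagram m x)) y) = (y :: _ \<Rightarrow>\<^sub>0 'k::field)"
proof -
  have "lin_ext (diagram_value n) (lin_ext (\<lambda>x. gen (chord_diagram m x)) y) =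
      (lin_ext (\<lambda>x. diagram_value n (chord_diagram m x)) y :: _ \<Rightarrow>\<^sub>0 'k)"
    by (simp add: lin_ext_lin_ext)
  also have "\<dots> = lin_ext gen y"
    by (rule lin_ext_cong) (use assms diagram_value_chord_diagram in blast)
  finally show ?thesis by (simp add: lin_ext_gen_id)
qed

lemma lin_ext_value_rel_span:
  assumes "a \<in> (diagram_rel_span n m :: (_ \<Rightarrow>\<^sub>0 'k::field) set)"
  shows "lin_ext (diagram_value n) a = (0 :: _ \<Rightarrow>\<^sub>0 'k)"
proof -
  have "lin_ext (diagram_value n) a \<in> ({0} :: (_ \<Rightarrow>\<^sub>0 'k) set)"
    by (rule rel_span_lin_map[OF diagram_rels_carrier lin_map_lin_ext lin_sub_zero _ assms])
      (simp add: diagram_value_rels)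
  then show ?thesis by simp
qed

lemma chord_class_linear: "chord_class n m \<in> linear_maps (free_vs (chord_basis n m)) (A_vs n m)"
  unfolding linear_maps_def chord_class_def
proof (intro CollectI conjI ballI allI funcsetI)
  fix y :: "nat \<times> nat \<times> word \<Rightarrow>\<^sub>0 'a" assume "y \<in> carrier (free_vs (chord_basis n m))"
  then have "Poly_Mapping.keys (lin_ext (\<lambda>x. gen (chord_diagram m x)) y :: _ \<Rightarrow>\<^sub>0 'a) \<subseteq> diagrams n m"
    by (intro keys_lin_ext) (use chord_diagram(1) in auto)
  then show "diagram_cls n m (lin_ext (\<lambda>x. gen (chord_diagram m x)) y) \<in> carrier (A_vs n m :: ('a, _) module)"
    by (simp add: A_vs_simps)
qed (simp_all add: A_vs_simps lin_ext_simps)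

text \<open>The values kill all relations, so they descend to the quotient, where they recover the
  coefficients of a combination of chords.\<close>

lemma chord_class_inj: "inj_on (chord_class n m) (carrier (free_vs (chord_basis n m) :: ('k::field, _) module))"
proof (rule inj_onI)
  fix y z :: "nat \<times> nat \<times> word \<Rightarrow>\<^sub>0 'k"
  assume yz: "y \<in> carrier (free_vs (chord_basis n m))" "z \<in> carrier (free_vs (chord_basis n m))"
    and eq: "chord_class n m y = chord_class n m z"
  have "lin_ext (diagram_value n) (lin_ext (\<lambda>x. gen (chord_diagram m x)) y - lin_ext (\<lambda>x. gen (chord_diagram m x)) z) = (0 :: _ \<Rightarrow>\<^sub>0 'k)"
    by (rule lin_ext_value_rel_span) (rule eq[unfolded chord_class_def cls_eq_iff[OF lin_sub_diagram_rel_span]])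
  then have "y - z = 0"
    using yz by (simp only: lin_ext_simps(5) lin_ext_value_chords free_vs_simps(1) mem_Collect_eq)
  then show "y = z" by simp
qed

lemma bead_equiv_cls:
  "bead_equiv n m D D' \<Longrightarrow> D \<in> diagrams n m \<Longrightarrow> D' \<in> diagrams n m \<Longrightarrow>
     diagram_cls n m (gen D) = (diagram_cls n m (gen D') :: (_ \<Rightarrow>\<^sub>0 'k::field) set)"
  by (simp add: cls_eq_iff[OF lin_sub_diagram_rel_span] bead_equiv_rel_span)

lemma chord_cls:
  assumes "D \<in> diagrams n m" "homotopy_trivial n D" "is_chord D"
  shows "diagram_cls n m (gen D) = chord_class n m (diagram_value n D :: _ \<Rightarrow>\<^sub>0 'k::field)"
proof -
  obtain x where x: "x \<in> chord_basis n m" "bead_equiv n m D (chord_diagram m x)"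
    using chord_normal_form[OF assms] by blast
  have "diagram_value n D = (gen x :: _ \<Rightarrow>\<^sub>0 'k)"
    unfolding bead_equiv_value[OF x(2)] by (rule diagram_value_chord_diagram[OF x(1)])
  moreover have "diagram_cls n m (gen D) = (diagram_cls n m (gen (chord_diagram m x)) :: (_ \<Rightarrow>\<^sub>0 'k) set)"
    by (rule bead_equiv_cls[OF x(2) assms(1) chord_diagram(1)[OF x(1)]])
  ultimately show ?thesis by (simp add: chord_class_def)
qed

text \<open>The spanning half. A chord equals its normal form; a lollipop is by STU a difference of
  two chords, whose values differ by the value of the lollipop because values respect STU.\<close>

lemma degree_one_cls:
  assumes "D \<in> degree_one_trivial n m"
  shows "diagram_cls n m (gen D) = chord_class n m (diagram_value n D :: _ \<Rightarrow>\<^sub>0 'k::field)"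
proof -
  have D: "D \<in> diagrams n m" "homotopy_trivial n D" "has_degree 1 D"
    using assms by (auto simp: degree_one_trivial_def)
  show ?thesis
  proof (cases "is_chord D")
    case True
    then show ?thesis by (rule chord_cls[OF D(1,2)])
  next
    case False
    then have "is_lollipop D" using degree_one_cases[OF D(1,3)] by blast
    then obtain E P Q where *: "bead_equiv n m D E" "E \<in> diagrams n m" "P \<in> diagrams n m" "Q \<in> diagrams n m"
     "homotopy_trivial n P" "homotopy_trivial n Q" "is_chord P" "is_chord Q"
     "(gen E - (gen P - gen Q) :: _ \<Rightarrow>\<^sub>0 'k) \<in> stu_rels n m"
      using lollipop_normal_form[OF D(1,2)] by blast
    have stu: "(gen E - (gen P - gen Q) :: _ \<Rightarrow>\<^sub>0 'k) \<in> diagram_rels n m" using *(9) by (simp add: diagram_rels_def)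
    have "diagram_cls n m (gen D) = (diagram_cls n m (gen E) :: (_ \<Rightarrow>\<^sub>0 'k) set)"
      by (rule bead_equiv_cls[OF *(1) D(1) *(2)])
    also have "\<dots> = diagram_cls n m (gen P - gen Q)"
      by (simp add: cls_eq_iff[OF lin_sub_diagram_rel_span] rel_span(2)[OF diagram_rels_carrier stu])
    also have "\<dots> = diagram_cls n m (lin_ext (\<lambda>x. gen (chord_diagram m x)) (diagram_value n P - diagram_value n Q))"
    proof -
      have "gen P - lin_ext (\<lambda>x. gen (chord_diagram m x)) (diagram_value n P) \<in> (diagram_rel_span n m :: (_ \<Rightarrow>\<^sub>0 'k) set)"
        "gen Q - lin_ext (\<lambda>x. gen (chord_diagram m x)) (diagram_value n Q) \<in> (diagram_rel_span n m :: (_ \<Rightarrow>\<^sub>0 'k) set)"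
        using chord_cls[OF *(3,5,7)] chord_cls[OF *(4,6,8)]
        by (simp_all add: chord_class_def cls_eq_iff[OF lin_sub_diagram_rel_span])
      from lin_subD(5)[OF lin_sub_diagram_rel_span this] show ?thesis
        by (simp add: cls_eq_iff[OF lin_sub_diagram_rel_span] lin_ext_simps algebra_simps)
    qed
    also have "diagram_value n P - diagram_value n Q = (diagram_value n D :: _ \<Rightarrow>\<^sub>0 'k)"
      using diagram_value_rels[OF stu] bead_equiv_value[OF *(1), where 'k='k] by (simp add: lin_ext_simps)
    finally show ?thesis by (simp add: chord_class_def)
  qed
qed

lemma chord_class_sum_cls:
  assumes "\<And>D. D \<in> Poly_Mapping.keys z \<Longrightarrow> D \<in> degree_one_trivial n m"
  shows "diagram_cls n m z = chord_class n m (lin_ext (diagram_value n) z :: _ \<Rightarrow>\<^sub>0 'k::field)"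
proof -
  let ?f = "\<lambda>D. lin_ext (\<lambda>x. gen (chord_diagram m x)) (diagram_value n D :: _ \<Rightarrow>\<^sub>0 'k)"
  have "lin_ext (\<lambda>D. gen D - ?f D) z \<in> (diagram_rel_span n m :: (_ \<Rightarrow>\<^sub>0 'k) set)"
    using degree_one_cls[OF assms]
    by (intro lin_sub_lin_ext[OF lin_sub_diagram_rel_span]) (simp add: chord_class_def cls_eq_iff[OF lin_sub_diagram_rel_span])
  also have "lin_ext (\<lambda>D. gen D - ?f D) z = lin_ext gen z - lin_ext ?f z"
    by (simp add: lin_ext_def scale_diff sum_subtractf)
  finally show ?thesis
    by (simp add: chord_class_def cls_eq_iff[OF lin_sub_diagram_rel_span] lin_ext_gen_id lin_ext_lin_ext)
qed

lemma carrier_A_deg_trivial: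
  "carrier (obj (A_deg_trivial 1 n) m) = chord_class n m ` carrier (free_vs (chord_basis n m) :: ('k::field, _) module)"
proof -
  let ?S = "diagram_class n m ` degree_one_trivial n m :: (diagram \<Rightarrow>\<^sub>0 'k) set set"
  have c: "carrier (obj (A_deg_trivial 1 n) m) = vspan (A_vs n m :: ('k, _) module) ?S"
    by (simp add: A_deg_trivial_def degree_one_trivial_def)
  have S: "?S \<subseteq> carrier (A_vs n m)"
    by (auto simp: A_vs_simps diagram_class_eq degree_one_trivial_def)
  let ?I = "chord_class n m ` carrier (free_vs (chord_basis n m) :: ('k, _) module)"
  note lin = linear_mapsD[OF chord_class_linear]
  have cl: "chord_class n m y \<oplus>\<^bsub>A_vs n m\<^esub> chord_class n m z = chord_class n m (y + z)"
    "c \<odot>\<^bsub>A_vs n m\<^esub> chord_class n m y = chord_class n m (scale c y)" for y z :: "_ \<Rightarrow>\<^sub>0 'k" and c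
    by (simp_all add: chord_class_def A_vs_simps lin_ext_simps)
  have sub: "submodule ?I KK (A_vs n m)"
    unfolding submodule_iff[OF module_A_vs]
  proof (intro conjI)
    show "?I \<subseteq> carrier (A_vs n m)" using lin(1) by blast
    show "\<zero>\<^bsub>A_vs n m\<^esub> \<in> ?I" by (rule image_eqI[of _ _ 0]) (simp_all add: A_vs_simps chord_class_def lin_ext_simps)
    show "\<forall>u\<in>?I. \<forall>v\<in>?I. u \<oplus>\<^bsub>A_vs n m\<^esub> v \<in> ?I"
      using lin_subD(2)[OF lin_sub_keys[of "chord_basis n m"]] by (auto simp: cl)
    show "\<forall>c. \<forall>u\<in>?I. c \<odot>\<^bsub>A_vs n m\<^esub> u \<in> ?I"
      using lin_subD(3)[OF lin_sub_keys[of "chord_basis n m"]] by (auto simp: cl)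
  qed
  have "?S \<subseteq> ?I"
  proof
    fix C assume "C \<in> ?S"
    then obtain D where D: "D \<in> degree_one_trivial n m" "C = diagram_cls n m (gen D)" by (auto simp: diagram_class_eq)
    then show "C \<in> ?I"
      using degree_one_cls[OF D(1), where 'k='k] diagram_value_carrier[of D n m, where 'k='k]
      by (auto simp: degree_one_trivial_def)
  qed
  then have "vspan (A_vs n m) ?S \<subseteq> ?I" by (rule vspan_least[OF sub])
  moreover have "?I \<subseteq> vspan (A_vs n m) ?S"
  proof
    fix C assume "C \<in> ?I"
    then obtain y where y: "Poly_Mapping.keys y \<subseteq> chord_basis n m" "C = chord_class n m y" by auto
    note vs = submodule_vspan[OF module_A_vs S, unfolded submodule_iff[OF module_A_vs]]
    have "chord_class n m y \<in> vspan (A_vs n m) ?S"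
      using y(1)
    proof (induction rule: free_vs_induct)
      case zero
      have "chord_class n m 0 = \<zero>\<^bsub>A_vs n m :: ('k, _) module\<^esub>" by (simp add: chord_class_def A_vs_simps lin_ext_simps)
      then show ?case using vs(1) by simp
    next
      case (gen x)
      then have "chord_class n m (gen x) \<in> ?S"
        using chord_diagram(1-3)[OF gen] by (simp add: chord_class_def diagram_class_eq degree_one_trivial_def)
      then show ?case using vs(2) by blast
    next
      case (add y z)
      then show ?case using vs(1) by (simp flip: cl)
    next
      case (scale c y)
      then show ?case using vs(1) by (simp flip: cl)
    qed
    then show "C \<in> vspan (A_vs n m) ?S" using y(2) by simp
  qed
  ultimately show ?thesis using c by blast
qed

lemma A_deg_trivial_simps:
  "x \<oplus>\<^bsub>obj (A_deg_trivial d n) m\<^esub> y = x \<oplus>\<^bsub>A_vs n m\<^esub> y"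
  "c \<odot>\<^bsub>obj (A_deg_trivial d n) m\<^esub> x = c \<odot>\<^bsub>A_vs n m\<^esub> x"
  "mor (A_deg_trivial d n) = A_map n"
  by (simp_all add: A_deg_trivial_def)

lemma module_A_deg_trivial: "module KK (obj (A_deg_trivial d n) m :: ('k::field, _) module)"
proof -
  have "diagram_class n m ` {D \<in> diagrams n m. has_degree d D \<and> homotopy_trivial n D} \<subseteq> carrier (A_vs n m :: ('k, _) module)"
    by (auto simp: A_vs_simps diagram_class_eq)
  from submodule.submodule_is_module[OF submodule_vspan(1)[OF module_A_vs this] module_A_vs]
  show ?thesis by (simp add: A_deg_trivial_def)
qed

lemma chord_class_iso:
  "chord_class n m \<in> linear_maps (free_vs (chord_basis n m)) (obj (A_deg_trivial 1 n) m)"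
  "bij_betw (chord_class n m) (carrier (free_vs (chord_basis n m))) (carrier (obj (A_deg_trivial 1 n) m :: ('k::field, _) module))"
proof -
  show "chord_class n m \<in> linear_maps (free_vs (chord_basis n m)) (obj (A_deg_trivial 1 n) m)"
    using linear_mapsD[OF chord_class_linear[of n m]] carrier_A_deg_trivial[of n m]
    unfolding linear_maps_def A_deg_trivial_simps by blast
  show "bij_betw (chord_class n m) (carrier (free_vs (chord_basis n m))) (carrier (obj (A_deg_trivial 1 n) m :: ('k::field, _) module))"
    unfolding bij_betw_def carrier_A_deg_trivial using chord_class_inj by blast
qed

lemma pulled_degree_one_trivial:
  assumes "D \<in> degree_one_trivial n b" "g \<in> gr a b" "c \<in> attachments a g D"
  shows "pulled_diagram n a g D c \<in> degree_one_trivial n a"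
proof -
  have D: "D \<in> diagrams n b" "homotopy_trivial n D" "has_degree 1 D"
    using assms by (auto simp: degree_one_trivial_def)
  have "length (legs (pulled_diagram n a g D c)) = length (legs D)"
    using mset_legs_pulled_diagram[OF D(1) assms(2,3)] by (metis size_mset)
  then show ?thesis
    using pulled_diagram_diagrams[OF D(1) assms(2,3)] homotopy_trivial_pulled_diagram[OF D(1) assms(2) D(2)] D(3)
    by (simp add: degree_one_trivial_def has_degree_def)
qed

lemma A_map_chord_class:
  assumes "x \<in> chord_basis n b" "g \<in> gr a b"
  shows "A_map n a b g (chord_class n b (gen x)) =
    chord_class n a (lin_ext (diagram_value n) (pullback n a g (chord_diagram b x)) :: _ \<Rightarrow>\<^sub>0 'k::field)"
proof -
  have D: "chord_diagram b x \<in> degree_one_trivial n b"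
    using chord_diagram(1-3)[OF assms(1)] by (simp add: degree_one_trivial_def)
  have "(pullback n a g (chord_diagram b x) :: _ \<Rightarrow>\<^sub>0 'k) \<in> {z. Poly_Mapping.keys z \<subseteq> degree_one_trivial n a}"
    unfolding pullback_def
    by (intro lin_sub_sum[OF lin_sub_keys] lin_subD(3)[OF lin_sub_keys])
      (use pulled_degree_one_trivial[OF D assms(2)] in auto)
  then show ?thesis
    unfolding chord_class_def lin_ext_gen A_map_cls[OF assms(2)]
    using chord_class_sum_cls[of "pullback n a g (chord_diagram b x)" n a] unfolding chord_class_def by auto
qed

lemma keys_lin_ext_value:
  assumes "Poly_Mapping.keys z \<subseteq> diagrams n m"
  shows "Poly_Mapping.keys (lin_ext (diagram_value n) z :: _ \<Rightarrow>\<^sub>0 'k::field) \<subseteq> chord_basis n m"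
  by (rule keys_lin_ext) (use assms diagram_value_carrier in blast)

lemma A_map_linear_degree_one:
  assumes "g \<in> gr a b"
  shows "A_map n a b g \<in> linear_maps (obj (A_deg_trivial 1 n) b :: ('k::field, _) module) (obj (A_deg_trivial 1 n) a)"
proof -
  note A = linear_mapsD[OF A_map_linear[OF assms, where 'k='k]]
  have sub: "v \<in> carrier (A_vs n b)" if "v \<in> carrier (obj (A_deg_trivial 1 n) b :: ('k, _) module)" for v
    using that linear_mapsD(1)[OF chord_class_linear] unfolding carrier_A_deg_trivial by blast
  have im: "A_map n a b g v \<in> carrier (obj (A_deg_trivial 1 n) a :: ('k, _) module)"
    if "v \<in> carrier (obj (A_deg_trivial 1 n) b)" for v
  proof -
    obtain y where y: "Poly_Mapping.keys y \<subseteq> chord_basis n b" "v = chord_class n b y"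
      using \<open>v \<in> _\<close> unfolding carrier_A_deg_trivial by auto
    define z where "z = lin_ext (pullback n a g) (lin_ext (\<lambda>x. gen (chord_diagram b x)) y)"
    have "Poly_Mapping.keys z \<subseteq> degree_one_trivial n a"
      unfolding z_def lin_ext_lin_ext
    proof (rule keys_lin_ext)
      fix x assume "x \<in> Poly_Mapping.keys y"
      then have x: "x \<in> chord_basis n b" using y(1) by blast
      have D: "chord_diagram b x \<in> degree_one_trivial n b"
        using chord_diagram(1-3)[OF x] by (simp add: degree_one_trivial_def)
      have "(pullback n a g (chord_diagram b x) :: _ \<Rightarrow>\<^sub>0 'k) \<in> {z. Poly_Mapping.keys z \<subseteq> degree_one_trivial n a}"
        unfolding pullback_def
        by (intro lin_sub_sum[OF lin_sub_keys] lin_subD(3)[OF lin_sub_keys])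
          (use pulled_degree_one_trivial[OF D assms] in auto)
      then show "Poly_Mapping.keys (lin_ext (pullback n a g) (gen (chord_diagram b x)) :: _ \<Rightarrow>\<^sub>0 'k) \<subseteq> degree_one_trivial n a"
        by simp
    qed
    then have z: "diagram_cls n a z = chord_class n a (lin_ext (diagram_value n) z)"
      "Poly_Mapping.keys (lin_ext (diagram_value n) z :: _ \<Rightarrow>\<^sub>0 'k) \<subseteq> chord_basis n a"
      using chord_class_sum_cls[of z n a] keys_lin_ext_value[of z n a]
      by (auto simp: degree_one_trivial_def)
    have "A_map n a b g v = diagram_cls n a z"
      unfolding y(2) chord_class_def z_def A_map_cls[OF assms] ..
    then show ?thesis unfolding carrier_A_deg_trivial using z by simp
  qed
  show ?thesis
    unfolding linear_maps_def A_deg_trivial_simps using A(2,3) sub im by blast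
qed


subsection \<open>The pullback of a chord\<close>

text \<open>The end on the arc \<open>i\<close> is attached to the new arc \<open>p\<close>, the end
  on \<open>j\<close> to \<open>q\<close>. If \<open>q\<close> comes first, the chord is read
  backwards and its holonomy is inverted. If \<open>p = q\<close>, the attachments which keep the
  order of the ends are counted by \<open>count_pairs\<close>, and the others make up the rest of
  the product of letter counts.\<close>

definition chord_pullback :: "nat \<Rightarrow> nat \<Rightarrow> (word \<Rightarrow> word) \<Rightarrow> nat \<times> nat \<times> word \<Rightarrow> (nat \<times> nat \<times> word \<Rightarrow>\<^sub>0 'k::field)" where
  "chord_pullback n a g = (\<lambda>(i, j, v). \<Sum>p<a. \<Sum>q<a.
     (let w = g [(p, True)]; w' = g [(q, True)] in
      if p < q then scale (count_letter i w * count_letter j w') (gen (p, q, v))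
      else if q < p then scale (count_letter i w * count_letter j w') (gen (q, p, inv\<^bsub>Fr n\<^esub> v))
      else scale (count_pairs i j w) (gen (p, p, v)) +
           scale (count_letter i w * count_letter j w - count_pairs i j w) (gen (p, p, inv\<^bsub>Fr n\<^esub> v))))"

lemma count_letter_sum: "count_letter i w = (\<Sum>s<length w. letter_sign i (w ! s))"
  by (simp add: count_letter_def sum_list_sum_nth atLeast0LessThan)

text \<open>The recursion as a sum over pairs of positions, which are what the attachments of a
  chord run over.\<close>

lemma count_pairs_sum:
  "count_pairs i j w = (\<Sum>s<length w. \<Sum>t<length w.
     if s < t \<or> s = t \<and> snd (w ! s) then letter_sign i (w ! s) * letter_sign j (w ! t) else (0 :: 'k::field))"
proof (induction w)
  case (Cons a w)
  have 1: "(\<Sum>t<length w. letter_sign i a * letter_sign j (w ! t)) = letter_sign i a * (count_letter j w :: 'k)"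
    by (simp add: count_letter_sum sum_distrib_left)
  have 2: "(if fst a = i \<and> fst a = j \<and> snd a then 1 else 0) = (if snd a then letter_sign i a * letter_sign j a else 0 :: 'k)"
    by (simp add: letter_sign_def)
  show ?case
    unfolding length_Cons sum.lessThan_Suc_shift count_pairs.simps 2 Cons by (simp add: 1 cong: if_cong)
qed simp

lemma ordered_concat:
  fixes h k :: nat
  assumes "concat xss = [h, k]" "h \<noteq> k" "i < length xss" "h \<in> set (xss ! i)" "j < length xss" "k \<in> set (xss ! j)"
  shows "i \<le> j"
proof -
  have "arc_legs (map Leg xs) = xs" for xs by (induction xs) auto
  then show ?thesis
    \<comment> \<open>An auxiliary record whose arcs carry the given lists as legs; the order of the
      legs concerns nothing but the arcs.\<close>
    using ordered_legs[of "\<lparr>arcs = map (map Leg) xss, edges = [], trivs = []\<rparr>" h k i j] assms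
    by (simp add: legs_def comp_def)
qed

lemma concat_two_one_list:
  assumes "concat xss = [h, k]" "h \<noteq> k" "i < length xss" "{h, k} \<subseteq> set (xss ! i)"
  shows "xss ! i = [h, k]"
proof -
  define P Q where "P = concat (take i xss)" and "Q = concat (drop (Suc i) xss)"
  have "concat xss = concat (take i xss @ xss ! i # drop (Suc i) xss)"
    by (rule arg_cong[OF id_take_nth_drop[OF assms(3)]])
  then have eq: "[h, k] = P @ xss ! i @ Q" using assms(1) by (simp add: P_def Q_def)
  have "2 \<le> length (xss ! i)"
    using card_mono[OF _ assms(4)] card_length[of "xss ! i"] assms(2) by simp
  moreover have "2 = length P + (length (xss ! i) + length Q)" using arg_cong[OF eq, of length] by simp
  ultimately have "length P = 0" "length Q = 0" by linarith+
  then have "P = []" "Q = []" by simp_all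
  then show ?thesis using eq by simp
qed

text \<open>The chord keeps its edge, so its value is determined by the order in which its two ends
  are met: by the arcs if these differ, then by the copies, and within a single copy by the
  orientation of the copy.\<close>

lemma pulled_chord_value:
  assumes x: "(i, j, v) \<in> chord_basis n b" and g: "g \<in> gr a b"
    and c: "c \<in> attachments a g (chord_diagram b (i, j, v))" and c01: "c 0 = (p, s)" "c 1 = (q, t)"
  shows "diagram_value n (pulled_diagram n a g (chord_diagram b (i, j, v)) c) =
    (gen (if p < q then (p, q, v) else if q < p then (q, p, inv\<^bsub>Fr n\<^esub> v)
      else if s < t \<or> s = t \<and> snd (g [(p, True)] ! s) then (p, p, v) else (p, p, inv\<^bsub>Fr n\<^esub> v)) :: _ \<Rightarrow>\<^sub>0 'k::field)"
proof -
  interpret group "Fr n" by (rule group_Fr)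
  let ?D = "chord_diagram b (i, j, v)"
  let ?P = "pulled_diagram n a g ?D c"
  have v: "v \<in> carrier (Fr n)" "i \<le> j" "j < b" using x by (auto simp: chord_basis_def)
  have D: "?D \<in> diagrams n b" by (rule chord_diagram(1)[OF x])
  have P: "?P \<in> diagrams n a" by (rule pulled_diagram_diagrams[OF D g c])
  have legsD: "legs ?D = [0, 1]" by (rule legs_chord_diagram[OF v(2,3)])
  have "mset (legs ?P) = {#0, 1#}" using mset_legs_pulled_diagram[OF D g c] legsD by simp
  then have "distinct (legs ?P)" "set (legs ?P) = {0, 1}"
    using mset_eq_imp_distinct_iff[of "legs ?P" "[0, 1]"] mset_eq_setD[of "legs ?P" "[0, 1]"] by auto
  then have two: "legs ?P = [0, 1] \<or> legs ?P = [1, 0]" by (intro distinct_list_two) auto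
  have m0: "(0::nat) \<in> set (legs ?D)" "(1::nat) \<in> set (legs ?D)" using legsD by auto
  note a0 = attachmentsD[OF c m0(1), unfolded c01 fst_conv snd_conv]
  note a1 = attachmentsD[OF c m0(2), unfolded c01 fst_conv snd_conv]
  have fi: "fst (g [(p, True)] ! s) = i" "fst (g [(q, True)] ! t) = j"
    using a0(3) a1(3) gr_letters[OF g a0(1,2)] gr_letters[OF g a1(1,2)]
    by (auto simp: chord_diagram_simps split: if_splits)
  have on_p: "0 \<in> set (arc_legs (arcs ?P ! p))" and on_q: "1 \<in> set (arc_legs (arcs ?P ! q))"
    using a0 a1 c01
    by (auto simp: arcs_pulled_diagram arc_legs_concat set_arc_legs_copy intro!: bexI[of _ s] bexI[of _ t])
  \<comment> \<open>The arcs of a chord diagram carry no beads and neither do their copies, so the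
    transports along the arcs are trivial.\<close>
  have pp: "prefix_product n (arcs ?P ! l) h = \<one>\<^bsub>Fr n\<^esub>" if "l < a" for l h
  proof -
    have "arc_beads (arc_copy n g ?D c l s') = []" if "s' < length (g [(l, True)])" for s'
      using gr_letters[OF g \<open>l < a\<close> that] by (simp add: arc_copy_eq oriented_copy_def chord_diagram_simps)
    then have "arc_beads (arcs ?P ! l) = []"
      using that by (auto simp: arcs_pulled_diagram arc_beads_concat)
    moreover have "arc_beads xs = [] \<Longrightarrow> prefix_product n xs h = \<one>\<^bsub>Fr n\<^esub>" for xs
    proof (induction xs)
      case (Cons x xs) then show ?case by (cases x) auto
    qed simp
    ultimately show ?thesis by blast
  qed
  have hol: "holonomy n ?P 0 1 v"
    by (rule holonomyI[of _ "[v]"]) (use v in \<open>simp_all add: chord_diagram_simps\<close>)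
  have hol': "holonomy n ?P 1 0 (inv\<^bsub>Fr n\<^esub> v)" by (rule holonomy_sym[OF P hol])
  have tr: "trivs ?P = []" by (simp add: chord_diagram_simps)
  have fw: "diagram_value n ?P = (gen (p, q, v) :: _ \<Rightarrow>\<^sub>0 'k)" if "legs ?P = [0, 1]"
  proof (rule diagram_value_chord[OF P _ tr])
    show "chord_inv n ?P (p, q, v)"
      unfolding chord_inv_def prod.case
      by (rule exI[of _ 0], rule exI[of _ 1], rule exI[of _ v])
        (use that a0(1) a1(1) on_p on_q hol pp v(1) in simp)
  qed
  have bw: "diagram_value n ?P = (gen (q, p, inv\<^bsub>Fr n\<^esub> v) :: _ \<Rightarrow>\<^sub>0 'k)" if "legs ?P = [1, 0]"
  proof (rule diagram_value_chord[OF P _ tr])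
    show "chord_inv n ?P (q, p, inv\<^bsub>Fr n\<^esub> v)"
      unfolding chord_inv_def prod.case
      by (rule exI[of _ 1], rule exI[of _ 0], rule exI[of _ "inv\<^bsub>Fr n\<^esub> v"])
        (use that a0(1) a1(1) on_p on_q hol' pp v(1) in simp)
  qed
  have le1: "p \<le> q" if "legs ?P = [0, 1]"
    by (rule ordered_legs[OF that]) (use a0(1) a1(1) on_p on_q in auto)
  have le2: "q \<le> p" if "legs ?P = [1, 0]"
    by (rule ordered_legs[OF that]) (use a0(1) a1(1) on_p on_q in auto)
  have inner: "s \<le> t \<and> (s = t \<longrightarrow> snd (g [(p, True)] ! s))" if pq: "p = q" and l: "legs ?P = [0, 1]"
  proof -
    have "concat (map arc_legs (arcs ?P)) = [0, 1]" using l by (simp add: legs_def)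
    from concat_two_one_list[OF this, of p] have "arc_legs (arcs ?P ! p) = [0, 1]"
      using a0(1) on_p on_q pq by simp
    then have cc: "concat (map (\<lambda>s. arc_legs (arc_copy n g ?D c p s)) [0..<length (g [(p, True)])]) = [0, 1]"
      using a0(1) by (simp add: arcs_pulled_diagram arc_legs_concat comp_def)
    have mem: "0 \<in> set (arc_legs (arc_copy n g ?D c p s))" "1 \<in> set (arc_legs (arc_copy n g ?D c p t))"
      using a0 a1 c01 pq by (auto simp: set_arc_legs_copy)
    have "s \<le> t" using ordered_concat[OF cc, of s t] mem a0(2) a1(2) pq by simp
    \<comment> \<open>If both ends lie on one copy, both come from the arc \<open>i = j\<close>, and
      a reversed copy would list them in the opposite order.\<close>
    moreover have "snd (g [(p, True)] ! s)" if st: "s = t"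
    proof (rule ccontr)
      assume n: "\<not> snd (g [(p, True)] ! s)"
      have "arc_legs (arc_copy n g ?D c p s) = [0, 1]"
        using concat_two_one_list[OF cc, of s] mem a0(2) st by simp
      moreover have "i = j" using fi st pq by simp
      then have "arc_legs (arcs ?D ! fst (g [(p, True)] ! s)) = [0, 1]"
        using fi v by (simp add: chord_diagram_simps)
      then have "arc_legs (arc_copy n g ?D c p s) = [1, 0]"
        using n c01 st pq by (simp add: arc_copy_eq oriented_copy_def)
      ultimately show False by simp
    qed
    ultimately show ?thesis by blast
  qed
  have inner': "t \<le> s \<and> (s = t \<longrightarrow> \<not> snd (g [(p, True)] ! s))" if pq: "p = q" and l: "legs ?P = [1, 0]"
  proof -
    have "concat (map arc_legs (arcs ?P)) = [1, 0]" using l by (simp add: legs_def)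
    from concat_two_one_list[OF this, of p] have "arc_legs (arcs ?P ! p) = [1, 0]"
      using a0(1) on_p on_q pq by simp
    then have cc: "concat (map (\<lambda>s. arc_legs (arc_copy n g ?D c p s)) [0..<length (g [(p, True)])]) = [1, 0]"
      using a0(1) by (simp add: arcs_pulled_diagram arc_legs_concat comp_def)
    have mem: "0 \<in> set (arc_legs (arc_copy n g ?D c p s))" "1 \<in> set (arc_legs (arc_copy n g ?D c p t))"
      using a0 a1 c01 pq by (auto simp: set_arc_legs_copy)
    have "t \<le> s" using ordered_concat[OF cc, of t s] mem a0(2) a1(2) pq by simp
    moreover have "\<not> snd (g [(p, True)] ! s)" if st: "s = t"
    proof
      assume n: "snd (g [(p, True)] ! s)"
      have "arc_legs (arc_copy n g ?D c p s) = [1, 0]"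
        using concat_two_one_list[OF cc, of s] mem a0(2) st by simp
      moreover have "i = j" using fi st pq by simp
      then have "arc_legs (arcs ?D ! fst (g [(p, True)] ! s)) = [0, 1]"
        using fi v by (simp add: chord_diagram_simps)
      then have "arc_legs (arc_copy n g ?D c p s) = [0, 1]"
        using n c01 st pq by (simp add: arc_copy_eq oriented_copy_def)
      ultimately show False by simp
    qed
    ultimately show ?thesis by blast
  qed
  show ?thesis
    using two
  proof
    assume l: "legs ?P = [0, 1]"
    then show ?thesis unfolding fw[OF l] using le1 inner by (intro arg_cong[of _ _ gen]) auto
  next
    assume l: "legs ?P = [1, 0]"
    then show ?thesis unfolding bw[OF l] using le2 inner' by (intro arg_cong[of _ _ gen]) auto
  qed
qed


text \<open>Each pair contributes to \<open>G\<close> or to \<open>H\<close>. The weights on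
  \<open>G\<close> add up to \<open>count_pairs\<close>, all weights together to the product of the
  letter counts.\<close>

lemma sum_ordered_pairs:
  fixes w :: word and G H :: "'x \<Rightarrow>\<^sub>0 'k::field"
  shows "(\<Sum>s<length w. \<Sum>t<length w. scale (letter_sign i (w ! s) * letter_sign j (w ! t))
      (if s < t \<or> s = t \<and> snd (w ! s) then G else H)) =
    scale (count_pairs i j w) G + scale (count_letter i w * count_letter j w - count_pairs i j w) H"
proof -
  let ?f = "\<lambda>s t. letter_sign i (w ! s) * letter_sign j (w ! t) :: 'k"
  let ?C = "\<lambda>s t. s < t \<or> s = t \<and> snd (w ! s)"
  have "scale f (if c then G else H) = scale (if c then f else 0) G + scale (f - (if c then f else 0)) H" for c and f :: 'k
    by (cases c) simp_all
  then have split: "scale (?f s t) (if ?C s t then G else H) =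
      scale (if ?C s t then ?f s t else 0) G + scale (?f s t - (if ?C s t then ?f s t else 0)) H" for s t .
  have "(\<Sum>s<length w. \<Sum>t<length w. scale (?f s t) (if ?C s t then G else H)) =
     scale (\<Sum>s<length w. \<Sum>t<length w. if ?C s t then ?f s t else 0) G +
     scale ((\<Sum>s<length w. \<Sum>t<length w. ?f s t) - (\<Sum>s<length w. \<Sum>t<length w. if ?C s t then ?f s t else 0)) H"
    unfolding split by (simp only: sum.distrib scale_sum_left[symmetric] sum_subtractf)
  also have "(\<Sum>s<length w. \<Sum>t<length w. ?f s t) = count_letter i w * count_letter j w"
    by (simp add: count_letter_sum sum_product)
  finally show ?thesis by (simp only: count_pairs_sum)
qed

lemma sum_pairs:
  fixes w w' :: word and G :: "'x \<Rightarrow>\<^sub>0 'k::field"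
  shows "(\<Sum>s<length w. \<Sum>t<length w'. scale (letter_sign i (w ! s) * letter_sign j (w' ! t)) G) =
    scale (count_letter i w * count_letter j w') G"
  by (simp only: count_letter_sum sum_product scale_sum_left)

text \<open>An attachment of a chord is a pair of occurrences of the letters \<open>i\<close> and
  \<open>j\<close> in the words of \<open>g\<close>, and its sign is the product of the signs of the
  two letters. Sorting the pairs by their arcs gives the closed formula.\<close>

lemma value_pullback_chord:
  assumes x: "(i, j, v) \<in> chord_basis n b" and g: "g \<in> gr a b"
  shows "lin_ext (diagram_value n) (pullback n a g (chord_diagram b (i, j, v))) =
    (chord_pullback n a g (i, j, v) :: _ \<Rightarrow>\<^sub>0 'k::field)"
proof -
  let ?D = "chord_diagram b (i, j, v)"
  let ?W = "\<lambda>p. g [(p, True)]"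
  let ?L = "\<lambda>x. ?W (fst x) ! snd x"
  let ?Q = "Sigma {..<a} (\<lambda>p. {..<length (?W p)})"
  let ?Q' = "\<lambda>i. {x \<in> ?Q. fst (?L x) = i}"
  define N where "N x y = (if fst x < fst y then (fst x, fst y, v) else if fst y < fst x then (fst y, fst x, inv\<^bsub>Fr n\<^esub> v)
      else if snd x < snd y \<or> snd x = snd y \<and> snd (?L x) then (fst x, fst x, v) else (fst x, fst x, inv\<^bsub>Fr n\<^esub> v))" for x y :: "nat \<times> nat"
  define sg where "sg x = (if snd (?L x) then 1 else - 1 :: 'k)" for x
  have v: "i \<le> j" "j < b" using x by (auto simp: chord_basis_def)
  have legsD: "legs ?D = [0, 1]" by (rule legs_chord_diagram[OF v])
  have leg: "h \<in> set (arc_legs (arcs ?D ! fst (?W p ! s))) \<longleftrightarrow> fst (?W p ! s) = (if h = 0 then i else j)"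
    if "p < a" "s < length (?W p)" "h \<in> {0, 1}" for p s h
    using that gr_letters[OF g that(1,2)] by (auto simp: chord_diagram_simps)
  have att: "attachments a g ?D = (\<Pi>\<^sub>E h\<in>{0, 1}. ?Q' (if h = 0 then i else j))"
    unfolding attachments_def legsD list.set
  proof (rule PiE_cong)
    fix h :: nat assume h: "h \<in> {0, 1}"
    show "{(p, s). p < a \<and> s < length (?W p) \<and> h \<in> set (arc_legs (arcs ?D ! fst (?W p ! s)))} =
        ?Q' (if h = 0 then i else j)"
      using leg[OF _ _ h] by auto
  qed
  have "lin_ext (diagram_value n) (pullback n a g ?D) =
     (\<Sum>c\<in>attachments a g ?D. scale ((-1) ^ card (reversed_legs g ?D c)) (diagram_value n (pulled_diagram n a g ?D c)) :: _ \<Rightarrow>\<^sub>0 'k)"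
    by (simp add: pullback_def lin_ext_sum lin_ext_simps)
  also have "\<dots> = (\<Sum>c\<in>attachments a g ?D. scale (sg (c 0) * sg (c 1)) (gen (N (c 0) (c 1))))"
  proof (rule sum.cong[OF refl])
    fix c assume c: "c \<in> attachments a g ?D"
    have val: "diagram_value n (pulled_diagram n a g ?D c) = (gen (N (c 0) (c 1)) :: _ \<Rightarrow>\<^sub>0 'k)"
      using pulled_chord_value[OF x g c prod.collapse[symmetric] prod.collapse[symmetric], where 'k='k] by (simp add: N_def)
    have two: "{h \<in> {0, 1::nat}. R h} = (if R 0 then {0} else {}) \<union> (if R 1 then {1} else {})" for R
      by (auto intro!: gr0I)
    have "reversed_legs g ?D c = {h \<in> {0, 1}. \<not> snd (?L (c h))}"
      by (simp add: reversed_legs_def legsD case_prod_beta)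
    then have "reversed_legs g ?D c = (if \<not> snd (?L (c 0)) then {0} else {}) \<union> (if \<not> snd (?L (c 1)) then {1} else {})"
      unfolding two .
    then have "(-1) ^ card (reversed_legs g ?D c) = sg (c 0) * sg (c 1)"
      by (simp add: sg_def)
    then show "scale ((-1) ^ card (reversed_legs g ?D c)) (diagram_value n (pulled_diagram n a g ?D c)) =
        scale (sg (c 0) * sg (c 1)) (gen (N (c 0) (c 1)))"
      by (simp only: val)
  qed
  also have "\<dots> = (\<Sum>(x, y)\<in>?Q' i \<times> ?Q' j. scale (sg x * sg y) (gen (N x y)))"
    by (rule sum.reindex_bij_witness[of _ "\<lambda>(x, y). \<lambda>h\<in>{0, 1::nat}. if h = 0 then x else y" "\<lambda>c. (c 0, c 1)"])
      (auto simp: att PiE_iff extensional_def fun_eq_iff)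
  also have "\<dots> = (\<Sum>x\<in>?Q' i. \<Sum>y\<in>?Q' j. scale (sg x * sg y) (gen (N x y)))"
    by (simp only: sum.cartesian_product)
  \<comment> \<open>\<open>letter_sign\<close> vanishes at all other letters, so the sums may run
    over all positions.\<close>
  also have "\<dots> = (\<Sum>x\<in>?Q. \<Sum>y\<in>?Q. scale (letter_sign i (?L x) * letter_sign j (?L y)) (gen (N x y)))"
  proof -
    have fin: "finite ?Q" by simp
    have "(\<Sum>y\<in>?Q' j. scale (r * sg y) (f y)) = (\<Sum>y\<in>?Q. scale (r * letter_sign j (?L y)) (f y))" for r j and f :: "nat \<times> nat \<Rightarrow> (nat \<times> nat \<times> word \<Rightarrow>\<^sub>0 'k)"
      by (rule sum.mono_neutral_cong_left[OF fin]) (auto simp: letter_sign_def sg_def)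
    moreover have "(\<Sum>x\<in>?Q' i. \<Sum>y\<in>?Q. scale (sg x * letter_sign j (?L y)) (gen (N x y))) =
        (\<Sum>x\<in>?Q. \<Sum>y\<in>?Q. scale (letter_sign i (?L x) * letter_sign j (?L y)) (gen (N x y)) :: _ \<Rightarrow>\<^sub>0 'k)"
      by (rule sum.mono_neutral_cong_left[OF fin]) (auto simp: letter_sign_def sg_def)
    ultimately show ?thesis by simp
  qed
  also have "\<dots> = (\<Sum>p<a. \<Sum>s<length (?W p). \<Sum>q<a. \<Sum>t<length (?W q).
      scale (letter_sign i (?W p ! s) * letter_sign j (?W q ! t)) (gen (N (p, s) (q, t))))"
  proof -
    have "(\<Sum>x\<in>?Q. F x) = (\<Sum>p<a. \<Sum>s<length (?W p). F (p, s))" for F :: "nat \<times> nat \<Rightarrow> (nat \<times> nat \<times> word \<Rightarrow>\<^sub>0 'k)"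
      by (simp add: sum.Sigma case_prod_beta')
    then show ?thesis by (simp only: fst_conv snd_conv)
  qed
  also have "\<dots> = (\<Sum>p<a. \<Sum>q<a. \<Sum>s<length (?W p). \<Sum>t<length (?W q).
      scale (letter_sign i (?W p ! s) * letter_sign j (?W q ! t)) (gen (N (p, s) (q, t))))"
    by (intro sum.cong[OF refl] sum.swap)
  also have "\<dots> = chord_pullback n a g (i, j, v)"
    unfolding chord_pullback_def prod.case
  proof (intro sum.cong[OF refl])
    fix p q assume "p \<in> {..<a}" "q \<in> {..<a}"
    consider "p < q" | "q < p" | "p = q" by linarith
    then show "(\<Sum>s<length (?W p). \<Sum>t<length (?W q).
      scale (letter_sign i (?W p ! s) * letter_sign j (?W q ! t)) (gen (N (p, s) (q, t)))) =
      (let w = ?W p; w' = ?W q in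
      if p < q then scale (count_letter i w * count_letter j w') (gen (p, q, v))
      else if q < p then scale (count_letter i w * count_letter j w') (gen (q, p, inv\<^bsub>Fr n\<^esub> v))
      else scale (count_pairs i j w) (gen (p, p, v)) +
           scale (count_letter i w * count_letter j w - count_pairs i j w) (gen (p, p, inv\<^bsub>Fr n\<^esub> v)) :: _ \<Rightarrow>\<^sub>0 'k)"
    proof cases
      case 1
      then show ?thesis by (simp add: N_def sum_pairs)
    next
      case 2
      then show ?thesis by (simp add: N_def sum_pairs)
    next
      case 3
      have eq: "gen (N (q, s) (q, t)) = (if s < t \<or> s = t \<and> snd (?W q ! s) then gen (q, q, v) else gen (q, q, inv\<^bsub>Fr n\<^esub> v) :: _ \<Rightarrow>\<^sub>0 'k)"
        for s t unfolding N_def by (simp only: fst_conv snd_conv less_irrefl if_False if_distrib[of gen])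
      show ?thesis unfolding Let_def 3 eq sum_ordered_pairs by simp
    qed
  qed
  finally show ?thesis .
qed

lemma A_map_chord_pullback:
  assumes "x \<in> chord_basis n b" "g \<in> gr a b"
  shows "A_map n a b g (chord_class n b (gen x)) = chord_class n a (chord_pullback n a g x :: _ \<Rightarrow>\<^sub>0 'k::field)"
proof -
  obtain i j v where x: "x = (i, j, v)" by (rule prod_cases3)
  show ?thesis
    unfolding A_map_chord_class[OF assms] unfolding x value_pullback_chord[OF assms(1)[unfolded x] assms(2)] ..
qed

lemma keys_chord_pullback:
  assumes "x \<in> chord_basis n b"
  shows "Poly_Mapping.keys (chord_pullback n a g x :: _ \<Rightarrow>\<^sub>0 'k::field) \<subseteq> chord_basis n a"
proof -
  obtain i j v where x: "x = (i, j, v)" by (rule prod_cases3)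
  have v: "v \<in> carrier (Fr n)" "inv\<^bsub>Fr n\<^esub> v \<in> carrier (Fr n)"
    using assms group.inv_closed[OF group_Fr] by (auto simp: x chord_basis_def)
  define K where "K = {z :: _ \<Rightarrow>\<^sub>0 'k. Poly_Mapping.keys z \<subseteq> chord_basis n a}"
  have K: "lin_sub K" unfolding K_def by (rule lin_sub_keys)
  have g: "scale c (gen y) \<in> K" if "y \<in> chord_basis n a" for c y
    by (rule lin_subD(3)[OF K]) (use that in \<open>simp add: K_def\<close>)
  have "chord_pullback n a g x \<in> K"
    unfolding x chord_pullback_def prod.case Let_def
    using v by (auto simp: chord_basis_def intro!: lin_sub_sum[OF K] lin_subD(2)[OF K] g)
  then have "chord_pullback n a g x \<in> {z :: _ \<Rightarrow>\<^sub>0 'k. Poly_Mapping.keys z \<subseteq> chord_basis n a}" by (simp only: K_def)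
  then show ?thesis by simp
qed


section \<open>Duals, tensor products and functors\<close>

lemma dual_carrierD:
  assumes "f \<in> carrier (dual V)"
  shows "u \<in> carrier V \<Longrightarrow> v \<in> carrier V \<Longrightarrow> f (u \<oplus>\<^bsub>V\<^esub> v) = f u + f v"
    "v \<in> carrier V \<Longrightarrow> f (c \<odot>\<^bsub>V\<^esub> v) = c * f v" "v \<notin> carrier V \<Longrightarrow> f v = undefined"
  using assms by (auto simp: dual_def linear_maps_def scalars_def extensional_def)

lemma dual_carrierI:
  assumes "\<And>u v. u \<in> carrier V \<Longrightarrow> v \<in> carrier V \<Longrightarrow> f (u \<oplus>\<^bsub>V\<^esub> v) = f u + f v"
    "\<And>c v. v \<in> carrier V \<Longrightarrow> f (c \<odot>\<^bsub>V\<^esub> v) = c * f v" "\<And>v. v \<notin> carrier V \<Longrightarrow> f v = undefined"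
  shows "f \<in> carrier (dual V)"
  using assms by (auto simp: dual_def linear_maps_def scalars_def extensional_def)

lemma dual_simps:
  "\<zero>\<^bsub>dual V\<^esub> = (\<lambda>v\<in>carrier V. 0)" "f \<oplus>\<^bsub>dual V\<^esub> h = (\<lambda>v\<in>carrier V. f v + h v)"
  "c \<odot>\<^bsub>dual V\<^esub> f = (\<lambda>v\<in>carrier V. c * f v)"
  by (simp_all add: dual_def)

lemma dual_ext:
  assumes "f \<in> carrier (dual V)" "h \<in> carrier (dual V)" "\<And>v. v \<in> carrier V \<Longrightarrow> f v = h v"
  shows "f = h"
proof
  fix v show "f v = h v"
    using assms(3)[of v] dual_carrierD(3)[OF assms(1), of v] dual_carrierD(3)[OF assms(2), of v]
    by (cases "v \<in> carrier V") simp_all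
qed

lemma module_dual:
  fixes V :: "('k::field, 'v) module"
  assumes "module KK V"
  shows "module KK (dual V)"
proof -
  interpret V: module KK V by fact
  have cl: "u \<in> carrier V \<Longrightarrow> c \<odot>\<^bsub>V\<^esub> u \<in> carrier V" for u c using V.smult_closed[of c u] by simp
  note D = dual_carrierD
  show ?thesis
  proof (rule module_KK_I)
    fix f h :: "'v \<Rightarrow> 'k" assume f: "f \<in> carrier (dual V)" and h: "h \<in> carrier (dual V)"
    show "f \<oplus>\<^bsub>dual V\<^esub> h \<in> carrier (dual V)"
      by (rule dual_carrierI) (simp_all add: dual_simps D[OF f] D[OF h] cl algebra_simps)
  next
    show "\<zero>\<^bsub>dual V\<^esub> \<in> carrier (dual V)" by (rule dual_carrierI) (simp_all add: dual_simps cl)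
  next
    fix c and f :: "'v \<Rightarrow> 'k" assume f: "f \<in> carrier (dual V)"
    show "c \<odot>\<^bsub>dual V\<^esub> f \<in> carrier (dual V)"
      by (rule dual_carrierI) (simp_all add: dual_simps D[OF f] cl algebra_simps)
  next
    fix f :: "'v \<Rightarrow> 'k" assume f: "f \<in> carrier (dual V)"
    show "\<zero>\<^bsub>dual V\<^esub> \<oplus>\<^bsub>dual V\<^esub> f = f" "1 \<odot>\<^bsub>dual V\<^esub> f = f"
      using D(3)[OF f] by (auto simp: dual_simps fun_eq_iff restrict_def)
  qed (auto simp: dual_simps fun_eq_iff restrict_def algebra_simps)
qed

lemma dual_map_closed:
  assumes "\<phi> \<in> linear_maps V W" "f \<in> carrier (dual W)" "module KK V"
  shows "dual_map V \<phi> f \<in> carrier (dual V)"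
proof -
  interpret V: module KK V by fact
  have cl: "u \<in> carrier V \<Longrightarrow> c \<odot>\<^bsub>V\<^esub> u \<in> carrier V" for u c using V.smult_closed[of c u] by simp
  note L = linear_mapsD[OF assms(1)] and D = dual_carrierD[OF assms(2)]
  show ?thesis
    by (rule dual_carrierI) (simp_all add: dual_map_def L D cl)
qed

lemma dual_map_linear:
  assumes "\<phi> \<in> linear_maps V W" "module KK V"
  shows "dual_map V \<phi> \<in> linear_maps (dual W) (dual V)"
proof -
  note L = linear_mapsD[OF assms(1)]
  show ?thesis
    unfolding linear_maps_def using dual_map_closed[OF assms(1) _ assms(2)]
    by (auto simp: dual_map_def dual_simps L fun_eq_iff restrict_def)
qed

section \<open>Covariant functors, their duals and presentations\<close>

definition covariant_functor :: "('k::field, 'v) gr_functor \<Rightarrow> bool" where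
  "covariant_functor M \<longleftrightarrow>
     (\<forall>m. module KK (obj M m)) \<and>
     (\<forall>a b. \<forall>g\<in>gr a b. mor M a b g \<in> linear_maps (obj M a) (obj M b)) \<and>
     (\<forall>a. \<forall>v\<in>carrier (obj M a). mor M a a (\<lambda>x\<in>carrier (Fr a). x) v = v) \<and>
     (\<forall>a b c. \<forall>g\<in>gr a b. \<forall>h\<in>gr b c. \<forall>v\<in>carrier (obj M a).
        mor M a c (compose (carrier (Fr a)) h g) v = mor M b c h (mor M a b g v))"

lemma covariant_functorD:
  assumes "covariant_functor M"
  shows "module KK (obj M m)"
    "g \<in> gr a b \<Longrightarrow> mor M a b g \<in> linear_maps (obj M a) (obj M b)"
    "v \<in> carrier (obj M a) \<Longrightarrow> mor M a a (\<lambda>x\<in>carrier (Fr a). x) v = v"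
    "g \<in> gr a b \<Longrightarrow> h \<in> gr b c \<Longrightarrow> w \<in> carrier (obj M a) \<Longrightarrow>
       mor M a c (compose (carrier (Fr a)) h g) w = mor M b c h (mor M a b g w)"
proof -
  note * = assms[unfolded covariant_functor_def]
  show "module KK (obj M m)" by (rule *[THEN conjunct1, rule_format])
  show "g \<in> gr a b \<Longrightarrow> mor M a b g \<in> linear_maps (obj M a) (obj M b)"
    by (rule *[THEN conjunct2, THEN conjunct1, rule_format])
  show "v \<in> carrier (obj M a) \<Longrightarrow> mor M a a (\<lambda>x\<in>carrier (Fr a). x) v = v"
    by (rule *[THEN conjunct2, THEN conjunct2, THEN conjunct1, rule_format])
  show "g \<in> gr a b \<Longrightarrow> h \<in> gr b c \<Longrightarrow> w \<in> carrier (obj M a) \<Longrightarrow>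
       mor M a c (compose (carrier (Fr a)) h g) w = mor M b c h (mor M a b g w)"
    by (rule *[THEN conjunct2, THEN conjunct2, THEN conjunct2, rule_format])
qed

lemma dual_functor_simps:
  "obj (dual_functor M) m = dual (obj M m)" "mor (dual_functor M) a b g = dual_map (obj M a) (mor M a b g)"
  by (simp_all add: dual_functor_def)

lemma contravariant_dual_functor:
  assumes "covariant_functor M"
  shows "contravariant_functor (dual_functor M)"
proof -
  note C = covariant_functorD[OF assms]
  show ?thesis
    unfolding contravariant_functor_def dual_functor_simps
  proof (intro conjI allI ballI)
    show "module KK (dual (obj M m))" for m by (rule module_dual[OF C(1)])
    show "dual_map (obj M a) (mor M a b g) \<in> linear_maps (dual (obj M b)) (dual (obj M a))" if "g \<in> gr a b" for a b g
      by (rule dual_map_linear[OF C(2)[OF that] C(1)])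
  next
    fix a f assume f: "f \<in> carrier (dual (obj M a))"
    show "dual_map (obj M a) (mor M a a (\<lambda>x\<in>carrier (Fr a). x)) f = f"
      by (rule dual_ext[OF dual_map_closed[OF C(2)[OF id_in_gr] f C(1)] f]) (simp add: dual_map_def C(3))
  next
    fix a b c g h f assume g: "g \<in> gr a b" and h: "h \<in> gr b c" and f: "f \<in> carrier (dual (obj M c))"
    show "dual_map (obj M a) (mor M a c (compose (carrier (Fr a)) h g)) f =
        dual_map (obj M a) (mor M a b g) (dual_map (obj M b) (mor M b c h) f)"
      using linear_mapsD(1)[OF C(2)[OF g]] C(4)[OF g h] by (simp add: dual_map_def fun_eq_iff restrict_def)
  qed
qed

lemma quot_map_linear:
  assumes X: "lin_sub X1" "lin_sub X2" and N: "lin_sub N1" "lin_sub N2"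
    and f: "lin_map f" "f ` X1 \<subseteq> X2" "f ` N1 \<subseteq> N2"
  shows "quot_map (pm_vs X2) N2 f \<in> linear_maps (quot_vs (pm_vs X1) N1) (quot_vs (pm_vs X2) N2)"
  unfolding linear_maps_def using f(2)
  by (auto simp: quot_vs_simps N quot_map_cls[OF f(1) N f(3)] lin_mapD[OF f(1)])

text \<open>The common shape of the second Passi functor and of the abelianization with scalars: the
  functor laws hold for representatives and descend.\<close>

lemma covariant_quotient_functor:
  fixes Y N :: "nat \<Rightarrow> ('x \<Rightarrow>\<^sub>0 'k::field) set"
  assumes Y: "\<And>m. lin_sub (Y m)" and N: "\<And>m. lin_sub (N m)"
    and F: "\<And>a b g. lin_map (F a b g)" "\<And>a b g. g \<in> gr a b \<Longrightarrow> F a b g ` Y a \<subseteq> Y b"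
      "\<And>a b g. g \<in> gr a b \<Longrightarrow> F a b g ` N a \<subseteq> N b"
    and id: "\<And>a y. y \<in> Y a \<Longrightarrow> F a a (\<lambda>x\<in>carrier (Fr a). x) y = y"
    and comp: "\<And>a b c g h y. g \<in> gr a b \<Longrightarrow> h \<in> gr b c \<Longrightarrow> y \<in> Y a \<Longrightarrow>
        F a c (compose (carrier (Fr a)) h g) y = F b c h (F a b g y)"
  shows "covariant_functor \<lparr>obj = \<lambda>m. quot_vs (pm_vs (Y m)) (N m),
     mor = \<lambda>a b g. quot_map (pm_vs (Y b)) (N b) (F a b g)\<rparr>"
  unfolding covariant_functor_def gr_functor.simps
proof (intro conjI allI ballI)
  show "module KK (quot_vs (pm_vs (Y m)) (N m))" for m by (rule module_quot_vs[OF Y N])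
  show "quot_map (pm_vs (Y b)) (N b) (F a b g) \<in> linear_maps (quot_vs (pm_vs (Y a)) (N a)) (quot_vs (pm_vs (Y b)) (N b))"
    if "g \<in> gr a b" for a b g
    by (rule quot_map_linear[OF Y Y N N F(1) F(2)[OF that] F(3)[OF that]])
next
  fix a v assume "v \<in> carrier (quot_vs (pm_vs (Y a)) (N a))"
  then obtain y where y: "y \<in> Y a" "v = cls (N a) y" by (auto simp: quot_vs_simps N)
  show "quot_map (pm_vs (Y a)) (N a) (F a a (\<lambda>x\<in>carrier (Fr a). x)) v = v"
    unfolding y(2) quot_map_cls[OF F(1) N N F(3)[OF id_in_gr]] id[OF y(1)] ..
next
  fix a b c g h v assume g: "g \<in> gr a b" and h: "h \<in> gr b c" and "v \<in> carrier (quot_vs (pm_vs (Y a)) (N a))"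
  then obtain y where y: "y \<in> Y a" "v = cls (N a) y" by (auto simp: quot_vs_simps N)
  show "quot_map (pm_vs (Y c)) (N c) (F a c (compose (carrier (Fr a)) h g)) v =
      quot_map (pm_vs (Y c)) (N c) (F b c h) (quot_map (pm_vs (Y b)) (N b) (F a b g) v)"
    unfolding y(2) quot_map_cls[OF F(1) N N F(3)[OF compose_in_gr[OF g h]]] quot_map_cls[OF F(1) N N F(3)[OF g]]
      quot_map_cls[OF F(1) N N F(3)[OF h]] comp[OF g h y(1)] ..
qed

text \<open>The common shape of the tensor product over S2 and of the symmetric square: the maps of
  generators satisfy the functor laws strictly and send every relation to a relation, so no
  computation in the quotient is left.\<close>

lemma contravariant_presented_functor:
  fixes B :: "nat \<Rightarrow> 'x set" and R :: "nat \<Rightarrow> ('x \<Rightarrow>\<^sub>0 'k::field) set"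
  assumes R: "\<And>m. R m \<subseteq> carrier (free_vs (B m))"
    and h: "\<And>a b g x. g \<in> gr a b \<Longrightarrow> x \<in> B b \<Longrightarrow> h a b g x \<in> B a"
      "\<And>a b g r. g \<in> gr a b \<Longrightarrow> r \<in> R b \<Longrightarrow> lin_ext (\<lambda>x. gen (h a b g x)) r \<in> R a"
    and id: "\<And>a x. x \<in> B a \<Longrightarrow> h a a (\<lambda>x\<in>carrier (Fr a). x) x = x"
    and comp: "\<And>a b c g k x. g \<in> gr a b \<Longrightarrow> k \<in> gr b c \<Longrightarrow> x \<in> B c \<Longrightarrow>
        h a c (compose (carrier (Fr a)) k g) x = h a b g (h b c k x)"
  shows "contravariant_functor \<lparr>obj = \<lambda>m. presented (B m) (R m),
     mor = \<lambda>a b g. presented_map (B a) (R a) (\<lambda>x. gen (h a b g x))\<rparr>"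
  unfolding contravariant_functor_def gr_functor.simps
proof (intro conjI allI ballI)
  have hR: "lin_ext (\<lambda>x. gen (h a b g x)) r \<in> rel_span (B a) (R a)" if "g \<in> gr a b" "r \<in> R b" for a b g r
    by (rule rel_span(2)[OF R h(2)[OF that]])
  have cl: "presented_map (B a) (R a) (\<lambda>x. gen (h a b g x)) (cls (rel_span (B b) (R b)) y) =
      cls (rel_span (B a) (R a)) (lin_ext (\<lambda>x. gen (h a b g x)) y)" if "g \<in> gr a b" for a b g y
    by (rule presented_map_cls[OF R R hR[OF that]])
  show "module KK (presented (B m) (R m))" for m by (rule module_presented[OF R])
  show "presented_map (B a) (R a) (\<lambda>x. gen (h a b g x)) \<in> linear_maps (presented (B b) (R b)) (presented (B a) (R a))"
    if "g \<in> gr a b" for a b g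
    by (rule presented_map_linear[OF R R hR[OF that]]) (use h(1)[OF that] in auto)
  show "presented_map (B a) (R a) (\<lambda>x. gen (h a a (\<lambda>x\<in>carrier (Fr a). x) x)) v = v"
    if v: "v \<in> carrier (presented (B a) (R a))" for a v
  proof -
    obtain y where y: "Poly_Mapping.keys y \<subseteq> B a" "v = cls (rel_span (B a) (R a)) y"
      using v by (auto simp: presented_simps[OF R])
    have "lin_ext (\<lambda>x. gen (h a a (\<lambda>x\<in>carrier (Fr a). x) x)) y = lin_ext gen y"
      by (rule lin_ext_cong) (use id y(1) in auto)
    then show ?thesis unfolding y(2) cl[OF id_in_gr] by (simp add: lin_ext_gen_id)
  qed
  fix a b c g k v assume g: "g \<in> gr a b" and k: "k \<in> gr b c" and "v \<in> carrier (presented (B c) (R c))"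
  then obtain y where y: "Poly_Mapping.keys y \<subseteq> B c" "v = cls (rel_span (B c) (R c)) y"
    by (auto simp: presented_simps[OF R])
  have "lin_ext (\<lambda>x. gen (h a c (compose (carrier (Fr a)) k g) x)) y = lin_ext (\<lambda>x. gen (h a b g (h b c k x))) y"
    by (rule lin_ext_cong) (use comp[OF g k] y(1) in auto)
  then show "presented_map (B a) (R a) (\<lambda>x. gen (h a c (compose (carrier (Fr a)) k g) x)) v =
     presented_map (B a) (R a) (\<lambda>x. gen (h a b g x)) (presented_map (B b) (R b) (\<lambda>x. gen (h b c k x)) v)"
    unfolding y(2) cl[OF compose_in_gr[OF g k]] cl[OF k] cl[OF g] by (simp add: lin_ext_lin_ext)
qed

section \<open>Bilinear relations\<close>

lemma bilin_relsE:
  assumes "r \<in> bilin_rels V W"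
  obtains (left) v v' w where "r = gen (v \<oplus>\<^bsub>V\<^esub> v', w) - gen (v, w) - gen (v', w)"
      "v \<in> carrier V" "v' \<in> carrier V" "w \<in> carrier W"
    | (right) v w w' where "r = gen (v, w \<oplus>\<^bsub>W\<^esub> w') - gen (v, w) - gen (v, w')"
      "v \<in> carrier V" "w \<in> carrier W" "w' \<in> carrier W"
    | (left_smult) c v w where "r = gen (c \<odot>\<^bsub>V\<^esub> v, w) - scale c (gen (v, w))" "v \<in> carrier V" "w \<in> carrier W"
    | (right_smult) c v w where "r = gen (v, c \<odot>\<^bsub>W\<^esub> w) - scale c (gen (v, w))" "v \<in> carrier V" "w \<in> carrier W"
  using assms unfolding bilin_rels_def by (elim UnE CollectE exE conjE) metis+

lemma bilin_relsI:
  "v \<in> carrier V \<Longrightarrow> v' \<in> carrier V \<Longrightarrow> w \<in> carrier W \<Longrightarrow> gen (v \<oplus>\<^bsub>V\<^esub> v', w) - gen (v, w) - gen (v', w) \<in> bilin_rels V W"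
  "v \<in> carrier V \<Longrightarrow> w \<in> carrier W \<Longrightarrow> w' \<in> carrier W \<Longrightarrow> gen (v, w \<oplus>\<^bsub>W\<^esub> w') - gen (v, w) - gen (v, w') \<in> bilin_rels V W"
  "v \<in> carrier V \<Longrightarrow> w \<in> carrier W \<Longrightarrow> gen (c \<odot>\<^bsub>V\<^esub> v, w) - scale c (gen (v, w)) \<in> bilin_rels V W"
  "v \<in> carrier V \<Longrightarrow> w \<in> carrier W \<Longrightarrow> gen (v, c \<odot>\<^bsub>W\<^esub> w) - scale c (gen (v, w)) \<in> bilin_rels V W"
  unfolding bilin_rels_def by blast+

lemma bilin_rels_carrier:
  fixes V :: "('k::field, 'v) module" and W :: "('k, 'w) module"
  assumes "module KK V" "module KK W"
  shows "bilin_rels V W \<subseteq> carrier (free_vs (carrier V \<times> carrier W))"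
proof
  interpret V: module KK V by fact
  interpret W: module KK W by fact
  define K where "K = {a :: _ \<Rightarrow>\<^sub>0 'k. Poly_Mapping.keys a \<subseteq> carrier V \<times> carrier W}"
  have K: "lin_sub K" unfolding K_def by (rule lin_sub_keys)
  have g: "gen (v, w) \<in> K" if "v \<in> carrier V" "w \<in> carrier W" for v w using that by (simp add: K_def)
  have s: "c \<odot>\<^bsub>V\<^esub> v \<in> carrier V" "d \<odot>\<^bsub>W\<^esub> w \<in> carrier W" if "v \<in> carrier V" "w \<in> carrier W" for c d v w
    using V.smult_closed[of c v] W.smult_closed[of d w] that by simp_all
  fix r assume "r \<in> bilin_rels V W"
  then have "r \<in> K"
  proof (cases rule: bilin_relsE)
    case (left v v' w) then show ?thesis by (auto intro!: lin_subD(5)[OF K] g)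
  next
    case (right v w w') then show ?thesis by (auto intro!: lin_subD(5)[OF K] g)
  next
    case (left_smult c v w) then show ?thesis using s by (auto intro!: lin_subD(5)[OF K] lin_subD(3)[OF K] g)
  next
    case (right_smult c v w) then show ?thesis using s by (auto intro!: lin_subD(5)[OF K] lin_subD(3)[OF K] g)
  qed
  then show "r \<in> carrier (free_vs (carrier V \<times> carrier W))" by (simp add: K_def)
qed

lemma bilin_rels_map:
  assumes F: "F \<in> linear_maps V V'" and G: "G \<in> linear_maps W W'" and r: "r \<in> bilin_rels V W"
  shows "lin_ext (\<lambda>(v, w). gen (F v, G w)) r \<in> bilin_rels V' W'"
  using r
proof (cases rule: bilin_relsE)
  case (left v v' w)
  then show ?thesis using bilin_relsI(1)[of "F v" V' "F v'" "G w" W'] linear_mapsD[OF F] linear_mapsD[OF G] by (simp add: lin_ext_simps)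
next
  case (right v w w')
  then show ?thesis using bilin_relsI(2)[of "F v" V' "G w" W' "G w'"] linear_mapsD[OF F] linear_mapsD[OF G] by (simp add: lin_ext_simps)
next
  case (left_smult c v w)
  then show ?thesis using bilin_relsI(3)[of "F v" V' "G w" W' c] linear_mapsD[OF F] linear_mapsD[OF G] by (simp add: lin_ext_simps)
next
  case (right_smult c v w)
  then show ?thesis using bilin_relsI(4)[of "F v" V' "G w" W' c] linear_mapsD[OF F] linear_mapsD[OF G] by (simp add: lin_ext_simps)
qed

lemma lin_ext_bilin_rels:
  fixes V :: "('k::field, 'v) module" and b :: "'v \<Rightarrow> 'w \<Rightarrow> ('y \<Rightarrow>\<^sub>0 'k)"
  assumes "\<And>v v' w. v \<in> carrier V \<Longrightarrow> v' \<in> carrier V \<Longrightarrow> w \<in> carrier W \<Longrightarrow> b (v \<oplus>\<^bsub>V\<^esub> v') w = b v w + b v' w"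
    "\<And>v w w'. v \<in> carrier V \<Longrightarrow> w \<in> carrier W \<Longrightarrow> w' \<in> carrier W \<Longrightarrow> b v (w \<oplus>\<^bsub>W\<^esub> w') = b v w + b v w'"
    "\<And>c v w. v \<in> carrier V \<Longrightarrow> w \<in> carrier W \<Longrightarrow> b (c \<odot>\<^bsub>V\<^esub> v) w = scale c (b v w)"
    "\<And>c v w. v \<in> carrier V \<Longrightarrow> w \<in> carrier W \<Longrightarrow> b v (c \<odot>\<^bsub>W\<^esub> w) = scale c (b v w)"
    and r: "r \<in> bilin_rels V W"
  shows "lin_ext (\<lambda>(v, w). b v w) r = 0"
  using r by (cases rule: bilin_relsE) (simp_all add: lin_ext_simps assms(1-4))


section \<open>Quadratic functions on free groups\<close>

definition polarization :: "nat \<Rightarrow> (word \<Rightarrow> 'k::field) \<Rightarrow> word \<Rightarrow> word \<Rightarrow> 'k" where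
  "polarization m \<phi> x y = \<phi> (x \<otimes>\<^bsub>Fr m\<^esub> y) - \<phi> x - \<phi> y"

text \<open>Polynomial functions of degree at most two in the sense of Passi, without constant
  term.\<close>

definition quadratic :: "nat \<Rightarrow> (word \<Rightarrow> 'k::field) \<Rightarrow> bool" where
  "quadratic m \<phi> \<longleftrightarrow> \<phi> [] = 0 \<and> (\<forall>x\<in>carrier (Fr m). \<forall>y\<in>carrier (Fr m). \<forall>z\<in>carrier (Fr m).
     polarization m \<phi> (x \<otimes>\<^bsub>Fr m\<^esub> y) z = polarization m \<phi> x z + polarization m \<phi> y z \<and>
     polarization m \<phi> z (x \<otimes>\<^bsub>Fr m\<^esub> y) = polarization m \<phi> z x + polarization m \<phi> z y)"

lemma quadraticD:
  assumes "quadratic m \<phi>"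
  shows "\<phi> [] = 0"
    "x \<in> carrier (Fr m) \<Longrightarrow> y \<in> carrier (Fr m) \<Longrightarrow> z \<in> carrier (Fr m) \<Longrightarrow>
       polarization m \<phi> (x \<otimes>\<^bsub>Fr m\<^esub> y) z = polarization m \<phi> x z + polarization m \<phi> y z"
    "x \<in> carrier (Fr m) \<Longrightarrow> y \<in> carrier (Fr m) \<Longrightarrow> z \<in> carrier (Fr m) \<Longrightarrow>
       polarization m \<phi> z (x \<otimes>\<^bsub>Fr m\<^esub> y) = polarization m \<phi> z x + polarization m \<phi> z y"
  using assms unfolding quadratic_def by blast+

lemma polarization_linear:
  "polarization m (\<lambda>x. \<phi> x + \<psi> x) x y = polarization m \<phi> x y + polarization m \<psi> x y"
  "polarization m (\<lambda>x. c * \<phi> x) x y = c * polarization m \<phi> x y"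
  "polarization m (\<lambda>x. \<Sum>k\<in>A. f k x) x y = (\<Sum>k\<in>A. polarization m (f k) x y)"
  by (simp_all add: polarization_def algebra_simps sum_subtractf sum.distrib)

lemma quadratic_add: "quadratic m \<phi> \<Longrightarrow> quadratic m \<psi> \<Longrightarrow> quadratic m (\<lambda>x. \<phi> x + \<psi> x)"
  unfolding quadratic_def polarization_linear by simp

lemma quadratic_scale: "quadratic m \<phi> \<Longrightarrow> quadratic m (\<lambda>x. c * \<phi> x)"
  unfolding quadratic_def polarization_linear by (simp add: algebra_simps)

lemma quadratic_sum: "(\<And>k. k \<in> A \<Longrightarrow> quadratic m (f k)) \<Longrightarrow> quadratic m (\<lambda>x. \<Sum>k\<in>A. f k x)"
  unfolding quadratic_def polarization_linear by (simp add: sum.distrib)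

lemma polarization_count_pairs:
  "polarization m (count_pairs i j) x y = count_letter i x * count_letter j y"
  by (simp add: polarization_def count_pairs_mult)

lemma quadratic_count_pairs: "quadratic m (count_pairs i j)"
  unfolding quadratic_def polarization_count_pairs by (simp add: count_letter_mult algebra_simps)

lemma polarization_inv:
  assumes "x \<in> carrier (Fr m)" "y \<in> carrier (Fr m)"
  shows "polarization m (\<lambda>x. \<phi> (inv\<^bsub>Fr m\<^esub> x)) x y = polarization m \<phi> (inv\<^bsub>Fr m\<^esub> y) (inv\<^bsub>Fr m\<^esub> x)"
  using group.inv_mult_group[OF group_Fr assms] by (simp add: polarization_def)

lemma inv_Nil: "inv\<^bsub>Fr m\<^esub> [] = []"
  using monoid.inv_one[OF group.is_monoid[OF group_Fr[of m]]] by (simp add: one_Fr)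

lemma quadratic_inv:
  assumes "quadratic m \<phi>" shows "quadratic m (\<lambda>x. \<phi> (inv\<^bsub>Fr m\<^esub> x))"
proof -
  interpret group "Fr m" by (rule group_Fr)
  show ?thesis
    unfolding quadratic_def
    using quadraticD[OF assms] by (simp add: polarization_inv inv_Nil inv_mult_group)
qed

lemma additive_zero:
  fixes \<phi> :: "word \<Rightarrow> 'k::field"
  assumes add: "\<And>x y. x \<in> carrier (Fr m) \<Longrightarrow> y \<in> carrier (Fr m) \<Longrightarrow> \<phi> (x \<otimes>\<^bsub>Fr m\<^esub> y) = \<phi> x + \<phi> y"
    and gens: "\<And>p. p < m \<Longrightarrow> \<phi> [(p, True)] = 0" and x: "x \<in> carrier (Fr m)"
  shows "\<phi> x = 0"
proof -
  interpret group "Fr m" by (rule group_Fr)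
  have "\<phi> (\<one>\<^bsub>Fr m\<^esub> \<otimes>\<^bsub>Fr m\<^esub> \<one>\<^bsub>Fr m\<^esub>) = \<phi> \<one>\<^bsub>Fr m\<^esub> + \<phi> \<one>\<^bsub>Fr m\<^esub>" by (rule add) auto
  then have "\<phi> [] = \<phi> [] + \<phi> []" unfolding one_Fr mult_Fr append_Nil reduce_simps(1) .
  then have one: "\<phi> [] = 0" using add_cancel_right_right[of "\<phi> []" "\<phi> []"] by blast
  have letter: "\<phi> [(p, e)] = 0" if p: "p < m" for p e
  proof (cases e)
    case False
    have inv: "inv\<^bsub>Fr m\<^esub> [(p, True)] \<otimes>\<^bsub>Fr m\<^esub> [(p, True)] = []"
      using l_inv[OF letter_in_Fr[OF p]] by (simp only: one_Fr)
    have "\<phi> (inv\<^bsub>Fr m\<^esub> [(p, True)] \<otimes>\<^bsub>Fr m\<^esub> [(p, True)]) = \<phi> (inv\<^bsub>Fr m\<^esub> [(p, True)]) + \<phi> [(p, True)]"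
      by (rule add) (use letter_in_Fr[OF p] in auto)
    then have "\<phi> [] = \<phi> (inv\<^bsub>Fr m\<^esub> [(p, True)]) + \<phi> [(p, True)]" unfolding inv .
    then show ?thesis using one gens[OF p] inv_letter[OF p] False by simp
  qed (use gens[OF p] in simp)
  show ?thesis
    using x
  proof (induction rule: Fr_induct)
    case (mult i e y)
    then show ?case using add[OF letter_in_Fr[OF mult(1)] mult(2)] letter by simp
  qed (rule one)
qed

text \<open>The additive case, applied to one argument after the other, makes the polarization
  vanish. Then the function itself is additive and the additive case applies once more.\<close>

lemma quadratic_zero:
  assumes q: "quadratic m \<phi>" and gens: "\<And>p. p < m \<Longrightarrow> \<phi> [(p, True)] = 0"
    "\<And>p q. p < m \<Longrightarrow> q < m \<Longrightarrow> polarization m \<phi> [(p, True)] [(q, True)] = 0"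
    and x: "x \<in> carrier (Fr m)"
  shows "\<phi> x = 0"
proof -
  have 1: "polarization m \<phi> [(p, True)] y = 0" if "p < m" "y \<in> carrier (Fr m)" for p y
    by (rule additive_zero[where \<phi> = "polarization m \<phi> [(p, True)]" and m = m])
      (use that quadraticD(3)[OF q] letter_in_Fr gens(2) in auto)
  have 2: "polarization m \<phi> x y = 0" if "x \<in> carrier (Fr m)" "y \<in> carrier (Fr m)" for x y
    by (rule additive_zero[where \<phi> = "\<lambda>x. polarization m \<phi> x y" and m = m])
      (use that quadraticD(2)[OF q] 1 in auto)
  show ?thesis
  proof (rule additive_zero[where \<phi> = \<phi> and m = m, OF _ gens(1) x])
    fix x y assume "x \<in> carrier (Fr m)" "y \<in> carrier (Fr m)"
    from 2[OF this] show "\<phi> (x \<otimes>\<^bsub>Fr m\<^esub> y) = \<phi> x + \<phi> y" by (simp add: polarization_def algebra_simps)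
  qed
qed

text \<open>
  The component of \<open>\<phi>\<close> dual to the ordered pair of generators \<open>p\<close>, \<open>q\<close>. Since inversion exchanges the
  two arguments of the polarization, \<open>count_pairs i j\<close> with \<open>i \<le> j\<close> suffices; for \<open>p = q\<close> the
  coefficients are determined by the values \<open>1\<close> and \<open>0\<close> of the two functions at the generator.
\<close>

definition quad_part :: "nat \<Rightarrow> (word \<Rightarrow> 'k::field) \<Rightarrow> nat \<Rightarrow> nat \<Rightarrow> word \<Rightarrow> 'k" where
  "quad_part m \<phi> p q x = (let b = polarization m \<phi> [(p, True)] [(q, True)] in
     if p < q then b * count_pairs p q x
     else if q < p then b * count_pairs q p (inv\<^bsub>Fr m\<^esub> x)
     else \<phi> [(p, True)] * count_pairs p p x + (b - \<phi> [(p, True)]) * count_pairs p p (inv\<^bsub>Fr m\<^esub> x))"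

lemma quad_part_eq:
  "quad_part m \<phi> p q = (let b = polarization m \<phi> [(p, True)] [(q, True)] in
     if p < q then (\<lambda>x. b * count_pairs p q x)
     else if q < p then (\<lambda>x. b * count_pairs q p (inv\<^bsub>Fr m\<^esub> x))
     else (\<lambda>x. \<phi> [(p, True)] * count_pairs p p x + (b - \<phi> [(p, True)]) * count_pairs p p (inv\<^bsub>Fr m\<^esub> x)))"
  by (auto simp: fun_eq_iff quad_part_def Let_def)

lemma quadratic_quad_part: "quadratic m (quad_part m \<phi> p q)"
proof -
  show ?thesis
    unfolding quad_part_eq Let_def
    by (auto intro!: quadratic_add quadratic_scale quadratic_count_pairs quadratic_inv[of m "count_pairs _ _"])
qed

text \<open>The parts are separated by the generators: each one sees the polarization at a single
  ordered pair, and a diagonal one also the value at its generator.\<close>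

lemma quad_part_gens:
  assumes "r < m" "s < m"
  shows "quad_part m \<phi> p q [(r, True)] = (if p = q \<and> q = r then \<phi> [(r, True)] else 0)"
    "polarization m (quad_part m \<phi> p q) [(r, True)] [(s, True)] =
       (if p = r \<and> q = s then polarization m \<phi> [(r, True)] [(s, True)] else 0)"
proof -
  have c: "[(r, True)] \<in> carrier (Fr m)" "[(s, True)] \<in> carrier (Fr m)" using assms by (auto intro: letter_in_Fr)
  show "quad_part m \<phi> p q [(r, True)] = (if p = q \<and> q = r then \<phi> [(r, True)] else 0)"
    using assms by (auto simp: quad_part_def Let_def inv_letter)
  have P: "polarization m (\<lambda>x. count_pairs u t (inv\<^bsub>Fr m\<^esub> x)) [(r, True)] [(s, True)] =
     (if u = s \<and> t = r then 1 else 0 :: 'a)" for u t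
    by (subst polarization_inv[OF c]) (simp add: polarization_count_pairs inv_letter assms letter_sign_def)
  show "polarization m (quad_part m \<phi> p q) [(r, True)] [(s, True)] =
       (if p = r \<and> q = s then polarization m \<phi> [(r, True)] [(s, True)] else 0)"
    unfolding quad_part_eq Let_def
    by (auto simp: polarization_linear P polarization_count_pairs letter_sign_def)
qed

text \<open>The function and the sum of its parts have the same values and polarizations at
  generators, and these determine a quadratic function.\<close>

lemma quadratic_decomposition:
  assumes q: "quadratic m \<phi>" and x: "x \<in> carrier (Fr m)"
  shows "\<phi> x = (\<Sum>p<m. \<Sum>q<m. quad_part m \<phi> p q x)"
proof -
  \<comment> \<open>The difference is written with a factor -1, to fit the closure properties under
    sums and multiples.\<close>
  let ?\<psi> = "\<lambda>x. \<phi> x + (- 1) * (\<Sum>p<m. \<Sum>q<m. quad_part m \<phi> p q x)"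
  have "?\<psi> x = 0"
  proof (rule quadratic_zero[OF _ _ _ x])
    show "quadratic m ?\<psi>"
      by (intro quadratic_add quadratic_scale quadratic_sum quadratic_quad_part q)
    fix r assume r: "r < m"
    have "(if p = q \<and> q = r then c else 0) = (if q = r then if p = r then c else 0 else 0)" for p q and c :: 'a
      by auto
    then have "(\<Sum>p<m. \<Sum>q<m. if p = q \<and> q = r then c else 0) = c" for c :: 'a
      using r by simp
    then show "?\<psi> [(r, True)] = 0" by (simp only: quad_part_gens[OF r r]) simp
    fix s assume s: "s < m"
    have "(\<Sum>p<m. \<Sum>q<m. if p = r \<and> q = s then c else 0) =
        (\<Sum>p<m. if p = r then (\<Sum>q<m. if q = s then c else 0) else 0)" for c :: 'a
      by (intro sum.cong) auto
    then show "polarization m ?\<psi> [(r, True)] [(s, True)] = 0"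
      using r s unfolding polarization_linear by (simp add: quad_part_gens[OF r s])
  qed
  then show ?thesis by simp
qed


section \<open>The dual of the second Passi functor\<close>

text \<open>A linear form, coded as a linear map to the free space on one point, so that the rules
  for \<open>lin_ext\<close> apply to it.\<close>

definition lin_fun :: "('x \<Rightarrow> 'k::field) \<Rightarrow> ('x \<Rightarrow>\<^sub>0 'k) \<Rightarrow> 'k" where
  "lin_fun f a = Poly_Mapping.lookup (lin_ext (\<lambda>x. Poly_Mapping.single () (f x)) a) ()"

lemma lin_fun_simps:
  "lin_fun f (a + b) = lin_fun f a + lin_fun f b" "lin_fun f (a - b) = lin_fun f a - lin_fun f b"
  "lin_fun f (scale c a) = c * lin_fun f a" "lin_fun f (gen x) = f x" "lin_fun f 0 = 0"
  by (simp_all add: lin_fun_def lin_ext_simps lookup_add lookup_minus)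

lemma lin_fun_eq: "lin_fun f a = (\<Sum>x\<in>Poly_Mapping.keys a. Poly_Mapping.lookup a x * f x)"
  by (simp add: lin_fun_def lin_ext_def lookup_sum)

lemma lin_fun_lin_ext: "lin_fun f (lin_ext h a) = lin_fun (\<lambda>x. lin_fun f (h x)) a"
proof -
  have *: "lin_fun f (\<Sum>x\<in>A. k x) = (\<Sum>x\<in>A. lin_fun f (k x))" for A and k
    by (induction A rule: infinite_finite_induct) (auto simp: lin_fun_simps)
  show ?thesis unfolding lin_ext_def lin_fun_eq[of "\<lambda>x. lin_fun f (h x)"] by (simp add: * lin_fun_simps)
qed

lemma lin_fun_cong: "(\<And>x. x \<in> Poly_Mapping.keys a \<Longrightarrow> f x = h x) \<Longrightarrow> lin_fun f a = lin_fun h a"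
  by (simp add: lin_fun_eq)

lemma lin_fun_fun:
  "lin_fun (\<lambda>x. f x + h x) a = lin_fun f a + lin_fun h a"
  "lin_fun (\<lambda>x. c * f x) a = c * lin_fun f a" "lin_fun (\<lambda>x. f x * c) a = lin_fun f a * c"
  by (simp_all add: lin_fun_eq algebra_simps sum.distrib sum_distrib_left)

lemma lin_fun_const: "lin_fun (\<lambda>_. c) a = c * lin_fun (\<lambda>_. 1) a"
  by (simp add: lin_fun_eq sum_distrib_left mult.commute)

lemma lin_sub_lin_fun: "lin_sub {a. lin_fun f a = 0}"
  by (auto simp: lin_sub_def lin_fun_simps)

section \<open>The augmentation ideal and its cube\<close>

lemma group_alg_mult_eq: "group_alg_mult G a b = lin_ext (\<lambda>x. lin_ext (\<lambda>y. gen (x \<otimes>\<^bsub>G\<^esub> y)) b) a"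
proof -
  have *: "scale c (Poly_Mapping.single z d) = Poly_Mapping.single z (c * d)" for c d :: 'b and z :: 'a
    by (auto intro!: poly_mapping_eqI simp: lookup_single when_def)
  show ?thesis by (simp add: group_alg_mult_def lin_ext_def scale_sum gen_def *)
qed

lemma aug_ideal_eq: "aug_ideal G = {a. Poly_Mapping.keys a \<subseteq> carrier G} \<inter> {a. lin_fun (\<lambda>_. 1) a = 0}"
  by (auto simp: aug_ideal_def lin_fun_eq)

lemma lin_sub_aug_ideal: "lin_sub (aug_ideal G)"
  unfolding aug_ideal_eq by (intro lin_sub_Int lin_sub_keys lin_sub_lin_fun)

lemma gen_diff_aug_ideal: "x \<in> carrier G \<Longrightarrow> y \<in> carrier G \<Longrightarrow> gen x - gen y \<in> aug_ideal G"
  using lin_subD(5)[OF lin_sub_keys[of "carrier G"], of "gen x" "gen y"]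
  by (simp add: aug_ideal_eq lin_fun_simps)

lemma keys_group_alg_mult:
  assumes "group G" "Poly_Mapping.keys a \<subseteq> carrier G" "Poly_Mapping.keys b \<subseteq> carrier G"
  shows "Poly_Mapping.keys (group_alg_mult G a b) \<subseteq> carrier G"
proof -
  interpret group G by fact
  show ?thesis unfolding group_alg_mult_eq using assms(2,3) by (intro keys_lin_ext) auto
qed

lemma lin_fun_group_alg_mult:
  "lin_fun f (group_alg_mult G a b) = lin_fun (\<lambda>x. lin_fun (\<lambda>y. f (x \<otimes>\<^bsub>G\<^esub> y)) b) a"
  by (simp add: group_alg_mult_eq lin_fun_lin_ext lin_fun_simps)

abbreviation cube_gens :: "'a monoid \<Rightarrow> ('a \<Rightarrow>\<^sub>0 'k::field) set" where
  "cube_gens G \<equiv> {group_alg_mult G (group_alg_mult G a b) c | a b c.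
        a \<in> aug_ideal G \<and> b \<in> aug_ideal G \<and> c \<in> aug_ideal G}"

lemma aug_ideal_mult:
  assumes "group G" "a \<in> aug_ideal G" "b \<in> aug_ideal G"
  shows "group_alg_mult G a b \<in> aug_ideal G"
  using keys_group_alg_mult[OF assms(1), of a b] assms(2,3)
  by (auto simp: aug_ideal_eq lin_fun_group_alg_mult lin_fun_eq[of "\<lambda>_. 0"])

lemma cube_gens_aug: "group G \<Longrightarrow> cube_gens G \<subseteq> aug_ideal G"
  using aug_ideal_mult by blast

lemma aug_ideal_cube:
  fixes G :: "'a monoid"
  assumes "group G"
  shows "lin_sub (aug_ideal_cube G :: ('a \<Rightarrow>\<^sub>0 'k::field) set)" "(r :: 'a \<Rightarrow>\<^sub>0 'k) \<in> cube_gens G \<Longrightarrow> r \<in> aug_ideal_cube G"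
    "aug_ideal_cube G \<subseteq> (aug_ideal G :: ('a \<Rightarrow>\<^sub>0 'k::field) set)"
    "lin_sub (P :: ('a \<Rightarrow>\<^sub>0 'k) set) \<Longrightarrow> cube_gens G \<subseteq> P \<Longrightarrow> aug_ideal_cube G \<subseteq> P"
proof -
  have R: "cube_gens G \<subseteq> carrier (free_vs (carrier G) :: ('k, _) module)"
    using cube_gens_aug[OF assms] by (auto simp: aug_ideal_eq)
  show "lin_sub (aug_ideal_cube G :: ('a \<Rightarrow>\<^sub>0 'k::field) set)"
    unfolding aug_ideal_cube_def by (rule rel_span(1)[OF R])
  show "r \<in> cube_gens G \<Longrightarrow> r \<in> aug_ideal_cube G"
    unfolding aug_ideal_cube_def by (rule rel_span(2)[OF R])
  show least: "lin_sub P \<Longrightarrow> cube_gens G \<subseteq> P \<Longrightarrow> aug_ideal_cube G \<subseteq> P" for P :: "('a \<Rightarrow>\<^sub>0 'k) set"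
    unfolding aug_ideal_cube_def by (rule rel_span_least[OF R])
  show "aug_ideal_cube G \<subseteq> (aug_ideal G :: ('a \<Rightarrow>\<^sub>0 'k::field) set)"
    by (rule least[OF lin_sub_aug_ideal cube_gens_aug[OF assms]])
qed

lemma group_alg_mult_linear:
  "group_alg_mult G (a + a') b = group_alg_mult G a b + group_alg_mult G a' b"
  "group_alg_mult G a (b + b') = group_alg_mult G a b + group_alg_mult G a b'"
  by (simp_all add: group_alg_mult_eq lin_ext_simps) (simp add: lin_ext_def scale_add sum.distrib)

lemma group_alg_mult_assoc:
  assumes "group G" "Poly_Mapping.keys a \<subseteq> carrier G" "Poly_Mapping.keys b \<subseteq> carrier G" "Poly_Mapping.keys c \<subseteq> carrier G"
  shows "group_alg_mult G (group_alg_mult G a b) c = group_alg_mult G a (group_alg_mult G b c)"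
proof -
  interpret group G by fact
  have "group_alg_mult G (group_alg_mult G a b) c = lin_ext (\<lambda>x. lin_ext (\<lambda>y. lin_ext (\<lambda>z. gen (x \<otimes>\<^bsub>G\<^esub> y \<otimes>\<^bsub>G\<^esub> z)) c) b) a"
    by (simp add: group_alg_mult_eq lin_ext_lin_ext)
  also have "\<dots> = lin_ext (\<lambda>x. lin_ext (\<lambda>y. lin_ext (\<lambda>z. gen (x \<otimes>\<^bsub>G\<^esub> (y \<otimes>\<^bsub>G\<^esub> z))) c) b) a"
    by (intro lin_ext_cong) (use assms(2-) in \<open>auto simp: m_assoc subset_iff\<close>)
  also have "\<dots> = group_alg_mult G a (group_alg_mult G b c)"
    by (simp add: group_alg_mult_eq lin_ext_lin_ext)
  finally show ?thesis .
qed

lemma aug_idealD: "a \<in> aug_ideal G \<Longrightarrow> Poly_Mapping.keys a \<subseteq> carrier G" "a \<in> aug_ideal G \<Longrightarrow> lin_fun (\<lambda>_. 1) a = 0"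
  by (auto simp: aug_ideal_eq)

lemma aug_ideal_map:
  assumes "h ` carrier G \<subseteq> carrier H"
  shows "lin_ext (\<lambda>x. gen (h x)) ` aug_ideal G \<subseteq> aug_ideal H"
proof
  fix b assume "b \<in> lin_ext (\<lambda>x. gen (h x)) ` aug_ideal G"
  then obtain a where a: "a \<in> aug_ideal G" "b = lin_ext (\<lambda>x. gen (h x)) a" by blast
  have "Poly_Mapping.keys b \<subseteq> carrier H" unfolding a(2)
    by (rule keys_lin_ext) (use assms aug_idealD(1)[OF a(1)] in auto)
  moreover have "lin_fun (\<lambda>_. 1) b = 0"
    unfolding a(2) lin_fun_lin_ext using aug_idealD(2)[OF a(1)] by (simp add: lin_fun_simps)
  ultimately show "b \<in> aug_ideal H" by (simp add: aug_ideal_eq)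
qed

text \<open>Homomorphisms give the functor, and the case of an antihomomorphism gives the
  involution. The latter sends a triple product to the triple product in the opposite order, which
  is then associated to the left again.\<close>

lemma cube_map:
  fixes H :: "'b monoid"
  assumes G: "group G" and H: "group H" and h: "h ` carrier G \<subseteq> carrier H"
    and mult: "(\<forall>x\<in>carrier G. \<forall>y\<in>carrier G. h (x \<otimes>\<^bsub>G\<^esub> y) = h x \<otimes>\<^bsub>H\<^esub> h y) \<or>
      (\<forall>x\<in>carrier G. \<forall>y\<in>carrier G. h (x \<otimes>\<^bsub>G\<^esub> y) = h y \<otimes>\<^bsub>H\<^esub> h x)"
  shows "lin_ext (\<lambda>x. gen (h x)) ` aug_ideal_cube G \<subseteq> (aug_ideal_cube H :: ('b \<Rightarrow>\<^sub>0 'k::field) set)"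
proof -
  let ?h = "lin_ext (\<lambda>x. gen (h x)) :: _ \<Rightarrow> 'b \<Rightarrow>\<^sub>0 'k"
  have aug: "?h a \<in> aug_ideal H" if "a \<in> aug_ideal G" for a using aug_ideal_map[OF h] that by blast
  have swap: "lin_ext (\<lambda>x. lin_ext (\<lambda>y. k x y) b) a = lin_ext (\<lambda>y. lin_ext (\<lambda>x. k x y) a) b"
    for k :: "'a \<Rightarrow> 'a \<Rightarrow> 'b \<Rightarrow>\<^sub>0 'k" and a b
    unfolding lin_ext_def scale_sum by (subst sum.swap) (simp add: mult.commute)
  have "?h r \<in> aug_ideal_cube H" if rG: "r \<in> cube_gens G" for r
  proof -
    obtain a b c where r: "r = group_alg_mult G (group_alg_mult G a b) c"
      and abc: "a \<in> aug_ideal G" "b \<in> aug_ideal G" "c \<in> aug_ideal G" using rG by blast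
    note ka = aug_idealD(1)[OF abc(1)] and kb = aug_idealD(1)[OF abc(2)] and kc = aug_idealD(1)[OF abc(3)]
    note kab = keys_group_alg_mult[OF G ka kb]
    note habc = aug[OF abc(1)] aug[OF abc(2)] aug[OF abc(3)]
    from mult have "?h r \<in> cube_gens H"
    proof
      assume m: "\<forall>x\<in>carrier G. \<forall>y\<in>carrier G. h (x \<otimes>\<^bsub>G\<^esub> y) = h x \<otimes>\<^bsub>H\<^esub> h y"
      have hom: "?h (group_alg_mult G u v) = group_alg_mult H (?h u) (?h v)"
        if "Poly_Mapping.keys u \<subseteq> carrier G" "Poly_Mapping.keys v \<subseteq> carrier G" for u v
        unfolding group_alg_mult_eq lin_ext_lin_ext lin_ext_gen
        by (intro lin_ext_cong arg_cong[of _ _ gen]) (use m that in blast)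
      show ?thesis unfolding r hom[OF kab kc] hom[OF ka kb] using habc by blast
    next
      assume m: "\<forall>x\<in>carrier G. \<forall>y\<in>carrier G. h (x \<otimes>\<^bsub>G\<^esub> y) = h y \<otimes>\<^bsub>H\<^esub> h x"
      have anti: "?h (group_alg_mult G u v) = group_alg_mult H (?h v) (?h u)"
        if "Poly_Mapping.keys u \<subseteq> carrier G" "Poly_Mapping.keys v \<subseteq> carrier G" for u v
      proof -
        have "?h (group_alg_mult G u v) = lin_ext (\<lambda>x. lin_ext (\<lambda>y. gen (h y \<otimes>\<^bsub>H\<^esub> h x)) v) u"
          unfolding group_alg_mult_eq lin_ext_lin_ext lin_ext_gen
          by (intro lin_ext_cong arg_cong[of _ _ gen]) (use m that in blast)
        also have "\<dots> = group_alg_mult H (?h v) (?h u)"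
          unfolding group_alg_mult_eq lin_ext_lin_ext lin_ext_gen by (rule swap)
        finally show ?thesis .
      qed
      show ?thesis
        unfolding r anti[OF kab kc] anti[OF ka kb]
          group_alg_mult_assoc[OF H aug_idealD(1)[OF habc(3)] aug_idealD(1)[OF habc(2)] aug_idealD(1)[OF habc(1)], symmetric]
        using habc by blast
    qed
    then show ?thesis by (rule aug_ideal_cube(2)[OF H])
  qed
  then have "aug_ideal_cube G \<subseteq> {a. ?h a \<in> aug_ideal_cube H}"
    by (intro aug_ideal_cube(4)[OF G] lin_sub_vimage lin_map_lin_ext aug_ideal_cube(1)[OF H]) auto
  then show ?thesis by blast
qed

section \<open>The second Passi functor and its involution\<close>

lemma passi2_simps:
  "obj passi2 m = quot_vs (pm_vs (aug_ideal (Fr m))) (aug_ideal_cube (Fr m))"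
  "mor passi2 a b g = quot_map (pm_vs (aug_ideal (Fr b))) (aug_ideal_cube (Fr b)) (lin_ext (\<lambda>x. gen (g x)))"
  by (simp_all add: passi2_def aug_ideal_vs_eq)

lemmas lin_sub_cube = aug_ideal_cube(1)[OF group_Fr]

lemma passi2_obj_simps:
  "carrier (obj passi2 m) = cls (aug_ideal_cube (Fr m)) ` aug_ideal (Fr m)"
  "cls (aug_ideal_cube (Fr m)) u \<oplus>\<^bsub>obj passi2 m\<^esub> cls (aug_ideal_cube (Fr m)) v = cls (aug_ideal_cube (Fr m)) (u + v)"
  "c \<odot>\<^bsub>obj passi2 m\<^esub> cls (aug_ideal_cube (Fr m)) v = cls (aug_ideal_cube (Fr m)) (scale c v)"
  unfolding passi2_simps by (rule quot_vs_simps[OF lin_sub_cube])+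

lemma gr_cube_map: "g \<in> gr a b \<Longrightarrow> lin_ext (\<lambda>x. gen (g x)) ` aug_ideal_cube (Fr a) \<subseteq> aug_ideal_cube (Fr b)"
  using gr_closed[of g a b] gr_mult[of g a b] by (intro cube_map group_Fr) auto

lemma gr_aug_map: "g \<in> gr a b \<Longrightarrow> lin_ext (\<lambda>x. gen (g x)) ` aug_ideal (Fr a) \<subseteq> aug_ideal (Fr b)"
  using gr_closed[of g a b] by (intro aug_ideal_map) auto

lemma covariant_passi2: "covariant_functor (passi2 :: ('k::field, _) gr_functor)"
proof -
  have eq: "(passi2 :: ('k, _) gr_functor) = \<lparr>obj = \<lambda>m. quot_vs (pm_vs (aug_ideal (Fr m))) (aug_ideal_cube (Fr m)),
     mor = \<lambda>a b g. quot_map (pm_vs (aug_ideal (Fr b))) (aug_ideal_cube (Fr b)) (lin_ext (\<lambda>x. gen (g x)))\<rparr>"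
    by (simp add: passi2_def aug_ideal_vs_eq)
  show ?thesis
    unfolding eq
  proof (rule covariant_quotient_functor)
    show "lin_ext (\<lambda>x. gen ((\<lambda>x\<in>carrier (Fr a). x) x)) y = (y :: _ \<Rightarrow>\<^sub>0 'k)" if "y \<in> aug_ideal (Fr a)" for a y
    proof -
      have "lin_ext (\<lambda>x. gen ((\<lambda>x\<in>carrier (Fr a). x) x)) y = lin_ext gen y"
        by (rule lin_ext_cong) (use aug_idealD(1)[OF that] in auto)
      then show ?thesis by (simp add: lin_ext_gen_id)
    qed
    show "lin_ext (\<lambda>x. gen (compose (carrier (Fr a)) h g x)) y = lin_ext (\<lambda>x. gen (h x)) (lin_ext (\<lambda>x. gen (g x)) y :: _ \<Rightarrow>\<^sub>0 'k)"
      if "y \<in> aug_ideal (Fr a)" for a g h and y :: "word \<Rightarrow>\<^sub>0 'k"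
      unfolding lin_ext_lin_ext lin_ext_gen
      by (rule lin_ext_cong) (use aug_idealD(1)[OF that] in \<open>auto simp: compose_def\<close>)
  qed (simp_all add: lin_sub_aug_ideal lin_sub_cube lin_map_lin_ext gr_cube_map gr_aug_map)
qed

lemma inv_maps:
  "lin_ext (\<lambda>x. gen (inv\<^bsub>Fr m\<^esub> x)) ` aug_ideal_cube (Fr m) \<subseteq> aug_ideal_cube (Fr m)"
  "lin_ext (\<lambda>x. gen (inv\<^bsub>Fr m\<^esub> x)) ` aug_ideal (Fr m) \<subseteq> aug_ideal (Fr m)"
proof -
  interpret group "Fr m" by (rule group_Fr)
  have inv: "(\<lambda>x. inv\<^bsub>Fr m\<^esub> x) ` carrier (Fr m) \<subseteq> carrier (Fr m)" by auto
  show "lin_ext (\<lambda>x. gen (inv\<^bsub>Fr m\<^esub> x)) ` aug_ideal (Fr m) \<subseteq> aug_ideal (Fr m)"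
    by (rule aug_ideal_map[OF inv])
  show "lin_ext (\<lambda>x. gen (inv\<^bsub>Fr m\<^esub> x)) ` aug_ideal_cube (Fr m) \<subseteq> aug_ideal_cube (Fr m)"
    by (rule cube_map[OF group_Fr group_Fr inv]) (simp add: inv_mult_group)
qed

lemma passi2_involution_linear: "passi2_involution m \<in> linear_maps (obj passi2 m) (obj passi2 m)"
  unfolding passi2_involution_def aug_ideal_vs_eq passi2_simps
  by (rule quot_map_linear[OF lin_sub_aug_ideal lin_sub_aug_ideal lin_sub_cube lin_sub_cube lin_map_lin_ext inv_maps(2,1)])

abbreviation passi2_cls :: "nat \<Rightarrow> (word \<Rightarrow>\<^sub>0 'k::field) \<Rightarrow> (word \<Rightarrow>\<^sub>0 'k) set" where
  "passi2_cls m \<equiv> cls (aug_ideal_cube (Fr m))"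

lemma passi2_mor_cls: "g \<in> gr a b \<Longrightarrow> mor passi2 a b g (passi2_cls a y) = passi2_cls b (lin_ext (\<lambda>x. gen (g x)) y)"
  unfolding passi2_simps by (rule quot_map_cls[OF lin_map_lin_ext lin_sub_cube lin_sub_cube gr_cube_map])

lemma passi2_involution_cls: "passi2_involution m (passi2_cls m y) = passi2_cls m (lin_ext (\<lambda>x. gen (inv\<^bsub>Fr m\<^esub> x)) y)"
  unfolding passi2_involution_def aug_ideal_vs_eq
  by (rule quot_map_cls[OF lin_map_lin_ext lin_sub_cube lin_sub_cube inv_maps(1)])

section \<open>Linear forms as quadratic functions\<close>

abbreviation passi2_dual :: "nat \<Rightarrow> ('k::field, (word \<Rightarrow>\<^sub>0 'k) set \<Rightarrow> 'k) module" where
  "passi2_dual m \<equiv> dual (obj passi2 m)"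

definition dual_fun :: "nat \<Rightarrow> ((word \<Rightarrow>\<^sub>0 'k::field) set \<Rightarrow> 'k) \<Rightarrow> word \<Rightarrow> 'k" where
  "dual_fun m f x = f (passi2_cls m (gen x - gen []))"

lemma Nil_in_Fr: "[] \<in> carrier (Fr m)"
  by (simp add: carrier_Fr)

lemma passi2_cls_carrier: "y \<in> aug_ideal (Fr m) \<Longrightarrow> passi2_cls m y \<in> carrier (obj passi2 m)"
  by (simp add: passi2_obj_simps)

lemma passi2_dualD:
  assumes f: "f \<in> carrier (passi2_dual m)"
  shows "y \<in> aug_ideal (Fr m) \<Longrightarrow> z \<in> aug_ideal (Fr m) \<Longrightarrow> f (passi2_cls m (y + z)) = f (passi2_cls m y) + f (passi2_cls m z)"
    "y \<in> aug_ideal (Fr m) \<Longrightarrow> f (passi2_cls m (scale c y)) = c * f (passi2_cls m y)"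
    "y \<in> aug_ideal_cube (Fr m) \<Longrightarrow> f (passi2_cls m y) = 0"
proof -
  show "y \<in> aug_ideal (Fr m) \<Longrightarrow> z \<in> aug_ideal (Fr m) \<Longrightarrow> f (passi2_cls m (y + z)) = f (passi2_cls m y) + f (passi2_cls m z)"
    using dual_carrierD(1)[OF f passi2_cls_carrier passi2_cls_carrier, of y z] by (simp add: passi2_obj_simps)
  show sc: "y \<in> aug_ideal (Fr m) \<Longrightarrow> f (passi2_cls m (scale c y)) = c * f (passi2_cls m y)" for c y
    using dual_carrierD(2)[OF f passi2_cls_carrier, of y c] by (simp add: passi2_obj_simps)
  assume "y \<in> aug_ideal_cube (Fr m)"
  then have "passi2_cls m y = passi2_cls m 0" by (simp add: cls_eq_iff[OF lin_sub_cube])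
  then show "f (passi2_cls m y) = 0" using sc[OF lin_subD(1)[OF lin_sub_aug_ideal], of 0] by simp
qed

lemma dual_fun_dual_map: "g \<in> gr a b \<Longrightarrow> x \<in> carrier (Fr a) \<Longrightarrow>
    dual_fun a (dual_map (obj passi2 a) (mor passi2 a b g) f) x = dual_fun b f (g x)"
  by (simp add: dual_fun_def dual_map_def passi2_mor_cls lin_ext_simps gr_one passi2_cls_carrier gen_diff_aug_ideal Nil_in_Fr)

lemma dual_fun_involution: "x \<in> carrier (Fr m) \<Longrightarrow>
    dual_fun m (dual_map (obj passi2 m) (passi2_involution m) f) x = dual_fun m f (inv\<^bsub>Fr m\<^esub> x)"
  by (simp add: dual_fun_def dual_map_def passi2_involution_cls lin_ext_simps inv_Nil passi2_cls_carrier gen_diff_aug_ideal Nil_in_Fr)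

lemma passi2_dual_eqI:
  fixes f h :: "(word \<Rightarrow>\<^sub>0 'k::field) set \<Rightarrow> 'k"
  assumes f: "f \<in> carrier (passi2_dual m)" and h: "h \<in> carrier (passi2_dual m)"
    and eq: "\<And>x. x \<in> carrier (Fr m) \<Longrightarrow> dual_fun m f x = dual_fun m h x"
  shows "f = h"
proof (rule dual_ext[OF f h])
  fix C assume "C \<in> carrier (obj passi2 m :: ('k, _) module)"
  then obtain a where a: "a \<in> aug_ideal (Fr m)" "C = passi2_cls m a" by (auto simp: passi2_obj_simps)
  \<comment> \<open>The differences \<open>gen x - gen []\<close> span the augmentation ideal:
    subtracting \<open>gen []\<close> in every term changes \<open>a\<close> by the sum of its
    coefficients times \<open>gen []\<close>, and this sum is 0.\<close>
  have "lin_ext (\<lambda>x. gen x - gen []) a = lin_ext gen a - scale (lin_fun (\<lambda>_. 1) a) (gen [])"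
    by (simp add: lin_ext_def lin_fun_eq scale_diff sum_subtractf scale_sum_left)
  then have aX: "lin_ext (\<lambda>x. gen x - gen []) a = a"
    using aug_idealD(2)[OF a(1)] by (simp add: lin_ext_gen_id)
  have "lin_ext (\<lambda>x. gen x - gen []) a \<in> {a \<in> aug_ideal (Fr m). f (passi2_cls m a) = h (passi2_cls m a)}"
  proof (rule lin_sub_lin_ext)
    show "lin_sub {a \<in> aug_ideal (Fr m). f (passi2_cls m a) = h (passi2_cls m a)}"
      using lin_subD[OF lin_sub_aug_ideal[of "Fr m"]] passi2_dualD(1,2)[OF f] passi2_dualD(1,2)[OF h]
        passi2_dualD(3)[OF f lin_subD(1)[OF lin_sub_cube]] passi2_dualD(3)[OF h lin_subD(1)[OF lin_sub_cube]]
      by (auto simp: lin_sub_def)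
    fix x assume "x \<in> Poly_Mapping.keys a"
    then have x: "x \<in> carrier (Fr m)" using aug_idealD(1)[OF a(1)] by blast
    then show "gen x - gen [] \<in> {a \<in> aug_ideal (Fr m). f (passi2_cls m a) = h (passi2_cls m a)}"
      using gen_diff_aug_ideal[OF x Nil_in_Fr] eq[OF x] by (simp add: dual_fun_def)
  qed
  then show "f C = h C" unfolding aX a(2) by simp
qed

text \<open>By xy - 1 = (x - 1) + (y - 1) + (x - 1)(y - 1), the polarization at x, y is the value of
  \<open>f\<close> at (x - 1)(y - 1). The same identity shows that its failure to be additive is the
  value at a triple product, which lies in the cube.\<close>

lemma quadratic_dual_fun:
  fixes f :: "(word \<Rightarrow>\<^sub>0 'k::field) set \<Rightarrow> 'k"
  assumes f: "f \<in> carrier (passi2_dual m)"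
  shows "quadratic m (dual_fun m f)"
proof -
  interpret group "Fr m" by (rule group_Fr)
  let ?X = "\<lambda>x. gen x - gen [] :: word \<Rightarrow>\<^sub>0 'k" and ?M = "group_alg_mult (Fr m)"
  note D = passi2_dualD[OF f]
  have X: "?X x \<in> aug_ideal (Fr m)" if "x \<in> carrier (Fr m)" for x by (rule gen_diff_aug_ideal[OF that Nil_in_Fr])
  have M: "?M a b \<in> aug_ideal (Fr m)" if "a \<in> aug_ideal (Fr m)" "b \<in> aug_ideal (Fr m)" for a b :: "word \<Rightarrow>\<^sub>0 'k"
    by (rule aug_ideal_mult[OF group_Fr that])
  have Xm: "?X (x \<otimes>\<^bsub>Fr m\<^esub> y) = ?X x + ?X y + ?M (?X x) (?X y)" if "x \<in> carrier (Fr m)" "y \<in> carrier (Fr m)" for x y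
    using that r_one[of x] l_one[of y] l_one[OF one_closed] by (simp add: group_alg_mult_eq lin_ext_simps one_Fr)
  have pol: "polarization m (dual_fun m f) x y = f (passi2_cls m (?M (?X x) (?X y)))"
    if "x \<in> carrier (Fr m)" "y \<in> carrier (Fr m)" for x y
    unfolding polarization_def dual_fun_def Xm[OF that]
    using that by (simp add: D(1) X M lin_subD(2)[OF lin_sub_aug_ideal])
  have cube: "f (passi2_cls m (?M (?M (?X x) (?X y)) (?X z))) = 0" "f (passi2_cls m (?M (?X x) (?M (?X y) (?X z)))) = 0"
    if "x \<in> carrier (Fr m)" "y \<in> carrier (Fr m)" "z \<in> carrier (Fr m)" for x y z
  proof -
    have "?M (?M (?X x) (?X y)) (?X z) \<in> cube_gens (Fr m)" using X that by blast
    then show 1: "f (passi2_cls m (?M (?M (?X x) (?X y)) (?X z))) = 0"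
      by (intro D(3) aug_ideal_cube(2)[OF group_Fr])
    show "f (passi2_cls m (?M (?X x) (?M (?X y) (?X z)))) = 0"
      using 1 group_alg_mult_assoc[OF group_Fr aug_idealD(1)[OF X] aug_idealD(1)[OF X] aug_idealD(1)[OF X], of x y z] that by simp
  qed
  show ?thesis
    unfolding quadratic_def
  proof (intro conjI ballI)
    show "dual_fun m f [] = 0" using D(3)[OF lin_subD(1)[OF lin_sub_cube]] by (simp add: dual_fun_def)
    fix x y z assume xyz: "x \<in> carrier (Fr m)" "y \<in> carrier (Fr m)" "z \<in> carrier (Fr m)"
    have xy: "x \<otimes>\<^bsub>Fr m\<^esub> y \<in> carrier (Fr m)" using xyz by simp
    show "polarization m (dual_fun m f) (x \<otimes>\<^bsub>Fr m\<^esub> y) z = polarization m (dual_fun m f) x z + polarization m (dual_fun m f) y z"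
      unfolding pol[OF xy xyz(3)] pol[OF xyz(1,3)] pol[OF xyz(2,3)] Xm[OF xyz(1,2)] group_alg_mult_linear
      using xyz cube(1)[OF xyz] by (simp add: D(1) X M lin_subD(2)[OF lin_sub_aug_ideal])
    show "polarization m (dual_fun m f) z (x \<otimes>\<^bsub>Fr m\<^esub> y) = polarization m (dual_fun m f) z x + polarization m (dual_fun m f) z y"
      unfolding pol[OF xyz(3) xy] pol[OF xyz(3,1)] pol[OF xyz(3,2)] Xm[OF xyz(1,2)] group_alg_mult_linear
      using xyz cube(2)[OF xyz(3,1,2)] by (simp add: D(1) X M lin_subD(2)[OF lin_sub_aug_ideal])
  qed
qed

text \<open>A function of a product which separates into a term in each factor is killed, since each
  term is summed freely over the other factor, whose coefficients add up to 0.\<close>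

lemma lin_fun_additive:
  assumes "a \<in> aug_ideal G" "b \<in> aug_ideal G"
    "\<And>x y. x \<in> carrier G \<Longrightarrow> y \<in> carrier G \<Longrightarrow> h (x \<otimes>\<^bsub>G\<^esub> y) = k x + l y"
  shows "lin_fun h (group_alg_mult G a b) = 0"
proof -
  note ka = aug_idealD(1)[OF assms(1)] and kb = aug_idealD(1)[OF assms(2)]
  have "lin_fun h (group_alg_mult G a b) = lin_fun (\<lambda>x. lin_fun (\<lambda>y. k x * 1 + l y) b) a"
    unfolding lin_fun_group_alg_mult
    by (intro lin_fun_cong) (use assms(3) ka kb in \<open>auto simp: subset_iff\<close>)
  also have "\<dots> = lin_fun (\<lambda>x. lin_fun l b) a"
    by (simp only: lin_fun_fun aug_idealD(2)[OF assms(2)] mult_zero_right add_0_left)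
  also have "\<dots> = 0" by (simp only: lin_fun_const[of "lin_fun l b"] aug_idealD(2)[OF assms(1)] mult_zero_right)
  finally show ?thesis .
qed

text \<open>Fix the last factor \<open>c\<close> of a triple product. Summing over \<open>c\<close>
  replaces \<phi> by its polarization, up to a constant killed by the other two factors, and the
  polarization is additive in its first argument, hence vanishes on products.\<close>

lemma quadratic_vanishes_cube:
  fixes \<phi> :: "word \<Rightarrow> 'k::field"
  assumes q: "quadratic m \<phi>" and r: "r \<in> aug_ideal_cube (Fr m)"
  shows "lin_fun \<phi> r = 0"
proof -
  have "lin_fun \<phi> r = 0" if rG: "r \<in> cube_gens (Fr m)" for r
  proof -
    obtain a b c where r: "r = group_alg_mult (Fr m) (group_alg_mult (Fr m) a b) c"
      and abc: "a \<in> aug_ideal (Fr m)" "b \<in> aug_ideal (Fr m)" "c \<in> aug_ideal (Fr m)" using rG by blast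
    let ?A = "group_alg_mult (Fr m) a b"
    have A: "?A \<in> aug_ideal (Fr m)" by (rule aug_ideal_mult[OF group_Fr abc(1,2)])
    have inner: "lin_fun (\<lambda>y. \<phi> (x \<otimes>\<^bsub>Fr m\<^esub> y)) c = lin_fun (polarization m \<phi> x) c + lin_fun \<phi> c" for x
    proof -
      have "lin_fun (\<lambda>y. \<phi> (x \<otimes>\<^bsub>Fr m\<^esub> y)) c = lin_fun (\<lambda>y. polarization m \<phi> x y + (\<phi> x * 1 + \<phi> y)) c"
        by (simp add: polarization_def)
      then show ?thesis by (simp only: lin_fun_fun aug_idealD(2)[OF abc(3)] mult_zero_right add_0_left)
    qed
    have "lin_fun \<phi> r = lin_fun (\<lambda>x. lin_fun (polarization m \<phi> x) c) ?A"
      unfolding r lin_fun_group_alg_mult[of \<phi> _ ?A] inner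
      by (simp only: lin_fun_fun lin_fun_const[of "lin_fun \<phi> c"] aug_idealD(2)[OF A] mult_zero_right add_0_right)
    also have "lin_fun (\<lambda>x. lin_fun (polarization m \<phi> x) c) ?A = 0"
    proof (rule lin_fun_additive[OF abc(1,2)])
      fix x y assume xy: "x \<in> carrier (Fr m)" "y \<in> carrier (Fr m)"
      have "lin_fun (polarization m \<phi> (x \<otimes>\<^bsub>Fr m\<^esub> y)) c = lin_fun (\<lambda>z. polarization m \<phi> x z + polarization m \<phi> y z) c"
        by (rule lin_fun_cong) (use quadraticD(2)[OF q xy] aug_idealD(1)[OF abc(3)] in blast)
      then show "lin_fun (polarization m \<phi> (x \<otimes>\<^bsub>Fr m\<^esub> y)) c = lin_fun (polarization m \<phi> x) c + lin_fun (polarization m \<phi> y) c"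
        by (simp add: lin_fun_fun)
    qed
    finally show ?thesis by simp
  qed
  then have "aug_ideal_cube (Fr m) \<subseteq> {a. lin_fun \<phi> a = 0}"
    by (intro aug_ideal_cube(4)[OF group_Fr] lin_sub_lin_fun) auto
  then show ?thesis using r by blast
qed

text \<open>The inverse of \<open>dual_fun\<close>: the linear extension of a quadratic function,
  which vanishes on the cube and so descends to the quotient.\<close>

definition fun_dual :: "nat \<Rightarrow> (word \<Rightarrow> 'k::field) \<Rightarrow> (word \<Rightarrow>\<^sub>0 'k) set \<Rightarrow> 'k" where
  "fun_dual m \<phi> = (\<lambda>C\<in>carrier (obj passi2 m). descend (lin_fun \<phi>) C)"

lemma fun_dual_cls:
  assumes "quadratic m \<phi>" "a \<in> aug_ideal (Fr m)"
  shows "fun_dual m \<phi> (passi2_cls m a) = lin_fun \<phi> a"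
proof -
  have "descend (lin_fun \<phi>) (passi2_cls m a) = lin_fun \<phi> a"
  proof (rule descend_cls[OF lin_sub_cube])
    fix u w :: "word \<Rightarrow>\<^sub>0 'a" assume "u - w \<in> aug_ideal_cube (Fr m)"
    from quadratic_vanishes_cube[OF assms(1) this] show "lin_fun \<phi> u = lin_fun \<phi> w" by (simp add: lin_fun_simps)
  qed
  then show ?thesis using passi2_cls_carrier[OF assms(2)] by (simp add: fun_dual_def)
qed

lemma fun_dual_closed:
  assumes q: "quadratic m \<phi>" shows "fun_dual m \<phi> \<in> carrier (passi2_dual m)"
proof (rule dual_carrierI)
  fix u v assume "u \<in> carrier (obj passi2 m :: ('a, _) module)" "v \<in> carrier (obj passi2 m :: ('a, _) module)"
  then obtain a b where "a \<in> aug_ideal (Fr m)" "b \<in> aug_ideal (Fr m)" "u = passi2_cls m a" "v = passi2_cls m b"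
    by (auto simp: passi2_obj_simps)
  then show "fun_dual m \<phi> (u \<oplus>\<^bsub>obj passi2 m\<^esub> v) = fun_dual m \<phi> u + fun_dual m \<phi> v"
    by (simp add: passi2_obj_simps fun_dual_cls[OF q] lin_fun_simps lin_subD(2)[OF lin_sub_aug_ideal])
next
  fix c v assume "v \<in> carrier (obj passi2 m :: ('a, _) module)"
  then obtain b where "b \<in> aug_ideal (Fr m)" "v = passi2_cls m b" by (auto simp: passi2_obj_simps)
  then show "fun_dual m \<phi> (c \<odot>\<^bsub>obj passi2 m\<^esub> v) = c * fun_dual m \<phi> v"
    by (simp add: passi2_obj_simps fun_dual_cls[OF q] lin_fun_simps lin_subD(3)[OF lin_sub_aug_ideal])
qed (simp add: fun_dual_def)

lemma dual_fun_fun_dual: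
  "quadratic m \<phi> \<Longrightarrow> x \<in> carrier (Fr m) \<Longrightarrow> dual_fun m (fun_dual m \<phi>) x = \<phi> x"
  by (simp add: dual_fun_def fun_dual_cls gen_diff_aug_ideal Nil_in_Fr lin_fun_simps quadraticD(1))

lemma fun_dual_eqI:
  fixes f :: "(word \<Rightarrow>\<^sub>0 'k::field) set \<Rightarrow> 'k" and \<phi> :: "word \<Rightarrow> 'k"
  assumes "f \<in> carrier (passi2_dual m)" "quadratic m \<phi>" "\<And>x. x \<in> carrier (Fr m) \<Longrightarrow> dual_fun m f x = \<phi> x"
  shows "f = fun_dual m \<phi>"
  by (rule passi2_dual_eqI[OF assms(1) fun_dual_closed[OF assms(2)]])
     (simp add: assms(3) dual_fun_fun_dual[OF assms(2)])


section \<open>Functors presented by chords\<close>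

lemma lin_ext_fun:
  "lin_ext (\<lambda>x. f x + h x) a = lin_ext f a + lin_ext h a"
  "lin_ext (\<lambda>x. scale c (f x)) a = scale c (lin_ext f a)"
  by (simp_all add: lin_ext_def scale_add sum.distrib scale_sum mult.commute)

text \<open>
  Modulo the relations, \<open>t\<close> and \<open>H\<close> are mutually inverse, so that the classes of the generators
  \<open>t m x\<close> form a basis.
\<close>

lemma nat_equiv_chords:
  fixes C :: "nat \<Rightarrow> 'x set" and R :: "nat \<Rightarrow> ('x \<Rightarrow>\<^sub>0 'k::field) set"
    and H :: "nat \<Rightarrow> 'x \<Rightarrow> (nat \<times> nat \<times> word \<Rightarrow>\<^sub>0 'k)"
  assumes R: "\<And>m. R m \<subseteq> carrier (free_vs (C m))"
    and h: "\<And>a b g x. g \<in> gr a b \<Longrightarrow> x \<in> C b \<Longrightarrow> h a b g x \<in> C a"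
      "\<And>a b g r. g \<in> gr a b \<Longrightarrow> r \<in> R b \<Longrightarrow> lin_ext (\<lambda>x. gen (h a b g x)) r \<in> R a"
      "\<And>a x. x \<in> C a \<Longrightarrow> h a a (\<lambda>x\<in>carrier (Fr a). x) x = x"
      "\<And>a b c g k x. g \<in> gr a b \<Longrightarrow> k \<in> gr b c \<Longrightarrow> x \<in> C c \<Longrightarrow>
        h a c (compose (carrier (Fr a)) k g) x = h a b g (h b c k x)"
    and t: "\<And>m x. x \<in> chord_basis n m \<Longrightarrow> t m x \<in> C m"
    and H: "\<And>m c. c \<in> C m \<Longrightarrow> Poly_Mapping.keys (H m c) \<subseteq> chord_basis n m"
      "\<And>m r. r \<in> R m \<Longrightarrow> lin_ext (H m) r = 0"
      "\<And>m x. x \<in> chord_basis n m \<Longrightarrow> H m (t m x) = gen x"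
      "\<And>m c. c \<in> C m \<Longrightarrow> gen c - lin_ext (\<lambda>x. gen (t m x)) (H m c) \<in> rel_span (C m) (R m)"
    and pull: "\<And>a b g x. g \<in> gr a b \<Longrightarrow> x \<in> chord_basis n b \<Longrightarrow> H a (h a b g (t b x)) = chord_pullback n a g x"
  shows "nat_equiv_op (A_deg_trivial 1 n :: ('k, _) gr_functor)
     \<lparr>obj = \<lambda>m. presented (C m) (R m), mor = \<lambda>a b g. presented_map (C a) (R a) (\<lambda>x. gen (h a b g x))\<rparr>"
proof -
  let ?T = "\<lambda>m x. gen (t m x) :: 'x \<Rightarrow>\<^sub>0 'k"
  define \<Theta> where "\<Theta> m y = cls (rel_span (C m) (R m)) (lin_ext (?T m) y)" for m y
  note S = rel_span(1)[OF R]
  have kT: "Poly_Mapping.keys (lin_ext (?T m) y) \<subseteq> C m" if "Poly_Mapping.keys y \<subseteq> chord_basis n m" for m y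
    by (rule keys_lin_ext) (use that t in auto)
  have HS: "lin_ext (H m) a = 0" if "a \<in> rel_span (C m) (R m)" for m a
    using rel_span_lin_map[OF R lin_map_lin_ext lin_sub_zero _ that, of "H m"] H(2) by auto
  have HT: "lin_ext (H m) (lin_ext (?T m) y) = y" if "Poly_Mapping.keys y \<subseteq> chord_basis n m" for m y
  proof -
    have "lin_ext (H m) (lin_ext (?T m) y) = lin_ext gen y"
      unfolding lin_ext_lin_ext lin_ext_gen by (rule lin_ext_cong) (use that H(3) in auto)
    then show ?thesis by (simp add: lin_ext_gen_id)
  qed
  \<comment> \<open>Every element is congruent to the combination of basis generators that
    \<open>H\<close> assigns to it. This gives surjectivity and rewrites the image of a morphism in
    basis form.\<close>
  have TH: "\<Theta> m (lin_ext (H m) z) = cls (rel_span (C m) (R m)) z" if "Poly_Mapping.keys z \<subseteq> C m" for m z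
  proof -
    have "lin_ext (\<lambda>c. gen c + scale (- 1) (lin_ext (?T m) (H m c))) z \<in> rel_span (C m) (R m)"
      by (rule lin_sub_lin_ext[OF S]) (use that H(4) in auto)
    then have "z - lin_ext (?T m) (lin_ext (H m) z) \<in> rel_span (C m) (R m)"
      unfolding lin_ext_fun by (simp add: lin_ext_gen_id lin_ext_lin_ext)
    then show ?thesis unfolding \<Theta>_def by (simp only: cls_eq_iff[OF S, symmetric])
  qed
  show ?thesis
  proof (rule nat_equiv_op_via_basis[where \<Psi> = "chord_class n" and \<Theta> = \<Theta> and B = "chord_basis n"])
    show "module KK (obj (A_deg_trivial 1 n) m :: ('k, _) module)" for m by (rule module_A_deg_trivial)
    show "mor (A_deg_trivial 1 n) a b g \<in> linear_maps (obj (A_deg_trivial 1 n) b :: ('k, _) module) (obj (A_deg_trivial 1 n) a)"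
      if "g \<in> gr a b" for a b g
      unfolding A_deg_trivial_simps by (rule A_map_linear_degree_one[OF that])
    show "contravariant_functor \<lparr>obj = \<lambda>m. presented (C m) (R m), mor = \<lambda>a b g. presented_map (C a) (R a) (\<lambda>x. gen (h a b g x))\<rparr>"
      by (rule contravariant_presented_functor[OF R h])
    show "chord_class n m \<in> linear_maps (free_vs (chord_basis n m)) (obj (A_deg_trivial 1 n) m)" for m
      by (rule chord_class_iso(1))
    show "bij_betw (chord_class n m) (carrier (free_vs (chord_basis n m))) (carrier (obj (A_deg_trivial 1 n) m :: ('k, _) module))" for m
      by (rule chord_class_iso(2))
    show "\<Theta> m \<in> linear_maps (free_vs (chord_basis n m))
        (obj \<lparr>obj = \<lambda>m. presented (C m) (R m), mor = \<lambda>a b g. presented_map (C a) (R a) (\<lambda>x. gen (h a b g x))\<rparr> m)" for m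
      using kT by (auto simp: linear_maps_def \<Theta>_def presented_simps[OF R] lin_ext_simps)
    show "bij_betw (\<Theta> m) (carrier (free_vs (chord_basis n m)))
        (carrier (obj \<lparr>obj = \<lambda>m. presented (C m) (R m), mor = \<lambda>a b g. presented_map (C a) (R a) (\<lambda>x. gen (h a b g x))\<rparr> m))" for m
      unfolding gr_functor.simps bij_betw_def
    proof
      show "inj_on (\<Theta> m) (carrier (free_vs (chord_basis n m)))"
      proof (rule inj_onI)
        fix y z assume yz: "y \<in> carrier (free_vs (chord_basis n m))" "z \<in> carrier (free_vs (chord_basis n m))"
          and "\<Theta> m y = \<Theta> m z"
        then have "lin_ext (?T m) y - lin_ext (?T m) z \<in> rel_span (C m) (R m)" by (simp add: \<Theta>_def cls_eq_iff[OF S])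
        from HS[OF this] show "y = z" using yz HT[of y] HT[of z] by (simp add: lin_ext_simps)
      qed
      have "cls (rel_span (C m) (R m)) z \<in> \<Theta> m ` carrier (free_vs (chord_basis n m))"
        if "Poly_Mapping.keys z \<subseteq> C m" for z
      proof -
        have "Poly_Mapping.keys (lin_ext (H m) z) \<subseteq> chord_basis n m" by (rule keys_lin_ext) (use that H(1) in auto)
        then show ?thesis unfolding TH[OF that, symmetric] by (intro imageI) simp
      qed
      then show "\<Theta> m ` carrier (free_vs (chord_basis n m)) = carrier (presented (C m) (R m))"
        using kT by (auto simp: presented_simps[OF R] \<Theta>_def)
    qed
    fix a b g x assume g: "g \<in> gr a b" and x: "x \<in> chord_basis n b"
    have "presented_map (C a) (R a) (\<lambda>x. gen (h a b g x)) (\<Theta> b (gen x)) = \<Theta> a (chord_pullback n a g x)"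
    proof -
      have "presented_map (C a) (R a) (\<lambda>x. gen (h a b g x)) (\<Theta> b (gen x)) =
          cls (rel_span (C a) (R a)) (lin_ext (\<lambda>x. gen (h a b g x)) (gen (t b x)))"
        using presented_map_cls[OF R R rel_span(2)[OF R h(2)[OF g]], of b "gen (t b x)"] by (simp add: \<Theta>_def)
      also have "\<dots> = \<Theta> a (lin_ext (H a) (gen (h a b g (t b x))))"
        unfolding lin_ext_gen[of "\<lambda>x. gen (h a b g x)"] by (rule TH[symmetric]) (simp add: h(1)[OF g t[OF x]])
      finally show ?thesis by (simp add: pull[OF g x])
    qed
    then show "\<exists>e\<in>carrier (free_vs (chord_basis n a)).
        mor (A_deg_trivial 1 n) a b g (chord_class n b (gen x)) = chord_class n a e \<and>
        mor \<lparr>obj = \<lambda>m. presented (C m) (R m), mor = \<lambda>a b g. presented_map (C a) (R a) (\<lambda>x. gen (h a b g x))\<rparr> a b g (\<Theta> b (gen x)) = \<Theta> a e"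
      using keys_chord_pullback[OF x] A_map_chord_pullback[OF x g]
      by (intro bexI[of _ "chord_pullback n a g x"]) (simp_all add: A_deg_trivial_simps)
  qed
qed


section \<open>The tensor product with the group algebra\<close>

text \<open>The coordinates of the tensor of \<phi> and \<open>v\<close>. Compared with
  \<open>quad_part\<close>, the function \<open>count_pairs p q\<close> is replaced by the chord
  with holonomy \<open>v\<close>, and its composition with inversion by the chord with the inverse
  holonomy.\<close>

definition quad_chords :: "nat \<Rightarrow> nat \<Rightarrow> (word \<Rightarrow> 'k::field) \<Rightarrow> word \<Rightarrow> (nat \<times> nat \<times> word \<Rightarrow>\<^sub>0 'k)" where
  "quad_chords n m \<phi> v = (\<Sum>p<m. \<Sum>q<m. (let b = polarization m \<phi> [(p, True)] [(q, True)] in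
     if p < q then scale b (gen (p, q, v)) else if q < p then scale b (gen (q, p, inv\<^bsub>Fr n\<^esub> v))
     else scale (\<phi> [(p, True)]) (gen (p, p, v)) + scale (b - \<phi> [(p, True)]) (gen (p, p, inv\<^bsub>Fr n\<^esub> v))))"

lemma quad_chords_eqI:
  assumes "\<And>p. p < m \<Longrightarrow> \<phi> [(p, True)] = \<psi> [(p, True)]"
    "\<And>p q. p < m \<Longrightarrow> q < m \<Longrightarrow> polarization m \<phi> [(p, True)] [(q, True)] = polarization m \<psi> [(p, True)] [(q, True)]"
  shows "quad_chords n m \<phi> v = quad_chords n m \<psi> v"
  unfolding quad_chords_def by (intro sum.cong refl) (simp add: assms Let_def cong: if_cong)

lemma quad_chords_cong:
  assumes "\<And>x. x \<in> carrier (Fr m) \<Longrightarrow> \<phi> x = \<psi> x"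
  shows "quad_chords n m \<phi> v = quad_chords n m \<psi> v"
  by (rule quad_chords_eqI)
     (simp_all add: assms polarization_def letter_in_Fr monoid.m_closed[OF group.is_monoid[OF group_Fr]])

lemma quad_chords_linear:
  "quad_chords n m (\<lambda>x. \<phi> x + \<psi> x) v = quad_chords n m \<phi> v + quad_chords n m \<psi> v"
  "quad_chords n m (\<lambda>x. c * \<phi> x) v = scale c (quad_chords n m \<phi> v)"
proof -
  show "quad_chords n m (\<lambda>x. \<phi> x + \<psi> x) v = quad_chords n m \<phi> v + quad_chords n m \<psi> v"
    unfolding quad_chords_def sum.distrib[symmetric] polarization_linear
    by (intro sum.cong refl) (auto simp: Let_def scale_add_left scale_diff_left algebra_simps)
  show "quad_chords n m (\<lambda>x. c * \<phi> x) v = scale c (quad_chords n m \<phi> v)"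
    unfolding quad_chords_def scale_sum polarization_linear
    by (intro sum.cong refl) (auto simp: Let_def scale_add scale_diff scale_diff_left right_diff_distrib)
qed

lemma keys_quad_chords:
  assumes "v \<in> carrier (Fr n)"
  shows "Poly_Mapping.keys (quad_chords n m \<phi> v :: _ \<Rightarrow>\<^sub>0 'k::field) \<subseteq> chord_basis n m"
proof -
  have v: "inv\<^bsub>Fr n\<^esub> v \<in> carrier (Fr n)" using group.inv_closed[OF group_Fr assms] .
  define K where "K = {z :: _ \<Rightarrow>\<^sub>0 'k. Poly_Mapping.keys z \<subseteq> chord_basis n m}"
  have K: "lin_sub K" unfolding K_def by (rule lin_sub_keys)
  have g: "scale c (gen y) \<in> K" if "y \<in> chord_basis n m" for c y
    by (rule lin_subD(3)[OF K]) (use that in \<open>simp add: K_def\<close>)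
  have "quad_chords n m \<phi> v \<in> K"
    unfolding quad_chords_def Let_def
    using v assms by (auto simp: chord_basis_def intro!: lin_sub_sum[OF K] lin_subD(2)[OF K] g)
  then show ?thesis by (simp add: K_def)
qed

lemma quad_chords_count_pairs:
  assumes "(i, j, v) \<in> chord_basis n m"
  shows "quad_chords n m (count_pairs i j) v = gen (i, j, v)"
proof -
  have "quad_chords n m (count_pairs i j) v = (\<Sum>p<m. \<Sum>q<m. if p = i then if q = j then gen (i, j, v) else 0 else 0)"
    unfolding quad_chords_def polarization_count_pairs
    using assms by (intro sum.cong refl) (auto simp: Let_def letter_sign_def chord_basis_def)
  also have "\<dots> = (\<Sum>p<m. if p = i then \<Sum>q<m. if q = j then gen (i, j, v) else 0 else 0)"
    by (intro sum.cong refl) auto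
  also have "\<dots> = gen (i, j, v)" using assms by (simp add: chord_basis_def)
  finally show ?thesis .
qed

text \<open>Here the two functors meet. Composed with \<open>g\<close>, the pair count has the
  product of letter counts as its polarization at generators and the pair count of the word as its
  value there, and these are the coefficients found by attaching the ends of a chord.\<close>

lemma quad_chords_pullback:
  assumes "g \<in> gr a b"
  shows "quad_chords n a (\<lambda>x. count_pairs i j (g x)) v = (chord_pullback n a g (i, j, v) :: _ \<Rightarrow>\<^sub>0 'k::field)"
proof -
  have "polarization a (\<lambda>x. count_pairs i j (g x)) [(p, True)] [(q, True)] =
      (count_letter i (g [(p, True)]) * count_letter j (g [(q, True)]) :: 'k)" if "p < a" "q < a" for p q
    using that by (simp add: polarization_def gr_mult[OF assms] letter_in_Fr count_pairs_mult)
  then show ?thesis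
    unfolding quad_chords_def chord_pullback_def prod.case
    by (intro sum.cong refl) (auto simp: Let_def dest: linorder_neqE_nat)
qed

text \<open>The polarization is odd in each argument, so inverting both changes only their order.
  Moreover the polarization at x and its inverse is minus the sum of the values at x and at its
  inverse, and by oddness minus the polarization at x and x.\<close>

lemma quadratic_inv_letters:
  assumes q: "quadratic m \<phi>" and pq: "p < m" "r < m"
  shows "polarization m (\<lambda>x. \<phi> (inv\<^bsub>Fr m\<^esub> x)) [(p, True)] [(r, True)] = polarization m \<phi> [(r, True)] [(p, True)]"
    "\<phi> (inv\<^bsub>Fr m\<^esub> [(p, True)]) = polarization m \<phi> [(p, True)] [(p, True)] - \<phi> [(p, True)]"
proof -
  interpret group "Fr m" by (rule group_Fr)
  note c = letter_in_Fr[OF pq(1), of True] letter_in_Fr[OF pq(2), of True]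
  note B = quadraticD(2,3)[OF q] and z = quadraticD(1)[OF q]
  have nil: "polarization m \<phi> [] x = 0" "polarization m \<phi> x [] = 0" if "x \<in> carrier (Fr m)" for x
    using that l_one[OF that] r_one[OF that] by (simp_all add: polarization_def z one_Fr)
  have neg: "polarization m \<phi> (inv\<^bsub>Fr m\<^esub> x) y = - polarization m \<phi> x y" "polarization m \<phi> y (inv\<^bsub>Fr m\<^esub> x) = - polarization m \<phi> y x"
    if "x \<in> carrier (Fr m)" "y \<in> carrier (Fr m)" for x y
    using B(1)[of "inv\<^bsub>Fr m\<^esub> x" x y] B(2)[of "inv\<^bsub>Fr m\<^esub> x" x y] that nil[OF that(2)]
    by (simp_all add: one_Fr eq_neg_iff_add_eq_0)
  show "polarization m (\<lambda>x. \<phi> (inv\<^bsub>Fr m\<^esub> x)) [(p, True)] [(r, True)] = polarization m \<phi> [(r, True)] [(p, True)]"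
    using c by (simp add: polarization_inv neg del: inv_letter)
  have "polarization m \<phi> [(p, True)] (inv\<^bsub>Fr m\<^esub> [(p, True)]) = - \<phi> [(p, True)] - \<phi> (inv\<^bsub>Fr m\<^esub> [(p, True)])"
    using r_inv[OF c(1)] by (simp only: polarization_def one_Fr z) simp
  then show "\<phi> (inv\<^bsub>Fr m\<^esub> [(p, True)]) = polarization m \<phi> [(p, True)] [(p, True)] - \<phi> [(p, True)]"
    using neg(2)[OF c(1) c(1)] by (simp add: algebra_simps)
qed

text \<open>Inversion transposes the polarization and exchanges the two diagonal coefficients, which
  is also the effect of inverting \<open>v\<close>.\<close>

lemma quad_chords_inv:
  assumes q: "quadratic m \<phi>" and v: "v \<in> carrier (Fr n)"
  shows "quad_chords n m (\<lambda>x. \<phi> (inv\<^bsub>Fr m\<^esub> x)) v = quad_chords n m \<phi> (inv\<^bsub>Fr n\<^esub> v)"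
proof -
  have vv: "inv\<^bsub>Fr n\<^esub> (inv\<^bsub>Fr n\<^esub> v) = v" by (rule group.inv_inv[OF group_Fr v])
  show ?thesis
    unfolding quad_chords_def
    \<comment> \<open>The exchanged summation on the right matches the transposed
      polarization.\<close>
    by (subst (2) sum.swap, intro sum.cong refl)
       (auto simp: Let_def quadratic_inv_letters[OF q] vv add.commute dest: linorder_neqE_nat)
qed

section \<open>The relations of the tensor product over S2\<close>

abbreviation tensor_gens :: "nat \<Rightarrow> nat \<Rightarrow> (((word \<Rightarrow>\<^sub>0 'k::field) set \<Rightarrow> 'k) \<times> (word \<Rightarrow>\<^sub>0 'k)) set" where
  "tensor_gens n m \<equiv> carrier (passi2_dual m) \<times> carrier (free_vs (carrier (Fr n)))"

abbreviation dual_involution :: "nat \<Rightarrow> ((word \<Rightarrow>\<^sub>0 'k::field) set \<Rightarrow> 'k) \<Rightarrow> (word \<Rightarrow>\<^sub>0 'k) set \<Rightarrow> 'k" where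
  "dual_involution m \<equiv> dual_map (obj passi2 m) (passi2_involution m)"

abbreviation inv_ext :: "nat \<Rightarrow> (word \<Rightarrow>\<^sub>0 'k::field) \<Rightarrow> (word \<Rightarrow>\<^sub>0 'k)" where
  "inv_ext n \<equiv> lin_ext (\<lambda>v. gen (inv\<^bsub>Fr n\<^esub> v))"

lemma module_passi2_dual: "module KK (passi2_dual m)"
  by (rule module_dual[OF covariant_functorD(1)[OF covariant_passi2]])

lemma dual_involution_closed: "f \<in> carrier (passi2_dual m) \<Longrightarrow> dual_involution m f \<in> carrier (passi2_dual m)"
  by (rule dual_map_closed[OF passi2_involution_linear _ covariant_functorD(1)[OF covariant_passi2]])

lemma passi2_dual_map_closed:
  "g \<in> gr a b \<Longrightarrow> f \<in> carrier (passi2_dual b) \<Longrightarrow> dual_map (obj passi2 a) (mor passi2 a b g) f \<in> carrier (passi2_dual a)"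
  by (rule dual_map_closed[OF covariant_functorD(2)[OF covariant_passi2] _ covariant_functorD(1)[OF covariant_passi2]])

lemma tensor_rels_eq:
  "passi2_dual_tensor_rels n m = bilin_rels (passi2_dual m) (free_vs (carrier (Fr n))) \<union>
     {gen (dual_involution m f, w) - gen (f, inv_ext n w) | f w.
        f \<in> carrier (passi2_dual m) \<and> w \<in> carrier (free_vs (carrier (Fr n)))}"
  unfolding passi2_dual_tensor_rels_def S2_tensor_rels_def dual_functor_simps ..

lemma inv_ext_closed: "Poly_Mapping.keys w \<subseteq> carrier (Fr n) \<Longrightarrow> Poly_Mapping.keys (inv_ext n w) \<subseteq> carrier (Fr n)"
  by (rule keys_lin_ext) (use group.inv_closed[OF group_Fr] in auto)

lemma tensor_rels_carrier: "passi2_dual_tensor_rels n m \<subseteq> carrier (free_vs (tensor_gens n m))"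
proof -
  have "gen (dual_involution m f, w) - gen (f, inv_ext n w) \<in> carrier (free_vs (tensor_gens n m))"
    if "f \<in> carrier (passi2_dual m)" "w \<in> carrier (free_vs (carrier (Fr n)))"
    for f :: "(word \<Rightarrow>\<^sub>0 'k::field) set \<Rightarrow> 'k" and w
    using that dual_involution_closed[OF that(1)] inv_ext_closed[of w n]
    unfolding free_vs_simps(1) by (intro lin_subD(5)[OF lin_sub_keys]) auto
  then show ?thesis
    unfolding tensor_rels_eq using bilin_rels_carrier[OF module_passi2_dual module_free_vs, of m "carrier (Fr n)"] by blast
qed

lemma dual_map_involution:
  assumes g: "g \<in> gr a b" and f: "f \<in> carrier (passi2_dual b)"
  shows "dual_map (obj passi2 a) (mor passi2 a b g) (dual_involution b f) =
     dual_involution a (dual_map (obj passi2 a) (mor passi2 a b g) f)"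
  by (rule passi2_dual_eqI[OF passi2_dual_map_closed[OF g dual_involution_closed[OF f]]
        dual_involution_closed[OF passi2_dual_map_closed[OF g f]]])
     (simp add: dual_fun_dual_map[OF g] dual_fun_involution gr_closed[OF g] gr_inv[OF g] group.inv_closed[OF group_Fr])

lemma dual_fun_linear:
  assumes "x \<in> carrier (Fr m)"
  shows "dual_fun m (f \<oplus>\<^bsub>passi2_dual m\<^esub> h) x = dual_fun m f x + dual_fun m h x"
    "dual_fun m (c \<odot>\<^bsub>passi2_dual m\<^esub> f) x = c * dual_fun m f x"
  by (simp_all add: dual_fun_def dual_simps passi2_cls_carrier gen_diff_aug_ideal[OF assms Nil_in_Fr])

definition tensor_chords :: "nat \<Rightarrow> nat \<Rightarrow> ((word \<Rightarrow>\<^sub>0 'k::field) set \<Rightarrow> 'k) \<Rightarrow> (word \<Rightarrow>\<^sub>0 'k) \<Rightarrow> (nat \<times> nat \<times> word \<Rightarrow>\<^sub>0 'k)" where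
  "tensor_chords n m f = lin_ext (quad_chords n m (dual_fun m f))"

lemma tensor_chords_linear:
  "tensor_chords n m (f \<oplus>\<^bsub>passi2_dual m\<^esub> h) w = tensor_chords n m f w + tensor_chords n m h w"
  "tensor_chords n m (c \<odot>\<^bsub>passi2_dual m\<^esub> f) w = scale c (tensor_chords n m f w)"
  unfolding tensor_chords_def lin_ext_fun[symmetric] quad_chords_linear[symmetric]
  by (rule lin_ext_cong, rule quad_chords_cong, simp add: dual_fun_linear)+

lemma tensor_chords_involution:
  assumes "f \<in> carrier (passi2_dual m)" "Poly_Mapping.keys w \<subseteq> carrier (Fr n)"
  shows "tensor_chords n m (dual_involution m f) w = tensor_chords n m f (inv_ext n w)"
  unfolding tensor_chords_def lin_ext_lin_ext lin_ext_gen
proof (rule lin_ext_cong)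
  fix v assume "v \<in> Poly_Mapping.keys w"
  then have v: "v \<in> carrier (Fr n)" using assms by blast
  have "quad_chords n m (dual_fun m (dual_involution m f)) v = quad_chords n m (\<lambda>x. dual_fun m f (inv\<^bsub>Fr m\<^esub> x)) v"
    by (rule quad_chords_cong) (rule dual_fun_involution)
  then show "quad_chords n m (dual_fun m (dual_involution m f)) v = quad_chords n m (dual_fun m f) (inv\<^bsub>Fr n\<^esub> v)"
    by (simp only: quad_chords_inv[OF quadratic_dual_fun[OF assms(1)] v])
qed

lemma tensor_chords_rels:
  assumes "r \<in> passi2_dual_tensor_rels n m"
  shows "lin_ext (\<lambda>(f, w). tensor_chords n m f w) r = 0"
  using assms unfolding tensor_rels_eq
proof
  assume r: "r \<in> bilin_rels (passi2_dual m) (free_vs (carrier (Fr n)))"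
  show ?thesis
    by (rule lin_ext_bilin_rels[OF _ _ _ _ r])
       (simp_all add: tensor_chords_linear, simp_all add: tensor_chords_def lin_ext_simps)
qed (auto simp: lin_ext_simps tensor_chords_involution)


text \<open>Congruence of the tensor of \<phi> and \<open>w\<close> with \<open>a\<close> modulo the
  relations. Quadraticity is carried along because \<open>fun_dual\<close> has its meaning only for
  such functions.\<close>

definition represents :: "nat \<Rightarrow> nat \<Rightarrow> (word \<Rightarrow> 'k::field) \<Rightarrow> (word \<Rightarrow>\<^sub>0 'k) \<Rightarrow>
    (((word \<Rightarrow>\<^sub>0 'k) set \<Rightarrow> 'k) \<times> (word \<Rightarrow>\<^sub>0 'k) \<Rightarrow>\<^sub>0 'k) \<Rightarrow> bool" where
  "represents n m \<phi> w a \<longleftrightarrow> quadratic m \<phi> \<and>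
     gen (fun_dual m \<phi>, w) - a \<in> rel_span (tensor_gens n m) (passi2_dual_tensor_rels n m)"

lemmas lin_sub_tensor = rel_span(1)[OF tensor_rels_carrier]

lemma tensor_bilin:
  "r \<in> bilin_rels (passi2_dual m) (free_vs (carrier (Fr n))) \<Longrightarrow> r \<in> rel_span (tensor_gens n m) (passi2_dual_tensor_rels n m)"
  by (rule rel_span(2)[OF tensor_rels_carrier]) (simp add: tensor_rels_eq)

lemma represents_gen: "quadratic m \<phi> \<Longrightarrow> represents n m \<phi> w (gen (fun_dual m \<phi>, w))"
  unfolding represents_def diff_self by (intro conjI lin_subD(1)[OF lin_sub_tensor])

lemma represents_scale:
  assumes "represents n m \<phi> w a" "Poly_Mapping.keys w \<subseteq> carrier (Fr n)"
  shows "represents n m (\<lambda>x. c * \<phi> x) w (scale c a)"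
proof -
  let ?S = "rel_span (tensor_gens n m) (passi2_dual_tensor_rels n m)"
  have q: "quadratic m \<phi>" and a: "gen (fun_dual m \<phi>, w) - a \<in> ?S" using assms(1) by (auto simp: represents_def)
  note F = fun_dual_closed[OF q]
  have s: "c \<odot>\<^bsub>passi2_dual m\<^esub> fun_dual m \<phi> \<in> carrier (passi2_dual m)"
    using module.smult_closed[OF module_passi2_dual _ F, of c] by simp
  have eq: "c \<odot>\<^bsub>passi2_dual m\<^esub> fun_dual m \<phi> = fun_dual m (\<lambda>x. c * \<phi> x)"
    by (rule fun_dual_eqI[OF s quadratic_scale[OF q]]) (simp add: dual_fun_linear dual_fun_fun_dual[OF q])
  have "gen (fun_dual m (\<lambda>x. c * \<phi> x), w) - scale c (gen (fun_dual m \<phi>, w)) \<in> ?S"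
    unfolding eq[symmetric] by (rule tensor_bilin[OF bilin_relsI(3)[OF F]]) (simp add: assms(2))
  from lin_subD(2)[OF lin_sub_tensor this lin_subD(3)[OF lin_sub_tensor a, of c]]
  show ?thesis using quadratic_scale[OF q] by (simp add: represents_def scale_diff)
qed

lemma represents_add:
  assumes "represents n m \<phi> w a" "represents n m \<psi> w b" "Poly_Mapping.keys w \<subseteq> carrier (Fr n)"
  shows "represents n m (\<lambda>x. \<phi> x + \<psi> x) w (a + b)"
proof -
  let ?S = "rel_span (tensor_gens n m) (passi2_dual_tensor_rels n m)"
  have q: "quadratic m \<phi>" "quadratic m \<psi>" and ab: "gen (fun_dual m \<phi>, w) - a \<in> ?S" "gen (fun_dual m \<psi>, w) - b \<in> ?S"
    using assms(1,2) by (auto simp: represents_def)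
  note F = fun_dual_closed[OF q(1)] fun_dual_closed[OF q(2)]
  have s: "fun_dual m \<phi> \<oplus>\<^bsub>passi2_dual m\<^esub> fun_dual m \<psi> \<in> carrier (passi2_dual m)"
    by (rule abelian_monoid.a_closed[OF abelian_group.axioms(1)[OF module.axioms(2)[OF module_passi2_dual]] F])
  have eq: "fun_dual m \<phi> \<oplus>\<^bsub>passi2_dual m\<^esub> fun_dual m \<psi> = fun_dual m (\<lambda>x. \<phi> x + \<psi> x)"
    by (rule fun_dual_eqI[OF s quadratic_add[OF q]]) (simp add: dual_fun_linear dual_fun_fun_dual[OF q(1)] dual_fun_fun_dual[OF q(2)])
  have "gen (fun_dual m (\<lambda>x. \<phi> x + \<psi> x), w) - gen (fun_dual m \<phi>, w) - gen (fun_dual m \<psi>, w) \<in> ?S"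
    unfolding eq[symmetric] by (rule tensor_bilin[OF bilin_relsI(1)[OF F]]) (simp add: assms(3))
  from lin_subD(2)[OF lin_sub_tensor lin_subD(2)[OF lin_sub_tensor this ab(1)] ab(2)]
  show ?thesis using quadratic_add[OF q] by (simp add: represents_def algebra_simps)
qed

lemma represents_zero:
  assumes "Poly_Mapping.keys w \<subseteq> carrier (Fr n)"
  shows "represents n m (\<lambda>x. 0 :: 'k::field) w 0"
proof -
  have "quadratic m (\<lambda>x. 0 :: 'k)" by (simp add: quadratic_def polarization_def)
  from represents_scale[OF represents_gen[OF this] assms, of 0] show ?thesis by simp
qed

lemma represents_sum:
  assumes "finite A" "\<And>k. k \<in> A \<Longrightarrow> represents n m (f k) w (a k)" "Poly_Mapping.keys w \<subseteq> carrier (Fr n)"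
  shows "represents n m (\<lambda>x. \<Sum>k\<in>A. f k x) w (\<Sum>k\<in>A. a k)"
  using assms(1,2)
proof (induction A rule: finite_induct)
  case empty then show ?case using represents_zero[OF assms(3)] by simp
next
  case (insert k A)
  then show ?case using represents_add[OF _ _ assms(3), of m "f k" "a k" "\<lambda>x. \<Sum>k\<in>A. f k x" "\<Sum>k\<in>A. a k"] by simp
qed

text \<open>The relation over S2 does this, since the dual of \<sigma> composes a function with
  inversion.\<close>

lemma represents_inv:
  assumes q: "quadratic m \<phi>" and v: "v \<in> carrier (Fr n)"
  shows "represents n m (\<lambda>x. \<phi> (inv\<^bsub>Fr m\<^esub> x)) (gen v) (gen (fun_dual m \<phi>, gen (inv\<^bsub>Fr n\<^esub> v)))"
proof -
  note F = fun_dual_closed[OF q]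
  have eq: "dual_involution m (fun_dual m \<phi>) = fun_dual m (\<lambda>x. \<phi> (inv\<^bsub>Fr m\<^esub> x))"
    by (rule fun_dual_eqI[OF dual_involution_closed[OF F] quadratic_inv[OF q]])
       (simp add: dual_fun_involution dual_fun_fun_dual[OF q] group.inv_closed[OF group_Fr])
  have "gen v \<in> carrier (free_vs (carrier (Fr n)))" using v by simp
  with F have "gen (dual_involution m (fun_dual m \<phi>), gen v) - gen (fun_dual m \<phi>, inv_ext n (gen v)) \<in> passi2_dual_tensor_rels n m"
    unfolding tensor_rels_eq by blast
  from rel_span(2)[OF tensor_rels_carrier this] show ?thesis using quadratic_inv[OF q] by (simp add: represents_def eq)
qed

definition chord_tensor :: "nat \<Rightarrow> nat \<times> nat \<times> word \<Rightarrow> ((word \<Rightarrow>\<^sub>0 'k::field) set \<Rightarrow> 'k) \<times> (word \<Rightarrow>\<^sub>0 'k)" where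
  "chord_tensor m = (\<lambda>(i, j, v). (fun_dual m (count_pairs i j), gen v))"

text \<open>Every part in the decomposition of \<phi> is a combination of pair counts with ordered
  indices and of their compositions with inversion. The inversions are moved across the tensor sign
  to \<open>v\<close>.\<close>

lemma represents_quad_chords:
  fixes \<phi> :: "word \<Rightarrow> 'k::field"
  assumes q: "quadratic m \<phi>" and v: "v \<in> carrier (Fr n)"
  shows "represents n m \<phi> (gen v) (lin_ext (\<lambda>x. gen (chord_tensor m x)) (quad_chords n m \<phi> v))"
proof -
  let ?T = "\<lambda>x. gen (chord_tensor m x) :: _ \<Rightarrow>\<^sub>0 'k"
  have gv: "Poly_Mapping.keys (gen v :: word \<Rightarrow>\<^sub>0 'k) \<subseteq> carrier (Fr n)" using v by simp
  have cp: "represents n m (count_pairs p q) (gen v) (?T (p, q, v))"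
    "represents n m (\<lambda>x. count_pairs p q (inv\<^bsub>Fr m\<^esub> x)) (gen v) (?T (p, q, inv\<^bsub>Fr n\<^esub> v))" for p q
    unfolding chord_tensor_def prod.case
    by (rule represents_gen[OF quadratic_count_pairs] represents_inv[OF quadratic_count_pairs v])+
  have part: "represents n m (quad_part m \<phi> p q) (gen v)
      (lin_ext ?T (let b = polarization m \<phi> [(p, True)] [(q, True)] in
         if p < q then scale b (gen (p, q, v)) else if q < p then scale b (gen (q, p, inv\<^bsub>Fr n\<^esub> v))
         else scale (\<phi> [(p, True)]) (gen (p, p, v)) + scale (b - \<phi> [(p, True)]) (gen (p, p, inv\<^bsub>Fr n\<^esub> v))))" for p q
  proof -
    show ?thesis
      unfolding quad_part_eq Let_def
      by (auto simp: lin_ext_simps intro!: represents_add represents_scale cp[unfolded comp_def] gv)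
  qed
  have "represents n m (\<lambda>x. \<Sum>p<m. \<Sum>q<m. quad_part m \<phi> p q x) (gen v) (lin_ext ?T (quad_chords n m \<phi> v))"
    unfolding quad_chords_def lin_ext_sum by (intro represents_sum part gv) auto
  moreover have "fun_dual m (\<lambda>x. \<Sum>p<m. \<Sum>q<m. quad_part m \<phi> p q x) = fun_dual m \<phi>"
    by (rule fun_dual_eqI[OF fun_dual_closed q])
       (simp_all add: dual_fun_fun_dual quadratic_sum quadratic_quad_part quadratic_decomposition[OF q, symmetric])
  ultimately show ?thesis using q by (simp add: represents_def)
qed

text \<open>Linearity in the second factor reduces the claim to a single group element, where
  \<open>f\<close> is recovered from its quadratic function.\<close>

lemma tensor_chords_spanning:
  fixes f :: "(word \<Rightarrow>\<^sub>0 'k::field) set \<Rightarrow> 'k"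
  assumes f: "f \<in> carrier (passi2_dual m)" and w: "Poly_Mapping.keys w \<subseteq> carrier (Fr n)"
  shows "gen (f, w) - lin_ext (\<lambda>x. gen (chord_tensor m x)) (tensor_chords n m f w) \<in>
     rel_span (tensor_gens n m) (passi2_dual_tensor_rels n m)"
  using w
proof (induction rule: free_vs_induct)
  case zero
  have "gen (f, scale 0 (0 :: word \<Rightarrow>\<^sub>0 'k)) - scale 0 (gen (f, 0)) \<in> rel_span (tensor_gens n m) (passi2_dual_tensor_rels n m)"
    using bilin_relsI(4)[OF f, of 0 "free_vs (carrier (Fr n))" 0] by (intro tensor_bilin) simp
  then show ?case by (simp add: tensor_chords_def lin_ext_simps)
next
  case (gen v)
  have "fun_dual m (dual_fun m f) = f"
    by (rule fun_dual_eqI[OF f quadratic_dual_fun[OF f] refl, symmetric])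
  then show ?case
    using represents_quad_chords[OF quadratic_dual_fun[OF f] gen] by (simp add: represents_def tensor_chords_def)
next
  case (add a b)
  have "gen (f, a + b) - gen (f, a) - gen (f, b) \<in> rel_span (tensor_gens n m) (passi2_dual_tensor_rels n m)"
    using bilin_relsI(2)[OF f, of a "free_vs (carrier (Fr n))" b] add by (intro tensor_bilin) simp
  from lin_subD(2)[OF lin_sub_tensor lin_subD(2)[OF lin_sub_tensor this add(3)] add(4)]
  show ?case by (simp add: tensor_chords_def lin_ext_simps algebra_simps)
next
  case (scale c a)
  have "gen (f, Defs.scale c a) - Defs.scale c (gen (f, a)) \<in> rel_span (tensor_gens n m) (passi2_dual_tensor_rels n m)"
    using bilin_relsI(4)[OF f, of a "free_vs (carrier (Fr n))" c] scale by (intro tensor_bilin) simp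
  from lin_subD(2)[OF lin_sub_tensor this lin_subD(3)[OF lin_sub_tensor scale(2), of c]]
  show ?case by (simp add: tensor_chords_def lin_ext_simps scale_diff)
qed

theorem nat_equiv_passi2_dual_tensor:
  "nat_equiv_op (A_deg_trivial 1 n :: ('k::field, _) gr_functor) (passi2_dual_tensor n)"
proof -
  have eq: "(passi2_dual_tensor n :: ('k, _) gr_functor) =
     \<lparr>obj = \<lambda>m. presented (tensor_gens n m) (passi2_dual_tensor_rels n m),
      mor = \<lambda>a b g. presented_map (tensor_gens n a) (passi2_dual_tensor_rels n a)
        (\<lambda>x. gen ((\<lambda>(f, w). (dual_map (obj passi2 a) (mor passi2 a b g) f, w)) x))\<rparr>"
    by (simp add: passi2_dual_tensor_def dual_functor_simps case_prod_beta')
  note fun_props = contravariant_functorD[OF contravariant_dual_functor[OF covariant_passi2], unfolded dual_functor_simps]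
  show ?thesis
    unfolding eq
  proof (rule nat_equiv_chords[where t = chord_tensor and H = "\<lambda>m (f, w). tensor_chords n m f w", OF tensor_rels_carrier])
    show "(\<lambda>(f, w). (dual_map (obj passi2 a) (mor passi2 a b g) f, w)) x \<in> tensor_gens n a"
      if "g \<in> gr a b" "x \<in> tensor_gens n b" for a b g and x :: "((word \<Rightarrow>\<^sub>0 'k) set \<Rightarrow> 'k) \<times> (word \<Rightarrow>\<^sub>0 'k)"
      using that passi2_dual_map_closed[OF that(1)] by auto
    show "lin_ext (\<lambda>x. gen ((\<lambda>(f, w). (dual_map (obj passi2 a) (mor passi2 a b g) f, w)) x)) r \<in> passi2_dual_tensor_rels n a"
      if g: "g \<in> gr a b" and r: "r \<in> passi2_dual_tensor_rels n b"
      for a b g and r :: "((word \<Rightarrow>\<^sub>0 'k) set \<Rightarrow> 'k) \<times> (word \<Rightarrow>\<^sub>0 'k) \<Rightarrow>\<^sub>0 'k"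
      using r unfolding tensor_rels_eq
    proof
      assume r: "r \<in> bilin_rels (passi2_dual b) (free_vs (carrier (Fr n)))"
      have id: "(\<lambda>w. w) \<in> linear_maps (free_vs (carrier (Fr n)) :: ('k, _) module) (free_vs (carrier (Fr n)))"
        by (simp add: linear_maps_def)
      from bilin_rels_map[OF fun_props(2)[OF g] this r]
      show "lin_ext (\<lambda>x. gen ((\<lambda>(f, w). (dual_map (obj passi2 a) (mor passi2 a b g) f, w)) x)) r \<in>
          bilin_rels (passi2_dual a) (free_vs (carrier (Fr n))) \<union>
          {gen (dual_involution a f, w) - gen (f, inv_ext n w) | f w.
             f \<in> carrier (passi2_dual a) \<and> w \<in> carrier (free_vs (carrier (Fr n)))}"
        by (simp add: case_prod_beta')
    next
      assume "r \<in> {gen (dual_involution b f, w) - gen (f, inv_ext n w) | f w.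
             f \<in> carrier (passi2_dual b) \<and> w \<in> carrier (free_vs (carrier (Fr n)))}"
      then obtain f w where f: "f \<in> carrier (passi2_dual b)" and w: "w \<in> carrier (free_vs (carrier (Fr n)))"
        and r: "r = gen (dual_involution b f, w) - gen (f, inv_ext n w)" by blast
      have "lin_ext (\<lambda>x. gen ((\<lambda>(f, w). (dual_map (obj passi2 a) (mor passi2 a b g) f, w)) x)) r =
          gen (dual_involution a (dual_map (obj passi2 a) (mor passi2 a b g) f), w) -
          gen (dual_map (obj passi2 a) (mor passi2 a b g) f, inv_ext n w)"
        by (simp add: r lin_ext_simps dual_map_involution[OF g f])
      then show "lin_ext (\<lambda>x. gen ((\<lambda>(f, w). (dual_map (obj passi2 a) (mor passi2 a b g) f, w)) x)) r \<in>
          bilin_rels (passi2_dual a) (free_vs (carrier (Fr n))) \<union>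
          {gen (dual_involution a f, w) - gen (f, inv_ext n w) | f w.
             f \<in> carrier (passi2_dual a) \<and> w \<in> carrier (free_vs (carrier (Fr n)))}"
        using passi2_dual_map_closed[OF g f] w by blast
    qed
    show "(\<lambda>(f, w). (dual_map (obj passi2 a) (mor passi2 a a (\<lambda>x\<in>carrier (Fr a). x)) f, w)) x = x"
      if "x \<in> tensor_gens n a" for a and x :: "((word \<Rightarrow>\<^sub>0 'k) set \<Rightarrow> 'k) \<times> (word \<Rightarrow>\<^sub>0 'k)"
      using that fun_props(3) by auto
    show "(\<lambda>(f, w). (dual_map (obj passi2 a) (mor passi2 a c (compose (carrier (Fr a)) k g)) f, w)) x =
        (\<lambda>(f, w). (dual_map (obj passi2 a) (mor passi2 a b g) f, w)) ((\<lambda>(f, w). (dual_map (obj passi2 b) (mor passi2 b c k) f, w)) x)"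
      if "g \<in> gr a b" "k \<in> gr b c" "x \<in> tensor_gens n c" for a b c g k and x :: "((word \<Rightarrow>\<^sub>0 'k) set \<Rightarrow> 'k) \<times> (word \<Rightarrow>\<^sub>0 'k)"
      using that(3) fun_props(4)[OF that(1,2)] by auto
    show "chord_tensor m x \<in> tensor_gens n m" if "x \<in> chord_basis n m" for m x
      using that fun_dual_closed[OF quadratic_count_pairs] by (auto simp: chord_tensor_def chord_basis_def)
    show "Poly_Mapping.keys ((\<lambda>(f, w). tensor_chords n m f w) c) \<subseteq> chord_basis n m"
      if "c \<in> tensor_gens n m" for m and c :: "((word \<Rightarrow>\<^sub>0 'k) set \<Rightarrow> 'k) \<times> (word \<Rightarrow>\<^sub>0 'k)"
      using that unfolding tensor_chords_def case_prod_beta' by (intro keys_lin_ext keys_quad_chords) auto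
    show "lin_ext (\<lambda>(f, w). tensor_chords n m f w) r = 0" if "r \<in> passi2_dual_tensor_rels n m"
      for m and r :: "((word \<Rightarrow>\<^sub>0 'k) set \<Rightarrow> 'k) \<times> (word \<Rightarrow>\<^sub>0 'k) \<Rightarrow>\<^sub>0 'k"
      by (rule tensor_chords_rels[OF that])
    show "(\<lambda>(f, w). tensor_chords n m f w) (chord_tensor m x) = (gen x :: _ \<Rightarrow>\<^sub>0 'k)" if x: "x \<in> chord_basis n m" for m x
    proof -
      obtain i j v where ijv: "x = (i, j, v)" by (rule prod_cases3)
      have "quad_chords n m (dual_fun m (fun_dual m (count_pairs i j))) v = (quad_chords n m (count_pairs i j) v :: _ \<Rightarrow>\<^sub>0 'k)"
        by (rule quad_chords_cong) (rule dual_fun_fun_dual[OF quadratic_count_pairs])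
      then show ?thesis using quad_chords_count_pairs[OF x[unfolded ijv]] by (simp add: ijv chord_tensor_def tensor_chords_def)
    qed
    show "gen c - lin_ext (\<lambda>x. gen (chord_tensor m x)) ((\<lambda>(f, w). tensor_chords n m f w) c) \<in>
        rel_span (tensor_gens n m) (passi2_dual_tensor_rels n m)" if "c \<in> tensor_gens n m"
      for m and c :: "((word \<Rightarrow>\<^sub>0 'k) set \<Rightarrow> 'k) \<times> (word \<Rightarrow>\<^sub>0 'k)"
      using that tensor_chords_spanning by auto
    show "(\<lambda>(f, w). tensor_chords n a f w) ((\<lambda>(f, w). (dual_map (obj passi2 a) (mor passi2 a b g) f, w)) (chord_tensor b x)) =
        (chord_pullback n a g x :: _ \<Rightarrow>\<^sub>0 'k)" if g: "g \<in> gr a b" and x: "x \<in> chord_basis n b" for a b g x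
    proof -
      obtain i j v where ijv: "x = (i, j, v)" by (rule prod_cases3)
      have "quad_chords n a (dual_fun a (dual_map (obj passi2 a) (mor passi2 a b g) (fun_dual b (count_pairs i j)))) v =
          (quad_chords n a (\<lambda>x. count_pairs i j (g x)) v :: _ \<Rightarrow>\<^sub>0 'k)"
        by (rule quad_chords_cong) (simp add: dual_fun_dual_map[OF g] dual_fun_fun_dual[OF quadratic_count_pairs] gr_closed[OF g])
      then show ?thesis using quad_chords_pullback[OF g, of n i j v] by (simp add: ijv chord_tensor_def tensor_chords_def)
    qed
  qed
qed


section \<open>The abelianization of a free group\<close>

abbreviation Fr_derived :: "nat \<Rightarrow> word set" where
  "Fr_derived m \<equiv> derived (Fr m) (carrier (Fr m))"

abbreviation ab_cls :: "nat \<Rightarrow> word \<Rightarrow> word set" where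
  "ab_cls m x \<equiv> Fr_derived m #>\<^bsub>Fr m\<^esub> x"

lemma carrier_abelianization: "carrier (abelianization (Fr m)) = ab_cls m ` carrier (Fr m)"
  unfolding abelianization_def by (rule carrier_FactGroup)

lemma Fr_derived_normal: "normal (Fr_derived m) (Fr m)"
  by (rule group.derived_self_is_normal[OF group_Fr])

lemmas Fr_derived_subgroup = normal_imp_subgroup[OF Fr_derived_normal]

lemma ab_cls_mult:
  "x \<in> carrier (Fr m) \<Longrightarrow> y \<in> carrier (Fr m) \<Longrightarrow>
     ab_cls m x \<otimes>\<^bsub>abelianization (Fr m)\<^esub> ab_cls m y = ab_cls m (x \<otimes>\<^bsub>Fr m\<^esub> y)"
  using normal.rcos_sum[OF Fr_derived_normal] by (simp add: abelianization_def FactGroup_def)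

text \<open>A homomorphism sends commutators to commutators, so the cosets in the union
  coincide.\<close>

lemma abelianization_map_cls:
  assumes g: "g \<in> gr a b" and x: "x \<in> carrier (Fr a)"
  shows "abelianization_map (Fr b) g (ab_cls a x) = ab_cls b (g x)"
proof -
  interpret a: group "Fr a" by (rule group_Fr)
  interpret b: group "Fr b" by (rule group_Fr)
  have gD: "g d \<in> Fr_derived b" if "d \<in> Fr_derived a" for d
  proof -
    have "g ` Fr_derived a = derived (Fr b) (g ` carrier (Fr a))"
      by (rule group_hom.derived_img[OF gr_group_hom[OF g], symmetric]) simp
    also have "\<dots> \<subseteq> Fr_derived b" using gr_closed[OF g] by (intro b.mono_derived) auto
    finally show ?thesis using that by blast
  qed
  have eq: "ab_cls b (g y) = ab_cls b (g x)" if "y \<in> ab_cls a x" for y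
  proof -
    from that obtain d where d: "d \<in> Fr_derived a" "y = d \<otimes>\<^bsub>Fr a\<^esub> x" by (auto simp: r_coset_def)
    have dc: "d \<in> carrier (Fr a)" using subgroup.subset[OF Fr_derived_subgroup] d(1) by blast
    have "g y \<in> ab_cls b (g x)"
      unfolding d(2) gr_mult[OF g dc x]
      by (rule b.rcosI[OF gD[OF d(1)] subgroup.subset[OF Fr_derived_subgroup] gr_closed[OF g x]])
    from b.repr_independence[OF this gr_closed[OF g x] Fr_derived_subgroup] show ?thesis by simp
  qed
  moreover have "x \<in> ab_cls a x" by (rule a.rcos_self[OF x Fr_derived_subgroup])
  ultimately show ?thesis unfolding abelianization_map_def by blast
qed

lemma abelianization_map_closed:
  assumes "g \<in> gr a b" "C \<in> carrier (abelianization (Fr a))"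
  shows "abelianization_map (Fr b) g C \<in> carrier (abelianization (Fr b))"
  using assms gr_closed by (auto simp: carrier_abelianization abelianization_map_cls)

text \<open>The exponent sum is a homomorphism to a commutative group, so its kernel is a subgroup
  which contains all commutators.\<close>

lemma count_letter_derived:
  assumes "d \<in> Fr_derived m" shows "count_letter i d = (0 :: 'k::field)"
proof -
  interpret group "Fr m" by (rule group_Fr)
  let ?K = "{x \<in> carrier (Fr m). count_letter i x = (0 :: 'k)}"
  have "subgroup ?K (Fr m)"
    by (rule subgroupI) (auto simp: count_letter_mult count_letter_inv intro!: exI[of _ "[]"] Nil_in_Fr)
  moreover have "derived_set (Fr m) (carrier (Fr m)) \<subseteq> ?K"
    by (auto simp: count_letter_mult count_letter_inv)
  ultimately have "Fr_derived m \<subseteq> ?K" unfolding derived_def by (intro generate_subgroup_incl)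
  then show ?thesis using assms by blast
qed

definition class_count :: "nat \<Rightarrow> word set \<Rightarrow> 'k::field" where
  "class_count i C = count_letter i (SOME x. x \<in> C)"

lemma class_count_cls:
  assumes x: "x \<in> carrier (Fr m)"
  shows "class_count i (ab_cls m x) = (count_letter i x :: 'k::field)"
  unfolding class_count_def
proof (rule someI2)
  show "x \<in> ab_cls m x" by (rule group.rcos_self[OF group_Fr x Fr_derived_subgroup])
  fix y assume "y \<in> ab_cls m x"
  then show "count_letter i y = (count_letter i x :: 'k)"
    by (auto simp: r_coset_def count_letter_mult count_letter_derived)
qed


section \<open>Extension of scalars of the abelianization\<close>

abbreviation ab_gens :: "nat \<Rightarrow> (word set \<times> 'k::field) set" where
  "ab_gens m \<equiv> carrier (abelianization (Fr m)) \<times> UNIV"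

abbreviation ab_rels :: "nat \<Rightarrow> (word set \<times> 'k::field \<Rightarrow>\<^sub>0 'k) set" where
  "ab_rels m \<equiv> extension_rels (abelianization (Fr m))"

lemma extension_relsE:
  assumes "r \<in> extension_rels A"
  obtains (mult) x y k where "r = gen (x \<otimes>\<^bsub>A\<^esub> y, k) - gen (x, k) - gen (y, k)" "x \<in> carrier A" "y \<in> carrier A"
    | (add) x k l where "r = gen (x, k + l) - gen (x, k) - gen (x, l)" "x \<in> carrier A"
    | (scale) c x k where "r = gen (x, c * k) - scale c (gen (x, k))" "x \<in> carrier A"
  using assms unfolding extension_rels_def by (elim UnE CollectE exE conjE) metis+

lemma extension_relsI:
  "x \<in> carrier A \<Longrightarrow> y \<in> carrier A \<Longrightarrow> gen (x \<otimes>\<^bsub>A\<^esub> y, k) - gen (x, k) - gen (y, k) \<in> extension_rels A"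
  "x \<in> carrier A \<Longrightarrow> gen (x, k + l) - gen (x, k) - gen (x, l) \<in> extension_rels A"
  "x \<in> carrier A \<Longrightarrow> gen (x, c * k) - scale c (gen (x, k)) \<in> extension_rels A"
  unfolding extension_rels_def by blast+

lemma abelianization_mult_closed:
  assumes "C \<in> carrier (abelianization (Fr m))" "C' \<in> carrier (abelianization (Fr m))"
  shows "C \<otimes>\<^bsub>abelianization (Fr m)\<^esub> C' \<in> carrier (abelianization (Fr m))"
  using assms monoid.m_closed[OF group.is_monoid[OF group_Fr[of m]]] by (auto simp: carrier_abelianization ab_cls_mult)

lemma ab_rels_carrier: "(ab_rels m :: (word set \<times> 'k::field \<Rightarrow>\<^sub>0 'k) set) \<subseteq> carrier (free_vs (ab_gens m))"
proof
  define K where "K = {a :: word set \<times> 'k \<Rightarrow>\<^sub>0 'k. Poly_Mapping.keys a \<subseteq> ab_gens m}"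
  have K: "lin_sub K" unfolding K_def by (rule lin_sub_keys)
  have g: "gen (C, k) \<in> K" if "C \<in> carrier (abelianization (Fr m))" for C k using that by (simp add: K_def)
  fix r :: "word set \<times> 'k \<Rightarrow>\<^sub>0 'k" assume "r \<in> ab_rels m"
  then have "r \<in> K"
  proof (cases rule: extension_relsE)
    case (mult x y k) then show ?thesis by (auto intro!: lin_subD(5)[OF K] g abelianization_mult_closed)
  next
    case (add x k l) then show ?thesis by (auto intro!: lin_subD(5)[OF K] g)
  next
    case (scale c x k) then show ?thesis by (auto intro!: lin_subD(5)[OF K] lin_subD(3)[OF K] g)
  qed
  then show "r \<in> carrier (free_vs (ab_gens m))" by (simp add: K_def)
qed

lemmas lin_sub_ab = rel_span(1)[OF ab_rels_carrier]

lemma ab_rels_map: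
  assumes g: "g \<in> gr a b" and r: "r \<in> ab_rels a"
  shows "lin_ext (\<lambda>(C, k). gen (abelianization_map (Fr b) g C, k)) r \<in> ab_rels b"
proof -
  let ?g = "abelianization_map (Fr b) g"
  have m: "?g (C \<otimes>\<^bsub>abelianization (Fr a)\<^esub> C') = ?g C \<otimes>\<^bsub>abelianization (Fr b)\<^esub> ?g C'"
    if "C \<in> carrier (abelianization (Fr a))" "C' \<in> carrier (abelianization (Fr a))" for C C'
    using that monoid.m_closed[OF group.is_monoid[OF group_Fr[of a]]]
    by (auto simp: carrier_abelianization ab_cls_mult abelianization_map_cls[OF g] gr_closed[OF g] gr_mult[OF g])
  note cl = abelianization_map_closed[OF g]
  show ?thesis
    using r
  proof (cases rule: extension_relsE)
    case (mult x y k) then show ?thesis using extension_relsI(1)[OF cl cl] by (simp add: lin_ext_simps m)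
  next
    case (add x k l) then show ?thesis using extension_relsI(2)[OF cl] by (simp add: lin_ext_simps)
  next
    case (scale c x k) then show ?thesis using extension_relsI(3)[OF cl] by (simp add: lin_ext_simps)
  qed
qed

abbreviation ab_obj :: "nat \<Rightarrow> ('k::field, (word set \<times> 'k \<Rightarrow>\<^sub>0 'k) set) module" where
  "ab_obj m \<equiv> obj ab_functor m"

lemma ab_obj_eq: "obj ab_functor m = presented (ab_gens m) (ab_rels m)"
  by (simp add: ab_functor_def)

lemma ab_span_map:
  assumes "g \<in> gr a b"
  shows "lin_ext (\<lambda>(C, k). gen (abelianization_map (Fr b) g C, k)) ` rel_span (ab_gens a) (ab_rels a) \<subseteq> rel_span (ab_gens b) (ab_rels b)"
  using rel_span_lin_map[OF ab_rels_carrier lin_map_lin_ext lin_sub_ab rel_span(2)[OF ab_rels_carrier ab_rels_map[OF assms]]]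
  by blast

lemma covariant_ab_functor: "covariant_functor (ab_functor :: ('k::field, _) gr_functor)"
proof -
  have eq: "(ab_functor :: ('k, _) gr_functor) =
     \<lparr>obj = \<lambda>m. quot_vs (pm_vs {y. Poly_Mapping.keys y \<subseteq> ab_gens m}) (rel_span (ab_gens m) (ab_rels m)),
      mor = \<lambda>a b g. quot_map (pm_vs {y. Poly_Mapping.keys y \<subseteq> ab_gens b}) (rel_span (ab_gens b) (ab_rels b))
        (lin_ext (\<lambda>(C, k). gen (abelianization_map (Fr b) g C, k)))\<rparr>"
    unfolding ab_functor_def presented_def presented_map_def free_vs_eq ..
  show ?thesis
    unfolding eq
  proof (rule covariant_quotient_functor[OF lin_sub_keys lin_sub_ab lin_map_lin_ext])
    show "lin_ext (\<lambda>(C, k). gen (abelianization_map (Fr b) g C, k)) ` {y :: word set \<times> 'k \<Rightarrow>\<^sub>0 'k. Poly_Mapping.keys y \<subseteq> ab_gens a}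
        \<subseteq> {y. Poly_Mapping.keys y \<subseteq> ab_gens b}" if "g \<in> gr a b" for a b g
    proof -
      have "Poly_Mapping.keys (lin_ext (\<lambda>(C, k). gen (abelianization_map (Fr b) g C, k)) y) \<subseteq> ab_gens b"
        if y: "Poly_Mapping.keys y \<subseteq> ab_gens a" for y :: "word set \<times> 'k \<Rightarrow>\<^sub>0 'k"
        by (rule keys_lin_ext) (use y abelianization_map_closed[OF \<open>g \<in> gr a b\<close>] in auto)
      then show ?thesis by blast
    qed
    show "lin_ext (\<lambda>(C, k). gen (abelianization_map (Fr b) g C, k)) ` rel_span (ab_gens a) (ab_rels a :: (_ \<Rightarrow>\<^sub>0 'k) set)
        \<subseteq> rel_span (ab_gens b) (ab_rels b)" if "g \<in> gr a b" for a b g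
      by (rule ab_span_map[OF that])
    show "lin_ext (\<lambda>(C, k). gen (abelianization_map (Fr a) (\<lambda>x\<in>carrier (Fr a). x) C, k)) y = y"
      if "y \<in> {y. Poly_Mapping.keys y \<subseteq> ab_gens a}" for a and y :: "word set \<times> 'k \<Rightarrow>\<^sub>0 'k"
    proof -
      have "lin_ext (\<lambda>(C, k). gen (abelianization_map (Fr a) (\<lambda>x\<in>carrier (Fr a). x) C, k)) y = lin_ext gen y"
        by (rule lin_ext_cong) (use that in \<open>auto simp: carrier_abelianization abelianization_map_cls[OF id_in_gr]\<close>)
      then show ?thesis by (simp add: lin_ext_gen_id)
    qed
    show "lin_ext (\<lambda>(C, k). gen (abelianization_map (Fr c) (compose (carrier (Fr a)) h g) C, k)) y =
        lin_ext (\<lambda>(C, k). gen (abelianization_map (Fr c) h C, k)) (lin_ext (\<lambda>(C, k). gen (abelianization_map (Fr b) g C, k)) y)"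
      if g: "g \<in> gr a b" and h: "h \<in> gr b c" and y: "y \<in> {y. Poly_Mapping.keys y \<subseteq> ab_gens a}"
      for a b c g h and y :: "word set \<times> 'k \<Rightarrow>\<^sub>0 'k"
      unfolding lin_ext_lin_ext
      by (rule lin_ext_cong)
         (use y in \<open>auto simp: carrier_abelianization abelianization_map_cls[OF compose_in_gr[OF g h]]
            abelianization_map_cls[OF g] abelianization_map_cls[OF h] gr_closed[OF g] compose_eq\<close>)
  qed
qed


section \<open>Linear forms on the abelianization\<close>

abbreviation ab_dual :: "nat \<Rightarrow> ('k::field, (word set \<times> 'k \<Rightarrow>\<^sub>0 'k) set \<Rightarrow> 'k) module" where
  "ab_dual m \<equiv> dual (obj ab_functor m)"

abbreviation ab_proj :: "nat \<Rightarrow> (word set \<times> 'k \<Rightarrow>\<^sub>0 'k::field) \<Rightarrow> (word set \<times> 'k \<Rightarrow>\<^sub>0 'k) set" where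
  "ab_proj m \<equiv> cls (rel_span (ab_gens m) (ab_rels m))"

lemma ab_obj_simps:
  "carrier (obj ab_functor m) = ab_proj m ` {a. Poly_Mapping.keys a \<subseteq> ab_gens m}"
  "ab_proj m u \<oplus>\<^bsub>obj ab_functor m\<^esub> ab_proj m v = ab_proj m (u + v)"
  "c \<odot>\<^bsub>obj ab_functor m\<^esub> ab_proj m v = ab_proj m (scale c v)"
  unfolding ab_obj_eq by (rule presented_simps[OF ab_rels_carrier])+

definition ab_value :: "nat \<Rightarrow> ((word set \<times> 'k \<Rightarrow>\<^sub>0 'k::field) set \<Rightarrow> 'k) \<Rightarrow> word \<Rightarrow> 'k" where
  "ab_value m f x = f (ab_proj m (gen (ab_cls m x, 1)))"

lemma ab_proj_gen_closed: "x \<in> carrier (Fr m) \<Longrightarrow> ab_proj m (gen (ab_cls m x, k)) \<in> carrier (obj ab_functor m)"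
  by (auto simp: ab_obj_simps carrier_abelianization)

text \<open>Scalars can be drawn out of the second factor, so the classes with scalar 1 already
  span.\<close>

lemma ab_proj_gen:
  fixes k :: "'k::field"
  assumes "x \<in> carrier (Fr m)"
  shows "ab_proj m (gen (ab_cls m x, k)) = k \<odot>\<^bsub>obj ab_functor m\<^esub> ab_proj m (gen (ab_cls m x, 1))"
proof -
  have "gen (ab_cls m x, k * 1) - scale k (gen (ab_cls m x, 1)) \<in> (ab_rels m :: (_ \<Rightarrow>\<^sub>0 'k) set)"
    using assms by (intro extension_relsI(3)) (auto simp: carrier_abelianization)
  from rel_span(2)[OF ab_rels_carrier this] show ?thesis by (simp add: ab_obj_simps cls_eq_iff[OF lin_sub_ab])
qed

lemma ab_value_mult:
  fixes f :: "(word set \<times> 'k::field \<Rightarrow>\<^sub>0 'k) set \<Rightarrow> 'k"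
  assumes f: "f \<in> carrier (ab_dual m)" and xy: "x \<in> carrier (Fr m)" "y \<in> carrier (Fr m)"
  shows "ab_value m f (x \<otimes>\<^bsub>Fr m\<^esub> y) = ab_value m f x + ab_value m f y"
proof -
  have "gen (ab_cls m x \<otimes>\<^bsub>abelianization (Fr m)\<^esub> ab_cls m y, 1) - gen (ab_cls m x, 1) - gen (ab_cls m y, 1) \<in> (ab_rels m :: (_ \<Rightarrow>\<^sub>0 'k) set)"
    using xy by (intro extension_relsI(1)) (auto simp: carrier_abelianization)
  from rel_span(2)[OF ab_rels_carrier this]
  have "ab_proj m (gen (ab_cls m (x \<otimes>\<^bsub>Fr m\<^esub> y), 1 :: 'k)) =
      ab_proj m (gen (ab_cls m x, 1)) \<oplus>\<^bsub>obj ab_functor m\<^esub> ab_proj m (gen (ab_cls m y, 1))"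
    by (simp add: ab_obj_simps cls_eq_iff[OF lin_sub_ab] ab_cls_mult[OF xy] diff_diff_add)
  then show ?thesis
    using dual_carrierD(1)[OF f ab_proj_gen_closed[OF xy(1)] ab_proj_gen_closed[OF xy(2)]] by (simp add: ab_value_def)
qed

text \<open>On the spanning classes a form is additive in the group element, so the free generators
  determine it.\<close>

lemma ab_dual_eqI:
  fixes f h :: "(word set \<times> 'k::field \<Rightarrow>\<^sub>0 'k) set \<Rightarrow> 'k"
  assumes f: "f \<in> carrier (ab_dual m)" and h: "h \<in> carrier (ab_dual m)"
    and eq: "\<And>p. p < m \<Longrightarrow> ab_value m f [(p, True)] = ab_value m h [(p, True)]"
  shows "f = h"
proof (rule dual_ext[OF f h])
  have val: "ab_value m f x = ab_value m h x" if "x \<in> carrier (Fr m)" for x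
    using additive_zero[of m "\<lambda>x. ab_value m f x - ab_value m h x" x] that ab_value_mult[OF f] ab_value_mult[OF h] eq
    by simp
  fix C assume "C \<in> carrier (ab_obj m :: ('k, _) module)"
  then obtain a where a: "Poly_Mapping.keys a \<subseteq> ab_gens m" "C = ab_proj m a" by (auto simp: ab_obj_simps)
  have cl: "ab_proj m a \<in> carrier (ab_obj m :: ('k, _) module)" if "Poly_Mapping.keys a \<subseteq> ab_gens m" for a
    using that by (auto simp: ab_obj_simps)
  note D = dual_carrierD[OF f] dual_carrierD[OF h]
  have "f (ab_proj m a) = h (ab_proj m a)"
    using a(1)
  proof (induction rule: free_vs_induct)
    case zero
    show ?case using D(2,5)[OF cl[of 0], of 0] by (simp add: ab_obj_simps(3))
  next
    case (gen x)
    then obtain y k where x: "x = (ab_cls m y, k)" "y \<in> carrier (Fr m)" by (auto simp: carrier_abelianization)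
    show ?case
      unfolding x(1) ab_proj_gen[OF x(2), of k] D(2,5)[OF ab_proj_gen_closed[OF x(2)]]
      using val[OF x(2)] by (simp add: ab_value_def)
  next
    case (add a b)
    then show ?case using D(1,4)[OF cl cl, of a b] by (simp add: ab_obj_simps)
  next
    case (scale c a)
    then show ?case using D(2,5)[OF cl, of a c] by (simp add: ab_obj_simps)
  qed
  then show "f C = h C" by (simp only: a(2))
qed

definition ab_coord :: "nat \<Rightarrow> nat \<Rightarrow> (word set \<times> 'k \<Rightarrow>\<^sub>0 'k::field) set \<Rightarrow> 'k" where
  "ab_coord m i = (\<lambda>u\<in>carrier (obj ab_functor m). descend (lin_fun (\<lambda>(C, k). class_count i C * k)) u)"

lemma ab_coord_proj:
  fixes a :: "word set \<times> 'k \<Rightarrow>\<^sub>0 'k::field"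
  assumes "Poly_Mapping.keys a \<subseteq> ab_gens m"
  shows "ab_coord m i (ab_proj m a) = lin_fun (\<lambda>(C, k). class_count i C * k) a"
proof -
  let ?L = "lin_fun (\<lambda>(C, k). class_count i C * k) :: (word set \<times> 'k \<Rightarrow>\<^sub>0 'k) \<Rightarrow> 'k"
  have "r \<in> {a. ?L a = 0}" if "r \<in> ab_rels m" for r
    using that
  proof (cases rule: extension_relsE)
    case (mult x y k)
    show ?thesis
      unfolding mult(1)
      using mult(2,3) monoid.m_closed[OF group.is_monoid[OF group_Fr[of m]]]
      by (auto simp: lin_fun_simps carrier_abelianization ab_cls_mult class_count_cls count_letter_mult algebra_simps)
  next
    case (add x k l)
    show ?thesis unfolding add(1) by (simp add: lin_fun_simps algebra_simps)
  next
    case (scale c x k)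
    show ?thesis unfolding scale(1) by (simp add: lin_fun_simps algebra_simps)
  qed
  then have "rel_span (ab_gens m) (ab_rels m) \<subseteq> {a. ?L a = 0}"
    by (intro rel_span_least[OF ab_rels_carrier lin_sub_lin_fun]) blast
  then have "descend ?L (ab_proj m a) = ?L a"
    by (intro descend_cls[OF lin_sub_ab]) (auto simp: lin_fun_simps dest!: subsetD)
  then show ?thesis using assms by (simp add: ab_coord_def ab_obj_simps)
qed

lemma ab_coord_closed: "ab_coord m i \<in> carrier (ab_dual m :: ('k::field, _) module)"
proof (rule dual_carrierI)
  fix u v assume "u \<in> carrier (ab_obj m :: ('k, _) module)" "v \<in> carrier (ab_obj m :: ('k, _) module)"
  then obtain a b where ab: "Poly_Mapping.keys a \<subseteq> ab_gens m" "Poly_Mapping.keys b \<subseteq> ab_gens m"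
      "u = ab_proj m a" "v = ab_proj m b" by (auto simp: ab_obj_simps)
  have "Poly_Mapping.keys (a + b) \<subseteq> ab_gens m" using Poly_Mapping.keys_add[of a b] ab(1,2) by blast
  then show "ab_coord m i (u \<oplus>\<^bsub>ab_obj m\<^esub> v) = ab_coord m i u + ab_coord m i v"
    using ab by (simp add: ab_obj_simps(2) ab_coord_proj lin_fun_simps)
next
  fix c v assume "v \<in> carrier (ab_obj m :: ('k, _) module)"
  then obtain b where b: "Poly_Mapping.keys b \<subseteq> ab_gens m" "v = ab_proj m b" by (auto simp: ab_obj_simps)
  have "Poly_Mapping.keys (scale c b) \<subseteq> ab_gens m" using keys_scale[of c b] b(1) by blast
  then show "ab_coord m i (c \<odot>\<^bsub>ab_obj m\<^esub> v) = c * ab_coord m i v"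
    using b by (simp add: ab_obj_simps(3) ab_coord_proj lin_fun_simps)
qed (simp add: ab_coord_def)

lemma ab_value_coord:
  assumes x: "x \<in> carrier (Fr m)"
  shows "ab_value m (ab_coord m i) x = (count_letter i x :: 'k::field)"
proof -
  have k: "Poly_Mapping.keys (gen (ab_cls m x, 1) :: word set \<times> 'k \<Rightarrow>\<^sub>0 'k) \<subseteq> ab_gens m"
    using x by (simp add: carrier_abelianization)
  show ?thesis unfolding ab_value_def ab_coord_proj[OF k] by (simp add: lin_fun_simps class_count_cls[OF x])
qed

lemma ab_value_linear:
  assumes "x \<in> carrier (Fr m)"
  shows "ab_value m (f \<oplus>\<^bsub>ab_dual m\<^esub> h) x = ab_value m f x + ab_value m h x"
    "ab_value m (c \<odot>\<^bsub>ab_dual m\<^esub> f) x = c * ab_value m f x"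
  by (simp_all add: ab_value_def dual_simps ab_proj_gen_closed[OF assms])

lemma ab_value_dual_map:
  fixes f :: "(word set \<times> 'k::field \<Rightarrow>\<^sub>0 'k) set \<Rightarrow> 'k"
  assumes g: "g \<in> gr a b" and x: "x \<in> carrier (Fr a)"
  shows "ab_value a (dual_map (obj ab_functor a) (mor ab_functor a b g) f) x = ab_value b f (g x)"
proof -
  have "mor ab_functor a b g (ab_proj a (gen (ab_cls a x, 1 :: 'k))) =
      ab_proj b (lin_ext (\<lambda>(C, k). gen (abelianization_map (Fr b) g C, k)) (gen (ab_cls a x, 1)))"
    unfolding ab_functor_def gr_functor.simps
    by (rule presented_map_cls[OF ab_rels_carrier ab_rels_carrier rel_span(2)[OF ab_rels_carrier ab_rels_map[OF g]]])
  then show ?thesis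
    by (simp add: ab_value_def dual_map_def abelianization_map_cls[OF g x] ab_proj_gen_closed[OF x])
qed


section \<open>The symmetric square\<close>

lemma module_ab_dual: "module KK (ab_dual m)"
  by (rule module_dual[OF covariant_functorD(1)[OF covariant_ab_functor]])

abbreviation sym2_gens where "sym2_gens m \<equiv> carrier (ab_dual m) \<times> carrier (ab_dual m)"

abbreviation sym2_span where "sym2_span m \<equiv> rel_span (sym2_gens m) (sym2_rels (ab_dual m))"

lemma sym2_rels_carrier: "sym2_rels (ab_dual m) \<subseteq> carrier (free_vs (sym2_gens m))"
proof -
  have "gen (f, h) - gen (h, f) \<in> carrier (free_vs (sym2_gens m))"
    if "f \<in> carrier (ab_dual m)" "h \<in> carrier (ab_dual m)"
    for f h :: "(word set \<times> 'k::field \<Rightarrow>\<^sub>0 'k) set \<Rightarrow> 'k"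
    using that unfolding free_vs_simps(1) by (intro lin_subD(5)[OF lin_sub_keys]) auto
  then show ?thesis
    unfolding sym2_rels_def using bilin_rels_carrier[OF module_ab_dual module_ab_dual, of m m] by blast
qed

lemmas lin_sub_sym2 = rel_span(1)[OF sym2_rels_carrier]

lemma sym2_commute:
  "f \<in> carrier (ab_dual m) \<Longrightarrow> h \<in> carrier (ab_dual m) \<Longrightarrow> gen (f, h) - gen (h, f) \<in> sym2_span m"
  by (rule rel_span(2)[OF sym2_rels_carrier]) (auto simp: sym2_rels_def)

lemma sym2_bilin: "r \<in> bilin_rels (ab_dual m) (ab_dual m) \<Longrightarrow> r \<in> sym2_span m"
  by (rule rel_span(2)[OF sym2_rels_carrier]) (simp add: sym2_rels_def)

text \<open>A combination of coordinate forms as one extensional function. The index set is a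
  parameter so that the expansion in the symmetric square can add one coordinate at a time.\<close>

definition ab_comb :: "nat \<Rightarrow> (nat \<Rightarrow> 'k) \<Rightarrow> nat set \<Rightarrow> (word set \<times> 'k \<Rightarrow>\<^sub>0 'k::field) set \<Rightarrow> 'k" where
  "ab_comb m c A = (\<lambda>u\<in>carrier (obj ab_functor m). \<Sum>p\<in>A. c p * ab_coord m p u)"

lemma ab_comb_insert:
  assumes "finite A" "p \<notin> A"
  shows "ab_comb m c (insert p A) = (c p \<odot>\<^bsub>ab_dual m\<^esub> ab_coord m p) \<oplus>\<^bsub>ab_dual m\<^esub> ab_comb m c A"
  using assms by (simp add: ab_comb_def dual_simps fun_eq_iff restrict_def)

lemma ab_comb_closed:
  assumes "finite A" shows "ab_comb m c A \<in> carrier (ab_dual m :: ('k::field, _) module)"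
  using assms
proof (induction A rule: finite_induct)
  case empty
  have "ab_comb m c {} = \<zero>\<^bsub>ab_dual m\<^esub>" by (simp add: ab_comb_def dual_simps)
  then show ?case using abelian_monoid.zero_closed[OF abelian_group.axioms(1)[OF module.axioms(2)[OF module_ab_dual]]] by metis
next
  case (insert p A)
  have "c p \<odot>\<^bsub>ab_dual m\<^esub> ab_coord m p \<in> carrier (ab_dual m)"
    using module.smult_closed[OF module_ab_dual _ ab_coord_closed] by simp
  then show ?case
    unfolding ab_comb_insert[OF insert(1,2)]
    by (rule abelian_monoid.a_closed[OF abelian_group.axioms(1)[OF module.axioms(2)[OF module_ab_dual]] _ insert(3)])
qed

lemma ab_dual_expansion:
  fixes f :: "(word set \<times> 'k::field \<Rightarrow>\<^sub>0 'k) set \<Rightarrow> 'k"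
  assumes f: "f \<in> carrier (ab_dual m)"
  shows "f = ab_comb m (\<lambda>p. ab_value m f [(p, True)]) {..<m}"
proof (rule ab_dual_eqI[OF f ab_comb_closed[OF finite_lessThan]])
  fix p assume p: "p < m"
  have x: "[(p, True)] \<in> carrier (Fr m)" by (rule letter_in_Fr[OF p])
  have "ab_value m (ab_comb m c {..<m}) [(p, True)] = (\<Sum>q<m. c q * ab_value m (ab_coord m q) [(p, True)])" for c :: "nat \<Rightarrow> 'k"
    by (simp add: ab_value_def ab_comb_def ab_proj_gen_closed[OF x])
  moreover have "c q * ab_value m (ab_coord m q) [(p, True)] = (if q = p then c p else 0)" for c :: "nat \<Rightarrow> 'k" and q
    by (simp add: ab_value_coord[OF x] letter_sign_def)
  ultimately show "ab_value m f [(p, True)] = ab_value m (ab_comb m (\<lambda>p. ab_value m f [(p, True)]) {..<m}) [(p, True)]"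
    using p by simp
qed

lemma sym2_comb_left:
  fixes h :: "(word set \<times> 'k::field \<Rightarrow>\<^sub>0 'k) set \<Rightarrow> 'k"
  assumes h: "h \<in> carrier (ab_dual m)" and "finite A"
  shows "gen (ab_comb m c A, h) - (\<Sum>p\<in>A. scale (c p) (gen (ab_coord m p, h))) \<in> sym2_span m"
  using assms(2)
proof (induction A rule: finite_induct)
  case empty
  have z: "0 \<odot>\<^bsub>ab_dual m\<^esub> ab_comb m c {} = ab_comb m c {}" by (simp add: ab_comb_def dual_simps fun_eq_iff restrict_def)
  show ?case using sym2_bilin[OF bilin_relsI(3)[OF ab_comb_closed[OF finite.emptyI] h], of 0 c] by (simp add: z)
next
  case (insert p A)
  have s: "c p \<odot>\<^bsub>ab_dual m\<^esub> ab_coord m p \<in> carrier (ab_dual m)"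
    using module.smult_closed[OF module_ab_dual _ ab_coord_closed] by simp
  note 1 = sym2_bilin[OF bilin_relsI(1)[OF s ab_comb_closed[OF insert(1)] h], of c]
  note 2 = sym2_bilin[OF bilin_relsI(3)[OF ab_coord_closed h], of "c p" p]
  from lin_subD(2)[OF lin_sub_sym2 lin_subD(2)[OF lin_sub_sym2 1 2] insert(3)]
  show ?case using insert(1,2) by (simp add: ab_comb_insert algebra_simps)
qed

lemma sym2_expansion_left:
  assumes "f \<in> carrier (ab_dual m)" "h \<in> carrier (ab_dual m)"
  shows "gen (f, h) - (\<Sum>p<m. scale (ab_value m f [(p, True)]) (gen (ab_coord m p, h))) \<in> sym2_span m"
  using sym2_comb_left[OF assms(2) finite_lessThan, of "\<lambda>p. ab_value m f [(p, True)]" m]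
  unfolding ab_dual_expansion[OF assms(1), symmetric] .

text \<open>The coordinates of a product of two forms in the monomials of degree two. The monomial
  of the coordinates \<open>p\<close> and \<open>q\<close> is the chord between these arcs, in
  increasing order; its holonomy lies in the trivial group.\<close>

definition sym2_chords :: "nat \<Rightarrow> ((word set \<times> 'k \<Rightarrow>\<^sub>0 'k::field) set \<Rightarrow> 'k) \<Rightarrow> ((word set \<times> 'k \<Rightarrow>\<^sub>0 'k) set \<Rightarrow> 'k) \<Rightarrow>
    (nat \<times> nat \<times> word \<Rightarrow>\<^sub>0 'k)" where
  "sym2_chords m f h = (\<Sum>p<m. \<Sum>q<m.
     scale (ab_value m f [(p, True)] * ab_value m h [(q, True)]) (gen (min p q, max p q, [])))"

definition chord_sym2 :: "nat \<Rightarrow> nat \<times> nat \<times> word \<Rightarrow>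
    ((word set \<times> 'k \<Rightarrow>\<^sub>0 'k::field) set \<Rightarrow> 'k) \<times> ((word set \<times> 'k \<Rightarrow>\<^sub>0 'k) set \<Rightarrow> 'k)" where
  "chord_sym2 m = (\<lambda>(i, j, v). (ab_coord m i, ab_coord m j))"

text \<open>The left factor is expanded in coordinates, the factors are exchanged, the other factor
  is expanded as well, and commutativity sorts the two indices.\<close>

lemma sym2_chords_spanning:
  fixes f h :: "(word set \<times> 'k::field \<Rightarrow>\<^sub>0 'k) set \<Rightarrow> 'k"
  assumes f: "f \<in> carrier (ab_dual m)" and h: "h \<in> carrier (ab_dual m)"
  shows "gen (f, h) - lin_ext (\<lambda>x. gen (chord_sym2 m x)) (sym2_chords m f h) \<in> sym2_span m"
proof -
  let ?x = "\<lambda>p. ab_coord m p :: (word set \<times> 'k \<Rightarrow>\<^sub>0 'k) set \<Rightarrow> 'k"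
  let ?f = "\<lambda>p. ab_value m f [(p, True)]" and ?h = "\<lambda>p. ab_value m h [(p, True)]"
  have S: "lin_sub (sym2_span m :: (((word set \<times> 'k \<Rightarrow>\<^sub>0 'k) set \<Rightarrow> 'k) \<times> ((word set \<times> 'k \<Rightarrow>\<^sub>0 'k) set \<Rightarrow> 'k) \<Rightarrow>\<^sub>0 'k) set)"
    by (rule lin_sub_sym2)
  have order: "gen (?x q, ?x p) - gen (?x (min p q), ?x (max p q)) \<in> sym2_span m" for p q
    using sym2_commute[OF ab_coord_closed ab_coord_closed, of m q p] lin_subD(1)[OF S]
    by (cases "p \<le> q") (simp_all add: min_def max_def)
  have "(gen (?x p, h) - gen (h, ?x p)) + (gen (h, ?x p) - (\<Sum>q<m. scale (?h q) (gen (?x q, ?x p)))) +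
      (\<Sum>q<m. scale (?h q) (gen (?x q, ?x p) - gen (?x (min p q), ?x (max p q)))) \<in> sym2_span m" for p
    by (intro lin_subD(2)[OF S] lin_sub_sum[OF S] lin_subD(3)[OF S] order sym2_commute[OF ab_coord_closed h]
        sym2_expansion_left[OF h ab_coord_closed])
  then have inner: "gen (?x p, h) - (\<Sum>q<m. scale (?h q) (gen (?x (min p q), ?x (max p q)))) \<in> sym2_span m" for p
    by (simp add: scale_diff sum_subtractf)
  have "(gen (f, h) - (\<Sum>p<m. scale (?f p) (gen (?x p, h)))) +
      (\<Sum>p<m. scale (?f p) (gen (?x p, h) - (\<Sum>q<m. scale (?h q) (gen (?x (min p q), ?x (max p q)))))) \<in> sym2_span m"
    by (intro lin_subD(2)[OF S] lin_sub_sum[OF S] lin_subD(3)[OF S] inner sym2_expansion_left[OF f h])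
  then show ?thesis
    by (simp add: scale_diff sum_subtractf scale_sum sym2_chords_def lin_ext_sum lin_ext_simps chord_sym2_def)
qed

lemma sym2_chords_rels:
  assumes "r \<in> sym2_rels (ab_dual m)"
  shows "lin_ext (\<lambda>(f, h). sym2_chords m f h) r = 0"
  using assms unfolding sym2_rels_def
proof
  assume r: "r \<in> bilin_rels (ab_dual m) (ab_dual m)"
  show ?thesis
  proof (rule lin_ext_bilin_rels[OF _ _ _ _ r])
    fix f f' h :: "(word set \<times> 'a \<Rightarrow>\<^sub>0 'a) set \<Rightarrow> 'a" and c
    show "sym2_chords m (f \<oplus>\<^bsub>ab_dual m\<^esub> f') h = sym2_chords m f h + sym2_chords m f' h"
      "sym2_chords m h (f \<oplus>\<^bsub>ab_dual m\<^esub> f') = sym2_chords m h f + sym2_chords m h f'"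
      "sym2_chords m (c \<odot>\<^bsub>ab_dual m\<^esub> f) h = scale c (sym2_chords m f h)"
      "sym2_chords m h (c \<odot>\<^bsub>ab_dual m\<^esub> f) = scale c (sym2_chords m h f)"
      unfolding sym2_chords_def sum.distrib[symmetric] scale_sum
      by (intro sum.cong refl; simp add: ab_value_linear letter_in_Fr algebra_simps scale_add_left)+
  qed
next
  have sw: "sym2_chords m f h = sym2_chords m h f" for f h :: "(word set \<times> 'a \<Rightarrow>\<^sub>0 'a) set \<Rightarrow> 'a"
    unfolding sym2_chords_def by (subst sum.swap) (simp add: mult.commute min.commute max.commute)
  assume "r \<in> {gen (v, w) - gen (w, v) | v w. v \<in> carrier (ab_dual m) \<and> w \<in> carrier (ab_dual m)}"
  then show ?thesis by (auto simp: lin_ext_simps) (simp add: sw)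
qed

lemma chord_basis_zero: "(i, j, v) \<in> chord_basis 0 m \<longleftrightarrow> i \<le> j \<and> j < m \<and> v = []"
  by (auto simp: chord_basis_def carrier_Fr)

text \<open>The free group of rank 0 is trivial, so the beads of every diagram multiply to
  \<open>1\<close>.\<close>

lemma A_deg_zero: "A_deg d 0 = A_deg_trivial d 0"
proof -
  have "homotopy_trivial 0 D" if "D \<in> diagrams 0 m" for D m
  proof -
    have "foldr (\<lambda>u v. u \<otimes>\<^bsub>Fr 0\<^esub> v) ws [] = []" if "set ws \<subseteq> carrier (Fr 0)" for ws
      using that by (induction ws) (auto simp: carrier_Fr mult_Fr)
    then show ?thesis using that unfolding homotopy_trivial_def arc_product_def one_Fr diagrams_def by blast
  qed
  then have "{D \<in> diagrams 0 m. has_degree d D} = {D \<in> diagrams 0 m. has_degree d D \<and> homotopy_trivial 0 D}" for m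
    by blast
  then show ?thesis by (simp add: A_deg_def A_deg_trivial_def)
qed

theorem nat_equiv_sym2:
  "nat_equiv_op (A_deg 1 0 :: ('k::field, _) gr_functor) (sym2_functor (dual_functor ab_functor))"
proof -
  let ?d = "\<lambda>a b g. dual_map (obj ab_functor a) (mor ab_functor a b g) :: ((word set \<times> 'k \<Rightarrow>\<^sub>0 'k) set \<Rightarrow> 'k) \<Rightarrow> _"
  have eq: "(sym2_functor (dual_functor ab_functor) :: ('k, _) gr_functor) =
     \<lparr>obj = \<lambda>m. presented (sym2_gens m) (sym2_rels (ab_dual m)),
      mor = \<lambda>a b g. presented_map (sym2_gens a) (sym2_rels (ab_dual a))
        (\<lambda>x. gen ((\<lambda>(f, h). (?d a b g f, ?d a b g h)) x))\<rparr>"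
    by (simp add: sym2_functor_def dual_functor_simps case_prod_beta')
  note F = contravariant_functorD[OF contravariant_dual_functor[OF covariant_ab_functor[where 'k = 'k]], unfolded dual_functor_simps]
  show ?thesis
    unfolding eq A_deg_zero
  proof (rule nat_equiv_chords[where t = chord_sym2 and H = "\<lambda>m (f, h). sym2_chords m f h", OF sym2_rels_carrier])
    show "(\<lambda>(f, h). (?d a b g f, ?d a b g h)) x \<in> sym2_gens a" if "g \<in> gr a b" "x \<in> sym2_gens b" for a b g x
      using that linear_mapsD(1)[OF F(2)] by auto
    show "lin_ext (\<lambda>x. gen ((\<lambda>(f, h). (?d a b g f, ?d a b g h)) x)) r \<in> sym2_rels (ab_dual a)"
      if g: "g \<in> gr a b" and r: "r \<in> sym2_rels (ab_dual b)" for a b g r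
      using r unfolding sym2_rels_def
    proof
      assume "r \<in> bilin_rels (ab_dual b) (ab_dual b)"
      from bilin_rels_map[OF F(2)[OF g] F(2)[OF g] this]
      show "lin_ext (\<lambda>x. gen ((\<lambda>(f, h). (?d a b g f, ?d a b g h)) x)) r \<in> bilin_rels (ab_dual a) (ab_dual a) \<union>
          {gen (v, w) - gen (w, v) | v w. v \<in> carrier (ab_dual a) \<and> w \<in> carrier (ab_dual a)}"
        by (simp add: case_prod_beta')
    next
      assume "r \<in> {gen (v, w) - gen (w, v) | v w. v \<in> carrier (ab_dual b) \<and> w \<in> carrier (ab_dual b)}"
      then obtain v w where vw: "v \<in> carrier (ab_dual b)" "w \<in> carrier (ab_dual b)" and r: "r = gen (v, w) - gen (w, v)" by blast
      have "lin_ext (\<lambda>x. gen ((\<lambda>(f, h). (?d a b g f, ?d a b g h)) x)) r =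
          gen (?d a b g v, ?d a b g w) - gen (?d a b g w, ?d a b g v)"
        by (simp add: r lin_ext_simps)
      then show "lin_ext (\<lambda>x. gen ((\<lambda>(f, h). (?d a b g f, ?d a b g h)) x)) r \<in> bilin_rels (ab_dual a) (ab_dual a) \<union>
          {gen (v, w) - gen (w, v) | v w. v \<in> carrier (ab_dual a) \<and> w \<in> carrier (ab_dual a)}"
        using linear_mapsD(1)[OF F(2)[OF g] vw(1)] linear_mapsD(1)[OF F(2)[OF g] vw(2)] by blast
    qed
    show "(\<lambda>(f, h). (?d a a (\<lambda>x\<in>carrier (Fr a). x) f, ?d a a (\<lambda>x\<in>carrier (Fr a). x) h)) x = x"
      if "x \<in> sym2_gens a" for a x
      using that F(3) by auto
    show "(\<lambda>(f, h). (?d a c (compose (carrier (Fr a)) k g) f, ?d a c (compose (carrier (Fr a)) k g) h)) x =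
        (\<lambda>(f, h). (?d a b g f, ?d a b g h)) ((\<lambda>(f, h). (?d b c k f, ?d b c k h)) x)"
      if "g \<in> gr a b" "k \<in> gr b c" "x \<in> sym2_gens c" for a b c g k x
    proof -
      obtain f h where x: "x = (f, h)" "f \<in> carrier (ab_dual c)" "h \<in> carrier (ab_dual c)" using \<open>x \<in> sym2_gens c\<close> by blast
      show ?thesis by (simp only: x(1) prod.case F(4)[OF that(1,2) x(2)] F(4)[OF that(1,2) x(3)])
    qed
    show "chord_sym2 m x \<in> sym2_gens m" if "x \<in> chord_basis 0 m" for m x
      using ab_coord_closed by (auto simp: chord_sym2_def case_prod_beta')
    show "Poly_Mapping.keys ((\<lambda>(f, h). sym2_chords m f h) c) \<subseteq> chord_basis 0 m"
      for m and c :: "((word set \<times> 'k \<Rightarrow>\<^sub>0 'k) set \<Rightarrow> 'k) \<times> ((word set \<times> 'k \<Rightarrow>\<^sub>0 'k) set \<Rightarrow> 'k)"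
    proof -
      have "sym2_chords m f h \<in> {a. Poly_Mapping.keys a \<subseteq> chord_basis 0 m}" for f h :: "(word set \<times> 'k \<Rightarrow>\<^sub>0 'k) set \<Rightarrow> 'k"
        unfolding sym2_chords_def
        by (intro lin_sub_sum[OF lin_sub_keys] lin_subD(3)[OF lin_sub_keys]) (auto simp: chord_basis_zero)
      then show ?thesis by (simp add: case_prod_beta')
    qed
    show "lin_ext (\<lambda>(f, h). sym2_chords m f h) r = 0" if "r \<in> sym2_rels (ab_dual m)"
      for m and r :: "((word set \<times> 'k \<Rightarrow>\<^sub>0 'k) set \<Rightarrow> 'k) \<times> ((word set \<times> 'k \<Rightarrow>\<^sub>0 'k) set \<Rightarrow> 'k) \<Rightarrow>\<^sub>0 'k"
      by (rule sym2_chords_rels[OF that])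
    show "(\<lambda>(f, h). sym2_chords m f h) (chord_sym2 m x) = (gen x :: _ \<Rightarrow>\<^sub>0 'k)" if x: "x \<in> chord_basis 0 m" for m x
    proof -
      obtain i j v where ijv: "x = (i, j, v)" by (rule prod_cases3)
      have ij: "i \<le> j" "j < m" "v = []" using x by (simp_all add: ijv chord_basis_zero)
      have "sym2_chords m (ab_coord m i) (ab_coord m j) =
          (\<Sum>p<m. \<Sum>q<m. if p = i then if q = j then gen (i, j, []) else 0 else 0 :: _ \<Rightarrow>\<^sub>0 'k)"
        unfolding sym2_chords_def using ij
        by (intro sum.cong refl) (auto simp: ab_value_coord letter_in_Fr letter_sign_def)
      also have "\<dots> = (\<Sum>p<m. if p = i then \<Sum>q<m. if q = j then gen (i, j, []) else 0 else 0)"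
        by (intro sum.cong refl) auto
      also have "\<dots> = gen (i, j, [])" using ij by simp
      finally show ?thesis by (simp add: ijv ij(3) chord_sym2_def)
    qed
    show "gen c - lin_ext (\<lambda>x. gen (chord_sym2 m x)) ((\<lambda>(f, h). sym2_chords m f h) c) \<in> sym2_span m"
      if "c \<in> sym2_gens m" for m and c :: "((word set \<times> 'k \<Rightarrow>\<^sub>0 'k) set \<Rightarrow> 'k) \<times> ((word set \<times> 'k \<Rightarrow>\<^sub>0 'k) set \<Rightarrow> 'k)"
      using that sym2_chords_spanning by auto
    show "(\<lambda>(f, h). sym2_chords a f h) ((\<lambda>(f, h). (?d a b g f, ?d a b g h)) (chord_sym2 b x)) = chord_pullback 0 a g x"
      if g: "g \<in> gr a b" and x: "x \<in> chord_basis 0 b" for a b g x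
    proof -
      obtain i j v where ijv: "x = (i, j, v)" by (rule prod_cases3)
      have v: "v = []" using x by (simp add: ijv chord_basis_zero)
      have val: "ab_value a (?d a b g (ab_coord b i)) [(p, True)] = count_letter i (g [(p, True)])" if "p < a" for p i
        using that by (simp add: ab_value_dual_map[OF g] ab_value_coord gr_closed[OF g] letter_in_Fr)
      \<comment> \<open>The empty word is its own inverse. On the diagonal the two terms of
        \<open>chord_pullback\<close> therefore combine, the pair counts cancel, and the product of
        the letter counts is left.\<close>
      have "sym2_chords a (?d a b g (ab_coord b i)) (?d a b g (ab_coord b j)) = chord_pullback 0 a g (i, j, [])"
        unfolding sym2_chords_def chord_pullback_def prod.case
        by (intro sum.cong refl)
           (auto simp: Let_def val inv_Nil min_def max_def scale_add_left[symmetric] dest: linorder_neqE_nat)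
      then show ?thesis by (simp add: ijv v chord_sym2_def)
    qed
  qed
qed


theorem proposition4:
  fixes n :: nat
  shows "nat_equiv_op (A_deg_trivial 1 n :: ('k::field_char_0, _) gr_functor) (passi2_dual_tensor n) \<and>
         nat_equiv_op (A_deg 1 0 :: ('k, _) gr_functor) (sym2_functor (dual_functor ab_functor))"
  by (intro conjI nat_equiv_passi2_dual_tensor nat_equiv_sym2)

end
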